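(* Let $m\ge0$ be an integer, $p>1$, $\epsilon>0$, and let $\Omega\subset\mathbb{R}^d$ be a bounded domain. Suppose the activation function $\sigma\in W^{m,\infty}(\mathbb{R})$ is non-zero and satisfies, for some constant $C_p$, the polynomial decay condition $$|\sigma^{(k)}(s)|\le C_p(1+|s|)^{-p}\qquad\text{for }0\le k\le m+1 .$$ Let $t=\min(p-1,\epsilon)$. Then there is a constant $C=C(p,m,\mathrm{diam}(\Omega),\sigma)$, depending only on $p$, $m$, $\mathrm{diam}(\Omega)$ and $\sigma$, such that for every $f\in\mathcal{B}^{m+1+\epsilon}$ and every integer $n\ge1$, $$\inf_{f_n\in\Sigma_d^n(\sigma)}\|f-f_n\|_{H^m(\Omega)}\le|\Omega|^{1/2}\,C(p,m,\mathrm{diam}(\Omega),\sigma)\,n^{-\frac12-\frac{t}{(2+t)(d+1)}}\,\|f\|_{\mathcal{B}^{m+1+\epsilon}} .$$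
   Context: For $\sigma:\mathbb{R}\to\mathbb{R}$, $\Sigma_d^n(\sigma)=\{x\mapsto\sum_{i=1}^n\beta_i\sigma(\omega_i\cdot x+b_i):\omega_i\in\mathbb{R}^d,\ b_i,\beta_i\in\mathbb{R}\}$. Fourier convention: $\hat f(\omega)=(2\pi)^{-d}\int_{\mathbb{R}^d} f(x)e^{-i\omega\cdot x}dx$, so that $f(x)=\int_{\mathbb{R}^d}e^{i\omega\cdot x}\hat f(\omega)d\omega$. The Barron norm of $f:\mathbb{R}^d\to\mathbb{R}$ is $\|f\|_{\mathcal{B}^s}=\int_{\mathbb{R}^d}(1+|\omega|)^s|\hat f(\omega)|\,d\omega$, and $\mathcal{B}^s=\{f:\|f\|_{\mathcal{B}^s}<\infty\}$ (real-valued functions whose Fourier transform is a function with this integral finite). $|\Omega|$ is the Lebesgue measure of $\Omega$, and $\|g\|_{H^m(\Omega)}=\big(\sum_{|\alpha|\le m}\|D^\alpha g\|_{L^2(\Omega)}^2\big)^{1/2}$. Derivatives $\sigma^{(k)}$ are weak derivatives (in particular the decay condition includes that the weak derivative $\sigma^{(m+1)}$ exists as a function), pointwise bounds hold almost everywhere, and "non-zero" means not almost everywhere zero. *)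

theory Defs
  imports "HOL-Analysis.Analysis"
begin

text \<open>
  The dimension \<open>d\<close> has to be quantified inside the statement, because the constant there may not
  depend on it. Hence \<open>\<real>\<^sup>d\<close> is the set of functions on \<open>{..<d}\<close>, extended by \<^const>\<open>undefined\<close>; this is
  the carrier of both the product topology and the product measure. Functions on \<open>\<real>\<^sup>d\<close> are total
  functions of which only the values on this carrier matter.
\<close>

definition Rd :: "nat \<Rightarrow> (nat \<Rightarrow> real) set" where
  "Rd d = {..<d} \<rightarrow>\<^sub>E UNIV"

definition Rd_top :: "nat \<Rightarrow> (nat \<Rightarrow> real) topology" where
  "Rd_top d = product_topology (\<lambda>_. euclideanreal) {..<d}"

definition Rd_leb :: "nat \<Rightarrow> (nat \<Rightarrow> real) measure" where
  "Rd_leb d = completion (\<Pi>\<^sub>M i\<in>{..<d}. lborel)"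

lemma topspace_Rd_top: "topspace (Rd_top d) = Rd d"
  by (simp add: Rd_top_def Rd_def)

lemma space_Rd_leb: "space (Rd_leb d) = Rd d"
  by (simp add: Rd_leb_def Rd_def space_PiM)

definition Rd_inner :: "nat \<Rightarrow> (nat \<Rightarrow> real) \<Rightarrow> (nat \<Rightarrow> real) \<Rightarrow> real" where
  "Rd_inner d x y = (\<Sum>i<d. x i * y i)"

definition Rd_norm :: "nat \<Rightarrow> (nat \<Rightarrow> real) \<Rightarrow> real" where
  "Rd_norm d x = L2_set x {..<d}"

definition Rd_diameter :: "nat \<Rightarrow> (nat \<Rightarrow> real) set \<Rightarrow> real" where
  "Rd_diameter d S = (if S = {} then 0 else SUP (x, y)\<in>S \<times> S. Rd_norm d (\<lambda>i. x i - y i))"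

definition bounded_domain :: "nat \<Rightarrow> (nat \<Rightarrow> real) set \<Rightarrow> bool" where
  "bounded_domain d \<Omega> \<longleftrightarrow>
     openin (Rd_top d) \<Omega> \<and> connectedin (Rd_top d) \<Omega> \<and> \<Omega> \<noteq> {} \<and> (\<exists>B. \<forall>x\<in>\<Omega>. Rd_norm d x \<le> B)"

definition partial_deriv ::
    "nat \<Rightarrow> ((nat \<Rightarrow> real) \<Rightarrow> 'b::real_normed_vector) \<Rightarrow> (nat \<Rightarrow> real) \<Rightarrow> 'b" where
  "partial_deriv i f x = vector_derivative (\<lambda>s. f (x(i := s))) (at (x i))"

definition partial_derivs ::
    "nat list \<Rightarrow> ((nat \<Rightarrow> real) \<Rightarrow> 'b::real_normed_vector) \<Rightarrow> (nat \<Rightarrow> real) \<Rightarrow> 'b" where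
  "partial_derivs js f = foldr partial_deriv js f"

definition smooth_Rd :: "nat \<Rightarrow> ((nat \<Rightarrow> real) \<Rightarrow> 'b::real_normed_vector) \<Rightarrow> bool" where
  "smooth_Rd d f \<longleftrightarrow> (\<forall>js. set js \<subseteq> {..<d} \<longrightarrow>
     continuous_map (Rd_top d) euclidean (partial_derivs js f) \<and>
     (\<forall>i<d. \<forall>x\<in>Rd d. (\<lambda>s. partial_derivs js f (x(i := s))) differentiable (at (x i))))"

text \<open>Multi-indices vanish outside \<open>{..<d}\<close>, so that each one is counted exactly once in sums.\<close>

definition multi_indices :: "nat \<Rightarrow> nat \<Rightarrow> (nat \<Rightarrow> nat) set" where
  "multi_indices d m = {\<alpha>. (\<forall>i\<ge>d. \<alpha> i = 0) \<and> (\<Sum>i<d. \<alpha> i) \<le> m}"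

definition multi_deriv ::
    "nat \<Rightarrow> (nat \<Rightarrow> nat) \<Rightarrow> ((nat \<Rightarrow> real) \<Rightarrow> 'b::real_normed_vector) \<Rightarrow> (nat \<Rightarrow> real) \<Rightarrow> 'b" where
  "multi_deriv d \<alpha> f = partial_derivs (concat (map (\<lambda>i. replicate (\<alpha> i) i) [0..<d])) f"

definition test_functions :: "nat \<Rightarrow> (nat \<Rightarrow> real) set \<Rightarrow> ((nat \<Rightarrow> real) \<Rightarrow> real) set" where
  "test_functions d \<Omega> = {\<phi>. smooth_Rd d \<phi> \<and>
     (\<exists>K. compactin (Rd_top d) K \<and> K \<subseteq> \<Omega> \<and> (\<forall>x\<in>Rd d - K. \<phi> x = 0))}"

definition schwartz :: "nat \<Rightarrow> ((nat \<Rightarrow> real) \<Rightarrow> complex) set" where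
  "schwartz d = {\<phi>. smooth_Rd d \<phi> \<and>
     (\<forall>\<alpha> k::nat. \<exists>B. \<forall>x\<in>Rd d. (1 + Rd_norm d x) ^ k * cmod (multi_deriv d \<alpha> \<phi> x) \<le> B)}"

definition locally_integrable ::
    "nat \<Rightarrow> (nat \<Rightarrow> real) set \<Rightarrow> ((nat \<Rightarrow> real) \<Rightarrow> real) \<Rightarrow> bool" where
  "locally_integrable d \<Omega> g \<longleftrightarrow>
     (\<forall>K. compactin (Rd_top d) K \<and> K \<subseteq> \<Omega> \<longrightarrow> set_integrable (Rd_leb d) K g)"

definition is_weak_deriv ::
    "nat \<Rightarrow> (nat \<Rightarrow> real) set \<Rightarrow> (nat \<Rightarrow> nat) \<Rightarrow> ((nat \<Rightarrow> real) \<Rightarrow> real) \<Rightarrow>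
     ((nat \<Rightarrow> real) \<Rightarrow> real) \<Rightarrow> bool" where
  "is_weak_deriv d \<Omega> \<alpha> g v \<longleftrightarrow> locally_integrable d \<Omega> g \<and> locally_integrable d \<Omega> v \<and>
     (\<forall>\<phi>\<in>test_functions d \<Omega>.
        (LINT x:\<Omega>|Rd_leb d. g x * multi_deriv d \<alpha> \<phi> x) =
        (-1) ^ (\<Sum>i<d. \<alpha> i) * (LINT x:\<Omega>|Rd_leb d. v x * \<phi> x))"

text \<open>Weak derivatives and Fourier transforms are unique up to null sets, so the choices made by
  \<open>SOME\<close> below do not affect the norms.\<close>

definition weak_deriv ::
    "nat \<Rightarrow> (nat \<Rightarrow> real) set \<Rightarrow> (nat \<Rightarrow> nat) \<Rightarrow> ((nat \<Rightarrow> real) \<Rightarrow> real) \<Rightarrow>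
     (nat \<Rightarrow> real) \<Rightarrow> real" where
  "weak_deriv d \<Omega> \<alpha> g = (SOME v. is_weak_deriv d \<Omega> \<alpha> g v)"

definition sobolev_space ::
    "nat \<Rightarrow> nat \<Rightarrow> (nat \<Rightarrow> real) set \<Rightarrow> ((nat \<Rightarrow> real) \<Rightarrow> real) set" where
  "sobolev_space d m \<Omega> = {g. \<forall>\<alpha>\<in>multi_indices d m. (\<exists>v. is_weak_deriv d \<Omega> \<alpha> g v) \<and>
     set_integrable (Rd_leb d) \<Omega> (\<lambda>x. (weak_deriv d \<Omega> \<alpha> g x)\<^sup>2)}"

definition sobolev_norm ::
    "nat \<Rightarrow> nat \<Rightarrow> (nat \<Rightarrow> real) set \<Rightarrow> ((nat \<Rightarrow> real) \<Rightarrow> real) \<Rightarrow> ennreal" where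
  "sobolev_norm d m \<Omega> g =
     (if g \<in> sobolev_space d m \<Omega>
      then ennreal (sqrt (\<Sum>\<alpha>\<in>multi_indices d m.
             LINT x:\<Omega>|Rd_leb d. (weak_deriv d \<Omega> \<alpha> g x)\<^sup>2))
      else \<infinity>)"

definition fourier_integral ::
    "nat \<Rightarrow> ((nat \<Rightarrow> real) \<Rightarrow> complex) \<Rightarrow> (nat \<Rightarrow> real) \<Rightarrow> complex" where
  "fourier_integral d \<phi> \<omega> =
     complex_of_real ((2 * pi) powr (- real d)) *
     (LINT x|Rd_leb d. \<phi> x * exp (- \<i> * complex_of_real (Rd_inner d \<omega> x)))"

definition tempered :: "nat \<Rightarrow> ((nat \<Rightarrow> real) \<Rightarrow> complex) \<Rightarrow> bool" where
  "tempered d u \<longleftrightarrow> (\<forall>\<phi>\<in>schwartz d. integrable (Rd_leb d) (\<lambda>x. u x * \<phi> x))"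

text \<open>
  A function with finite Barron norm need not be integrable, so its Fourier transform is taken in the
  sense of tempered distributions; for integrable \<open>f\<close> it is \<^const>\<open>fourier_integral\<close>.
  Absolute convergence in \<^const>\<open>tempered\<close> excludes nothing relevant: for \<open>s \<ge> 0\<close> a finite norm
  makes the transform integrable and hence \<open>f\<close> bounded almost everywhere.
\<close>

definition is_fourier_transform ::
    "nat \<Rightarrow> ((nat \<Rightarrow> real) \<Rightarrow> real) \<Rightarrow> ((nat \<Rightarrow> real) \<Rightarrow> complex) \<Rightarrow> bool" where
  "is_fourier_transform d f g \<longleftrightarrow> tempered d (\<lambda>x. complex_of_real (f x)) \<and> tempered d g \<and>
     (\<forall>\<phi>\<in>schwartz d. (LINT \<omega>|Rd_leb d. g \<omega> * \<phi> \<omega>) =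
        (LINT x|Rd_leb d. complex_of_real (f x) * fourier_integral d \<phi> x))"

definition fourier_transform ::
    "nat \<Rightarrow> ((nat \<Rightarrow> real) \<Rightarrow> real) \<Rightarrow> (nat \<Rightarrow> real) \<Rightarrow> complex" where
  "fourier_transform d f = (SOME g. is_fourier_transform d f g)"

definition barron_norm :: "nat \<Rightarrow> real \<Rightarrow> ((nat \<Rightarrow> real) \<Rightarrow> real) \<Rightarrow> ennreal" where
  "barron_norm d s f =
     (if \<exists>g. is_fourier_transform d f g
      then \<integral>\<^sup>+ \<omega>. ennreal ((1 + Rd_norm d \<omega>) powr s * cmod (fourier_transform d f \<omega>)) \<partial>Rd_leb d
      else \<infinity>)"

definition barron_space :: "nat \<Rightarrow> real \<Rightarrow> ((nat \<Rightarrow> real) \<Rightarrow> real) set" where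
  "barron_space d s = {f. barron_norm d s f < \<infinity>}"

definition test_functions_real :: "(real \<Rightarrow> real) set" where
  "test_functions_real = {\<phi>. (\<forall>k x. (deriv ^^ k) \<phi> differentiable (at x)) \<and>
     (\<exists>K. compact K \<and> (\<forall>x. x \<notin> K \<longrightarrow> \<phi> x = 0))}"

definition is_weak_deriv_real :: "nat \<Rightarrow> (real \<Rightarrow> real) \<Rightarrow> (real \<Rightarrow> real) \<Rightarrow> bool" where
  "is_weak_deriv_real k \<sigma> v \<longleftrightarrow>
     (\<forall>K. compact K \<longrightarrow> \<sigma> absolutely_integrable_on K \<and> v absolutely_integrable_on K) \<and>
     (\<forall>\<phi>\<in>test_functions_real.
        (LINT x|lebesgue. \<sigma> x * (deriv ^^ k) \<phi> x) = (-1) ^ k * (LINT x|lebesgue. v x * \<phi> x))"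

definition W_inf :: "nat \<Rightarrow> (real \<Rightarrow> real) set" where
  "W_inf m = {\<sigma>. \<forall>k\<le>m. \<exists>v. is_weak_deriv_real k \<sigma> v \<and> (\<exists>B. AE s in lebesgue. \<bar>v s\<bar> \<le> B)}"

definition shallow_nets :: "(real \<Rightarrow> real) \<Rightarrow> nat \<Rightarrow> nat \<Rightarrow> ((nat \<Rightarrow> real) \<Rightarrow> real) set" where
  "shallow_nets \<sigma> d n =
     {(\<lambda>x. \<Sum>i<n. \<beta> i * \<sigma> (Rd_inner d (\<omega> i) x + b i)) | \<beta> \<omega> b. \<forall>i<n. \<omega> i \<in> Rd d}"

end

theory Submission
  imports Defs "HOL-Probability.Probability"
begin

text \<open>
  The activation decays, so its Fourier integral is defined and non-zero at some \<open>a \<noteq> 0\<close>, and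
  integrating over the bias writes \<open>exp (i \<omega> \<cdot> x)\<close> as a superposition of neurons
  \<open>\<sigma> (\<omega> \<cdot> x / a + b)\<close>. Hence \<open>f\<close> is, together with its derivatives, the mean of normalised neurons under
  a finite measure on the space of parameters \<open>(\<omega>, b)\<close>, whose mass is controlled by the Barron norm.
  Plain sampling from it gives the rate \<open>n powr (- 1 / 2)\<close>. The additional factor comes from
  stratification: the normalised neurons depend on their parameters in a Lipschitz way, so the
  parameters with \<open>|\<omega>| \<le> r\<close> and \<open>|b|\<close> at most of order \<open>r\<close> are divided into at most \<open>n / 4\<close> cells of
  diameter of order \<open>r n powr (- 1 / (d + 1))\<close>, and the variance is taken within each cell, while the
  remaining parameters have mass at most of order \<open>r powr (- t)\<close>; the radius \<open>r\<close> balances the two.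

  The constant must not depend on \<open>d\<close>. Therefore the cells meeting the region are counted as lattice
  points of an \<open>l\<^sub>1\<close> ball, with a bound of the form \<open>(C \<rho>)^(d + 1)\<close>, and if \<open>n\<close> is smaller than
  \<open>100 ^ (d + 1)\<close> there are too few neurons for a division, but the additional factor is bounded below
  and plain sampling suffices.
\<close>

section \<open>Determining a density from its Fourier transform\<close>

text \<open>The radius is found from squared errors: within a cell the variance is the square of a
  Lipschitz increment, (r n^(-1/(d+1)))^2, while the tail contributes its mass r^(-t) to the first
  power. Equating the two gives r = n^(2/((2+t)(d+1))), and the root of the common value is the
  additional factor of the rate. The order m + 1 + eps of the Barron norm splits accordingly: m
  powers of |omega| come from the derivatives, one from integrating over the biases, since a neuron
  of frequency omega keeps its full size on an interval of biases of length proportional to |omega|,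
  and the rest pays for large frequencies; large biases are paid for by p - 1. Two further obstacles
  are analytic. The activation and its derivatives are given weakly and almost everywhere, so
  continuous representatives with increments of the same decay have to be constructed first. And the
  Fourier transform of \<open>f\<close> is given as a distribution, so inversion is obtained by
  testing with translated Gaussians and from uniqueness of characteristic functions.\<close>

lemma integral_zero_Dynkin:
  fixes c :: "'a \<Rightarrow> 'b::{banach, second_countable_topology}"
  assumes c: "integrable M c" and X: "X \<in> measurable M N"
    and N: "sets N = sigma_sets (space N) G" "G \<subseteq> Pow (space N)" "Int_stable G"
    and total: "(LINT x|M. c x) = 0"
    and zero: "\<And>A. A \<in> G \<Longrightarrow> (LINT x|M. indicator A (X x) *\<^sub>R c x) = 0"
    and B: "B \<in> sets N"
  shows "(LINT x|M. indicator B (X x) *\<^sub>R c x) = 0"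
proof -
  have conv: "(LINT x|M. indicator A (X x) *\<^sub>R c x) = (LINT x:X -` A \<inter> space M|M. c x)" for A
    unfolding set_lebesgue_integral_def
    by (rule Bochner_Integration.integral_cong) (auto simp: indicator_def)
  have int: "set_integrable M (X -` A \<inter> space M) c" if "A \<in> sets N" for A
    unfolding set_integrable_def using c X that
    by (intro integrable_mult_indicator) (auto intro: measurable_sets)
  have "B \<in> sigma_sets (space N) G"
    using B N(1) by simp
  \<comment> \<open>The sets over which the integral vanishes form a Dynkin system: complements use
    that the total integral is zero, disjoint unions the countable additivity of the set
    integral.\<close>
  with N(3,2) show ?thesis
  proof (induction rule: sigma_sets_induct_disjoint)
    case (basic A)
    then show ?case by (rule zero)
  next
    case empty
    then show ?case by simp
  next
    case (compl A)
    then have A: "A \<in> sets N" using N(1) by simp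
    have "(LINT x|M. indicator (space N - A) (X x) *\<^sub>R c x) = (LINT x|M. c x - indicator A (X x) *\<^sub>R c x)"
      by (rule Bochner_Integration.integral_cong)
        (use X in \<open>auto simp: indicator_def dest: measurable_space\<close>)
    also have "\<dots> = (LINT x|M. c x) - (LINT x|M. indicator A (X x) *\<^sub>R c x)"
    proof (rule Bochner_Integration.integral_diff[OF c])
      show "integrable M (\<lambda>x. indicator A (X x) *\<^sub>R c x)"
        using int[OF A] unfolding set_integrable_def
        by (rule Bochner_Integration.integrable_cong[THEN iffD1, rotated 2]) (auto simp: indicator_def)
    qed
    finally show ?case using total compl by simp
  next
    case (union A)
    then have A: "A i \<in> sets N" for i using N(1) by auto
    have U: "X -` (\<Union>i. A i) \<inter> space M = (\<Union>i. X -` A i \<inter> space M)" by auto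
    have "(LINT x:(\<Union>i. X -` A i \<inter> space M)|M. c x) = (\<Sum>i. LINT x:X -` A i \<inter> space M|M. c x)"
    proof (rule lebesgue_integral_countable_add)
      show "X -` A i \<inter> space M \<in> sets M" for i
        using A X by (auto intro: measurable_sets)
      show "set_integrable M (\<Union>i. X -` A i \<inter> space M) c"
        unfolding U[symmetric] by (rule int) (use A in auto)
    qed (use union(1) in \<open>auto simp: disjoint_family_on_def\<close>)
    then show ?case
      using union unfolding conv U by simp
  qed
qed

text \<open>Open intervals generate the Borel sets and are closed under intersection, so the Dynkin
  argument applies; the total integral is the limit of those over the intervals from -n to
  n.\<close>

lemma integral_indicator_zero_of_intervals:
  fixes c :: "'a \<Rightarrow> 'b::{banach, second_countable_topology}" and X :: "'a \<Rightarrow> real"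
  assumes c: "integrable M c" and X: "X \<in> borel_measurable M"
    and zero: "\<And>a b. (LINT x|M. indicator {a<..<b} (X x) *\<^sub>R c x) = 0"
    and B: "B \<in> sets borel"
  shows "(LINT x|M. indicator B (X x) *\<^sub>R c x) = 0"
proof (rule integral_zero_Dynkin[OF c X _ _ _ _ _ B, where G = "range (\<lambda>(a, b). {a<..<b})"])
  show "sets borel = sigma_sets (space borel) (range (\<lambda>(a, b::real). {a<..<b}))"
    by (subst borel_eq_box) (simp, unfold box_real, rule refl)
  show "Int_stable (range (\<lambda>(a, b::real). {a<..<b}))"
  proof (unfold Int_stable_def, safe)
    fix a b a' b' :: real
    have "{a<..<b} \<inter> {a'<..<b'} = {max a a'<..<min b b'}" by auto
    then show "{a<..<b} \<inter> {a'<..<b'} \<in> range (\<lambda>(a, b). {a<..<b})" by auto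
  qed
  have "(\<lambda>n. LINT x|M. indicator {-real n<..<real n} (X x) *\<^sub>R c x) \<longlonglongrightarrow> (LINT x|M. c x)"
  proof (rule integral_dominated_convergence[where w = "\<lambda>x. norm (c x)"])
    show "AE x in M. (\<lambda>n. indicator {-real n<..<real n} (X x) *\<^sub>R c x) \<longlonglongrightarrow> c x"
    proof (rule AE_I2, rule tendsto_eventually)
      fix x
      obtain k :: nat where k: "\<bar>X x\<bar> < real k" using reals_Archimedean2 by blast
      show "\<forall>\<^sub>F n in sequentially. indicator {-real n<..<real n} (X x) *\<^sub>R c x = c x"
        using eventually_ge_at_top[of k] by eventually_elim (use k in \<open>auto simp: indicator_def\<close>)
    qed
  qed (use c X in \<open>auto simp: indicator_def\<close>)
  then show "(LINT x|M. c x) = 0"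
    by (simp add: zero LIMSEQ_const_iff)
qed (use zero in auto)

lemma AE_zero_of_intervals:
  fixes c :: "real \<Rightarrow> real"
  assumes c: "integrable lborel c" and zero: "\<And>a b. (LINT x|lborel. indicator {a<..<b} x * c x) = 0"
  shows "AE x in lborel. c x = 0"
proof (rule density_unique_real[OF c])
  fix A :: "real set" assume "A \<in> sets lborel"
  then show "(LINT x:A|lborel. c x) = (LINT x:A|lborel. 0)"
    using integral_indicator_zero_of_intervals[of lborel c "\<lambda>x. x" A] c zero
    by (simp add: set_lebesgue_integral_def)
qed simp

text \<open>The value \<eta> = 0 shows that the positive and the negative part of \<open>c\<close>
  have the same mass \<open>r\<close>. Divided by \<open>r\<close> and pushed forward under
  \<open>X\<close> they are probability distributions with equal characteristic functions, so they
  coincide by Levy's uniqueness theorem. Carrying a map \<open>X\<close> allows the use for a single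
  coordinate of a vector.\<close>

lemma integral_indicator_zero_of_fourier_real:
  fixes c :: "'a \<Rightarrow> real" and X :: "'a \<Rightarrow> real"
  assumes c: "integrable M c" and X: "X \<in> borel_measurable M"
    and zero: "\<And>\<eta>. (LINT x|M. complex_of_real (c x) * iexp (\<eta> * X x)) = 0"
    and B: "B \<in> sets borel"
  shows "(LINT x|M. indicator B (X x) * c x) = 0"
proof -
  note [measurable] = X borel_measurable_integrable[OF c] B
  define P where "P f r = distr (density M (\<lambda>x. ennreal (max 0 (f x) / r))) borel X" for f :: "'a \<Rightarrow> real" and r
  have cp: "integrable M (\<lambda>x. max 0 (c x))" and cm: "integrable M (\<lambda>x. max 0 (- c x))"
    using c by auto
  define r where "r = (LINT x|M. max 0 (c x))"
  have dec: "c x = max 0 (c x) - max 0 (- c x)" for x by auto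
  have "complex_of_real (LINT x|M. c x) = 0"
    using zero[of 0] by simp
  then have "(LINT x|M. c x) = 0" by simp
  then have r': "r = (LINT x|M. max 0 (- c x))"
    unfolding r_def using Bochner_Integration.integral_diff[OF cp cm] dec by simp
  have r0: "r \<ge> 0" unfolding r_def by (rule Bochner_Integration.integral_nonneg) auto
  show ?thesis
  \<comment> \<open>With mass zero there is nothing to normalise, but then \<open>c\<close> vanishes
    almost everywhere.\<close>
  proof (cases "r = 0")
    case True
    have "AE x in M. max 0 (c x) = 0" "AE x in M. max 0 (- c x) = 0"
      using integral_nonneg_eq_0_iff_AE[OF cp] integral_nonneg_eq_0_iff_AE[OF cm] True r' r_def by auto
    then have "AE x in M. indicator B (X x) * c x = 0"
      by eventually_elim (auto simp: max_def split: if_splits)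
    then show ?thesis by (rule integral_eq_zero_AE)
  next
    case False
    with r0 have r: "r > 0" by simp
    have dist: "real_distribution (P f r)" if f: "integrable M (\<lambda>x. max 0 (f x))"
      "f \<in> borel_measurable M" "(LINT x|M. max 0 (f x)) = r" for f
    proof -
      have "emeasure (density M (\<lambda>x. ennreal (max 0 (f x) / r))) (space M) = (\<integral>\<^sup>+x. ennreal (max 0 (f x) / r) \<partial>M)"
        using f by (subst emeasure_density) (auto intro!: nn_integral_cong)
      also have "\<dots> = ennreal (LINT x|M. max 0 (f x) / r)"
        using f r by (intro nn_integral_eq_integral) auto
      also have "\<dots> = 1" using f r by simp
      finally have "prob_space (density M (\<lambda>x. ennreal (max 0 (f x) / r)))"
        by (intro prob_spaceI) simp
      then show ?thesis
        unfolding P_def by (intro prob_space.real_distribution_distr) auto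
    qed
    have ch: "char (P f r) \<eta> = (LINT x|M. complex_of_real (max 0 (f x)) * iexp (\<eta> * X x)) / r"
      if "f \<in> borel_measurable M" for f \<eta>
      using that r unfolding P_def char_def
      by (subst integral_distr, simp, simp, subst integral_density)
         (auto simp: scaleR_conv_of_real simp flip: integral_divide_zero intro!: Bochner_Integration.integral_cong)
    have int: "integrable M (\<lambda>x. complex_of_real (max 0 (f x)) * iexp (\<eta> * X x))"
      if f: "integrable M (\<lambda>x. max 0 (f x))" "f \<in> borel_measurable M" for f \<eta>
      by (rule Bochner_Integration.integrable_bound[OF f(1)]) (use f in \<open>auto simp: norm_mult\<close>)
    have "char (P c r) \<eta> = char (P (\<lambda>x. - c x) r) \<eta>" for \<eta>
    proof -
      have "(LINT x|M. complex_of_real (max 0 (c x)) * iexp (\<eta> * X x)) -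
          (LINT x|M. complex_of_real (max 0 (- c x)) * iexp (\<eta> * X x)) =
          (LINT x|M. complex_of_real (c x) * iexp (\<eta> * X x))"
        using int[of c \<eta>] int[of "\<lambda>x. - c x" \<eta>] cp cm
        by (subst Bochner_Integration.integral_diff[symmetric])
           (simp_all flip: left_diff_distrib of_real_diff dec)
      then show ?thesis using zero[of \<eta>] r by (simp only: ch borel_measurable_integrable[OF c] borel_measurable_uminus) simp
    qed
    then have eq: "P c r = P (\<lambda>x. - c x) r"
      using cp cm r' r_def by (intro Levy_uniqueness dist ext) auto
    have meas: "measure (P f r) B = (LINT x|M. indicator B (X x) * max 0 (f x)) / r"
      if f: "integrable M (\<lambda>x. max 0 (f x))" "f \<in> borel_measurable M" "(LINT x|M. max 0 (f x)) = r" for f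
    proof -
      have sB: "B \<inter> space (P f r) = B" by (simp add: P_def)
      have "measure (P f r) B = (LINT y|P f r. indicator B y)"
        using sB by simp
      also have "\<dots> = (LINT x|M. (max 0 (f x) / r) *\<^sub>R indicator B (X x))"
        using f r unfolding P_def by (subst integral_distr, simp, simp, subst integral_density) auto
      finally show ?thesis
        by (simp add: mult.commute)
    qed
    have "(LINT x|M. indicator B (X x) * max 0 (c x)) = (LINT x|M. indicator B (X x) * max 0 (- c x))"
      using meas[of c] meas[of "\<lambda>x. - c x"] eq cp cm r' r_def r by simp
    moreover have "integrable M (\<lambda>x. indicator B (X x) * max 0 (f x))"
      if f: "integrable M (\<lambda>x. max 0 (f x))" "f \<in> borel_measurable M" for f :: "'a \<Rightarrow> real"
      by (rule Bochner_Integration.integrable_bound[OF f(1)]) (use f in \<open>auto simp: indicator_def\<close>)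
    ultimately have "(LINT x|M. indicator B (X x) * max 0 (c x) - indicator B (X x) * max 0 (- c x)) = 0"
      using cp cm by (subst Bochner_Integration.integral_diff) auto
    moreover have "indicator B (X x) * max 0 (c x) - indicator B (X x) * max 0 (- c x) = indicator B (X x) * c x" for x
      by (auto simp: indicator_def)
    ultimately show ?thesis by simp
  qed
qed

text \<open>Conjugating the condition at -\<eta> gives it for the conjugate of \<open>c\<close> as
  well; sum and difference then yield it for the real and the imaginary part, to which the real case
  applies.\<close>

lemma integral_indicator_zero_of_fourier:
  fixes c :: "'a \<Rightarrow> complex" and X :: "'a \<Rightarrow> real"
  assumes c: "integrable M c" and X: "X \<in> borel_measurable M"
    and zero: "\<And>\<eta>. (LINT x|M. c x * iexp (\<eta> * X x)) = 0"
    and B: "B \<in> sets borel"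
  shows "(LINT x|M. indicator B (X x) *\<^sub>R c x) = 0"
proof -
  note [measurable] = X borel_measurable_integrable[OF c] B
  have int: "integrable M (\<lambda>x. c x * iexp (\<eta> * X x))" for \<eta>
    by (rule Bochner_Integration.integrable_bound[OF c]) (auto simp: norm_mult)
  have [measurable]: "(\<lambda>x. cnj (c x)) \<in> borel_measurable M"
    by (rule borel_measurable_continuous_on[where f = cnj]) (auto intro: continuous_intros)
  have intc: "integrable M (\<lambda>x. cnj (c x) * iexp (\<eta> * X x))" for \<eta>
    by (rule Bochner_Integration.integrable_bound[OF c]) (auto simp: norm_mult)
  have conj: "cnj (c x * iexp (- \<eta> * X x)) = cnj (c x) * iexp (\<eta> * X x)" for x \<eta>
    by (simp add: exp_cnj)
  have "(LINT x|M. cnj (c x) * iexp (\<eta> * X x)) = cnj (LINT x|M. c x * iexp (- \<eta> * X x))" for \<eta>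
    unfolding conj[symmetric] by (rule Bochner_Integration.integral_cnj)
  then have zc: "(LINT x|M. cnj (c x) * iexp (\<eta> * X x)) = 0" for \<eta>
    by (simp only: zero complex_cnj_zero)
  have "(LINT x|M. complex_of_real (Re (c x)) * iexp (\<eta> * X x)) =
      (LINT x|M. (c x * iexp (\<eta> * X x) + cnj (c x) * iexp (\<eta> * X x)) / 2)" for \<eta>
    by (intro Bochner_Integration.integral_cong refl)
       (simp only: complex_add_cnj mult.assoc flip: distrib_right, simp)
  then have re: "(LINT x|M. complex_of_real (Re (c x)) * iexp (\<eta> * X x)) = 0" for \<eta>
    by (simp only: integral_divide_zero Bochner_Integration.integral_add[OF int intc] zero zc)
       simp
  have "(LINT x|M. complex_of_real (Im (c x)) * iexp (\<eta> * X x)) =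
      (LINT x|M. (- \<i> / 2) * (c x * iexp (\<eta> * X x) - cnj (c x) * iexp (\<eta> * X x)))" for \<eta>
    by (intro Bochner_Integration.integral_cong refl) (simp add: complex_eq_iff field_simps)
  then have im: "(LINT x|M. complex_of_real (Im (c x)) * iexp (\<eta> * X x)) = 0" for \<eta>
    by (simp only: integral_mult_right_zero Bochner_Integration.integral_diff[OF int intc] zero zc)
       simp
  have intB: "integrable M (\<lambda>x. indicator B (X x) *\<^sub>R c x)"
    by (rule Bochner_Integration.integrable_bound[OF c]) (auto simp: indicator_def)
  have "Re (LINT x|M. indicator B (X x) *\<^sub>R c x) = (LINT x|M. indicator B (X x) * Re (c x))"
    using intB by (subst integral_Re[symmetric]) auto
  moreover have "Im (LINT x|M. indicator B (X x) *\<^sub>R c x) = (LINT x|M. indicator B (X x) * Im (c x))"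
    using intB by (subst integral_Im[symmetric]) auto
  ultimately show ?thesis
    using integral_indicator_zero_of_fourier_real[OF _ X re B] integral_indicator_zero_of_fourier_real[OF _ X im B] c
    by (simp add: complex_eq_iff)
qed

text \<open>The indicators are introduced one coordinate at a time: once all other factors are absorbed
  into the density, only the one-dimensional determining property is needed.\<close>

lemma integral_prod_indicator_zero:
  fixes c :: "('i \<Rightarrow> real) \<Rightarrow> complex" and U :: "(real \<Rightarrow> complex) set"
  assumes c: "integrable M c" and I: "finite I"
    and X: "\<And>i. i \<in> I \<Longrightarrow> (\<lambda>x. x i) \<in> borel_measurable M"
    and u0: "u0 \<in> U" and U: "\<And>u. u \<in> U \<Longrightarrow> u \<in> borel_measurable borel" "\<And>u t. u \<in> U \<Longrightarrow> cmod (u t) \<le> 1"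
    and det: "\<And>(c :: ('i \<Rightarrow> real) \<Rightarrow> complex) X B. integrable M c \<Longrightarrow> X \<in> borel_measurable M \<Longrightarrow>
       (\<And>u. u \<in> U \<Longrightarrow> (LINT x|M. c x * u (X x)) = 0) \<Longrightarrow> B \<in> sets borel \<Longrightarrow>
       (LINT x|M. indicator B (X x) *\<^sub>R c x) = 0"
    and zero: "\<And>u. (\<And>i. i \<in> I \<Longrightarrow> u i \<in> U) \<Longrightarrow> (LINT x|M. c x * (\<Prod>i\<in>I. u i (x i))) = 0"
    and B: "\<And>i. i \<in> I \<Longrightarrow> B i \<in> sets borel"
  shows "(LINT x|M. c x * (\<Prod>i\<in>I. indicator (B i) (x i))) = 0"
proof -
  \<comment> \<open>The invariant of the induction: coordinates in \<open>J\<close> already carry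
    indicators, the others still carry functions from \<open>U\<close>.\<close>
  have "(LINT x|M. c x * (\<Prod>i\<in>J. indicator (B i) (x i)) * (\<Prod>i\<in>I-J. u i (x i))) = 0"
    if "finite J" "J \<subseteq> I" "\<And>i. i \<in> I \<Longrightarrow> u i \<in> U" for J u
    using that
  proof (induction J arbitrary: u rule: finite_induct)
    case empty
    then show ?case using zero by simp
  next
    case (insert j J)
    define c' where "c' x = c x * (\<Prod>i\<in>J. indicator (B i) (x i)) * (\<Prod>i\<in>I-insert j J. u i (x i))" for x
    have jI: "j \<in> I" "J \<subseteq> I" using insert by auto
    have m: "(\<lambda>x. u i (x i)) \<in> borel_measurable M" if "i \<in> I" for i
      using U(1)[OF insert(5)[OF that]] X[OF that] by (rule measurable_compose_rev)
    have mB: "(\<lambda>x. indicator (B i) (x i) :: complex) \<in> borel_measurable M" if "i \<in> I" for i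
      by (rule measurable_compose[OF X[OF that]]) (use B[OF that] in simp)
    have bound: "norm (\<Prod>i\<in>K. u i (x i)) \<le> 1" if "K \<subseteq> I" for K x
      unfolding prod_norm[symmetric] by (intro prod_le_1) (use that U(2) insert in auto)
    have boundB: "norm (\<Prod>i\<in>K. indicator (B i) (x i) :: complex) \<le> 1" for K x
      unfolding prod_norm[symmetric] by (intro prod_le_1) (auto simp: indicator_def)
    have c': "integrable M c'"
    proof (rule Bochner_Integration.integrable_bound[OF c])
      show "c' \<in> borel_measurable M"
        unfolding c'_def using c jI m mB by (intro borel_measurable_times borel_measurable_prod) auto
      have "norm (c' x) \<le> norm (c x) * 1 * 1" for x
        unfolding c'_def norm_mult by (intro mult_mono bound boundB) (auto simp: jI)
      then show "AE x in M. norm (c' x) \<le> norm (c x)" by simp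
    qed
    have "(LINT x|M. indicator (B j) (x j) *\<^sub>R c' x) = 0"
    proof (rule det[OF c' X[OF jI(1)] _ B[OF jI(1)]])
      fix v assume v: "v \<in> U"
      have "(LINT x|M. c x * (\<Prod>i\<in>J. indicator (B i) (x i)) * (\<Prod>i\<in>I-J. (u(j := v)) i (x i))) = 0"
        using insert v by (intro insert.IH) auto
      moreover have "(\<Prod>i\<in>I-J. (u(j := v)) i (x i)) = v (x j) * (\<Prod>i\<in>I-insert j J. u i (x i))" for x
      proof -
        have "(\<Prod>i\<in>I-J. (u(j := v)) i (x i)) = (\<Prod>i\<in>insert j (I - insert j J). (u(j := v)) i (x i))"
          using jI insert by (intro prod.cong) auto
        also have "\<dots> = v (x j) * (\<Prod>i\<in>I-insert j J. (u(j := v)) i (x i))"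
          using I by (subst prod.insert) auto
        also have "(\<Prod>i\<in>I-insert j J. (u(j := v)) i (x i)) = (\<Prod>i\<in>I-insert j J. u i (x i))"
          by (rule prod.cong) auto
        finally show ?thesis .
      qed
      ultimately show "(LINT x|M. c' x * v (x j)) = 0"
        unfolding c'_def by (simp add: mult_ac)
    qed
    moreover have "indicator (B j) (x j) *\<^sub>R c' x =
        c x * (\<Prod>i\<in>insert j J. indicator (B i) (x i)) * (\<Prod>i\<in>I-insert j J. u i (x i))" for x
      using insert by (simp add: c'_def indicator_def)
    ultimately show ?case by simp
  qed
  from this[of I "\<lambda>_. u0"] show ?thesis
    using I u0 by simp
qed

text \<open>Boxes with Borel sides generate the product sigma-algebra and are stable under
  intersection; taking every side to be the whole line gives the vanishing total integral that the
  Dynkin argument requires.\<close>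

lemma AE_zero_PiM:
  fixes c :: "('i \<Rightarrow> real) \<Rightarrow> real"
  assumes I: "finite I" and c: "integrable (\<Pi>\<^sub>M i\<in>I. lborel) c"
    and zero: "\<And>B. (\<And>i. i \<in> I \<Longrightarrow> B i \<in> sets borel) \<Longrightarrow>
      (LINT x|(\<Pi>\<^sub>M i\<in>I. lborel). c x * (\<Prod>i\<in>I. indicator (B i) (x i))) = 0"
  shows "AE x in (\<Pi>\<^sub>M i\<in>I. lborel). c x = 0"
proof (rule density_unique_real[OF c])
  let ?M = "\<Pi>\<^sub>M i\<in>I. lborel :: real measure"
  fix A assume A: "A \<in> sets ?M"
  have "(LINT x|?M. indicator A x *\<^sub>R c x) = 0"
  proof (rule integral_zero_Dynkin[OF c, where N = ?M and G = "prod_algebra I (\<lambda>_. lborel)"])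
    show "sets ?M = sigma_sets (space ?M) (prod_algebra I (\<lambda>_. lborel))"
      by (simp add: sets_PiM space_PiM)
    show "prod_algebra I (\<lambda>_. lborel) \<subseteq> Pow (space ?M)"
      using prod_algebra_sets_into_space[of I "\<lambda>_. lborel :: real measure"] by (simp add: space_PiM)
    show "(LINT x|?M. c x) = 0" using zero[of "\<lambda>_. UNIV"] by simp
    fix B assume "B \<in> prod_algebra I (\<lambda>_. lborel :: real measure)"
    then obtain E where B: "B = Pi\<^sub>E I E" "\<And>i. i \<in> I \<Longrightarrow> E i \<in> sets borel"
      by (subst (asm) prod_algebra_eq_finite[OF I]) auto
    have "(LINT x|?M. indicator B x *\<^sub>R c x) = (LINT x|?M. c x * (\<Prod>i\<in>I. indicator (E i) (x i)))"
    proof (rule Bochner_Integration.integral_cong[OF refl])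
      fix x assume "x \<in> space ?M"
      then have x: "x \<in> extensional I" by (simp add: space_PiM PiE_def)
      show "indicator B x *\<^sub>R c x = c x * (\<Prod>i\<in>I. indicator (E i) (x i))"
      proof (cases "\<forall>i\<in>I. x i \<in> E i")
        case True then show ?thesis using x B by (simp add: PiE_def)
      next
        case False
        then have "(\<Prod>i\<in>I. indicator (E i) (x i) :: real) = 0" using I by (auto simp: prod_zero_iff indicator_def)
        with False show ?thesis using B by (auto simp: indicator_def)
      qed
    qed
    also have "\<dots> = 0" using B by (intro zero) auto
    finally show "(LINT x|?M. indicator B x *\<^sub>R c x) = 0" .
  qed (use A Int_stable_prod_algebra in auto)
  then show "(LINT x:A|?M. c x) = (LINT x:A|?M. 0)"
    by (simp add: set_lebesgue_integral_def)
qed simp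

section \<open>Smooth bumps on the line\<close>

text \<open>The flat function exp(-1/x), with a polynomial in 1/x as a factor so that the family is
  closed under differentiation; \<open>p = 1\<close> is the function itself.\<close>

definition expinv_poly :: "real poly \<Rightarrow> real \<Rightarrow> real" where
  "expinv_poly p x = (if x > 0 then poly p (1 / x) * exp (- (1 / x)) else 0)"

lemma poly_exp_minus_tendsto_0: "((\<lambda>x. poly p x * exp (- x)) \<longlongrightarrow> (0::real)) at_top"
proof -
  have "((\<lambda>x. \<Sum>i\<le>degree p. coeff p i * (x ^ i / exp x)) \<longlongrightarrow> (\<Sum>i\<le>degree p. coeff p i * 0)) at_top"
    by (intro tendsto_intros tendsto_power_div_exp_0)
  moreover have "(\<Sum>i\<le>degree p. coeff p i * (x ^ i / exp x)) = poly p x * exp (- x)" for x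
    by (simp add: poly_altdef exp_minus sum_distrib_right divide_simps)
  ultimately show ?thesis by simp
qed

text \<open>For y = 1/x one has dy/dx = -y^2, so p(y) exp(-y) has the derivative y^2 (p - p')(y)
  exp(-y); this is where the polynomial comes from. At 0 the difference quotient from the right is
  again a polynomial in y times exp(-y) and tends to 0.\<close>

lemma expinv_poly_has_derivative:
  "(expinv_poly p has_real_derivative expinv_poly ([:0, 0, 1:] * (p - pderiv p)) x) (at x)"
proof (cases x "0 :: real" rule: linorder_cases)
  case less
  have "((\<lambda>_. 0) has_real_derivative 0) (at x)" by simp
  then have "(expinv_poly p has_real_derivative 0) (at x)"
    by (rule DERIV_cong_ev[THEN iffD1, OF refl _ refl, rotated])
       (use less in \<open>auto simp: expinv_poly_def eventually_nhds intro!: exI[of _ "{..<0}"]\<close>)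
  then show ?thesis using less by (simp add: expinv_poly_def)
next
  case greater
  have "((\<lambda>x. poly p (1 / x) * exp (- (1 / x))) has_real_derivative
      poly ([:0, 0, 1:] * (p - pderiv p)) (1 / x) * exp (- (1 / x))) (at x)"
    using greater
    by (auto intro!: derivative_eq_intros poly_DERIV simp: divide_simps power2_eq_square algebra_simps)
  then have "(expinv_poly p has_real_derivative
      poly ([:0, 0, 1:] * (p - pderiv p)) (1 / x) * exp (- (1 / x))) (at x)"
    by (rule DERIV_cong_ev[THEN iffD1, OF refl _ refl, rotated])
       (use greater in \<open>auto simp: expinv_poly_def eventually_nhds intro!: exI[of _ "{0<..}"]\<close>)
  then show ?thesis using greater by (simp add: expinv_poly_def)
next
  case equal
  have "((\<lambda>y. expinv_poly p y / y) \<longlongrightarrow> 0) (at 0)"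
  proof (rule filterlim_split_at)
    show "((\<lambda>y. expinv_poly p y / y) \<longlongrightarrow> 0) (at_left 0)"
      by (rule tendsto_eventually) (auto simp: eventually_at_left_field expinv_poly_def intro!: exI[of _ "-1"])
    have "((\<lambda>y. poly (pCons 0 p) (inverse y) * exp (- inverse y)) \<longlongrightarrow> (0::real)) (at_right 0)"
      by (rule filterlim_compose[OF poly_exp_minus_tendsto_0 filterlim_inverse_at_top_right])
    then show "((\<lambda>y. expinv_poly p y / y) \<longlongrightarrow> 0) (at_right 0)"
      by (rule Lim_transform_eventually)
         (auto simp: eventually_at_right_field expinv_poly_def field_simps intro!: exI[of _ 1])
  qed
  then have "(expinv_poly p has_real_derivative 0) (at 0)"
    by (simp add: has_field_derivative_iff expinv_poly_def)
  then show ?thesis using equal by (simp add: expinv_poly_def)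
qed

text \<open>The order is finite so that closure under products can be proved by induction: the
  derivative of a product is a sum of products of functions that are smooth to one order
  less.\<close>

definition smooth_upto :: "nat \<Rightarrow> (real \<Rightarrow> real) \<Rightarrow> bool" where
  "smooth_upto n f \<longleftrightarrow> (\<forall>k<n. \<forall>x. (deriv ^^ k) f differentiable (at x))"

definition smooth_real :: "(real \<Rightarrow> real) \<Rightarrow> bool" where
  "smooth_real f \<longleftrightarrow> (\<forall>k x. (deriv ^^ k) f differentiable (at x))"

lemma smooth_real_iff: "smooth_real f \<longleftrightarrow> (\<forall>n. smooth_upto n f)"
  unfolding smooth_real_def smooth_upto_def by blast

lemma smooth_upto_Suc:
  "smooth_upto (Suc n) f \<longleftrightarrow> (\<forall>x. f differentiable (at x)) \<and> smooth_upto n (deriv f)"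
  unfolding smooth_upto_def by (simp add: All_less_Suc2 funpow_swap1)

lemma smooth_real_deriv: "smooth_real f \<Longrightarrow> smooth_real (deriv f)"
  unfolding smooth_real_def by (metis funpow_swap1 funpow.simps(2) comp_apply)

lemma smooth_real_has_derivative:
  "smooth_real f \<Longrightarrow> ((deriv ^^ k) f has_real_derivative (deriv ^^ Suc k) f x) (at x)"
  unfolding smooth_real_def by (simp add: DERIV_deriv_iff_real_differentiable)

lemma smooth_real_has_derivative':
  "smooth_real f \<Longrightarrow> (f has_real_derivative deriv f x) (at x)"
  using smooth_real_has_derivative[of f 0 x] by simp

text \<open>A certificate for smoothness: once a candidate is named for every order, one derivative
  rule relating consecutive candidates settles all iterated derivatives.\<close>

lemma smooth_realI:
  assumes "\<And>k x. (U k has_real_derivative U (Suc k) x) (at x)" and "f = U 0"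
  shows "smooth_real f" "(deriv ^^ k) f = U k"
proof -
  have *: "(deriv ^^ k) f = U k" for k
    by (induction k) (use assms in \<open>auto intro!: DERIV_imp_deriv\<close>)
  then show "(deriv ^^ k) f = U k" .
  show "smooth_real f"
    unfolding smooth_real_def * using assms(1) real_differentiable_def by blast
qed

lemma smooth_real_continuous_on:
  assumes "smooth_real f" shows "continuous_on A ((deriv ^^ k) f)"
  using smooth_real_has_derivative[OF assms]
  by (intro continuous_at_imp_continuous_on ballI) (blast intro: DERIV_isCont)

lemma smooth_real_borel: "smooth_real f \<Longrightarrow> (deriv ^^ k) f \<in> borel_measurable borel"
  by (intro borel_measurable_continuous_onI smooth_real_continuous_on)

lemma smooth_real_expinv_poly: "smooth_real (expinv_poly p)"
  by (rule smooth_realI(1)[where U = "\<lambda>k. expinv_poly (((\<lambda>p. [:0, 0, 1:] * (p - pderiv p)) ^^ k) p)"])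
     (use expinv_poly_has_derivative in auto)

lemma smooth_upto_add:
  "smooth_upto n f \<Longrightarrow> smooth_upto n g \<Longrightarrow> smooth_upto n (\<lambda>x. f x + g x)"
proof (induction n arbitrary: f g)
  case (Suc n)
  then have d: "\<And>x. f differentiable (at x)" "\<And>x. g differentiable (at x)"
    by (auto simp: smooth_upto_Suc)
  then have "deriv (\<lambda>x. f x + g x) = (\<lambda>x. deriv f x + deriv g x)"
    by (intro ext DERIV_imp_deriv DERIV_add) (simp_all add: DERIV_deriv_iff_real_differentiable)
  with Suc d show ?case by (auto simp: smooth_upto_Suc)
qed (simp add: smooth_upto_def)

lemma smooth_upto_mono: "smooth_upto n f \<Longrightarrow> m \<le> n \<Longrightarrow> smooth_upto m f"
  unfolding smooth_upto_def by auto

lemma smooth_upto_mult: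
  "smooth_upto n f \<Longrightarrow> smooth_upto n g \<Longrightarrow> smooth_upto n (\<lambda>x. f x * g x)"
proof (induction n arbitrary: f g)
  case (Suc n)
  then have d: "\<And>x. f differentiable (at x)" "\<And>x. g differentiable (at x)"
    by (auto simp: smooth_upto_Suc)
  then have "deriv (\<lambda>x. f x * g x) = (\<lambda>x. deriv f x * g x + deriv g x * f x)"
    by (intro ext DERIV_imp_deriv DERIV_mult) (simp_all add: DERIV_deriv_iff_real_differentiable)
  moreover have "smooth_upto n f" "smooth_upto n g"
    using Suc.prems by (auto elim: smooth_upto_mono)
  ultimately show ?case
    using Suc d by (auto simp: smooth_upto_Suc intro!: smooth_upto_add Suc.IH)
qed (simp add: smooth_upto_def)

lemma smooth_real_add: "smooth_real f \<Longrightarrow> smooth_real g \<Longrightarrow> smooth_real (\<lambda>x. f x + g x)"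
  by (simp add: smooth_real_iff smooth_upto_add)

lemma smooth_real_mult: "smooth_real f \<Longrightarrow> smooth_real g \<Longrightarrow> smooth_real (\<lambda>x. f x * g x)"
  by (simp add: smooth_real_iff smooth_upto_mult)

lemma smooth_real_affine:
  assumes "smooth_real f" shows "smooth_real (\<lambda>x. f (c * x + e))"
proof (rule smooth_realI(1)[where U = "\<lambda>k x. c ^ k * (deriv ^^ k) f (c * x + e)"])
  fix k x
  have "((\<lambda>x. (deriv ^^ k) f (c * x + e)) has_real_derivative (deriv ^^ Suc k) f (c * x + e) * c) (at x)"
    by (rule DERIV_chain2[OF smooth_real_has_derivative[OF assms]]) (auto intro!: derivative_eq_intros)
  from DERIV_cmult[OF this, of "c ^ k"]
  show "((\<lambda>x. c ^ k * (deriv ^^ k) f (c * x + e)) has_real_derivative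
      c ^ Suc k * (deriv ^^ Suc k) f (c * x + e)) (at x)"
    by (simp add: mult_ac)
qed simp

lemma smooth_real_const: "smooth_real (\<lambda>_. c)"
  by (rule smooth_realI(1)[where U = "\<lambda>k _. if k = 0 then c else 0"]) auto

text \<open>As \<open>n\<close> grows, \<open>exp (-1 / (n y))\<close> tends to 1 for \<open>y > 0\<close>, so the scaled bumps tend to the
  indicator of the open interval, without a smooth step function.\<close>

definition bump :: "real \<Rightarrow> real \<Rightarrow> nat \<Rightarrow> real \<Rightarrow> real" where
  "bump u v n x = expinv_poly 1 (real (Suc n) * (x - u)) * expinv_poly 1 (real (Suc n) * (v - x))"

lemma expinv_bounds: "0 \<le> expinv_poly 1 x" "expinv_poly 1 x \<le> 1"
  by (auto simp: expinv_poly_def)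

lemma bump_bounds: "0 \<le> bump u v n x" "bump u v n x \<le> 1"
  unfolding bump_def using expinv_bounds by (auto intro!: mult_le_one)

lemma bump_eq_0: "x \<notin> {u<..<v} \<Longrightarrow> bump u v n x = 0"
  unfolding bump_def expinv_poly_def by (auto simp: zero_less_mult_iff)

lemma bump_pos: "x \<in> {u<..<v} \<Longrightarrow> bump u v n x > 0"
  unfolding bump_def expinv_poly_def by (auto simp: zero_less_mult_iff)

lemma smooth_real_bump: "smooth_real (bump u v n)"
proof -
  have *: "bump u v n = (\<lambda>x. expinv_poly 1 (real (Suc n) * x + - real (Suc n) * u) *
      expinv_poly 1 (- real (Suc n) * x + real (Suc n) * v))"
    unfolding bump_def by (intro ext arg_cong2[where f = "(*)"] arg_cong[where f = "expinv_poly 1"])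
      (auto simp: algebra_simps)
  show ?thesis
    unfolding * by (intro smooth_real_mult smooth_real_affine smooth_real_expinv_poly)
qed

lemma bump_tendsto: "(\<lambda>n. bump u v n x) \<longlonglongrightarrow> indicator {u<..<v} x"
proof (cases "x \<in> {u<..<v}")
  case True
  have "(\<lambda>n. expinv_poly 1 (real (Suc n) * y)) \<longlonglongrightarrow> 1" if "y > 0" for y
  proof -
    have "(\<lambda>n. inverse (real (Suc n)) * (1 / y)) \<longlonglongrightarrow> 0 * (1 / y)"
      by (intro tendsto_intros LIMSEQ_inverse_real_of_nat)
    then have "(\<lambda>n. exp (- (inverse (real (Suc n)) * (1 / y)))) \<longlonglongrightarrow> exp (- (0 * (1 / y)))"
      by (rule tendsto_exp[OF tendsto_minus])
    moreover have "expinv_poly 1 (real (Suc n) * y) = exp (- (inverse (real (Suc n)) * (1 / y)))" for n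
      using that mult_pos_pos[of "real (Suc n)" y] by (simp add: expinv_poly_def field_simps del: of_nat_Suc)
    ultimately show ?thesis by simp
  qed
  from tendsto_mult[OF this[of "x - u"] this[of "v - x"]] True
  show ?thesis unfolding bump_def by simp
next
  case False
  then have "\<not> (u < x \<and> x < v)" by auto
  with False show ?thesis by (simp add: bump_eq_0)
qed

section \<open>Test functions on the line and the fundamental lemma\<close>

lemma test_functions_real_iff:
  "\<phi> \<in> test_functions_real \<longleftrightarrow> smooth_real \<phi> \<and> (\<exists>K. compact K \<and> (\<forall>x. x \<notin> K \<longrightarrow> \<phi> x = 0))"
  unfolding test_functions_real_def smooth_real_def by simp

lemma bump_test_function: "bump u v n \<in> test_functions_real"
  unfolding test_functions_real_iff using smooth_real_bump bump_eq_0
  by (auto intro!: exI[of _ "{u..v}"])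

lemma deriv_zero_outside:
  assumes "closed K" "\<And>x. x \<notin> K \<Longrightarrow> \<phi> x = (0::real)" "x \<notin> K"
  shows "deriv \<phi> x = 0"
proof (rule DERIV_imp_deriv)
  have "((\<lambda>_. 0) has_real_derivative 0) (at x)" by simp
  then show "(\<phi> has_real_derivative 0) (at x)"
    by (rule DERIV_cong_ev[THEN iffD1, OF refl _ refl, rotated])
       (use assms in \<open>auto simp: eventually_nhds intro!: exI[of _ "- K"]\<close>)
qed

lemma test_function_deriv:
  assumes "\<phi> \<in> test_functions_real" shows "deriv \<phi> \<in> test_functions_real"
proof -
  obtain K where K: "compact K" "\<And>x. x \<notin> K \<Longrightarrow> \<phi> x = 0"
    using assms by (auto simp: test_functions_real_iff)
  have "deriv \<phi> x = 0" if "x \<notin> K" for x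
    by (rule deriv_zero_outside[OF compact_imp_closed[OF K(1)] K(2) that])
  with K(1) assms show ?thesis
    unfolding test_functions_real_iff using smooth_real_deriv[of \<phi>] by metis
qed

lemma test_function_supportE:
  assumes "\<phi> \<in> test_functions_real"
  obtains R where "R > 0" "\<And>x. \<bar>x\<bar> \<ge> R \<Longrightarrow> \<phi> x = 0"
proof -
  obtain K where K: "compact K" "\<And>x. x \<notin> K \<Longrightarrow> \<phi> x = 0"
    using assms by (auto simp: test_functions_real_iff)
  obtain R where "R > 0" "\<And>x. x \<in> K \<Longrightarrow> norm x \<le> R"
    using compact_imp_bounded[OF K(1)] by (auto simp: bounded_pos)
  then show ?thesis using K by (intro that[of "R + 1"]) force+
qed

lemma test_function_bounded:
  assumes "\<phi> \<in> test_functions_real" obtains B where "B > 0" "\<And>x. \<bar>\<phi> x\<bar> \<le> B"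
proof -
  obtain R where R: "R > 0" "\<And>x. \<bar>x\<bar> \<ge> R \<Longrightarrow> \<phi> x = 0"
    using test_function_supportE[OF assms] by metis
  have "continuous_on {-R..R} \<phi>"
    using smooth_real_continuous_on[of \<phi> "{-R..R}" 0] assms by (simp add: test_functions_real_iff)
  then have "bounded (\<phi> ` {-R..R})"
    by (intro compact_imp_bounded compact_continuous_image) auto
  then obtain B where B: "B > 0" "\<And>x. x \<in> {-R..R} \<Longrightarrow> \<bar>\<phi> x\<bar> \<le> B"
    by (auto simp: bounded_pos)
  show ?thesis
  proof (rule that[OF B(1)])
    fix x show "\<bar>\<phi> x\<bar> \<le> B"
      using B R by (cases "\<bar>x\<bar> \<le> R") (auto simp: abs_le_iff)
  qed
qed

lemma test_function_borel: "\<phi> \<in> test_functions_real \<Longrightarrow> \<phi> \<in> borel_measurable borel"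
  using smooth_real_borel[of \<phi> 0] by (simp add: test_functions_real_iff)

text \<open>A Lebesgue integrable function has a Borel version with the same integrals, so this
  reduces to the Borel case.\<close>

lemma AE_zero_of_intervals_lebesgue:
  fixes c :: "real \<Rightarrow> real"
  assumes c: "integrable lebesgue c" and zero: "\<And>a b. (LINT x|lebesgue. indicator {a<..<b} x * c x) = 0"
  shows "AE x in lebesgue. c x = 0"
proof -
  obtain c' where c': "c' \<in> borel_measurable lborel" "AE x in lborel. c x = c' x"
    using completion_ex_borel_measurable_real[of c lborel] c by auto
  have ae: "AE x in lebesgue. c x = c' x" using c'(2) by (rule AE_completion)
  have cm: "c \<in> borel_measurable lebesgue" "c' \<in> borel_measurable lebesgue"
    using c c'(1) by (simp_all add: measurable_completion)
  have "integrable lebesgue c'"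
    using c integrable_cong_AE[OF cm ae] by simp
  then have int: "integrable lborel c'" using c'(1) integrable_completion by blast
  have "AE x in lborel. c' x = 0"
  proof (rule AE_zero_of_intervals[OF int])
    fix a b :: real
    have "(LINT x|lborel. indicator {a<..<b} x * c' x) = (LINT x|lebesgue. indicator {a<..<b} x * c' x)"
      using c'(1) by (subst integral_completion) auto
    also have "\<dots> = (LINT x|lebesgue. indicator {a<..<b} x * c x)"
      using cm ae by (intro integral_cong_AE borel_measurable_times borel_measurable_indicator) auto
    finally show "(LINT x|lborel. indicator {a<..<b} x * c' x) = 0" using zero by simp
  qed
  then have "AE x in lebesgue. c' x = 0" by (rule AE_completion)
  with ae show ?thesis by eventually_elim simp
qed

text \<open>The bumps of an open interval converge to its indicator and are bounded by 1, so by
  dominated convergence the integral of \<open>h\<close> over every bounded interval is zero. A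
  dominating function exists on bounded sets only, hence the cut-off to the intervals from -N to
  N.\<close>

lemma AE_zero_of_test_functions:
  fixes h :: "real \<Rightarrow> real"
  assumes h: "\<And>K. compact K \<Longrightarrow> h absolutely_integrable_on K"
    and zero: "\<And>\<phi>. \<phi> \<in> test_functions_real \<Longrightarrow> (LINT x|lebesgue. h x * \<phi> x) = 0"
  shows "AE x in lebesgue. h x = 0"
proof -
  have "AE x in lebesgue. indicator {-real N<..<real N} x * h x = 0" for N
  proof (rule AE_zero_of_intervals_lebesgue)
    have hN: "integrable lebesgue (\<lambda>x. indicator {-real N..real N} x * h x)"
      using h[of "{-real N..real N}"] by (simp add: set_integrable_def)
    have bd: "integrable lebesgue (\<lambda>x. indicator S x * h x)" if "S \<in> sets borel" "S \<subseteq> {-real N..real N}" for S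
    proof (rule Bochner_Integration.integrable_bound[OF hN])
      have "(\<lambda>x. indicator S x *\<^sub>R (indicator {-real N..real N} x * h x)) \<in> borel_measurable lebesgue"
        using hN that(1) by (intro borel_measurable_scaleR borel_measurable_indicator) auto
      also have "(\<lambda>x. indicator S x *\<^sub>R (indicator {-real N..real N} x * h x)) = (\<lambda>x. indicator S x * h x)"
        using that(2) by (auto simp: indicator_def fun_eq_iff)
      finally show "(\<lambda>x. indicator S x * h x) \<in> borel_measurable lebesgue" .
    qed (use that in \<open>auto simp: indicator_def intro!: AE_I2\<close>)
    show "integrable lebesgue (\<lambda>x. indicator {-real N<..<real N} x * h x)"
      by (rule bd) auto
    fix a b :: real
    \<comment> \<open>The interval is clipped to the cut-off, so that its bumps live where
      \<open>h\<close> is known to be integrable.\<close>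
    define u v where "u = max a (- real N)" and "v = min b (real N)"
    have uv: "{u<..<v} \<subseteq> {-real N..real N}" by (auto simp: u_def v_def)
    have "(\<lambda>n. LINT x|lebesgue. h x * bump u v n x) \<longlonglongrightarrow> (LINT x|lebesgue. h x * indicator {u<..<v} x)"
    proof (rule integral_dominated_convergence[where w = "\<lambda>x. norm (indicator {-real N..real N} x * h x)"])
      show "integrable lebesgue (\<lambda>x. norm (indicator {-real N..real N} x * h x))"
        using hN by auto
      show "AE x in lebesgue. (\<lambda>n. h x * bump u v n x) \<longlonglongrightarrow> h x * indicator {u<..<v} x"
        by (intro AE_I2 tendsto_mult tendsto_const bump_tendsto)
      show "AE x in lebesgue. norm (h x * bump u v n x) \<le> norm (indicator {-real N..real N} x * h x)" for n
      proof (rule AE_I2)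
        fix x show "norm (h x * bump u v n x) \<le> norm (indicator {-real N..real N} x * h x)"
          using uv bump_eq_0[of x u v n] bump_bounds[of u v n x]
          by (cases "x \<in> {u<..<v}") (auto simp: abs_mult indicator_def intro!: mult_left_le)
      qed
      show "(\<lambda>x. h x * indicator {u<..<v} x) \<in> borel_measurable lebesgue"
        using bd[OF _ uv] by (simp add: mult.commute borel_measurable_integrable)
      have "(\<lambda>x. (indicator {u<..<v} x * h x) * bump u v n x) \<in> borel_measurable lebesgue" for n
        using test_function_borel[OF bump_test_function[of u v n]]
        by (intro borel_measurable_times[OF borel_measurable_integrable[OF bd[OF _ uv]] measurable_completion]) auto
      also have "(\<lambda>x. (indicator {u<..<v} x * h x) * bump u v n x) = (\<lambda>x. h x * bump u v n x)" for n
        using bump_eq_0[of _ u v n] by (auto simp: indicator_def fun_eq_iff)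
      finally show "(\<lambda>x. h x * bump u v n x) \<in> borel_measurable lebesgue" for n .
    qed
    then have "(LINT x|lebesgue. h x * indicator {u<..<v} x) = 0"
      by (simp add: zero[OF bump_test_function] LIMSEQ_const_iff)
    moreover have "(\<lambda>x. indicator {a<..<b} x * (indicator {-real N<..<real N} x * h x)) = (\<lambda>x. h x * indicator {u<..<v} x)"
      by (auto simp: indicator_def u_def v_def fun_eq_iff)
    ultimately show "(LINT x|lebesgue. indicator {a<..<b} x * (indicator {-real N<..<real N} x * h x)) = 0"
      by (simp only:)
  qed
  then have "AE x in lebesgue. \<forall>N. indicator {-real N<..<real N} x * h x = 0"
    unfolding AE_all_countable by blast
  then show ?thesis
  proof eventually_elim
    case (elim x)
    obtain N :: nat where "\<bar>x\<bar> < real N" using reals_Archimedean2 by blast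
    then show ?case using elim[rule_format, of N] by (auto simp: indicator_def)
  qed
qed

section \<open>Weak derivatives on the line\<close>

lemma (in pair_sigma_finite) integrable_mult_pair:
  fixes f g :: "_ \<Rightarrow> _::{real_normed_field, banach, second_countable_topology}"
  assumes f: "integrable M1 f" and g: "integrable M2 g"
  shows "integrable (M1 \<Otimes>\<^sub>M M2) (\<lambda>(x, y). f x * g y)"
proof (rule Fubini_integrable)
  note [measurable] = borel_measurable_integrable[OF f] borel_measurable_integrable[OF g]
  show "(\<lambda>(x, y). f x * g y) \<in> borel_measurable (M1 \<Otimes>\<^sub>M M2)" by measurable
qed (use f g in \<open>auto simp: norm_mult\<close>)

text \<open>The integral starts at minus infinity, which the decay of the derivatives permits;
  constants of integration are added where they are needed.\<close>

definition primitive :: "(real \<Rightarrow> real) \<Rightarrow> real \<Rightarrow> real" where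
  "primitive v x = (LINT t|lborel. indicator {..x} t * v t)"

lemma primitive_diff:
  assumes v: "integrable lborel v" and xy: "x \<le> y"
  shows "primitive v y - primitive v x = (LINT t|lborel. indicator {x..y} t * v t)"
proof -
  have int: "integrable lborel (\<lambda>t. indicator {..x} t * v t)" for x
    using integrable_mult_indicator[of "{..x}" lborel v] v by simp
  have "primitive v y - primitive v x = (LINT t|lborel. indicator {..y} t * v t - indicator {..x} t * v t)"
    unfolding primitive_def using int by simp
  also have "\<dots> = (LINT t|lborel. indicator {x..y} t * v t)"
  proof (rule integral_cong_AE)
    show "AE t in lborel. indicator {..y} t * v t - indicator {..x} t * v t = indicator {x..y} t * v t"
      using AE_lborel_singleton[of x] by eventually_elim (use xy in \<open>auto simp: indicator_def\<close>)
  qed (use v in auto)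
  finally show ?thesis .
qed

lemma primitive_lipschitz:
  assumes v: "integrable lborel v" and xy: "x \<le> y" and W: "\<And>t. x \<le> t \<Longrightarrow> t \<le> y \<Longrightarrow> \<bar>v t\<bar> \<le> W"
  shows "\<bar>primitive v y - primitive v x\<bar> \<le> W * (y - x)"
proof -
  have "norm (LINT t|lborel. indicator {x..y} t * v t) \<le> (LINT t|lborel. indicator {x..y} t * W)"
  proof (rule Bochner_Integration.integral_norm_bound_integral)
    show "integrable lborel (\<lambda>t. indicator {x..y} t * W)"
      using xy by (intro integrable_mult_left integrable_real_indicator) auto
  qed (use v W integrable_mult_indicator[of "{x..y}" lborel v] in \<open>auto simp: indicator_def\<close>)
  then show ?thesis using xy by (simp add: primitive_diff[OF v xy] mult.commute)
qed

lemma primitive_continuous: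
  assumes v: "integrable lborel v" and W: "\<And>t. \<bar>v t\<bar> \<le> W"
  shows "continuous_on UNIV (primitive v)"
proof -
  have "W-lipschitz_on UNIV (primitive v)"
  proof (rule lipschitz_onI)
    fix x y :: real
    show "dist (primitive v x) (primitive v y) \<le> W * dist x y"
      using primitive_lipschitz[OF v, of x y W] primitive_lipschitz[OF v, of y x W] W
      by (cases "x \<le> y") (auto simp: dist_real_def abs_minus_commute)
    show "0 \<le> W" using W[of 0] by linarith
  qed
  then show ?thesis by (rule lipschitz_on_continuous_on)
qed

lemma test_function_integrable:
  assumes "\<phi> \<in> test_functions_real" shows "integrable lborel \<phi>"
proof -
  obtain R where R: "R > 0" "\<And>x. \<bar>x\<bar> \<ge> R \<Longrightarrow> \<phi> x = 0"
    using test_function_supportE[OF assms] by metis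
  have "integrable lborel (\<lambda>x. indicator {-R..R} x *\<^sub>R \<phi> x)"
    using smooth_real_continuous_on[of \<phi> "{-R..R}" 0] assms
    by (intro borel_integrable_compact) (auto simp: test_functions_real_iff)
  also have "(\<lambda>x. indicator {-R..R} x *\<^sub>R \<phi> x) = \<phi>"
  proof
    fix x show "indicator {-R..R} x *\<^sub>R \<phi> x = \<phi> x"
      using R(2)[of x] by (cases "\<bar>x\<bar> \<ge> R") (auto simp: indicator_def)
  qed
  finally show ?thesis .
qed

text \<open>Fubini on the region t <= x: integrating the derivative of \<phi> over x >= t leaves
  \<open>- \<phi> t\<close>, integrating \<open>v\<close> over t <= x leaves the primitive. This
  works although \<open>v\<close> is merely integrable and its primitive need not be
  differentiable.\<close>

lemma primitive_integration_by_parts: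
  assumes v: "integrable lborel v" and \<phi>: "\<phi> \<in> test_functions_real"
  shows "(LINT x|lborel. primitive v x * deriv \<phi> x) = - (LINT x|lborel. v x * \<phi> x)"
proof -
  have d\<phi>: "deriv \<phi> \<in> test_functions_real" by (rule test_function_deriv[OF \<phi>])
  obtain R where R: "R > 0" "\<And>x. \<bar>x\<bar> \<ge> R \<Longrightarrow> \<phi> x = 0" "\<And>x. \<bar>x\<bar> \<ge> R \<Longrightarrow> deriv \<phi> x = 0"
  proof -
    obtain R1 where R1: "R1 > 0" "\<And>x. \<bar>x\<bar> \<ge> R1 \<Longrightarrow> \<phi> x = 0" using test_function_supportE[OF \<phi>] by metis
    obtain R2 where R2: "R2 > 0" "\<And>x. \<bar>x\<bar> \<ge> R2 \<Longrightarrow> deriv \<phi> x = 0" using test_function_supportE[OF d\<phi>] by metis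
    show ?thesis by (rule that[of "max R1 R2"]) (use R1 R2 in auto)
  qed
  note [measurable] = borel_measurable_integrable[OF v] test_function_borel[OF \<phi>] test_function_borel[OF d\<phi>]
  have m: "(\<lambda>(x, t). (if t \<le> x then 1 else 0) * v t * deriv \<phi> x) \<in> borel_measurable (lborel \<Otimes>\<^sub>M lborel)"
    by measurable
  have inner: "(LINT x|lborel. (if t \<le> x then 1 else 0) * v t * deriv \<phi> x) = - (v t * \<phi> t)" for t
  proof -
    \<comment> \<open>\<open>S\<close> lies beyond the support and to the right of \<open>t\<close>,
      so that the fundamental theorem applies on a genuine interval whose right end contributes
      nothing.\<close>
    define S where "S = max R (\<bar>t\<bar> + 1)"
    have "(LINT x|lborel. indicator {t..S} x *\<^sub>R deriv \<phi> x) = \<phi> S - \<phi> t"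
      by (rule integral_FTC_atLeastAtMost)
         (use smooth_real_has_derivative'[of \<phi>] smooth_real_continuous_on[of \<phi> _ 1] \<phi>
          in \<open>auto simp: S_def test_functions_real_iff has_real_derivative_iff_has_vector_derivative
                intro: has_vector_derivative_at_within\<close>)
    also have "\<phi> S = 0" using R by (auto simp: S_def)
    also have "(LINT x|lborel. indicator {t..S} x *\<^sub>R deriv \<phi> x) = (LINT x|lborel. (if t \<le> x then 1 else 0) * deriv \<phi> x)"
    proof (intro Bochner_Integration.integral_cong refl)
      fix x show "indicator {t..S} x *\<^sub>R deriv \<phi> x = (if t \<le> x then 1 else 0) * deriv \<phi> x"
        using R(3)[of x] by (cases "x \<le> S") (auto simp: indicator_def S_def)
    qed
    finally have "(LINT x|lborel. (if t \<le> x then 1 else 0) * deriv \<phi> x) = - \<phi> t" by simp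
    moreover have "(LINT x|lborel. (if t \<le> x then 1 else 0) * v t * deriv \<phi> x) =
        v t * (LINT x|lborel. (if t \<le> x then 1 else 0) * deriv \<phi> x)"
    proof -
      have "(\<lambda>x. (if t \<le> x then 1 else 0) * v t * deriv \<phi> x) = (\<lambda>x. v t * ((if t \<le> x then 1 else 0) * deriv \<phi> x))"
        by (auto simp: fun_eq_iff)
      then show ?thesis by (simp only: integral_mult_right_zero)
    qed
    ultimately show ?thesis by simp
  qed
  have "integrable (lborel \<Otimes>\<^sub>M lborel) (\<lambda>(x, t). (if t \<le> x then 1 else 0) * v t * deriv \<phi> x)"
    by (rule Bochner_Integration.integrable_bound[OF lborel_pair.integrable_mult_pair[OF test_function_integrable[OF d\<phi>] v]])
       (use m in \<open>auto simp: abs_mult\<close>)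
  then have "(LINT t|lborel. (LINT x|lborel. (if t \<le> x then 1 else 0) * v t * deriv \<phi> x)) =
      (LINT x|lborel. (LINT t|lborel. (if t \<le> x then 1 else 0) * v t * deriv \<phi> x))"
    by (rule lborel_pair.Fubini_integral)
  also have "\<dots> = (LINT x|lborel. primitive v x * deriv \<phi> x)"
    unfolding primitive_def
    by (intro Bochner_Integration.integral_cong refl, subst integral_mult_left_zero[symmetric])
       (auto intro!: Bochner_Integration.integral_cong simp: indicator_def)
  finally show ?thesis by (simp add: inner)
qed

text \<open>An antiderivative is constant on either side of the support. Normalised to vanish on the
  left, it vanishes on the right because the mean is zero, so it has compact support again.\<close>

lemma test_function_antiderivative:
  assumes \<psi>: "\<psi> \<in> test_functions_real" and zero: "(LINT x|lborel. \<psi> x) = 0"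
  obtains \<xi> where "\<xi> \<in> test_functions_real" "deriv \<xi> = \<psi>"
proof -
  have sm: "smooth_real \<psi>" using \<psi> by (simp add: test_functions_real_iff)
  have cont: "continuous_on A \<psi>" for A using smooth_real_continuous_on[OF sm, of A 0] by simp
  then have "isCont \<psi> x" for x using continuous_on_eq_continuous_at[of UNIV \<psi>] by auto
  then obtain F where F: "\<And>x. (F has_vector_derivative \<psi> x) (at x)"
    using einterval_antiderivative[of "-\<infinity>" "\<infinity>" \<psi>] by auto
  obtain R where R: "R > 0" "\<And>x. \<bar>x\<bar> \<ge> R \<Longrightarrow> \<psi> x = 0"
    using test_function_supportE[OF \<psi>] by metis
  define \<xi> where "\<xi> x = F x - F (- R)" for x
  have ftc: "(LINT t|lborel. indicator {a..b} t *\<^sub>R \<psi> t) = F b - F a" if "a \<le> b" for a b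
    by (rule integral_FTC_atLeastAtMost[OF that has_vector_derivative_at_within[OF F] cont])
  have d: "(\<xi> has_real_derivative \<psi> x) (at x)" for x
    unfolding \<xi>_def using F[of x] by (auto intro!: derivative_eq_intros simp: has_real_derivative_iff_has_vector_derivative)
  have "smooth_real \<xi>"
  proof (rule smooth_realI(1)[where U = "\<lambda>k. case k of 0 \<Rightarrow> \<xi> | Suc k \<Rightarrow> (deriv ^^ k) \<psi>"])
    show "((case k of 0 \<Rightarrow> \<xi> | Suc k \<Rightarrow> (deriv ^^ k) \<psi>) has_real_derivative
        (case Suc k of 0 \<Rightarrow> \<xi> | Suc k \<Rightarrow> (deriv ^^ k) \<psi>) x) (at x)" for k x
      using d smooth_real_has_derivative[OF sm] by (cases k) auto
  qed simp
  moreover have "\<xi> x = 0" if "x \<notin> {-R..R}" for x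
  proof (cases "x < - R")
    case True
    have "(LINT t|lborel. indicator {x..-R} t *\<^sub>R \<psi> t) = 0"
      by (rule integral_eq_zero_AE, rule AE_I2) (use R in \<open>auto simp: indicator_def\<close>)
    then show ?thesis using ftc[of x "-R"] True by (simp add: \<xi>_def)
  next
    case False
    then have x: "x > R" using that by auto
    have "(LINT t|lborel. indicator {-R..x} t *\<^sub>R \<psi> t) = (LINT t|lborel. \<psi> t)"
    proof (intro Bochner_Integration.integral_cong refl)
      fix t show "indicator {-R..x} t *\<^sub>R \<psi> t = \<psi> t"
        using R(2)[of t] x by (cases "\<bar>t\<bar> \<ge> R") (auto simp: indicator_def)
    qed
    then show ?thesis using ftc[of "-R" x] x R(1) zero by (simp add: \<xi>_def)
  qed
  ultimately have "\<xi> \<in> test_functions_real"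
    unfolding test_functions_real_iff by (intro conjI exI[of _ "{-R..R}"]) auto
  moreover have "deriv \<xi> = \<psi>" using d by (intro ext DERIV_imp_deriv)
  ultimately show ?thesis by (rule that)
qed

lemma integrable_times_test_function:
  assumes h: "\<And>K. compact K \<Longrightarrow> h absolutely_integrable_on K" and \<phi>: "\<phi> \<in> test_functions_real"
  shows "integrable lebesgue (\<lambda>x. h x * \<phi> x)"
proof -
  obtain R where R: "R > 0" "\<And>x. \<bar>x\<bar> \<ge> R \<Longrightarrow> \<phi> x = 0" using test_function_supportE[OF \<phi>] by metis
  obtain B where B: "B > 0" "\<And>x. \<bar>\<phi> x\<bar> \<le> B" using test_function_bounded[OF \<phi>] by metis
  have hR: "integrable lebesgue (\<lambda>x. indicator {-R..R} x *\<^sub>R h x)"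
    using h[of "{-R..R}"] by (simp add: set_integrable_def)
  have \<phi>m: "\<phi> \<in> borel_measurable lebesgue"
    by (rule measurable_completion) (use test_function_borel[OF \<phi>] in simp)
  have "integrable lebesgue (\<lambda>x. (indicator {-R..R} x *\<^sub>R h x) * \<phi> x)"
  proof (rule Bochner_Integration.integrable_bound)
    show "integrable lebesgue (\<lambda>x. B * norm (indicator {-R..R} x *\<^sub>R h x))"
      using hR by (intro integrable_mult_right integrable_norm)
    show "AE x in lebesgue. norm ((indicator {-R..R} x *\<^sub>R h x) * \<phi> x) \<le> norm (B * norm (indicator {-R..R} x *\<^sub>R h x))"
    proof (rule AE_I2)
      fix x show "norm ((indicator {-R..R} x *\<^sub>R h x) * \<phi> x) \<le> norm (B * norm (indicator {-R..R} x *\<^sub>R h x))"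
        using B(1) mult_right_mono[OF B(2)[of x], of "norm (indicator {-R..R} x *\<^sub>R h x)"]
        by (simp add: abs_mult mult.commute)
    qed
    show "(\<lambda>x. (indicator {-R..R} x *\<^sub>R h x) * \<phi> x) \<in> borel_measurable lebesgue"
      using hR \<phi>m by (intro borel_measurable_times) auto
  qed
  also have "(\<lambda>x. (indicator {-R..R} x *\<^sub>R h x) * \<phi> x) = (\<lambda>x. h x * \<phi> x)"
  proof
    fix x show "(indicator {-R..R} x *\<^sub>R h x) * \<phi> x = h x * \<phi> x"
      using R(2)[of x] by (cases "\<bar>x\<bar> \<ge> R") (auto simp: indicator_def)
  qed
  finally show ?thesis .
qed

lemma continuous_absolutely_integrable_compact:
  fixes f :: "real \<Rightarrow> real"
  assumes "continuous_on UNIV f" "compact K" shows "f absolutely_integrable_on K"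
proof -
  have "integrable lborel (\<lambda>x. indicator K x *\<^sub>R f x)"
    using assms by (intro borel_integrable_compact) (auto intro: continuous_on_subset)
  then have "integrable lebesgue (\<lambda>x. indicator K x *\<^sub>R f x)"
    using integrable_completion[of "\<lambda>x. indicator K x *\<^sub>R f x" lborel] by auto
  then show ?thesis by (simp add: set_integrable_def)
qed

text \<open>The du Bois-Reymond argument: \<open>h\<close> minus the primitive of \<open>v\<close>
  annihilates all derivatives of test functions. Subtracting from a test function the multiple of a
  fixed bump with the same integral leaves a function of mean zero, which is such a derivative; so
  the difference acts on test functions like a constant.\<close>

lemma weak_derivative_imp_primitive:
  assumes h: "\<And>K. compact K \<Longrightarrow> h absolutely_integrable_on K"
    and v: "integrable lborel v" "\<And>t. \<bar>v t\<bar> \<le> W"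
    and eq: "\<And>\<phi>. \<phi> \<in> test_functions_real \<Longrightarrow>
      (LINT x|lebesgue. h x * deriv \<phi> x) = - (LINT x|lborel. v x * \<phi> x)"
  obtains c where "AE x in lebesgue. h x = c + primitive v x"
proof -
  have Hc: "continuous_on UNIV (primitive v)" by (rule primitive_continuous[OF v])
  then have Hm: "primitive v \<in> borel_measurable borel" by (rule borel_measurable_continuous_onI)
  define g where "g x = h x - primitive v x" for x
  have g: "g absolutely_integrable_on K" if "compact K" for K
    unfolding g_def using h[OF that] continuous_absolutely_integrable_compact[OF Hc that]
    by (intro set_integral_diff)
  have zero: "(LINT x|lebesgue. g x * deriv \<xi> x) = 0" if \<xi>: "\<xi> \<in> test_functions_real" for \<xi>
  proof -
    have d: "deriv \<xi> \<in> test_functions_real" by (rule test_function_deriv[OF \<xi>])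
    have "(LINT x|lebesgue. g x * deriv \<xi> x) =
        (LINT x|lebesgue. h x * deriv \<xi> x) - (LINT x|lebesgue. primitive v x * deriv \<xi> x)"
      unfolding g_def left_diff_distrib
      by (intro Bochner_Integration.integral_diff integrable_times_test_function[OF _ d] h
          continuous_absolutely_integrable_compact[OF Hc])
    also have "(LINT x|lebesgue. primitive v x * deriv \<xi> x) = (LINT x|lborel. primitive v x * deriv \<xi> x)"
      using Hm test_function_borel[OF d] by (intro integral_completion) auto
    finally show ?thesis by (simp add: eq[OF \<xi>] primitive_integration_by_parts[OF v(1) \<xi>])
  qed
  define b where "b = bump (-1) 1 0"
  have b: "b \<in> test_functions_real" unfolding b_def by (rule bump_test_function)
  define J where "J = (LINT x|lborel. b x)"
  have J: "J > 0"
  proof -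
    have "J \<ge> 0" unfolding J_def b_def by (intro Bochner_Integration.integral_nonneg bump_bounds)
    moreover have "J \<noteq> 0"
    proof
      assume "J = 0"
      then have "AE x in lborel. b x = 0"
        using integral_nonneg_eq_0_iff_AE[OF test_function_integrable[OF b]] bump_bounds
        unfolding J_def b_def by auto
      \<comment> \<open>The zero set of \<open>b\<close> is closed; of full measure it would be the
        whole line, but it misses 0.\<close>
      then have "AE x in lebesgue. x \<in> {x. b x = 0}" by (auto intro: AE_completion)
      moreover have "closed {x. b x = 0}"
        using smooth_real_continuous_on[of b UNIV 0] b
        by (intro closed_Collect_eq) (auto simp: test_functions_real_iff)
      ultimately have "(0::real) \<in> {x. b x = 0}" by (intro mem_closed_if_AE_lebesgue)
      then show False using bump_pos[of 0 "-1" 1 0] by (simp add: b_def)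
    qed
    ultimately show ?thesis by simp
  qed
  \<comment> \<open>The value of the constant is forced by testing with \<open>b\<close>
    itself.\<close>
  define c where "c = (LINT x|lebesgue. g x * b x) / J"
  have "AE x in lebesgue. g x - c = 0"
  proof (rule AE_zero_of_test_functions)
    show "(\<lambda>x. g x - c) absolutely_integrable_on K" if "compact K" for K
      using g[OF that] continuous_absolutely_integrable_compact[OF continuous_on_const that]
      by (intro set_integral_diff)
    fix \<phi> :: "real \<Rightarrow> real" assume \<phi>: "\<phi> \<in> test_functions_real"
    define r where "r = (LINT x|lborel. \<phi> x) / J"
    define \<psi> where "\<psi> x = \<phi> x + (- r) * b x" for x
    have "\<psi> \<in> test_functions_real"
    proof -
      obtain R1 where R1: "\<And>x. \<bar>x\<bar> \<ge> R1 \<Longrightarrow> \<phi> x = 0" using test_function_supportE[OF \<phi>] by metis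
      obtain R2 where R2: "\<And>x. \<bar>x\<bar> \<ge> R2 \<Longrightarrow> b x = 0" using test_function_supportE[OF b] by metis
      have "\<psi> x = 0" if "x \<notin> {- max R1 R2..max R1 R2}" for x
        unfolding \<psi>_def using that R1[of x] R2[of x] by auto
      moreover have "smooth_real \<psi>"
        unfolding \<psi>_def using \<phi> b
        by (intro smooth_real_add smooth_real_mult smooth_real_const) (auto simp: test_functions_real_iff)
      ultimately show ?thesis unfolding test_functions_real_iff by blast
    qed
    moreover have "(LINT x|lborel. \<psi> x) = 0"
      unfolding \<psi>_def using test_function_integrable[OF \<phi>] test_function_integrable[OF b] J
      by (simp add: r_def J_def)
    ultimately obtain \<xi> where \<xi>: "\<xi> \<in> test_functions_real" "deriv \<xi> = \<psi>"
      by (rule test_function_antiderivative)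
    have i1: "integrable lebesgue (\<lambda>x. g x * \<phi> x)" and i2: "integrable lebesgue (\<lambda>x. g x * b x)"
      by (intro integrable_times_test_function g \<phi> b; assumption)+
    have "0 = (LINT x|lebesgue. g x * \<phi> x - r * (g x * b x))"
      using zero[OF \<xi>(1)] unfolding \<xi>(2) \<psi>_def by (simp add: algebra_simps)
    also have "\<dots> = (LINT x|lebesgue. g x * \<phi> x) - r * (LINT x|lebesgue. g x * b x)"
      using i1 i2 by simp
    finally have "(LINT x|lebesgue. g x * \<phi> x) = c * (LINT x|lborel. \<phi> x)"
      using J by (simp add: c_def r_def)
    moreover have "(LINT x|lebesgue. \<phi> x) = (LINT x|lborel. \<phi> x)"
      using test_function_borel[OF \<phi>] by (intro integral_completion) auto
    moreover have "integrable lebesgue \<phi>"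
      using test_function_integrable[OF \<phi>] integrable_completion[of \<phi> lborel] by auto
    ultimately show "(LINT x|lebesgue. (g x - c) * \<phi> x) = 0"
      using i1 by (simp add: left_diff_distrib)
  qed
  then have "AE x in lebesgue. h x = c + primitive v x"
    by eventually_elim (simp add: g_def)
  then show ?thesis by (rule that)
qed

section \<open>Integrals over the bias\<close>

lemma nn_integral_powr_tail:
  fixes A H p :: real
  assumes H: "H \<ge> 0" and p: "p > 1"
  shows "(\<integral>\<^sup>+b. ennreal ((1 + b - A) powr (- p)) * indicator {A + H..} b \<partial>lborel) = ennreal ((1 + H) powr (1 - p) / (p - 1))"
proof -
  have "(\<integral>\<^sup>+b. ennreal ((1 + b - A) powr (- p)) * indicator {A + H..} b \<partial>lborel) =
      ennreal (0 - (- ((1 + (A + H) - A) powr (1 - p)) / (p - 1)))"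
  proof (rule nn_integral_FTC_atLeast)
    fix x assume x: "A + H \<le> x"
    have pos: "1 + x - A > 0" using x H by linarith
    have zz: "(1 + x - A) powr (1 - p) = (1 + x - A) * (1 + x - A) powr (- p)"
      using pos powr_mult_base[of "1 + x - A" "- p"] by simp
    have "((\<lambda>b. (1 + b - A) powr (1 - p)) has_real_derivative (1 - p) * (1 + x - A) powr (- p)) (at x)"
      using pos by (auto intro!: derivative_eq_intros simp: zz)
    then show "((\<lambda>b. - ((1 + b - A) powr (1 - p)) / (p - 1)) has_real_derivative (1 + x - A) powr (- p)) (at x)"
      by (intro DERIV_cong[OF DERIV_cdivide[OF DERIV_minus]]) (use p in \<open>auto simp: divide_simps algebra_simps\<close>)
    show "0 \<le> (1 + x - A) powr - p" by simp
  next
    have "((\<lambda>b. - ((1 + b - A) powr (1 - p)) / (p - 1)) \<longlongrightarrow> - 0 / (p - 1)) at_top"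
      using p by (intro tendsto_intros tendsto_neg_powr) (auto, real_asymp)
    then show "((\<lambda>b. - ((1 + b - A) powr (1 - p)) / (p - 1)) \<longlongrightarrow> 0) at_top" by simp
  qed simp
  then show ?thesis by simp
qed

text \<open>In the application \<open>A\<close> is proportional to |omega|: it bounds the biases on
  which the weight is constant, and \<open>H\<close> is the distance from there. Each of the two
  sides contributes the same one-sided integral.\<close>

lemma nn_integral_weight_tail:
  fixes A H p :: real
  assumes A: "A \<ge> 0" and H: "H \<ge> 0" and p: "p > 1"
  shows "(\<integral>\<^sup>+b. ennreal ((1 + max 0 (\<bar>b\<bar> - A)) powr (- p)) * indicator {b. \<bar>b\<bar> \<ge> A + H} b \<partial>lborel)
    \<le> ennreal (2 * (1 + H) powr (1 - p) / (p - 1))"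
proof -
  let ?f = "\<lambda>b. ennreal ((1 + b - A) powr (- p)) * indicator {A + H..} b"
  have "(\<integral>\<^sup>+b. ?f (- b) \<partial>lborel) = (\<integral>\<^sup>+b. ?f b \<partial>lborel)"
    using nn_integral_real_affine[of ?f "- 1" 0] by simp
  moreover have "(\<integral>\<^sup>+b. ennreal ((1 + max 0 (\<bar>b\<bar> - A)) powr (- p)) * indicator {b. \<bar>b\<bar> \<ge> A + H} b \<partial>lborel) \<le>
      (\<integral>\<^sup>+b. ?f b + ?f (- b) \<partial>lborel)"
    using A H by (intro nn_integral_mono) (auto simp: indicator_def abs_if max_def algebra_simps split: if_splits)
  moreover have "(\<integral>\<^sup>+b. ?f b + ?f (- b) \<partial>lborel) = (\<integral>\<^sup>+b. ?f b \<partial>lborel) + (\<integral>\<^sup>+b. ?f (- b) \<partial>lborel)"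
    by (rule nn_integral_add) auto
  ultimately show ?thesis
    using p by (simp add: nn_integral_powr_tail[OF H p] flip: ennreal_plus)
qed

text \<open>The term linear in \<open>A\<close> is the length of the plateau. With \<open>A\<close>
  proportional to |omega| it is the one power of 1 + |omega| by which the Barron norm exceeds the m
  powers due to the derivatives.\<close>

lemma nn_integral_weight:
  fixes A p :: real
  assumes A: "A \<ge> 0" and p: "p > 1"
  shows "(\<integral>\<^sup>+b. ennreal ((1 + max 0 (\<bar>b\<bar> - A)) powr (- p)) \<partial>lborel) \<le> ennreal (2 * A + 2 / (p - 1))"
proof -
  have "(\<integral>\<^sup>+b. ennreal ((1 + max 0 (\<bar>b\<bar> - A)) powr (- p)) \<partial>lborel) \<le>
     (\<integral>\<^sup>+b. indicator {-A..A} b + ennreal ((1 + max 0 (\<bar>b\<bar> - A)) powr (- p)) * indicator {b. \<bar>b\<bar> \<ge> A + 0} b \<partial>lborel)"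
    by (intro nn_integral_mono) (auto simp: indicator_def abs_if max_def split: if_splits)
  also have "\<dots> = (\<integral>\<^sup>+b. indicator {-A..A} b \<partial>lborel) +
     (\<integral>\<^sup>+b. ennreal ((1 + max 0 (\<bar>b\<bar> - A)) powr (- p)) * indicator {b. \<bar>b\<bar> \<ge> A + 0} b \<partial>lborel)"
    by (rule nn_integral_add) auto
  also have "\<dots> \<le> ennreal (2 * A) + ennreal (2 * (1 + 0) powr (1 - p) / (p - 1))"
    using A by (intro add_mono nn_integral_weight_tail[OF A _ p]) auto
  also have "\<dots> = ennreal (2 * A + 2 / (p - 1))"
    using A p by (subst ennreal_plus[symmetric]) auto
  finally show ?thesis .
qed

lemma integrable_powr_decay:
  assumes "p > 1" shows "integrable lborel (\<lambda>x. (1 + \<bar>x\<bar>) powr (- p) :: real)"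
proof (rule integrableI_bounded)
  have "(\<integral>\<^sup>+x. ennreal (norm ((1 + \<bar>x\<bar>) powr (- p))) \<partial>lborel) \<le> ennreal (2 * 0 + 2 / (p - 1))"
    using nn_integral_weight[of 0 p] assms by simp
  then show "(\<integral>\<^sup>+x. ennreal (norm ((1 + \<bar>x\<bar>) powr (- p))) \<partial>lborel) < \<infinity>"
    using le_less_trans ennreal_less_top by (metis infinity_ennreal_def)
qed simp

text \<open>If the integral vanished at every \<open>a\<close> other than 0, continuity would make
  it vanish at 0 too, and uniqueness would give s = 0 almost everywhere. The value 0 has to be
  avoided because frequencies will be divided by \<open>a\<close>.\<close>

lemma fourier_nonzero:
  fixes s :: "real \<Rightarrow> real"
  assumes s: "integrable lborel s" and nz: "\<not> (AE x in lborel. s x = 0)"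
  obtains a where "a \<noteq> 0" "(LINT y|lborel. complex_of_real (s y) * iexp (- a * y)) \<noteq> 0"
proof (rule ccontr)
  assume "\<not> thesis"
  with that have neg: "\<forall>a. a \<noteq> 0 \<longrightarrow> (LINT y|lborel. complex_of_real (s y) * iexp (- a * y)) = 0"
    by blast
  have z: "(LINT y|lborel. complex_of_real (s y) * iexp (a * y)) = 0" if "a \<noteq> 0" for a
    using neg[rule_format, of "- a"] that by simp
  note [measurable] = borel_measurable_integrable[OF s]
  have "(\<lambda>n. LINT y|lborel. complex_of_real (s y) * iexp (inverse (real (Suc n)) * y)) \<longlonglongrightarrow>
      (LINT y|lborel. complex_of_real (s y) * iexp (0 * y))"
  proof (rule integral_dominated_convergence[where w = "\<lambda>y. norm (s y)"])
    show "AE y in lborel. (\<lambda>n. complex_of_real (s y) * iexp (inverse (real (Suc n)) * y)) \<longlonglongrightarrow>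
        complex_of_real (s y) * iexp (0 * y)"
      by (intro AE_I2 tendsto_intros LIMSEQ_inverse_real_of_nat)
  qed (use s in \<open>auto simp: norm_mult\<close>)
  moreover have "(LINT y|lborel. complex_of_real (s y) * iexp (inverse (real (Suc n)) * y)) = 0" for n
    by (rule z) simp
  ultimately have "(LINT y|lborel. complex_of_real (s y) * iexp (0 * y)) = 0"
    by (simp only: LIMSEQ_const_iff)
  with z have "(LINT y|lborel. complex_of_real (s y) * iexp (a * y)) = 0" for a
    by (cases "a = 0") auto
  from integral_indicator_zero_of_fourier_real[OF s _ this]
  have "AE x in lborel. s x = 0"
    by (intro AE_zero_of_intervals[OF s]) auto
  with nz show False by simp
qed

section \<open>Regular representatives of the activation\<close>

lemma le_of_AE_continuous:
  fixes f g :: "real \<Rightarrow> real"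
  assumes "continuous_on UNIV f" "continuous_on UNIV g" "AE x in lebesgue. f x \<le> g x"
  shows "f x \<le> g x"
proof -
  have "closed {x. f x \<le> g x}" using assms(1,2) by (rule closed_Collect_le)
  from mem_closed_if_AE_lebesgue[OF this, of x] assms(3) show ?thesis by simp
qed

lemma is_weak_deriv_realD:
  assumes "is_weak_deriv_real k \<sigma> v" "compact K"
  shows "\<sigma> absolutely_integrable_on K" "v absolutely_integrable_on K"
  using assms by (auto simp: is_weak_deriv_real_def)

text \<open>Integrability over growing compact intervals gives measurability, the Lebesgue
  sigma-algebra is a completion and so provides a Borel version, and setting that version to 0 where
  the bound fails makes the bound hold everywhere.\<close>

lemma borel_representative:
  assumes w: "is_weak_deriv_real k \<sigma> v" and b: "AE s in lebesgue. \<bar>v s\<bar> \<le> g s"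
    and g: "g \<in> borel_measurable borel" "\<And>s. 0 \<le> g s"
  obtains v' where "v' \<in> borel_measurable borel" "\<And>s. \<bar>v' s\<bar> \<le> g s" "AE s in lebesgue. v s = v' s"
proof -
  have "v \<in> borel_measurable lebesgue"
  proof (rule borel_measurable_LIMSEQ_real)
    show "(\<lambda>n. indicator {-real n..real n} x *\<^sub>R v x) \<longlonglongrightarrow> v x" for x
    proof (rule tendsto_eventually)
      obtain k :: nat where k: "\<bar>x\<bar> < real k" using reals_Archimedean2 by blast
      show "\<forall>\<^sub>F n in sequentially. indicator {-real n..real n} x *\<^sub>R v x = v x"
        using eventually_ge_at_top[of k] by eventually_elim (use k in \<open>auto simp: indicator_def\<close>)
    qed
    show "(\<lambda>x. indicator {-real n..real n} x *\<^sub>R v x) \<in> borel_measurable lebesgue" for n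
      using is_weak_deriv_realD(2)[OF w, of "{-real n..real n}"] by (simp add: set_integrable_def)
  qed
  then obtain v0 where v0: "v0 \<in> borel_measurable lborel" "AE x in lborel. v x = v0 x"
    using completion_ex_borel_measurable_real by blast
  define v' where "v' x = (if \<bar>v0 x\<bar> \<le> g x then v0 x else 0)" for x
  show ?thesis
  proof (rule that)
    show "v' \<in> borel_measurable borel" unfolding v'_def using v0(1) g(1) by measurable
    show "\<bar>v' s\<bar> \<le> g s" for s using g(2) by (simp add: v'_def)
    show "AE s in lebesgue. v s = v' s"
      using AE_completion[OF v0(2)] b by eventually_elim (auto simp: v'_def)
  qed
qed

text \<open>The increments are controlled by the decay of the next derivative, which is what makes even
  the top order \<open>m\<close> Lipschitz.\<close>

lemma regular_representatives:
  fixes \<sigma> :: "real \<Rightarrow> real"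
  assumes p: "p > 1"
    and \<sigma>: "\<exists>Cp. \<forall>k\<le>m + 1. \<exists>v. is_weak_deriv_real k \<sigma> v \<and>
           (AE s in lebesgue. \<bar>v s\<bar> \<le> Cp * (1 + \<bar>s\<bar>) powr (- p))"
  obtains s :: "nat \<Rightarrow> real \<Rightarrow> real" and Cs where "Cs > 0"
    "AE x in lebesgue. \<sigma> x = s 0 x"
    "\<And>k. k \<le> m \<Longrightarrow> continuous_on UNIV (s k)"
    "\<And>k x. k < m \<Longrightarrow> (s k has_real_derivative s (Suc k) x) (at x)"
    "\<And>k x. k \<le> m \<Longrightarrow> \<bar>s k x\<bar> \<le> Cs * (1 + \<bar>x\<bar>) powr (- p)"
    "\<And>k x y. k \<le> m \<Longrightarrow> \<bar>x - y\<bar> \<le> 1 \<Longrightarrow> \<bar>s k x - s k y\<bar> \<le> Cs * (1 + \<bar>x\<bar>) powr (- p) * \<bar>x - y\<bar>"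
proof -
  obtain C0 where C0: "\<forall>k\<le>m + 1. \<exists>v. is_weak_deriv_real k \<sigma> v \<and>
      (AE s in lebesgue. \<bar>v s\<bar> \<le> C0 * (1 + \<bar>s\<bar>) powr (- p))"
    using \<sigma> by blast
  \<comment> \<open>The maximum makes \<open>g\<close> nonnegative whatever the sign of
    \<open>C0\<close>.\<close>
  define Cp where "Cp = max C0 1"
  define g where "g s = Cp * (1 + \<bar>s\<bar>) powr (- p)" for s :: real
  have Cp: "Cp > 0" by (simp add: Cp_def)
  have g0: "0 \<le> g s" for s using Cp by (simp add: g_def)
  have gm: "g \<in> borel_measurable borel" unfolding g_def by measurable
  have gc: "continuous_on UNIV g" unfolding g_def by (auto intro!: continuous_intros)
  have gint: "integrable lborel g" unfolding g_def by (intro integrable_mult_right integrable_powr_decay p)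
  have gle: "g s \<le> Cp" for s
  proof -
    have "(1 + \<bar>s\<bar>) powr (- p) \<le> 1 powr (- p)" using p by (intro powr_mono2') auto
    then show ?thesis unfolding g_def using Cp by (simp add: mult_left_le)
  qed
  define P where "P k v' \<longleftrightarrow> v' \<in> borel_measurable borel \<and> (\<forall>s. \<bar>v' s\<bar> \<le> g s) \<and> (\<forall>\<phi>\<in>test_functions_real.
        (LINT x|lebesgue. \<sigma> x * (deriv ^^ k) \<phi> x) = (-1) ^ k * (LINT x|lborel. v' x * \<phi> x))" for k v'
  have ex: "\<exists>v'. P k v'"
    if k: "k \<le> m + 1" for k
  proof -
    obtain v where v: "is_weak_deriv_real k \<sigma> v" "AE s in lebesgue. \<bar>v s\<bar> \<le> C0 * (1 + \<bar>s\<bar>) powr (- p)"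
      using C0 k by blast
    have "AE s in lebesgue. \<bar>v s\<bar> \<le> g s"
      using v(2)
    proof eventually_elim
      case (elim s)
      have "C0 * (1 + \<bar>s\<bar>) powr (- p) \<le> g s" unfolding g_def Cp_def by (intro mult_right_mono) auto
      with elim show ?case by linarith
    qed
    from borel_representative[OF v(1) this gm g0]
    obtain v' where v': "v' \<in> borel_measurable borel" "\<And>s. \<bar>v' s\<bar> \<le> g s" "AE s in lebesgue. v s = v' s"
      by metis
    have "(LINT x|lebesgue. \<sigma> x * (deriv ^^ k) \<phi> x) = (-1) ^ k * (LINT x|lborel. v' x * \<phi> x)"
      if \<phi>: "\<phi> \<in> test_functions_real" for \<phi>
    proof -
      have m: "(\<lambda>x. v' x * \<phi> x) \<in> borel_measurable borel"
        using v'(1) test_function_borel[OF \<phi>] by measurable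
      have "(LINT x|lebesgue. v x * \<phi> x) = (LINT x|lebesgue. v' x * \<phi> x)"
      proof (rule integral_cong_AE)
        show "(\<lambda>x. v x * \<phi> x) \<in> borel_measurable lebesgue"
          using integrable_times_test_function[OF is_weak_deriv_realD(2)[OF v(1)] \<phi>] by simp
        show "(\<lambda>x. v' x * \<phi> x) \<in> borel_measurable lebesgue"
          by (rule measurable_completion) (use m in simp)
        show "AE x in lebesgue. v x * \<phi> x = v' x * \<phi> x" using v'(3) by eventually_elim simp
      qed
      also have "\<dots> = (LINT x|lborel. v' x * \<phi> x)" by (rule integral_completion) (use m in simp)
      finally show ?thesis using v(1) \<phi> by (auto simp: is_weak_deriv_real_def)
    qed
    with v' show ?thesis unfolding P_def by blast
  qed
  define v where "v k = (SOME v'. P k v')" for k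
  have vP: "P k (v k)" if "k \<le> m + 1" for k unfolding v_def by (rule someI_ex[OF ex[OF that]])
  have v: "\<And>k. k \<le> m + 1 \<Longrightarrow> v k \<in> borel_measurable borel"
      "\<And>k s. k \<le> m + 1 \<Longrightarrow> \<bar>v k s\<bar> \<le> g s"
      "\<And>k \<phi>. k \<le> m + 1 \<Longrightarrow> \<phi> \<in> test_functions_real \<Longrightarrow>
        (LINT x|lebesgue. \<sigma> x * (deriv ^^ k) \<phi> x) = (-1) ^ k * (LINT x|lborel. v k x * \<phi> x)"
    using vP unfolding P_def by blast+
  have vint: "integrable lborel (v k)" if "k \<le> m + 1" for k
    by (rule Bochner_Integration.integrable_bound[OF gint]) (use v(1,2)[OF that] g0 in auto)
  have vloc: "v k absolutely_integrable_on K" if "k \<le> m + 1" "compact K" for k K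
  proof -
    have "integrable lborel (\<lambda>x. indicator K x *\<^sub>R v k x)"
      using vint[OF that(1)] that(2) by (intro integrable_mult_indicator) (auto intro: borel_compact)
    then show ?thesis
      using integrable_completion[of "\<lambda>x. indicator K x *\<^sub>R v k x" lborel] by (auto simp: set_integrable_def)
  qed
  have vW: "\<bar>v k s\<bar> \<le> Cp" if "k \<le> m + 1" for k s using v(2)[OF that, of s] gle[of s] by linarith
  \<comment> \<open>Inserting the derivative of a test function into the identity of order k and
    comparing with order k + 1 shows that \<open>v (Suc k)\<close> is the weak derivative of
    \<open>v k\<close>.\<close>
  have exc: "\<exists>c. AE x in lebesgue. v k x = c + primitive (v (Suc k)) x" if k: "k \<le> m" for k
  proof -
    have eq: "(LINT x|lebesgue. v k x * deriv \<phi> x) = - (LINT x|lborel. v (Suc k) x * \<phi> x)"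
      if \<phi>: "\<phi> \<in> test_functions_real" for \<phi>
    proof -
      have d\<phi>: "deriv \<phi> \<in> test_functions_real" by (rule test_function_deriv[OF \<phi>])
      have "(-1) ^ k * (LINT x|lborel. v k x * deriv \<phi> x) = (LINT x|lebesgue. \<sigma> x * (deriv ^^ k) (deriv \<phi>) x)"
        using v(3)[OF _ d\<phi>, of k] k by simp
      also have "(deriv ^^ k) (deriv \<phi>) = (deriv ^^ Suc k) \<phi>" by (simp add: funpow_swap1)
      also have "(LINT x|lebesgue. \<sigma> x * (deriv ^^ Suc k) \<phi> x) = (-1) ^ Suc k * (LINT x|lborel. v (Suc k) x * \<phi> x)"
        using v(3)[OF _ \<phi>, of "Suc k"] k by simp
      finally have "(LINT x|lborel. v k x * deriv \<phi> x) = - (LINT x|lborel. v (Suc k) x * \<phi> x)"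
        by (cases "even k") auto
      moreover have "(LINT x|lebesgue. v k x * deriv \<phi> x) = (LINT x|lborel. v k x * deriv \<phi> x)"
        using v(1)[of k] k test_function_borel[OF d\<phi>] by (intro integral_completion) auto
      ultimately show ?thesis by simp
    qed
    show ?thesis
      by (rule weak_derivative_imp_primitive[of "v k" "v (Suc k)" Cp])
         (use k eq vint[of "Suc k"] vloc[of k] vW[of "Suc k"] in auto)
  qed
  define c where "c k = (SOME c. AE x in lebesgue. v k x = c + primitive (v (Suc k)) x)" for k
  have c: "AE x in lebesgue. v k x = c k + primitive (v (Suc k)) x" if "k \<le> m" for k
    unfolding c_def by (rule someI_ex[OF exc[OF that]])
  \<comment> \<open>Being a primitive, \<open>s k\<close> is continuous by construction. It consumes
    the derivative of order k + 1, so the hypothesis up to order m + 1 provides it for k up to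
    m.\<close>
  define s where "s k x = c k + primitive (v (Suc k)) x" for k x
  have sv: "AE x in lebesgue. v k x = s k x" if "k \<le> m" for k
    using c[OF that] by (simp add: s_def)
  have sc: "continuous_on UNIV (s k)" if "k \<le> m" for k
    unfolding s_def using that
    by (intro continuous_intros primitive_continuous[OF vint vW]) auto
  \<comment> \<open>Both sides are continuous, so the bound passes from almost everywhere to
    everywhere.\<close>
  have sb: "\<bar>s k x\<bar> \<le> g x" if k: "k \<le> m" for k x
  proof (rule le_of_AE_continuous[OF _ gc])
    show "continuous_on UNIV (\<lambda>x. \<bar>s k x\<bar>)" using sc[OF k] by (rule continuous_on_rabs)
    show "AE x in lebesgue. \<bar>s k x\<bar> \<le> g x"
      using sv[OF k]
    proof eventually_elim
      case (elim x)
      then show ?case using v(2)[of k x] k by simp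
    qed
  qed
  have lip: "\<bar>s k x - s k y\<bar> \<le> 2 powr p * g x * \<bar>x - y\<bar>" if k: "k \<le> m" and xy: "\<bar>x - y\<bar> \<le> 1" for k x y
  proof -
    have W: "\<bar>v (Suc k) t\<bar> \<le> 2 powr p * g x" if "\<bar>t - x\<bar> \<le> 1" for t
    proof -
      \<comment> \<open>For t within distance 1 of x, 1 + |t| is at least (1 + |x|) / 2; this is the
        origin of the factor \<open>2 powr p\<close>.\<close>
      have "(1 + \<bar>t\<bar>) powr (- p) \<le> ((1 + \<bar>x\<bar>) / 2) powr (- p)"
        using that p by (intro powr_mono2') auto
      also have "\<dots> = 2 powr p * (1 + \<bar>x\<bar>) powr (- p)"
        by (subst powr_divide) (auto simp: powr_minus_divide)
      finally have "g t \<le> 2 powr p * g x"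
        unfolding g_def using Cp by (simp add: mult.left_commute)
      with v(2)[of "Suc k" t] k show ?thesis by simp
    qed
    have diff: "s k x - s k y = primitive (v (Suc k)) x - primitive (v (Suc k)) y" by (simp add: s_def)
    have vk: "integrable lborel (v (Suc k))" using vint k by simp
    show ?thesis
    proof (cases "x \<le> y")
      case True
      have "\<bar>primitive (v (Suc k)) y - primitive (v (Suc k)) x\<bar> \<le> 2 powr p * g x * (y - x)"
        by (rule primitive_lipschitz[OF vk True W]) (use xy in auto)
      with True show ?thesis unfolding diff by simp
    next
      case False
      then have "y \<le> x" by simp
      have "\<bar>primitive (v (Suc k)) x - primitive (v (Suc k)) y\<bar> \<le> 2 powr p * g x * (x - y)"
        by (rule primitive_lipschitz[OF vk \<open>y \<le> x\<close> W]) (use xy in auto)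
      with False show ?thesis unfolding diff by simp
    qed
  qed
  \<comment> \<open>Below the top order the integrand \<open>v (Suc k)\<close> may be replaced by
    the continuous \<open>s (Suc k)\<close>, so the fundamental theorem turns the primitive into a
    classical one.\<close>
  have der: "(s k has_real_derivative s (Suc k) x) (at x)" if k: "k < m" for k x
  proof -
    have cont: "continuous_on A (s (Suc k))" for A using sc[of "Suc k"] k by (auto intro: continuous_on_subset)
    then have "isCont (s (Suc k)) x" for x using continuous_on_eq_continuous_at[of UNIV "s (Suc k)"] by auto
    then obtain F where F: "\<And>x. (F has_vector_derivative s (Suc k) x) (at x)"
      using einterval_antiderivative[of "-\<infinity>" "\<infinity>" "s (Suc k)"] by auto
    have incr: "s k z - s k y = F z - F y" if "y \<le> z" for y z
    proof -
      have "s k z - s k y = (LINT t|lborel. indicator {y..z} t * v (Suc k) t)"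
        using primitive_diff[OF vint[of "Suc k"] that] k by (simp add: s_def)
      also have "\<dots> = (LINT t|lborel. indicator {y..z} t *\<^sub>R s (Suc k) t)"
      proof (rule integral_cong_AE)
        have "AE t in lborel. v (Suc k) t = s (Suc k) t"
          using sv[of "Suc k"] k by (simp add: AE_completion_iff)
        then show "AE t in lborel. indicator {y..z} t * v (Suc k) t = indicator {y..z} t *\<^sub>R s (Suc k) t"
          by eventually_elim simp
      qed (use v(1)[of "Suc k"] k borel_measurable_continuous_onI[OF cont] in auto)
      also have "\<dots> = F z - F y"
        by (rule integral_FTC_atLeastAtMost[OF that has_vector_derivative_at_within[OF F] cont])
      finally show ?thesis .
    qed
    have eq: "s k = (\<lambda>z. F z + (s k 0 - F 0))"
    proof
      fix z show "s k z = F z + (s k 0 - F 0)"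
        using incr[of 0 z] incr[of z 0] by (cases "0 \<le> z") auto
    qed
    have "(F has_real_derivative s (Suc k) x) (at x)"
      using F[of x] by (simp add: has_real_derivative_iff_has_vector_derivative)
    from DERIV_add[OF this DERIV_const[of "s k 0 - F 0"]]
    show ?thesis by (subst eq) simp
  qed
  \<comment> \<open>A weak derivative of order 0 has the same integrals against test functions as
    \<sigma>, hence equals it almost everywhere.\<close>
  have \<sigma>v: "AE x in lebesgue. \<sigma> x - v 0 x = 0"
  proof (rule AE_zero_of_test_functions)
    obtain v0 where v0: "is_weak_deriv_real 0 \<sigma> v0" using C0 by blast
    have \<sigma>loc: "\<sigma> absolutely_integrable_on K" if "compact K" for K
      by (rule is_weak_deriv_realD(1)[OF v0 that])
    show "(\<lambda>x. \<sigma> x - v 0 x) absolutely_integrable_on K" if "compact K" for K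
      using \<sigma>loc[OF that] vloc[OF _ that, of 0] by (intro set_integral_diff) auto
    fix \<phi> assume \<phi>: "\<phi> \<in> test_functions_real"
    have "(LINT x|lebesgue. \<sigma> x * \<phi> x) = (LINT x|lborel. v 0 x * \<phi> x)" using v(3)[OF _ \<phi>, of 0] by simp
    moreover have "(LINT x|lebesgue. v 0 x * \<phi> x) = (LINT x|lborel. v 0 x * \<phi> x)"
      using v(1)[of 0] test_function_borel[OF \<phi>] by (intro integral_completion) auto
    ultimately show "(LINT x|lebesgue. (\<sigma> x - v 0 x) * \<phi> x) = 0"
      unfolding left_diff_distrib
      using integrable_times_test_function[OF \<sigma>loc \<phi>] integrable_times_test_function[OF vloc \<phi>, of 0]
      by simp
  qed
  show ?thesis
  proof (rule that[of "2 powr p * Cp" s])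
    have p1: "1 \<le> 2 powr p" using p ge_one_powr_ge_zero[of 2 p] by simp
    show "2 powr p * Cp > 0" using Cp by simp
    show "AE x in lebesgue. \<sigma> x = s 0 x" using \<sigma>v sv[of 0] by (auto elim: eventually_elim2)
    show "\<bar>s k x\<bar> \<le> 2 powr p * Cp * (1 + \<bar>x\<bar>) powr (- p)" if "k \<le> m" for k x
      using sb[OF that, of x] mult_right_mono[OF p1 g0[of x]] by (simp add: g_def mult.assoc)
    show "\<bar>s k x - s k y\<bar> \<le> 2 powr p * Cp * (1 + \<bar>x\<bar>) powr (- p) * \<bar>x - y\<bar>"
      if "k \<le> m" "\<bar>x - y\<bar> \<le> 1" for k x y
      using lip[OF that] by (simp add: g_def mult.assoc)
  qed (use sc der in auto)
qed

section \<open>Test functions on \<open>\<real>\<^sup>d\<close>\<close>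

abbreviation Rd_borel :: "nat \<Rightarrow> (nat \<Rightarrow> real) measure" where
  "Rd_borel d \<equiv> \<Pi>\<^sub>M i\<in>{..<d}. lborel"

lemma space_Rd_borel: "space (Rd_borel d) = Rd d"
  by (simp add: Rd_def space_PiM)

lemma Rd_upd: "x \<in> Rd d \<Longrightarrow> i < d \<Longrightarrow> x(i := s) \<in> Rd d"
  by (auto simp: Rd_def PiE_def extensional_def)

lemma product_sigma_finite_lborel: "product_sigma_finite (\<lambda>_. lborel :: real measure)"
  by standard

lemma sigma_finite_Rd_borel: "sigma_finite_measure (Rd_borel d)"
  by (rule product_sigma_finite.sigma_finite[OF product_sigma_finite_lborel]) simp

text \<open>Rational corners make the boxes countable, so that statements holding almost everywhere
  on each box combine to one on an open set, and open sets become measurable.\<close>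

definition rational_boxes :: "nat \<Rightarrow> (nat \<Rightarrow> real \<times> real) set" where
  "rational_boxes d = {..<d} \<rightarrow>\<^sub>E (\<rat> \<times> \<rat>)"

definition open_box :: "nat \<Rightarrow> (nat \<Rightarrow> real \<times> real) \<Rightarrow> (nat \<Rightarrow> real) set" where
  "open_box d r = (\<Pi>\<^sub>E i\<in>{..<d}. {fst (r i)<..<snd (r i)})"

definition closed_box :: "nat \<Rightarrow> (nat \<Rightarrow> real \<times> real) \<Rightarrow> (nat \<Rightarrow> real) set" where
  "closed_box d r = (\<Pi>\<^sub>E i\<in>{..<d}. {fst (r i)..snd (r i)})"

lemma countable_rational_boxes: "countable (rational_boxes d)"
  unfolding rational_boxes_def by (intro countable_PiE countable_SIGMA countable_rat) auto

lemma open_box_subset: "open_box d r \<subseteq> closed_box d r"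
  unfolding open_box_def closed_box_def by (intro PiE_mono) auto

lemma sets_open_box: "open_box d r \<in> sets (Rd_borel d)"
  unfolding open_box_def by (rule sets_PiM_I_finite) auto

lemma sets_closed_box: "closed_box d r \<in> sets (Rd_borel d)"
  unfolding closed_box_def by (rule sets_PiM_I_finite) auto

lemma compactin_closed_box: "compactin (Rd_top d) (closed_box d r)"
  unfolding Rd_top_def closed_box_def compactin_PiE by auto

lemma emeasure_closed_box: "emeasure (Rd_borel d) (closed_box d r) < \<infinity>"
proof -
  have "emeasure (Rd_borel d) (closed_box d r) = (\<Prod>i<d. emeasure lborel {fst (r i)..snd (r i)})"
    unfolding closed_box_def
    by (rule product_sigma_finite.emeasure_PiM[OF product_sigma_finite_lborel]) auto
  also have "\<dots> < \<infinity>"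
    by (auto simp: less_top[symmetric] ennreal_prod_eq_top emeasure_lborel_Icc_eq)
  finally show ?thesis .
qed

lemma openin_contains_rational_box:
  assumes S: "openin (Rd_top d) S" and x: "x \<in> S"
  obtains r where "r \<in> rational_boxes d" "x \<in> open_box d r" "closed_box d r \<subseteq> S"
proof -
  have "\<exists>U. (\<forall>i\<in>{..<d}. open (U i)) \<and> x \<in> Pi\<^sub>E {..<d} U \<and> Pi\<^sub>E {..<d} U \<subseteq> S"
    using S x unfolding Rd_top_def openin_product_topology_alt by auto
  then obtain U where U': "\<forall>i\<in>{..<d}. open (U i)" and U: "x \<in> Pi\<^sub>E {..<d} U" "Pi\<^sub>E {..<d} U \<subseteq> S"
    by blast
  have "\<exists>q. q \<in> \<rat> \<times> \<rat> \<and> x i \<in> {fst q<..<snd q} \<and> {fst q..snd q} \<subseteq> U i" if i: "i < d" for i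
  proof -
    have "x i \<in> U i" using U(1) i by auto
    moreover have "open (U i)" using U' i by auto
    ultimately obtain e where e: "e > 0" "\<And>y. dist y (x i) < e \<Longrightarrow> y \<in> U i"
      unfolding open_dist by blast
    obtain a where a: "a \<in> \<rat>" "x i - e < a" "a < x i" using Rats_dense_in_real[of "x i - e" "x i"] e(1) by auto
    obtain b where b: "b \<in> \<rat>" "x i < b" "b < x i + e" using Rats_dense_in_real[of "x i" "x i + e"] e(1) by auto
    have "{a..b} \<subseteq> U i" using a b by (auto intro!: e(2) simp: dist_real_def)
    then show ?thesis using a b by (intro exI[of _ "(a, b)"]) auto
  qed
  then obtain q where q: "\<And>i. i < d \<Longrightarrow> q i \<in> \<rat> \<times> \<rat> \<and> x i \<in> {fst (q i)<..<snd (q i)} \<and> {fst (q i)..snd (q i)} \<subseteq> U i"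
    by metis
  define r where "r = restrict q {..<d}"
  show ?thesis
  proof (rule that)
    show "r \<in> rational_boxes d" unfolding rational_boxes_def r_def using q by auto
    show "x \<in> open_box d r" unfolding open_box_def r_def using q U(1) by (auto simp: PiE_def)
    have "closed_box d r \<subseteq> Pi\<^sub>E {..<d} U"
      unfolding closed_box_def r_def by (intro PiE_mono) (use q in auto)
    then show "closed_box d r \<subseteq> S" using U(2) by blast
  qed
qed

lemma openin_eq_Union_boxes:
  assumes "openin (Rd_top d) S"
  shows "S = (\<Union>r\<in>{r \<in> rational_boxes d. closed_box d r \<subseteq> S}. open_box d r)"
proof (intro equalityI subsetI)
  fix x assume "x \<in> S"
  from openin_contains_rational_box[OF assms this]
  show "x \<in> (\<Union>r\<in>{r \<in> rational_boxes d. closed_box d r \<subseteq> S}. open_box d r)" by blast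
qed (use open_box_subset in blast)

text \<open>The boxes that exhaust an open set can be taken from a countable family, so the product
  sigma-algebra contains the topology of the product.\<close>

lemma openin_Rd_sets:
  assumes "openin (Rd_top d) S" shows "S \<in> sets (Rd_borel d)"
proof -
  have "(\<Union>r\<in>{r \<in> rational_boxes d. closed_box d r \<subseteq> S}. open_box d r) \<in> sets (Rd_borel d)"
    using countable_rational_boxes sets_open_box
    by (intro sets.countable_UN') (auto intro: countable_subset)
  then show ?thesis using openin_eq_Union_boxes[OF assms] by simp
qed

lemma closedin_Rd_sets:
  assumes "closedin (Rd_top d) S" shows "S \<in> sets (Rd_borel d)"
proof -
  have "Rd d - S \<in> sets (Rd_borel d)"
    using assms openin_Rd_sets by (auto simp: closedin_def topspace_Rd_top)
  from sets.compl_sets[OF this] have "Rd d - (Rd d - S) \<in> sets (Rd_borel d)"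
    by (simp add: space_Rd_borel)
  moreover have "Rd d - (Rd d - S) = S" using assms by (auto simp: closedin_def topspace_Rd_top)
  ultimately show ?thesis by simp
qed

lemma continuous_map_Rd_measurable:
  fixes f :: "(nat \<Rightarrow> real) \<Rightarrow> 'b::{second_countable_topology, metric_space}"
  assumes "continuous_map (Rd_top d) euclidean f" shows "f \<in> borel_measurable (Rd_borel d)"
proof (rule borel_measurableI)
  fix S :: "'b set" assume "open S"
  then have "openin (Rd_top d) {x \<in> topspace (Rd_top d). f x \<in> S}"
    using assms by (intro openin_continuous_map_preimage) auto
  moreover have "{x \<in> topspace (Rd_top d). f x \<in> S} = f -` S \<inter> space (Rd_borel d)"
    by (auto simp: topspace_Rd_top space_Rd_borel)
  ultimately show "f -` S \<inter> space (Rd_borel d) \<in> sets (Rd_borel d)"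
    using openin_Rd_sets by metis
qed

lemma continuous_map_upd:
  assumes x: "x \<in> Rd d" and i: "i < d"
  shows "continuous_map euclideanreal (Rd_top d) (\<lambda>s. x(i := s))"
  unfolding Rd_top_def
proof (rule continuous_map_coordinatewise_then_product)
  fix k assume "k \<in> {..<d}"
  show "continuous_map euclideanreal euclideanreal (\<lambda>s. (x(i := s)) k)"
    by (cases "k = i") auto
qed (use x i in \<open>auto simp: Rd_def PiE_def extensional_def\<close>)

lemma continuous_on_upd:
  assumes "continuous_map (Rd_top d) euclidean f" "x \<in> Rd d" "i < d"
  shows "continuous_on UNIV (\<lambda>s. f (x(i := s)))"
  using continuous_map_compose[OF continuous_map_upd[OF assms(2,3)] assms(1)] by (simp add: o_def)

lemma compactin_Rd_closedin: "compactin (Rd_top d) K \<Longrightarrow> closedin (Rd_top d) K"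
  unfolding Rd_top_def by (intro compactin_imp_closedin) (auto simp: Hausdorff_space_product_topology)

lemma compactin_Rd_subset: "compactin (Rd_top d) K \<Longrightarrow> K \<subseteq> Rd d"
  using compactin_subset_topspace topspace_Rd_top by metis

lemma compactin_Rd_sets: "compactin (Rd_top d) K \<Longrightarrow> K \<in> sets (Rd_borel d)"
  by (intro closedin_Rd_sets compactin_Rd_closedin)

lemma compactin_Rd_bounded:
  assumes K: "compactin (Rd_top d) K"
  obtains B where "B > 0" "\<And>x i. x \<in> K \<Longrightarrow> i < d \<Longrightarrow> \<bar>x i\<bar> \<le> B"
proof -
  have "\<exists>b. \<forall>x\<in>K. \<bar>x i\<bar> \<le> b" if i: "i < d" for i
  proof -
    have "compactin euclideanreal ((\<lambda>x. x i) ` K)"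
      using i continuous_map_product_coordinates[of i "{..<d}" "\<lambda>_. euclideanreal"]
      by (intro image_compactin[OF K]) (auto simp: Rd_top_def)
    then have "bounded ((\<lambda>x. x i) ` K)" by (simp add: compact_imp_bounded)
    then show ?thesis by (auto simp: bounded_iff)
  qed
  then obtain b where b: "\<And>i x. i < d \<Longrightarrow> x \<in> K \<Longrightarrow> \<bar>x i\<bar> \<le> b i" by metis
  show ?thesis
  proof (rule that[of "1 + (\<Sum>i<d. \<bar>b i\<bar>)"])
    show "0 < 1 + (\<Sum>i<d. \<bar>b i\<bar>)" by (simp add: add_pos_nonneg sum_nonneg)
    fix x i assume "x \<in> K" "i < d"
    then have "\<bar>x i\<bar> \<le> b i" by (intro b)
    also have "\<dots> \<le> (\<Sum>i<d. \<bar>b i\<bar>)"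
      using \<open>i < d\<close> member_le_sum[of i "{..<d}" "\<lambda>i. \<bar>b i\<bar>"] by auto
    finally show "\<bar>x i\<bar> \<le> 1 + (\<Sum>i<d. \<bar>b i\<bar>)" by simp
  qed
qed

lemma compactin_Rd_emeasure:
  assumes K: "compactin (Rd_top d) K" shows "emeasure (Rd_borel d) K < \<infinity>"
proof -
  obtain B where B: "\<And>x i. x \<in> K \<Longrightarrow> i < d \<Longrightarrow> \<bar>x i\<bar> \<le> B"
    using compactin_Rd_bounded[OF K] by metis
  have "K \<subseteq> closed_box d (\<lambda>_. (-B, B))"
    using B compactin_Rd_subset[OF K] by (force simp: closed_box_def Rd_def PiE_def abs_le_iff)
  then have "emeasure (Rd_borel d) K \<le> emeasure (Rd_borel d) (closed_box d (\<lambda>_. (-B, B)))"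
    by (intro emeasure_mono sets_closed_box)
  also have "\<dots> < \<infinity>" by (rule emeasure_closed_box)
  finally show ?thesis .
qed

lemma compactin_continuous_bounded:
  fixes f :: "(nat \<Rightarrow> real) \<Rightarrow> real"
  assumes K: "compactin (Rd_top d) K" and f: "continuous_map (Rd_top d) euclideanreal f"
  obtains B where "B > 0" "\<And>x. x \<in> K \<Longrightarrow> \<bar>f x\<bar> \<le> B"
proof -
  have "bounded (f ` K)" using image_compactin[OF K f] by (simp add: compact_imp_bounded)
  then show ?thesis using that by (auto simp: bounded_pos)
qed

section \<open>Partial derivatives and integration by parts\<close>

lemma partial_derivs_Nil: "partial_derivs [] f = f"
  by (simp add: partial_derivs_def)

lemma partial_derivs_Cons: "partial_derivs (i # js) f = partial_deriv i (partial_derivs js f)"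
  by (simp add: partial_derivs_def)

lemma partial_derivs_append: "partial_derivs (js @ ks) f = partial_derivs js (partial_derivs ks f)"
  by (simp add: partial_derivs_def)

lemma partial_deriv_zero_outside:
  fixes f :: "(nat \<Rightarrow> real) \<Rightarrow> 'b::real_normed_vector"
  assumes K: "closedin (Rd_top d) K" and z: "\<And>x. x \<in> Rd d - K \<Longrightarrow> f x = 0"
    and x: "x \<in> Rd d - K" and i: "i < d"
  shows "partial_deriv i f x = 0"
proof -
  have "openin euclideanreal {s \<in> topspace euclideanreal. x(i := s) \<in> Rd d - K}"
    using K x i
    by (intro openin_continuous_map_preimage[OF continuous_map_upd]) (auto simp: closedin_def topspace_Rd_top)
  then have op: "open {s. x(i := s) \<in> Rd d - K}" by simp
  have "((\<lambda>_. 0) has_vector_derivative 0) (at (x i))" by simp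
  then have "((\<lambda>s. f (x(i := s))) has_vector_derivative 0) (at (x i))"
    by (rule has_vector_derivative_transform_within_open[OF _ op]) (use x z in auto)
  then show ?thesis unfolding partial_deriv_def by (rule vector_derivative_at)
qed

lemma partial_derivs_zero_outside:
  fixes f :: "(nat \<Rightarrow> real) \<Rightarrow> 'b::real_normed_vector"
  assumes K: "closedin (Rd_top d) K" and z: "\<And>x. x \<in> Rd d - K \<Longrightarrow> f x = 0"
    and js: "set js \<subseteq> {..<d}" and x: "x \<in> Rd d - K"
  shows "partial_derivs js f x = 0"
  using js x
proof (induction js arbitrary: x)
  case (Cons i js)
  then show ?case
    unfolding partial_derivs_Cons by (intro partial_deriv_zero_outside[OF K]) auto
qed (simp add: z partial_derivs_Nil)

lemma smooth_Rd_partial_derivs: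
  assumes "smooth_Rd d f" "set js \<subseteq> {..<d}" shows "smooth_Rd d (partial_derivs js f)"
  unfolding smooth_Rd_def
proof (intro allI impI)
  fix ks assume "set ks \<subseteq> {..<d}"
  with assms have "set (ks @ js) \<subseteq> {..<d}" by simp
  with assms(1) have "continuous_map (Rd_top d) euclidean (partial_derivs (ks @ js) f) \<and>
     (\<forall>i<d. \<forall>x\<in>Rd d. (\<lambda>s. partial_derivs (ks @ js) f (x(i := s))) differentiable (at (x i)))"
    unfolding smooth_Rd_def by blast
  then show "continuous_map (Rd_top d) euclidean (partial_derivs ks (partial_derivs js f)) \<and>
     (\<forall>i<d. \<forall>x\<in>Rd d. (\<lambda>s. partial_derivs ks (partial_derivs js f) (x(i := s))) differentiable (at (x i)))"
    unfolding partial_derivs_append .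
qed

lemma smooth_Rd_continuous: "smooth_Rd d f \<Longrightarrow> continuous_map (Rd_top d) euclidean f"
  unfolding smooth_Rd_def by (drule spec[of _ "[]"]) (simp add: partial_derivs_Nil)

lemma smooth_Rd_partial_deriv: "smooth_Rd d f \<Longrightarrow> i < d \<Longrightarrow> smooth_Rd d (partial_deriv i f)"
  using smooth_Rd_partial_derivs[of d f "[i]"] by (simp add: partial_derivs_Cons partial_derivs_Nil)

lemma smooth_Rd_has_vector_derivative:
  assumes f: "smooth_Rd d f" and i: "i < d" and x: "x \<in> Rd d"
  shows "((\<lambda>s. f (x(i := s))) has_vector_derivative partial_deriv i f (x(i := t))) (at t)"
proof -
  let ?y = "x(i := t)"
  have "?y \<in> Rd d" using x i by (rule Rd_upd)
  then have "(\<lambda>s. partial_derivs [] f (?y(i := s))) differentiable (at (?y i))"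
    using f i unfolding smooth_Rd_def by (metis empty_set empty_subsetI)
  then show ?thesis
    unfolding partial_derivs_Nil partial_deriv_def by (simp add: vector_derivative_works)
qed

lemma test_functionsD:
  assumes "\<phi> \<in> test_functions d \<Omega>"
  shows "smooth_Rd d \<phi>" "\<exists>K. compactin (Rd_top d) K \<and> K \<subseteq> \<Omega> \<and> (\<forall>x\<in>Rd d - K. \<phi> x = 0)"
  using assms by (auto simp: test_functions_def)

lemma test_functions_partial_derivs:
  assumes \<phi>: "\<phi> \<in> test_functions d \<Omega>" and js: "set js \<subseteq> {..<d}"
  shows "partial_derivs js \<phi> \<in> test_functions d \<Omega>"
proof -
  obtain K where K: "compactin (Rd_top d) K" "K \<subseteq> \<Omega>" "\<And>x. x \<in> Rd d - K \<Longrightarrow> \<phi> x = 0"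
    using test_functionsD(2)[OF \<phi>] by blast
  have "partial_derivs js \<phi> x = 0" if "x \<in> Rd d - K" for x
    by (rule partial_derivs_zero_outside[OF compactin_Rd_closedin[OF K(1)] K(3) js that])
  then show ?thesis
    unfolding test_functions_def using smooth_Rd_partial_derivs[OF test_functionsD(1)[OF \<phi>] js] K by blast
qed

lemma test_functions_bounded:
  assumes \<phi>: "\<phi> \<in> test_functions d \<Omega>"
  obtains B where "B > 0" "\<And>x. x \<in> Rd d \<Longrightarrow> \<bar>\<phi> x\<bar> \<le> B"
proof -
  obtain K where K: "compactin (Rd_top d) K" "K \<subseteq> \<Omega>" "\<And>x. x \<in> Rd d - K \<Longrightarrow> \<phi> x = 0"
    using test_functionsD(2)[OF \<phi>] by blast
  obtain B where B: "B > 0" "\<And>x. x \<in> K \<Longrightarrow> \<bar>\<phi> x\<bar> \<le> B"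
    using compactin_continuous_bounded[OF K(1) smooth_Rd_continuous[OF test_functionsD(1)[OF \<phi>]]] by metis
  show ?thesis
  proof (rule that[OF B(1)])
    fix x assume "x \<in> Rd d"
    then show "\<bar>\<phi> x\<bar> \<le> B" using B K(3)[of x] by (cases "x \<in> K") auto
  qed
qed

lemma test_functions_measurable: "\<phi> \<in> test_functions d \<Omega> \<Longrightarrow> \<phi> \<in> borel_measurable (Rd_borel d)"
  by (intro continuous_map_Rd_measurable smooth_Rd_continuous test_functionsD(1))

lemma integrable_bounded_times_test_function:
  assumes \<phi>: "\<phi> \<in> test_functions d \<Omega>" and h: "h \<in> borel_measurable (Rd_borel d)"
    and B: "\<And>x. x \<in> Rd d \<Longrightarrow> \<bar>h x\<bar> \<le> B"
  shows "integrable (Rd_borel d) (\<lambda>x. h x * \<phi> x)"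
proof -
  obtain K where K: "compactin (Rd_top d) K" "K \<subseteq> \<Omega>" "\<And>x. x \<in> Rd d - K \<Longrightarrow> \<phi> x = 0"
    using test_functionsD(2)[OF \<phi>] by blast
  obtain b where b: "b > 0" "\<And>x. x \<in> Rd d \<Longrightarrow> \<bar>\<phi> x\<bar> \<le> b"
    using test_functions_bounded[OF \<phi>] by metis
  show ?thesis
  proof (rule Bochner_Integration.integrable_bound)
    show "integrable (Rd_borel d) (\<lambda>x. indicator K x * (B * b))"
      using compactin_Rd_emeasure[OF K(1)] compactin_Rd_sets[OF K(1)]
      by (intro integrable_mult_left integrable_real_indicator) auto
    show "(\<lambda>x. h x * \<phi> x) \<in> borel_measurable (Rd_borel d)"
      using h test_functions_measurable[OF \<phi>] by measurable
    show "AE x in Rd_borel d. norm (h x * \<phi> x) \<le> norm (indicator K x * (B * b))"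
    proof (rule AE_I2)
      fix x assume "x \<in> space (Rd_borel d)"
      then have x: "x \<in> Rd d" by (simp add: space_Rd_borel)
      have B0: "B \<ge> 0" using B[OF x] by linarith
      show "norm (h x * \<phi> x) \<le> norm (indicator K x * (B * b))"
      proof (cases "x \<in> K")
        case True
        have "\<bar>h x\<bar> * \<bar>\<phi> x\<bar> \<le> B * b" by (intro mult_mono B[OF x] b(2)[OF x] B0) auto
        then show ?thesis using True B0 b(1) by (simp add: abs_mult)
      qed (use K(3)[of x] x in auto)
    qed
  qed
qed

text \<open>Fubini splits off coordinate i, and on every line in that direction the sum of the two
  integrands is the derivative of \<open>G\<close> times \<psi>, which vanishes at both ends. Apart
  from measurability and boundedness, \<open>G\<close> needs regularity along these lines
  only.\<close>

lemma integration_by_parts_Rd: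
  assumes \<psi>: "\<psi> \<in> test_functions d \<Omega>" and i: "i < d"
    and G: "G \<in> borel_measurable (Rd_borel d)" "G' \<in> borel_measurable (Rd_borel d)"
    and B: "\<And>x. x \<in> Rd d \<Longrightarrow> \<bar>G x\<bar> \<le> B" "\<And>x. x \<in> Rd d \<Longrightarrow> \<bar>G' x\<bar> \<le> B"
    and der: "\<And>x t. x \<in> Rd d \<Longrightarrow> ((\<lambda>s. G (x(i := s))) has_real_derivative G' (x(i := t))) (at t)"
    and cont: "\<And>x. x \<in> Rd d \<Longrightarrow> continuous_on UNIV (\<lambda>t. G' (x(i := t)))"
  shows "(LINT x|Rd_borel d. G x * partial_deriv i \<psi> x) = - (LINT x|Rd_borel d. G' x * \<psi> x)"
proof -
  interpret product_sigma_finite "\<lambda>_. lborel :: real measure" by (rule product_sigma_finite_lborel)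
  have d\<psi>: "partial_deriv i \<psi> \<in> test_functions d \<Omega>"
    using test_functions_partial_derivs[OF \<psi>, of "[i]"] i by (simp add: partial_derivs_Cons partial_derivs_Nil)
  have sm: "smooth_Rd d \<psi>" by (rule test_functionsD(1)[OF \<psi>])
  have i1: "integrable (Rd_borel d) (\<lambda>x. G x * partial_deriv i \<psi> x)"
    by (rule integrable_bounded_times_test_function[OF d\<psi> G(1) B(1)])
  have i2: "integrable (Rd_borel d) (\<lambda>x. G' x * \<psi> x)"
    by (rule integrable_bounded_times_test_function[OF \<psi> G(2) B(2)])
  define f where "f x = G x * partial_deriv i \<psi> x + G' x * \<psi> x" for x
  obtain K where K: "compactin (Rd_top d) K" "K \<subseteq> \<Omega>" "\<And>x. x \<in> Rd d - K \<Longrightarrow> \<psi> x = 0"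
    using test_functionsD(2)[OF \<psi>] by blast
  obtain R where R: "R > 0" "\<And>x i. x \<in> K \<Longrightarrow> i < d \<Longrightarrow> \<bar>x i\<bar> \<le> R"
    using compactin_Rd_bounded[OF K(1)] by metis
  have K': "partial_deriv i \<psi> x = 0" if "x \<in> Rd d - K" for x
    by (rule partial_deriv_zero_outside[OF compactin_Rd_closedin[OF K(1)] K(3) that i])
  have inner: "(LINT y|lborel. f (x(i := y))) = 0" if "x \<in> space (\<Pi>\<^sub>M j\<in>{..<d} - {i}. lborel :: real measure)" for x
  proof -
    \<comment> \<open>\<open>x\<close> is taken from the product over the other coordinates and has
      the value \<open>undefined\<close> at i; setting it to 0 there gives a point of
      \<open>Rd d\<close> on the same line.\<close>
    let ?z = "x(i := 0)"
    have z: "?z \<in> Rd d" using that i by (auto simp: space_PiM Rd_def PiE_def extensional_def)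
    have upd: "x(i := y) = ?z(i := y)" for y by simp
    have out: "x(i := y) \<in> Rd d - K" if "\<bar>y\<bar> > R" for y
      using R(2)[of "x(i := y)" i] i that Rd_upd[OF z i, of y] by auto
    have "(LINT y|lborel. f (x(i := y))) = (LINT y|lborel. indicator {-(R+1)..R+1} y *\<^sub>R f (x(i := y)))"
    proof (intro Bochner_Integration.integral_cong refl)
      fix y show "f (x(i := y)) = indicator {-(R+1)..R+1} y *\<^sub>R f (x(i := y))"
        using out[of y] K(3) K' by (cases "\<bar>y\<bar> > R") (auto simp: f_def indicator_def)
    qed
    also have "\<dots> = G (x(i := R+1)) * \<psi> (x(i := R+1)) - G (x(i := -(R+1))) * \<psi> (x(i := -(R+1)))"
    proof (rule integral_FTC_atLeastAtMost)
      fix y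
      have "((\<lambda>s. \<psi> (?z(i := s))) has_real_derivative partial_deriv i \<psi> (?z(i := y))) (at y)"
        using smooth_Rd_has_vector_derivative[OF sm i z]
        by (simp add: has_real_derivative_iff_has_vector_derivative)
      from DERIV_mult[OF der[OF z] this]
      have "((\<lambda>s. G (x(i := s)) * \<psi> (x(i := s))) has_real_derivative f (x(i := y))) (at y)"
        by (simp add: f_def algebra_simps)
      then show "((\<lambda>s. G (x(i := s)) * \<psi> (x(i := s))) has_vector_derivative f (x(i := y))) (at y within {- (R + 1)..R + 1})"
        by (auto simp: has_real_derivative_iff_has_vector_derivative intro: has_vector_derivative_at_within)
    next
      have "continuous_on UNIV (\<lambda>s. G (?z(i := s)))"
        using der[OF z] by (intro continuous_at_imp_continuous_on ballI) (blast intro: DERIV_isCont)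
      moreover have "continuous_on UNIV (\<lambda>s. \<psi> (?z(i := s)))"
        by (rule continuous_on_upd[OF smooth_Rd_continuous[OF sm] z i])
      moreover have "continuous_on UNIV (\<lambda>s. partial_deriv i \<psi> (?z(i := s)))"
        by (rule continuous_on_upd[OF smooth_Rd_continuous[OF smooth_Rd_partial_deriv[OF sm i]] z i])
      ultimately have "continuous_on UNIV (\<lambda>s. f (?z(i := s)))"
        unfolding f_def using cont[OF z] by (intro continuous_intros)
      then show "continuous_on {- (R + 1)..R + 1} (\<lambda>y. f (x(i := y)))"
        using continuous_on_subset[of UNIV _ "{- (R + 1)..R + 1}"] by simp
    qed (use R(1) in simp)
    also have "\<dots> = 0"
      using out[of "R + 1"] out[of "-(R + 1)"] K(3) R(1) by simp
    finally show ?thesis .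
  qed
  have ins: "insert i ({..<d} - {i}) = {..<d}" using i by auto
  have "(LINT x|Rd_borel d. f x) = (LINT x|(\<Pi>\<^sub>M j\<in>{..<d} - {i}. lborel). (LINT y|lborel. f (x(i := y))))"
  proof -
    have "integrable (Rd_borel d) f" unfolding f_def using i1 i2 by simp
    then show ?thesis using product_integral_insert[of "{..<d} - {i}" i f] unfolding ins by simp
  qed
  also have "\<dots> = (LINT x|(\<Pi>\<^sub>M j\<in>{..<d} - {i}. lborel :: real measure). 0)"
    by (intro Bochner_Integration.integral_cong refl inner)
  finally have "(LINT x|Rd_borel d. f x) = 0" by simp
  then show ?thesis using i1 i2 by (simp add: f_def)
qed

lemma Rd_inner_upd:
  assumes "i < d" shows "Rd_inner d w (x(i := t)) = w i * t + (\<Sum>j\<in>{..<d} - {i}. w j * x j)"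
proof -
  have "Rd_inner d w (x(i := t)) = (\<Sum>j\<in>insert i ({..<d} - {i}). w j * (x(i := t)) j)"
    unfolding Rd_inner_def using assms by (intro sum.cong) auto
  also have "\<dots> = w i * t + (\<Sum>j\<in>{..<d} - {i}. w j * (x(i := t)) j)"
    by (subst sum.insert) auto
  also have "(\<Sum>j\<in>{..<d} - {i}. w j * (x(i := t)) j) = (\<Sum>j\<in>{..<d} - {i}. w j * x j)"
    by (intro sum.cong) auto
  finally show ?thesis .
qed

lemma Rd_inner_measurable [measurable]: "(\<lambda>x. Rd_inner d w x) \<in> borel_measurable (Rd_borel d)"
  unfolding Rd_inner_def by measurable

text \<open>Each partial derivative taken off the test function produces a factor \<open>w i\<close>
  and raises the order of \<open>s\<close> by one. The starting order \<open>k\<close> is arbitrary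
  so that the induction over the list can continue at the next order.\<close>

lemma ridge_integration_by_parts:
  fixes s :: "nat \<Rightarrow> real \<Rightarrow> real"
  assumes cont: "\<And>k. k \<le> m \<Longrightarrow> continuous_on UNIV (s k)"
    and der: "\<And>k x. k < m \<Longrightarrow> (s k has_real_derivative s (Suc k) x) (at x)"
    and bound: "\<And>k x. k \<le> m \<Longrightarrow> \<bar>s k x\<bar> \<le> B"
    and \<phi>: "\<phi> \<in> test_functions d \<Omega>" and js: "set js \<subseteq> {..<d}" and k: "k + length js \<le> m"
  shows "(LINT x|Rd_borel d. s k (Rd_inner d w x + c) * partial_derivs js \<phi> x) =
    (- 1) ^ length js * (\<Prod>j\<leftarrow>js. w j) * (LINT x|Rd_borel d. s (k + length js) (Rd_inner d w x + c) * \<phi> x)"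
  using js k
proof (induction js arbitrary: k)
  case (Cons i js)
  have i: "i < d" and km: "k < m" using Cons.prems by auto
  have \<psi>: "partial_derivs js \<phi> \<in> test_functions d \<Omega>"
    using Cons.prems by (intro test_functions_partial_derivs[OF \<phi>]) auto
  have sm: "s k' \<in> borel_measurable borel" if "k' \<le> m" for k'
    by (rule borel_measurable_continuous_onI[OF cont[OF that]])
  have B0: "B \<ge> 0" using bound[of 0 0] by simp
  have "(LINT x|Rd_borel d. s k (Rd_inner d w x + c) * partial_deriv i (partial_derivs js \<phi>) x) =
      - (LINT x|Rd_borel d. w i * s (Suc k) (Rd_inner d w x + c) * partial_derivs js \<phi> x)"
  proof (rule integration_by_parts_Rd[OF \<psi> i, where B = "B + \<bar>w i\<bar> * B"])
    have im: "(\<lambda>x. Rd_inner d w x + c) \<in> borel_measurable (Rd_borel d)" by measurable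
    show "(\<lambda>x. s k (Rd_inner d w x + c)) \<in> borel_measurable (Rd_borel d)"
      using km by (intro measurable_compose[OF im sm]) auto
    have "(\<lambda>x. s (Suc k) (Rd_inner d w x + c)) \<in> borel_measurable (Rd_borel d)"
      using km by (intro measurable_compose[OF im sm]) auto
    then show "(\<lambda>x. w i * s (Suc k) (Rd_inner d w x + c)) \<in> borel_measurable (Rd_borel d)"
      by simp
    show "\<bar>s k (Rd_inner d w x + c)\<bar> \<le> B + \<bar>w i\<bar> * B" for x
      using bound[of k "Rd_inner d w x + c"] km B0 by (simp add: add_increasing2)
    show "\<bar>w i * s (Suc k) (Rd_inner d w x + c)\<bar> \<le> B + \<bar>w i\<bar> * B" for x
      using bound[of "Suc k" "Rd_inner d w x + c"] km B0
      by (simp add: abs_mult add_increasing mult_left_mono)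
    fix x
    define r where "r = (\<Sum>j\<in>{..<d} - {i}. w j * x j)"
    have upd: "Rd_inner d w (x(i := t)) = w i * t + r" for t
      unfolding r_def by (rule Rd_inner_upd[OF i])
    show "((\<lambda>t. s k (Rd_inner d w (x(i := t)) + c)) has_real_derivative
        w i * s (Suc k) (Rd_inner d w (x(i := t)) + c)) (at t)" for t
      unfolding upd
      by (rule DERIV_cong[OF DERIV_chain2[OF der[OF km]]]) (auto intro!: derivative_eq_intros)
    have "continuous_on UNIV (\<lambda>t. s (Suc k) (w i * t + r + c))"
      using km by (intro continuous_on_compose2[OF cont[of "Suc k"]]) (auto intro!: continuous_intros)
    then show "continuous_on UNIV (\<lambda>t. w i * s (Suc k) (Rd_inner d w (x(i := t)) + c))"
      unfolding upd by (intro continuous_intros)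
  qed
  also have "\<dots> = - (w i * (LINT x|Rd_borel d. s (Suc k) (Rd_inner d w x + c) * partial_derivs js \<phi> x))"
    by (simp add: mult.assoc)
  also have "(LINT x|Rd_borel d. s (Suc k) (Rd_inner d w x + c) * partial_derivs js \<phi> x) =
      (- 1) ^ length js * (\<Prod>j\<leftarrow>js. w j) * (LINT x|Rd_borel d. s (Suc k + length js) (Rd_inner d w x + c) * \<phi> x)"
    using Cons.prems by (intro Cons.IH) auto
  finally show ?case by (simp add: partial_derivs_Cons)
qed (simp add: partial_derivs_Nil)

text \<open>\<open>U i k\<close> stands for the k-th derivative of the i-th factor and
  \<open>n i\<close> for the order taken in coordinate i. Both the bumps and the Gaussians have this
  form, so their partial derivatives reduce to one-dimensional facts.\<close>

definition coord_prod :: "nat \<Rightarrow> (nat \<Rightarrow> nat \<Rightarrow> real \<Rightarrow> 'b::real_normed_field) \<Rightarrow> (nat \<Rightarrow> nat) \<Rightarrow> (nat \<Rightarrow> real) \<Rightarrow> 'b" where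
  "coord_prod d U n x = (\<Prod>i<d. U i (n i) (x i))"

lemma coord_prod_upd:
  assumes "i < d"
  shows "coord_prod d U n (x(i := t)) = U i (n i) t * (\<Prod>j\<in>{..<d} - {i}. U j (n j) (x j))"
proof -
  have "coord_prod d U n (x(i := t)) = (\<Prod>j\<in>insert i ({..<d} - {i}). U j (n j) ((x(i := t)) j))"
    unfolding coord_prod_def using assms by (intro prod.cong) auto
  also have "\<dots> = U i (n i) t * (\<Prod>j\<in>{..<d} - {i}. U j (n j) ((x(i := t)) j))"
    by (subst prod.insert) auto
  also have "(\<Prod>j\<in>{..<d} - {i}. U j (n j) ((x(i := t)) j)) = (\<Prod>j\<in>{..<d} - {i}. U j (n j) (x j))"
    by (intro prod.cong) auto
  finally show ?thesis .
qed

lemma coord_prod_has_derivative: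
  assumes U: "\<And>i k t. i < d \<Longrightarrow> (U i k has_vector_derivative U i (Suc k) t) (at t)" and i: "i < d"
  shows "((\<lambda>s. coord_prod d U n (x(i := s))) has_vector_derivative
    coord_prod d U (n(i := Suc (n i))) (x(i := t))) (at t)"
proof -
  have "(\<Prod>j\<in>{..<d} - {i}. U j ((n(i := Suc (n i))) j) (x j)) = (\<Prod>j\<in>{..<d} - {i}. U j (n j) (x j))"
    by (intro prod.cong) auto
  then show ?thesis
    unfolding coord_prod_upd[OF i]
    using has_vector_derivative_mult_left[OF U[OF i, of "n i" t]] by simp
qed

text \<open>Differentiation in one coordinate acts on one factor only, so a list of coordinates
  matters only through its multiplicities.\<close>

lemma partial_derivs_coord_prod:
  assumes U: "\<And>i k t. i < d \<Longrightarrow> (U i k has_vector_derivative U i (Suc k) t) (at t)"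
    and js: "set js \<subseteq> {..<d}"
  shows "partial_derivs js (coord_prod d U (\<lambda>_. 0)) = coord_prod d U (count_list js)"
  using js
proof (induction js)
  case (Cons i js)
  have "partial_deriv i (coord_prod d U (count_list js)) x = coord_prod d U (count_list (i # js)) x" for x
  proof -
    have "((\<lambda>s. coord_prod d U (count_list js) (x(i := s))) has_vector_derivative
        coord_prod d U ((count_list js)(i := Suc (count_list js i))) (x(i := x i))) (at (x i))"
      using Cons by (intro coord_prod_has_derivative U) auto
    moreover have "(count_list js)(i := Suc (count_list js i)) = count_list (i # js)" by auto
    ultimately show ?thesis unfolding partial_deriv_def by (simp add: vector_derivative_at)
  qed
  then have "partial_deriv i (coord_prod d U (count_list js)) = coord_prod d U (count_list (i # js))"
    by (rule ext)
  with Cons show ?case by (simp only: partial_derivs_Cons set_simps insert_subset)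
qed (simp add: partial_derivs_Nil fun_eq_iff coord_prod_def)

lemma continuous_map_coord_prod:
  assumes U: "\<And>i k. i < d \<Longrightarrow> continuous_on UNIV (U i k)"
  shows "continuous_map (Rd_top d) euclidean (coord_prod d U n)"
proof -
  have 1: "continuous_map (Rd_top d) euclidean (\<lambda>x. U i (n i) (x i))" if "i < d" for i
  proof -
    have "continuous_map (Rd_top d) euclideanreal (\<lambda>x. x i)"
      using continuous_map_product_coordinates[of i "{..<d}" "\<lambda>_. euclideanreal"] that
      by (simp add: Rd_top_def)
    moreover have "continuous_map euclideanreal euclidean (U i (n i))" using U[OF that] by simp
    ultimately have "continuous_map (Rd_top d) euclidean (U i (n i) \<circ> (\<lambda>x. x i))"
      by (rule continuous_map_compose)
    then show ?thesis by (simp add: o_def)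
  qed
  have "continuous_map (Rd_top d) euclidean (\<lambda>x. \<Prod>i\<in>{..<d}. U i (n i) (x i))"
    using 1 by (auto simp: continuous_map_atin intro!: tendsto_prod)
  then show ?thesis by (simp add: coord_prod_def[abs_def])
qed

lemma smooth_Rd_coord_prod:
  assumes U: "\<And>i k t. i < d \<Longrightarrow> (U i k has_vector_derivative U i (Suc k) t) (at t)"
  shows "smooth_Rd d (coord_prod d U (\<lambda>_. 0))"
  unfolding smooth_Rd_def
proof (intro allI impI conjI ballI)
  fix js assume js: "set js \<subseteq> {..<d}"
  have pd: "partial_derivs js (coord_prod d U (\<lambda>_. 0)) = coord_prod d U (count_list js)"
    by (rule partial_derivs_coord_prod) (use U js in auto)
  have "continuous_on UNIV (U i k)" if "i < d" for i k
    using U[OF that] by (intro continuous_at_imp_continuous_on ballI) (blast intro: has_vector_derivative_continuous)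
  then show "continuous_map (Rd_top d) euclidean (partial_derivs js (coord_prod d U (\<lambda>_. 0)))"
    unfolding pd by (rule continuous_map_coord_prod)
  fix i x assume i: "i < d"
  have "((\<lambda>s. coord_prod d U (count_list js) (x(i := s))) has_vector_derivative
      coord_prod d U ((count_list js)(i := Suc (count_list js i))) (x(i := x i))) (at (x i))"
    using U i by (rule coord_prod_has_derivative)
  then show "(\<lambda>s. partial_derivs js (coord_prod d U (\<lambda>_. 0)) (x(i := s))) differentiable (at (x i))"
    unfolding pd by (rule differentiableI_vector)
qed

lemma not_in_PiE_Rd: "x \<in> Rd d \<Longrightarrow> x \<notin> Pi\<^sub>E {..<d} A \<Longrightarrow> \<exists>i<d. x i \<notin> A i"
  by (auto simp: Rd_def PiE_def Pi_def)

lemma not_in_closed_box: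
  "x \<in> Rd d \<Longrightarrow> x \<notin> closed_box d r \<Longrightarrow> \<exists>i<d. x i \<notin> {fst (r i)<..<snd (r i)}"
  unfolding closed_box_def by (drule (1) not_in_PiE_Rd) force

lemma not_in_open_box:
  "x \<in> Rd d \<Longrightarrow> x \<notin> open_box d r \<Longrightarrow> \<exists>i<d. x i \<notin> {fst (r i)<..<snd (r i)}"
  unfolding open_box_def by (drule (1) not_in_PiE_Rd)

definition bump_prod :: "nat \<Rightarrow> (nat \<Rightarrow> real \<times> real) \<Rightarrow> nat \<Rightarrow> (nat \<Rightarrow> real) \<Rightarrow> real" where
  "bump_prod d r n = coord_prod d (\<lambda>i k. (deriv ^^ k) (bump (fst (r i)) (snd (r i)) n)) (\<lambda>_. 0)"

lemma bump_prod_eq: "bump_prod d r n x = (\<Prod>i<d. bump (fst (r i)) (snd (r i)) n (x i))"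
  by (simp add: bump_prod_def coord_prod_def)

lemma bump_prod_test_function:
  assumes "closed_box d r \<subseteq> \<Omega>" shows "bump_prod d r n \<in> test_functions d \<Omega>"
proof -
  have "smooth_Rd d (bump_prod d r n)"
    unfolding bump_prod_def
    using smooth_real_has_derivative[OF smooth_real_bump]
    by (intro smooth_Rd_coord_prod) (simp add: has_real_derivative_iff_has_vector_derivative)
  moreover have "bump_prod d r n x = 0" if x: "x \<in> Rd d - closed_box d r" for x
  proof -
    obtain i where i: "i < d" "x i \<notin> {fst (r i)<..<snd (r i)}"
      using not_in_closed_box[of x d r] x by (elim DiffE) metis
    show ?thesis
      unfolding bump_prod_eq using i(1) bump_eq_0[OF i(2)] by (intro prod_zero) auto
  qed
  ultimately show ?thesis
    unfolding test_functions_def using compactin_closed_box[of d r] assms by blast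
qed

lemma prod_indicator_open_box:
  assumes "x \<in> Rd d"
  shows "(\<Prod>i<d. indicator {fst (r i)<..<snd (r i)} (x i)) = (indicator (open_box d r) x :: real)"
proof (cases "x \<in> open_box d r")
  case True
  have "x i \<in> {fst (r i)<..<snd (r i)}" if "i < d" for i
    by (rule PiE_mem[OF True[unfolded open_box_def]]) (use that in simp)
  with True show ?thesis by (simp add: prod.neutral)
next
  case False
  then obtain i where "i < d" "x i \<notin> {fst (r i)<..<snd (r i)}"
    using not_in_open_box[OF assms] by metis
  then have "(\<Prod>i<d. indicator {fst (r i)<..<snd (r i)} (x i) :: real) = 0"
    by (intro prod_zero) (auto intro!: bexI[of _ i])
  with False show ?thesis by simp
qed

lemma bump_prod_tendsto:
  "x \<in> Rd d \<Longrightarrow> (\<lambda>n. bump_prod d r n x) \<longlonglongrightarrow> indicator (open_box d r) x"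
  unfolding bump_prod_eq prod_indicator_open_box[symmetric] by (intro tendsto_prod bump_tendsto)

lemma bump_prod_bounds: "0 \<le> bump_prod d r n x" "bump_prod d r n x \<le> 1"
  unfolding bump_prod_eq by (auto intro!: prod_nonneg prod_le_1 bump_bounds)

text \<open>Products of bumps converge to the indicator of a box, so \<open>v\<close> has integral
  zero over every box inside. This extends to Borel rectangles one coordinate at a time, with
  indicators of intervals as the determining family, and rectangles determine a density.\<close>

lemma weak_uniqueness_box:
  assumes Q: "closed_box d r \<subseteq> \<Omega>" and v: "locally_integrable d \<Omega> v"
    and zero: "\<And>\<phi>. \<phi> \<in> test_functions d \<Omega> \<Longrightarrow> (LINT x:\<Omega>|Rd_leb d. v x * \<phi> x) = 0"
  shows "AE x in Rd_leb d. x \<in> open_box d r \<longrightarrow> v x = 0"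
proof -
  let ?M = "Rd_borel d" and ?L = "Rd_leb d"
  have L: "?L = completion ?M" by (simp add: Rd_leb_def)
  \<comment> \<open>Cutting \<open>v\<close> off to the closed box makes it globally integrable. Its
    Borel version \<open>c'\<close> is needed because the uniqueness results concern the uncompleted
    product measure.\<close>
  define c where "c x = indicator (closed_box d r) x * v x" for x
  have c: "integrable ?L c"
    using v Q compactin_closed_box[of d r] unfolding locally_integrable_def c_def set_integrable_def by auto
  then have "c \<in> borel_measurable (completion ?M)" unfolding L by (rule borel_measurable_integrable)
  then obtain c' where c': "c' \<in> borel_measurable ?M" "AE x in ?M. c x = c' x"
    using completion_ex_borel_measurable_real by blast
  have ae: "AE x in ?L. c x = c' x" unfolding L using c'(2) by (rule AE_completion)
  have c'L: "c' \<in> borel_measurable ?L" unfolding L using c'(1) by (rule measurable_completion)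
  have "integrable ?L c'"
    using integrable_cong_AE[OF borel_measurable_integrable[OF c] c'L ae] c by simp
  then have c'int: "integrable ?M c'" using integrable_completion[OF c'(1)] unfolding L by simp
  define e where "e x = indicator (open_box d r) x * c' x" for x
  have e: "integrable ?M e"
    unfolding e_def using integrable_mult_indicator[OF sets_open_box c'int, of r] by simp
  have sub0: "(LINT x|?L. c x * indicator (open_box d r') x) = 0"
    if sub: "\<And>i. i < d \<Longrightarrow> fst (r i) \<le> fst (r' i) \<and> snd (r' i) \<le> snd (r i)" for r'
  proof -
    have sub': "closed_box d r' \<subseteq> closed_box d r"
      unfolding closed_box_def by (intro PiE_mono) (use sub in force)
    have sets: "open_box d r' \<in> sets ?L" "closed_box d r' \<in> sets ?L"
      unfolding L using sets_open_box sets_closed_box by (auto intro: sets_completionI_sets)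
    have b0: "bump_prod d r' n x = 0" if x: "x \<in> Rd d - closed_box d r'" for n x
    proof -
      obtain i where i: "i < d" "x i \<notin> {fst (r' i)<..<snd (r' i)}"
        using not_in_closed_box[of x d r'] x by (elim DiffE) metis
      show ?thesis
        unfolding bump_prod_eq using i(1) bump_eq_0[OF i(2)] by (intro prod_zero) auto
    qed
    have bm: "bump_prod d r' n \<in> borel_measurable ?L" for n
      unfolding L
      by (rule measurable_completion, rule test_functions_measurable, rule bump_prod_test_function[of d r' UNIV]) simp
    have "(\<lambda>n. LINT x|?L. c x * bump_prod d r' n x) \<longlonglongrightarrow> (LINT x|?L. c x * indicator (open_box d r') x)"
    proof (rule integral_dominated_convergence[where w = "\<lambda>x. norm (c x)"])
      show "integrable ?L (\<lambda>x. norm (c x))" using c by auto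
      show "AE x in ?L. (\<lambda>n. c x * bump_prod d r' n x) \<longlonglongrightarrow> c x * indicator (open_box d r') x"
        by (intro AE_I2 tendsto_mult tendsto_const bump_prod_tendsto) (simp add: space_Rd_leb)
      show "AE x in ?L. norm (c x * bump_prod d r' n x) \<le> norm (c x)" for n
        using bump_prod_bounds[of d r' n] by (intro AE_I2) (simp add: abs_mult mult_left_le)
      show "(\<lambda>x. c x * indicator (open_box d r') x) \<in> borel_measurable ?L"
        using borel_measurable_integrable[OF c] sets(1) by (intro borel_measurable_times borel_measurable_indicator)
      show "(\<lambda>x. c x * bump_prod d r' n x) \<in> borel_measurable ?L" for n
        using borel_measurable_integrable[OF c] bm by (intro borel_measurable_times)
    qed
    moreover have "(LINT x|?L. c x * bump_prod d r' n x) = 0" for n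
    proof -
      have "(LINT x|?L. c x * bump_prod d r' n x) = (LINT x:\<Omega>|?L. v x * bump_prod d r' n x)"
        unfolding set_lebesgue_integral_def
      proof (rule Bochner_Integration.integral_cong[OF refl])
        fix x assume "x \<in> space ?L"
        then have "x \<in> Rd d" by (simp add: space_Rd_leb)
        then show "c x * bump_prod d r' n x = indicator \<Omega> x *\<^sub>R (v x * bump_prod d r' n x)"
          using b0[of x n] sub' Q by (cases "x \<in> closed_box d r'") (auto simp: c_def indicator_def)
      qed
      also have "\<dots> = 0"
        using sub' Q by (intro zero bump_prod_test_function) blast
      finally show ?thesis .
    qed
    ultimately show ?thesis by (simp add: LIMSEQ_const_iff)
  qed
  have e_zero: "(LINT x|?M. e x * (\<Prod>i<d. indicator {a i<..<b i} (x i))) = 0" for a b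
  proof -
    \<comment> \<open>Restricting to a further box amounts to passing to the intersection, again a
      box and possibly empty.\<close>
    define r' where "r' i = (max (a i) (fst (r i)), min (b i) (snd (r i)))" for i
    have eq: "e x * (\<Prod>i<d. indicator {a i<..<b i} (x i)) = c' x * indicator (open_box d r') x" if x: "x \<in> Rd d" for x
    proof -
      have "indicator (open_box d r) x * (\<Prod>i<d. indicator {a i<..<b i} (x i) :: real) =
          (\<Prod>i<d. indicator {fst (r i)<..<snd (r i)} (x i) * indicator {a i<..<b i} (x i))"
        unfolding prod.distrib by (simp add: prod_indicator_open_box[OF x])
      also have "\<dots> = (\<Prod>i<d. indicator {fst (r' i)<..<snd (r' i)} (x i))"
        by (intro prod.cong) (auto simp: r'_def indicator_def)
      finally show ?thesis by (simp add: prod_indicator_open_box[OF x] e_def)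
    qed
    have "(LINT x|?M. e x * (\<Prod>i<d. indicator {a i<..<b i} (x i))) = (LINT x|?M. c' x * indicator (open_box d r') x)"
      by (intro Bochner_Integration.integral_cong refl eq) (simp add: space_Rd_borel)
    also have "\<dots> = (LINT x|?L. c' x * indicator (open_box d r') x)"
      unfolding L by (rule integral_completion[symmetric])
        (intro borel_measurable_times borel_measurable_indicator c'(1) sets_open_box)
    also have "\<dots> = (LINT x|?L. c x * indicator (open_box d r') x)"
    proof (rule integral_cong_AE)
      have s: "open_box d r' \<in> sets ?L" unfolding L using sets_open_box by (auto intro: sets_completionI_sets)
      show "(\<lambda>x. c' x * indicator (open_box d r') x) \<in> borel_measurable ?L"
        using c'L s by (intro borel_measurable_times borel_measurable_indicator)
      show "(\<lambda>x. c x * indicator (open_box d r') x) \<in> borel_measurable ?L"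
        using borel_measurable_integrable[OF c] s by (intro borel_measurable_times borel_measurable_indicator)
      show "AE x in ?L. c' x * indicator (open_box d r') x = c x * indicator (open_box d r') x"
        using ae by eventually_elim simp
    qed
    also have "\<dots> = 0" by (rule sub0) (auto simp: r'_def)
    finally show ?thesis .
  qed
  have "AE x in ?M. e x = 0"
  proof (rule AE_zero_PiM[OF _ e])
    fix B :: "nat \<Rightarrow> real set" assume B: "\<And>i. i \<in> {..<d} \<Longrightarrow> B i \<in> sets borel"
    \<comment> \<open>The coordinatewise result is stated for complex functions, so the real
      indicators are embedded.\<close>
    define U where "U = {u. \<exists>a b. u = (\<lambda>t. complex_of_real (indicator {a<..<b::real} t))}"
    have "(LINT x|?M. complex_of_real (e x) * (\<Prod>i\<in>{..<d}. indicator (B i) (x i))) = 0"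
    proof (rule integral_prod_indicator_zero[where U = U and ?u0.0 = "\<lambda>t. complex_of_real (indicator {0<..<0} t)"])
      show "integrable ?M (\<lambda>x. complex_of_real (e x))" using e by simp
      show "(\<lambda>t. complex_of_real (indicator {0<..<0::real} t)) \<in> U"
        unfolding U_def by blast
      show "u \<in> borel_measurable borel" if "u \<in> U" for u using that by (auto simp: U_def)
      show "cmod (u t) \<le> 1" if "u \<in> U" for u t using that by (auto simp: U_def indicator_def)
      fix f :: "(nat \<Rightarrow> real) \<Rightarrow> complex" and X :: "(nat \<Rightarrow> real) \<Rightarrow> real" and B :: "real set"
      assume f: "integrable ?M f" and X: "X \<in> borel_measurable ?M" and B: "B \<in> sets borel"
        and z: "\<And>u. u \<in> U \<Longrightarrow> (LINT x|?M. f x * u (X x)) = 0"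
      show "(LINT x|?M. indicator B (X x) *\<^sub>R f x) = 0"
      proof (rule integral_indicator_zero_of_intervals[OF f X _ B])
        fix a b
        have "(\<lambda>t. complex_of_real (indicator {a<..<b} t)) \<in> U" unfolding U_def by blast
        from z[OF this] show "(LINT x|?M. indicator {a<..<b} (X x) *\<^sub>R f x) = 0"
          by (simp add: scaleR_conv_of_real mult.commute)
      qed
    next
      fix u :: "nat \<Rightarrow> real \<Rightarrow> complex" assume u: "\<And>i. i \<in> {..<d} \<Longrightarrow> u i \<in> U"
      have "\<forall>i\<in>{..<d}. \<exists>q. u i = (\<lambda>t. complex_of_real (indicator {fst q<..<snd q} t))"
    proof
      fix i assume i: "i \<in> {..<d}"
      obtain a b where "u i = (\<lambda>t. complex_of_real (indicator {a<..<b} t))"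
        using u[OF i] unfolding U_def by blast
      then show "\<exists>q. u i = (\<lambda>t. complex_of_real (indicator {fst q<..<snd q} t))" by (intro exI[of _ "(a, b)"]) simp
    qed
      then obtain q where q: "\<forall>i\<in>{..<d}. u i = (\<lambda>t. complex_of_real (indicator {fst (q i)<..<snd (q i)} t))"
        by (rule bchoice[THEN exE])
      have "(\<Prod>i\<in>{..<d}. u i (x i)) = complex_of_real (\<Prod>i<d. indicator {fst (q i)<..<snd (q i)} (x i))" for x
        unfolding of_real_prod using q by (intro prod.cong) auto
      then have "(LINT x|?M. complex_of_real (e x) * (\<Prod>i\<in>{..<d}. u i (x i))) =
          complex_of_real (LINT x|?M. e x * (\<Prod>i<d. indicator {fst (q i)<..<snd (q i)} (x i)))"
        unfolding integral_complex_of_real[symmetric] by simp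
      then show "(LINT x|?M. complex_of_real (e x) * (\<Prod>i\<in>{..<d}. u i (x i))) = 0"
        by (simp only: e_zero of_real_0)
    qed (use B in auto)
    moreover have "complex_of_real (e x) * (\<Prod>i\<in>{..<d}. indicator (B i) (x i)) =
        complex_of_real (e x * (\<Prod>i\<in>{..<d}. indicator (B i) (x i)))" for x
      by (simp add: of_real_prod indicator_def of_bool_def if_distrib cong: if_cong)
    ultimately have "complex_of_real (LINT x|?M. e x * (\<Prod>i\<in>{..<d}. indicator (B i) (x i))) = 0"
      unfolding integral_complex_of_real[symmetric] by simp
    then show "(LINT x|?M. e x * (\<Prod>i\<in>{..<d}. indicator (B i) (x i))) = 0" by simp
  qed simp
  then have "AE x in ?L. e x = 0" unfolding L by (rule AE_completion)
  with ae show ?thesis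
  proof eventually_elim
    case (elim x)
    then show ?case using open_box_subset[of d r] by (auto simp: e_def c_def indicator_def split: if_splits)
  qed
qed

text \<open>An open set is the union of the countably many rational boxes whose closed versions it
  contains, so the null sets of the boxes combine.\<close>

lemma weak_uniqueness:
  assumes \<Omega>: "openin (Rd_top d) \<Omega>" and v: "locally_integrable d \<Omega> v"
    and zero: "\<And>\<phi>. \<phi> \<in> test_functions d \<Omega> \<Longrightarrow> (LINT x:\<Omega>|Rd_leb d. v x * \<phi> x) = 0"
  shows "AE x in Rd_leb d. x \<in> \<Omega> \<longrightarrow> v x = 0"
proof -
  have "AE x in Rd_leb d. \<forall>r\<in>{r \<in> rational_boxes d. closed_box d r \<subseteq> \<Omega>}. x \<in> open_box d r \<longrightarrow> v x = 0"
    using countable_rational_boxes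
    by (subst AE_ball_countable) (auto intro: countable_subset weak_uniqueness_box[OF _ v zero])
  then show ?thesis
  proof eventually_elim
    case (elim x)
    then show ?case using openin_eq_Union_boxes[OF \<Omega>] by blast
  qed
qed

section \<open>Fourier inversion\<close>

text \<open>The Hermite polynomials up to sign: \<open>gauss_poly k\<close> is the polynomial factor
  in the k-th derivative of exp(-t^2/2).\<close>

fun gauss_poly :: "nat \<Rightarrow> real poly" where
  "gauss_poly 0 = 1"
| "gauss_poly (Suc k) = pderiv (gauss_poly k) - [:0, 1:] * gauss_poly k"

definition gauss_deriv :: "real \<Rightarrow> nat \<Rightarrow> real \<Rightarrow> complex" where
  "gauss_deriv a k t = complex_of_real (poly (gauss_poly k) (t - a) * exp (- ((t - a)\<^sup>2 / 2)))"

lemma gauss_deriv_has_derivative: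
  "(gauss_deriv a k has_vector_derivative gauss_deriv a (Suc k) t) (at t)"
proof -
  have "((\<lambda>t. poly (gauss_poly k) (t - a) * exp (- ((t - a)\<^sup>2 / 2))) has_real_derivative
      poly (gauss_poly (Suc k)) (t - a) * exp (- ((t - a)\<^sup>2 / 2))) (at t)"
    by (rule derivative_eq_intros DERIV_chain2[OF poly_DERIV] refl | simp add: field_simps)+
  then have "((\<lambda>t. complex_of_real (poly (gauss_poly k) (t - a) * exp (- ((t - a)\<^sup>2 / 2)))) has_vector_derivative
      complex_of_real (poly (gauss_poly (Suc k)) (t - a) * exp (- ((t - a)\<^sup>2 / 2)))) (at t)"
    unfolding has_real_derivative_iff_has_vector_derivative
    by (rule bounded_linear.has_vector_derivative[OF bounded_linear_of_real])
  then show ?thesis unfolding gauss_deriv_def .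
qed

text \<open>The centre is variable because a translation becomes a modulation on the Fourier side;
  with all centres these functions probe all frequencies.\<close>

definition gauss_fun :: "nat \<Rightarrow> (nat \<Rightarrow> real) \<Rightarrow> (nat \<Rightarrow> real) \<Rightarrow> complex" where
  "gauss_fun d \<eta> = coord_prod d (\<lambda>i. gauss_deriv (\<eta> i)) (\<lambda>_. 0)"

lemma gauss_fun_eq: "gauss_fun d \<eta> x = (\<Prod>i<d. complex_of_real (exp (- ((x i - \<eta> i)\<^sup>2 / 2))))"
  by (simp add: gauss_fun_def coord_prod_def gauss_deriv_def)

text \<open>From u <= exp u at u = y / (M + 1), raised to the power M. Dividing by M + 1 rather than
  by M covers M = 0.\<close>

lemma power_times_exp_bound:
  fixes y :: real assumes "y \<ge> 0" shows "y ^ M * exp (- y) \<le> real (Suc M) ^ M"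
proof -
  have "y / real (Suc M) \<le> exp (y / real (Suc M))"
    using exp_ge_add_one_self[of "y / real (Suc M)"] by linarith
  then have "(y / real (Suc M)) ^ M \<le> exp (y / real (Suc M)) ^ M"
    using assms by (intro power_mono) auto
  also have "\<dots> = exp (real M * (y / real (Suc M)))" by (rule exp_of_nat_mult[symmetric])
  also have "\<dots> \<le> exp y"
    using assms by (simp add: field_simps)
  finally have "y ^ M \<le> real (Suc M) ^ M * exp y"
    by (simp add: power_divide field_simps)
  then show ?thesis by (simp add: exp_minus field_simps)
qed

lemma poly_growth_bound:
  fixes p :: "real poly"
  shows "\<bar>poly p y\<bar> \<le> (\<Sum>i\<le>degree p. \<bar>coeff p i\<bar>) * (1 + \<bar>y\<bar>) ^ degree p"
proof -
  have "\<bar>poly p y\<bar> \<le> (\<Sum>i\<le>degree p. \<bar>coeff p i * y ^ i\<bar>)"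
    unfolding poly_altdef by (rule sum_abs)
  also have "\<dots> \<le> (\<Sum>i\<le>degree p. \<bar>coeff p i\<bar> * (1 + \<bar>y\<bar>) ^ degree p)"
  proof (rule sum_mono)
    fix i assume i: "i \<in> {..degree p}"
    have "\<bar>y\<bar> ^ i \<le> (1 + \<bar>y\<bar>) ^ i" by (rule power_mono) auto
    also have "\<dots> \<le> (1 + \<bar>y\<bar>) ^ degree p" using i by (intro power_increasing) auto
    finally show "\<bar>coeff p i * y ^ i\<bar> \<le> \<bar>coeff p i\<bar> * (1 + \<bar>y\<bar>) ^ degree p"
      by (simp add: abs_mult power_abs mult_left_mono)
  qed
  finally show ?thesis by (simp add: sum_distrib_right)
qed

lemma gauss_deriv_bounded:
  obtains B where "B \<ge> 0" "\<And>t. (1 + \<bar>t\<bar>) ^ N * cmod (gauss_deriv a k t) \<le> B"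
proof -
  define p where "p = gauss_poly k"
  define c where "c = (\<Sum>i\<le>degree p. \<bar>coeff p i\<bar>)"
  define M where "M = N + degree p"
  define B where "B = (1 + \<bar>a\<bar>) ^ N * c * (exp 2 * real (Suc M) ^ M)"
  have c0: "c \<ge> 0" unfolding c_def by (intro sum_nonneg) auto
  have "(1 + \<bar>t\<bar>) ^ N * cmod (gauss_deriv a k t) \<le> B" for t
  proof -
    define y where "y = t - a"
    have "(1 + \<bar>t\<bar>) \<le> (1 + \<bar>a\<bar>) * (1 + \<bar>y\<bar>)"
    proof -
      have "0 \<le> \<bar>a\<bar> * \<bar>y\<bar>" by simp
      moreover have "\<bar>t\<bar> \<le> \<bar>a\<bar> + \<bar>y\<bar>" using abs_triangle_ineq[of a y] by (simp add: y_def)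
      moreover have "(1 + \<bar>a\<bar>) * (1 + \<bar>y\<bar>) = 1 + \<bar>a\<bar> + \<bar>y\<bar> + \<bar>a\<bar> * \<bar>y\<bar>" by (simp add: algebra_simps)
      ultimately show ?thesis by linarith
    qed
    then have "(1 + \<bar>t\<bar>) ^ N \<le> ((1 + \<bar>a\<bar>) * (1 + \<bar>y\<bar>)) ^ N" by (intro power_mono) auto
    then have 1: "(1 + \<bar>t\<bar>) ^ N \<le> (1 + \<bar>a\<bar>) ^ N * (1 + \<bar>y\<bar>) ^ N" by (simp add: power_mult_distrib)
    \<comment> \<open>Completing the square compares the Gaussian with exp(-(1 + |y|)), against
      which every power of 1 + |y| is bounded; the constant exp 2 is generous.\<close>
    have "0 \<le> (\<bar>y\<bar> - 1)\<^sup>2" by simp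
    then have "- (y\<^sup>2 / 2) \<le> 2 - (1 + \<bar>y\<bar>)" by (simp add: power2_diff)
    then have ex: "exp (- (y\<^sup>2 / 2)) \<le> exp 2 * exp (- (1 + \<bar>y\<bar>))" by (simp flip: exp_add)
    have 2: "cmod (gauss_deriv a k t) \<le> (c * (1 + \<bar>y\<bar>) ^ degree p) * (exp 2 * exp (- (1 + \<bar>y\<bar>)))"
    proof -
      have eq: "cmod (gauss_deriv a k t) = \<bar>poly p y\<bar> * exp (- (y\<^sup>2 / 2))"
        unfolding gauss_deriv_def norm_of_real by (simp add: abs_mult p_def y_def)
      show ?thesis
        unfolding eq using ex poly_growth_bound[of p y] c0 by (intro mult_mono) (auto simp: c_def)
    qed
    have "(1 + \<bar>t\<bar>) ^ N * cmod (gauss_deriv a k t) \<le>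
        ((1 + \<bar>a\<bar>) ^ N * (1 + \<bar>y\<bar>) ^ N) * ((c * (1 + \<bar>y\<bar>) ^ degree p) * (exp 2 * exp (- (1 + \<bar>y\<bar>))))"
      by (intro mult_mono 1 2) (auto simp: c0)
    also have "\<dots> = (1 + \<bar>a\<bar>) ^ N * c * (exp 2 * ((1 + \<bar>y\<bar>) ^ M * exp (- (1 + \<bar>y\<bar>))))"
      by (simp add: M_def power_add mult_ac)
    also have "\<dots> \<le> B"
      unfolding B_def using c0 by (intro mult_left_mono power_times_exp_bound) auto
    finally show ?thesis .
  qed
  moreover have "B \<ge> 0" unfolding B_def using c0 by simp
  ultimately show ?thesis using that by blast
qed

lemma one_plus_sum_le_prod:
  fixes g :: "nat \<Rightarrow> real"
  assumes "\<And>i. g i \<ge> 0" shows "1 + (\<Sum>i<d. g i) \<le> (\<Prod>i<d. 1 + g i)"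
proof (induction d)
  case (Suc d)
  have "1 * g d \<le> (\<Prod>i<d. 1 + g i) * g d"
    using assms by (intro mult_right_mono prod_ge_1) auto
  with Suc show ?case by (simp add: algebra_simps)
qed simp

text \<open>Decay in \<open>schwartz\<close> is measured by the norm, while a product of
  one-dimensional functions decays coordinate by coordinate; this inequality connects the
  two.\<close>

lemma Rd_norm_le_prod: "1 + Rd_norm d x \<le> (\<Prod>i<d. 1 + \<bar>x i\<bar>)"
proof -
  have "1 + Rd_norm d x \<le> 1 + (\<Sum>i<d. \<bar>x i\<bar>)"
    unfolding Rd_norm_def by (intro add_left_mono L2_set_le_sum_abs)
  also have "\<dots> \<le> (\<Prod>i<d. 1 + \<bar>x i\<bar>)" by (rule one_plus_sum_le_prod) simp
  finally show ?thesis .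
qed

lemma Rd_norm_nonneg [simp]: "0 \<le> Rd_norm d x"
  by (simp add: Rd_norm_def L2_set_nonneg)

lemma multi_deriv_list: "set (concat (map (\<lambda>i. replicate (\<alpha> i) i) [0..<d])) \<subseteq> {..<d}"
  by auto

lemma gauss_fun_schwartz: "gauss_fun d \<eta> \<in> schwartz d"
  unfolding schwartz_def
proof (intro CollectI conjI allI)
  show "smooth_Rd d (gauss_fun d \<eta>)"
    unfolding gauss_fun_def by (rule smooth_Rd_coord_prod) (rule gauss_deriv_has_derivative)
  fix \<alpha> :: "nat \<Rightarrow> nat" and k :: nat
  define js where "js = concat (map (\<lambda>i. replicate (\<alpha> i) i) [0..<d])"
  have pd: "multi_deriv d \<alpha> (gauss_fun d \<eta>) = coord_prod d (\<lambda>i. gauss_deriv (\<eta> i)) (count_list js)"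
    unfolding multi_deriv_def js_def[symmetric] gauss_fun_def
    by (rule partial_derivs_coord_prod) (use gauss_deriv_has_derivative multi_deriv_list js_def in auto)
  have "\<exists>B. B \<ge> 0 \<and> (\<forall>t. (1 + \<bar>t\<bar>) ^ k * cmod (gauss_deriv (\<eta> i) (count_list js i) t) \<le> B)" for i
    using gauss_deriv_bounded[of k "\<eta> i" "count_list js i"] by metis
  then obtain B where B: "\<And>i. B i \<ge> 0" "\<And>i t. (1 + \<bar>t\<bar>) ^ k * cmod (gauss_deriv (\<eta> i) (count_list js i) t) \<le> B i"
    by metis
  have "(1 + Rd_norm d x) ^ k * cmod (multi_deriv d \<alpha> (gauss_fun d \<eta>) x) \<le> (\<Prod>i<d. B i)" for x
  proof -
    have "(1 + Rd_norm d x) ^ k * cmod (multi_deriv d \<alpha> (gauss_fun d \<eta>) x) \<le>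
        (\<Prod>i<d. 1 + \<bar>x i\<bar>) ^ k * (\<Prod>i<d. cmod (gauss_deriv (\<eta> i) (count_list js i) (x i)))"
      unfolding pd coord_prod_def prod_norm
      by (intro mult_right_mono power_mono Rd_norm_le_prod) (auto simp: add_nonneg_nonneg)
    also have "\<dots> = (\<Prod>i<d. (1 + \<bar>x i\<bar>) ^ k * cmod (gauss_deriv (\<eta> i) (count_list js i) (x i)))"
      by (simp add: prod_power_distrib prod.distrib)
    also have "\<dots> \<le> (\<Prod>i<d. B i)" by (intro prod_mono conjI B) auto
    finally show ?thesis .
  qed
  then show "\<exists>B. \<forall>x\<in>Rd d. (1 + Rd_norm d x) ^ k * cmod (multi_deriv d \<alpha> (gauss_fun d \<eta>) x) \<le> B"
    by blast
qed

lemma gauss_integrable: "integrable lborel (\<lambda>t. exp (- ((t - a)\<^sup>2 / 2)) :: real)"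
proof -
  have "integrable lborel (\<lambda>t. sqrt (2 * pi) * normal_density a 1 t)" by simp
  then show ?thesis by (simp add: normal_density_def)
qed

text \<open>This is the characteristic function of the standard normal distribution, freed from the
  normalisation of its density.\<close>

lemma gauss_fourier_0:
  "(LINT t|lborel. complex_of_real (exp (- (t\<^sup>2 / 2))) * iexp (\<zeta> * t)) =
    complex_of_real (sqrt (2 * pi) * exp (- (\<zeta>\<^sup>2 / 2)))"
proof -
  have "char std_normal_distribution \<zeta> = (LINT t|lborel. std_normal_density t *\<^sub>R iexp (\<zeta> * t))"
    unfolding char_def by (rule integral_density) (auto simp: normal_density_nonneg)
  also have "\<dots> = (LINT t|lborel. complex_of_real (1 / sqrt (2 * pi)) * (complex_of_real (exp (- (t\<^sup>2 / 2))) * iexp (\<zeta> * t)))"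
    by (intro Bochner_Integration.integral_cong refl) (simp add: normal_density_def scaleR_conv_of_real)
  also have "\<dots> = complex_of_real (1 / sqrt (2 * pi)) * (LINT t|lborel. complex_of_real (exp (- (t\<^sup>2 / 2))) * iexp (\<zeta> * t))"
    by (rule integral_mult_right_zero)
  finally have "complex_of_real (exp (- (\<zeta>\<^sup>2) / 2)) =
      complex_of_real (1 / sqrt (2 * pi)) * (LINT t|lborel. complex_of_real (exp (- (t\<^sup>2 / 2))) * iexp (\<zeta> * t))"
    by (simp add: char_std_normal_distribution)
  then show ?thesis by (simp add: field_simps)
qed

lemma gauss_fourier:
  "(LINT t|lborel. complex_of_real (exp (- ((t - a)\<^sup>2 / 2))) * iexp (\<zeta> * t)) =
    complex_of_real (sqrt (2 * pi) * exp (- (\<zeta>\<^sup>2 / 2))) * iexp (\<zeta> * a)"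
proof -
  have "(LINT t|lborel. complex_of_real (exp (- ((t - a)\<^sup>2 / 2))) * iexp (\<zeta> * t)) =
      (LINT t|lborel. complex_of_real (exp (- ((a + 1 * t - a)\<^sup>2 / 2))) * iexp (\<zeta> * (a + 1 * t)))"
    using lborel_integral_real_affine[of 1 "\<lambda>t. complex_of_real (exp (- ((t - a)\<^sup>2 / 2))) * iexp (\<zeta> * t)" a]
    by simp
  also have "\<dots> = (LINT t|lborel. iexp (\<zeta> * a) * (complex_of_real (exp (- (t\<^sup>2 / 2))) * iexp (\<zeta> * t)))"
    by (intro Bochner_Integration.integral_cong refl) (simp add: ring_distribs exp_add)
  also have "\<dots> = iexp (\<zeta> * a) * (LINT t|lborel. complex_of_real (exp (- (t\<^sup>2 / 2))) * iexp (\<zeta> * t))"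
    by (rule integral_mult_right_zero)
  finally show ?thesis unfolding gauss_fourier_0 by (simp only: mult.commute)
qed

lemma iexp_Rd_inner: "iexp (Rd_inner d \<zeta> x) = (\<Prod>i<d. iexp (\<zeta> i * x i))"
  by (simp add: Rd_inner_def sum_distrib_left exp_sum)

lemma gauss_fun_integrable: "integrable (Rd_borel d) (gauss_fun d \<eta>)"
proof -
  interpret product_sigma_finite "\<lambda>_. lborel :: real measure" by (rule product_sigma_finite_lborel)
  show ?thesis
    unfolding gauss_fun_eq[abs_def] by (intro product_integrable_prod) (auto intro: gauss_integrable)
qed

lemma gauss_fun_fourier:
  "(LINT x|Rd_borel d. gauss_fun d \<eta> x * iexp (Rd_inner d \<zeta> x)) =
    complex_of_real (sqrt (2 * pi) ^ d) * gauss_fun d (\<lambda>_. 0) \<zeta> * iexp (Rd_inner d \<zeta> \<eta>)"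
proof -
  interpret product_sigma_finite "\<lambda>_. lborel :: real measure" by (rule product_sigma_finite_lborel)
  have "(LINT x|Rd_borel d. gauss_fun d \<eta> x * iexp (Rd_inner d \<zeta> x)) =
      (LINT x|Rd_borel d. (\<Prod>i<d. complex_of_real (exp (- ((x i - \<eta> i)\<^sup>2 / 2))) * iexp (\<zeta> i * x i)))"
    unfolding gauss_fun_eq iexp_Rd_inner by (simp only: prod.distrib)
  also have "\<dots> = (\<Prod>i<d. (LINT t|lborel. complex_of_real (exp (- ((t - \<eta> i)\<^sup>2 / 2))) * iexp (\<zeta> i * t)))"
  proof (rule product_integral_prod)
    fix i
    show "integrable lborel (\<lambda>t. complex_of_real (exp (- ((t - \<eta> i)\<^sup>2 / 2))) * iexp (\<zeta> i * t))"
      by (rule Bochner_Integration.integrable_bound[OF gauss_integrable[of "\<eta> i"]]) (auto simp: norm_mult)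
  qed simp
  also have "\<dots> = (\<Prod>i<d. complex_of_real (sqrt (2 * pi)) * complex_of_real (exp (- ((\<zeta> i)\<^sup>2 / 2))) * iexp (\<zeta> i * \<eta> i))"
    unfolding gauss_fourier by simp
  also have "\<dots> = (\<Prod>i<d. complex_of_real (sqrt (2 * pi))) * gauss_fun d (\<lambda>_. 0) \<zeta> * iexp (Rd_inner d \<zeta> \<eta>)"
    unfolding prod.distrib iexp_Rd_inner gauss_fun_eq by simp
  finally show ?thesis by simp
qed

lemma gauss_fun_measurable: "gauss_fun d \<eta> \<in> borel_measurable (Rd_borel d)"
  using gauss_fun_integrable by (rule borel_measurable_integrable)

lemma Rd_inner_commute: "Rd_inner d x y = Rd_inner d y x"
  by (simp add: Rd_inner_def mult.commute)

lemma Rd_inner_uminus: "Rd_inner d (\<lambda>i. - x i) y = - Rd_inner d x y"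
  by (simp add: Rd_inner_def sum_negf)

lemma iexp_Rd_inner_measurable [measurable]:
  "(\<lambda>x. iexp (Rd_inner d w x)) \<in> borel_measurable (Rd_borel d)"
  by measurable

lemma gauss_fun_fourier_integral:
  "fourier_integral d (gauss_fun d \<eta>) x =
    complex_of_real ((2 * pi) powr (- real d) * sqrt (2 * pi) ^ d) * gauss_fun d (\<lambda>_. 0) x * iexp (- Rd_inner d x \<eta>)"
proof -
  have "exp (- \<i> * complex_of_real (Rd_inner d x y)) = iexp (Rd_inner d (\<lambda>i. - x i) y)" for y
    by (simp add: Rd_inner_uminus)
  then have "(LINT y|Rd_leb d. gauss_fun d \<eta> y * exp (- \<i> * complex_of_real (Rd_inner d x y))) =
      (LINT y|Rd_leb d. gauss_fun d \<eta> y * iexp (Rd_inner d (\<lambda>i. - x i) y))"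
    by simp
  also have "\<dots> = (LINT y|Rd_borel d. gauss_fun d \<eta> y * iexp (Rd_inner d (\<lambda>i. - x i) y))"
    unfolding Rd_leb_def
    by (intro integral_completion borel_measurable_times gauss_fun_measurable iexp_Rd_inner_measurable)
  also have "\<dots> = complex_of_real (sqrt (2 * pi) ^ d) * gauss_fun d (\<lambda>_. 0) (\<lambda>i. - x i) * iexp (Rd_inner d (\<lambda>i. - x i) \<eta>)"
    by (rule gauss_fun_fourier)
  finally show ?thesis
    unfolding fourier_integral_def by (simp add: gauss_fun_eq Rd_inner_uminus)
qed

text \<open>The power of 2 pi sits entirely in \<open>fourier_integral\<close>, so the inverse
  carries no constant.\<close>

definition fourier_inverse :: "nat \<Rightarrow> ((nat \<Rightarrow> real) \<Rightarrow> complex) \<Rightarrow> (nat \<Rightarrow> real) \<Rightarrow> complex" where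
  "fourier_inverse d g x = (LINT \<omega>|Rd_borel d. g \<omega> * iexp (Rd_inner d \<omega> x))"

lemma Rd_inner_pair_measurable [measurable]:
  "(\<lambda>(x, y). Rd_inner d x y) \<in> borel_measurable (Rd_borel d \<Otimes>\<^sub>M Rd_borel d)"
  unfolding Rd_inner_def by measurable

lemma fourier_inverse_measurable:
  assumes [measurable]: "g \<in> borel_measurable (Rd_borel d)"
  shows "fourier_inverse d g \<in> borel_measurable (Rd_borel d)"
proof -
  interpret sigma_finite_measure "Rd_borel d" by (rule sigma_finite_Rd_borel)
  have [measurable]: "(\<lambda>p. Rd_inner d (snd p) (fst p)) \<in> borel_measurable (Rd_borel d \<Otimes>\<^sub>M Rd_borel d)"
    unfolding Rd_inner_def by measurable
  have "(\<lambda>(x, \<omega>). g \<omega> * iexp (Rd_inner d \<omega> x)) \<in> borel_measurable (Rd_borel d \<Otimes>\<^sub>M Rd_borel d)"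
    unfolding split_beta' by measurable
  then show ?thesis unfolding fourier_inverse_def by (rule borel_measurable_lebesgue_integral)
qed

lemma fourier_inverse_bound:
  assumes g: "integrable (Rd_borel d) g"
  shows "cmod (fourier_inverse d g x) \<le> (LINT \<omega>|Rd_borel d. cmod (g \<omega>))"
proof -
  have "cmod (fourier_inverse d g x) \<le> (LINT \<omega>|Rd_borel d. cmod (g \<omega> * iexp (Rd_inner d \<omega> x)))"
    unfolding fourier_inverse_def by (rule integral_norm_bound)
  then show ?thesis by (simp add: norm_mult)
qed

text \<open>For a = 2 pi: the constant of the transform cancels the factors of two Gaussian
  integrals, one from transforming the test function, one from transforming the inverse transform
  times a Gaussian.\<close>

lemma powr_minus_sqrt_power:
  fixes a :: real
  assumes "a > 0" shows "a powr (- real d) * sqrt a ^ d * sqrt a ^ d = 1"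
proof -
  have "sqrt a ^ d * sqrt a ^ d = (sqrt a * sqrt a) ^ d" by (rule power_mult_distrib[symmetric])
  also have "sqrt a * sqrt a = a" using assms by simp
  finally show ?thesis using assms by (simp only: mult.assoc powr_minus powr_realpow) simp
qed

text \<open>\<open>f\<close> need not be integrable, so it is multiplied by the Gaussian
  \<open>G\<close>. Testing with translated Gaussians shows that \<open>f\<close> and the inverse
  transform \<open>F\<close>, both multiplied by \<open>G\<close>, have the same Fourier transform;
  the products are integrable, hence equal almost everywhere, and \<open>G\<close> has no zero. As
  \<open>f\<close> is real, real parts are compared.\<close>

lemma fourier_inversion:
  assumes ft: "is_fourier_transform d f g" and g: "integrable (Rd_leb d) g"
  obtains g' where "g' \<in> borel_measurable (Rd_borel d)" "AE \<omega> in Rd_borel d. g \<omega> = g' \<omega>"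
    "AE x in Rd_leb d. f x = Re (fourier_inverse d g' x)"
proof -
  let ?M = "Rd_borel d" and ?L = "Rd_leb d"
  have L: "?L = completion ?M" by (simp add: Rd_leb_def)
  interpret sigma_finite_measure ?M by (rule sigma_finite_Rd_borel)
  interpret pair_sigma_finite ?M ?M ..
  interpret product_sigma_finite "\<lambda>_. lborel :: real measure" by (rule product_sigma_finite_lborel)
  define G where "G = gauss_fun d (\<lambda>_. 0)"
  define Gr where "Gr x = (\<Prod>i<d. exp (- ((x i)\<^sup>2 / 2)))" for x :: "nat \<Rightarrow> real"
  have GGr: "G x = complex_of_real (Gr x)" for x
    by (simp add: G_def Gr_def gauss_fun_eq)
  have Gr_pos: "Gr x > 0" for x unfolding Gr_def by (intro prod_pos) auto
  have Gm: "G \<in> borel_measurable ?M" unfolding G_def by (rule gauss_fun_measurable)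
  have Grm[measurable]: "Gr \<in> borel_measurable ?M" unfolding Gr_def by measurable
  have Gi: "integrable ?M G" unfolding G_def by (rule gauss_fun_integrable)
  have "g \<in> borel_measurable (completion ?M)" using g unfolding L by (rule borel_measurable_integrable)
  have gRe: "\<exists>g'\<in>borel_measurable ?M. AE x in ?M. Re (g x) = g' x"
    using \<open>g \<in> _\<close> by (intro completion_ex_borel_measurable_real measurable_compose[OF _ borel_measurable_Re])
  have gIm: "\<exists>g'\<in>borel_measurable ?M. AE x in ?M. Im (g x) = g' x"
    using \<open>g \<in> _\<close> by (intro completion_ex_borel_measurable_real measurable_compose[OF _ borel_measurable_Im])
  obtain g1 g2 where g12: "g1 \<in> borel_measurable ?M" "AE x in ?M. Re (g x) = g1 x"
      "g2 \<in> borel_measurable ?M" "AE x in ?M. Im (g x) = g2 x"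
    using gRe gIm by blast
  \<comment> \<open>Borel versions of \<open>g\<close>, and below of \<open>f\<close> times the
    Gaussian, are taken because Fubini's theorem and the uniqueness results are applied to the
    uncompleted measure.\<close>
  define g' where "g' x = Complex (g1 x) (g2 x)" for x
  have g'm[measurable]: "g' \<in> borel_measurable ?M"
    unfolding g'_def Complex_eq using g12 by measurable
  have g'ae: "AE \<omega> in ?M. g \<omega> = g' \<omega>"
    using g12(2,4) by eventually_elim (simp add: g'_def complex_eq_iff)
  have g'aeL: "AE \<omega> in ?L. g \<omega> = g' \<omega>" unfolding L by (rule AE_completion[OF g'ae])
  have g'L: "g' \<in> borel_measurable ?L" unfolding L by (rule measurable_completion[OF g'm])
  have "integrable ?L g'" using g integrable_cong_AE[OF borel_measurable_integrable[OF g] g'L g'aeL] by simp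
  then have g'i: "integrable ?M g'" using integrable_completion[OF g'm] unfolding L by simp
  have fG: "integrable ?L (\<lambda>x. complex_of_real (f x) * G x)"
    using ft gauss_fun_schwartz[of d "\<lambda>_. 0"] unfolding is_fourier_transform_def tempered_def G_def by blast
  have fGr: "integrable ?L (\<lambda>x. f x * Gr x)"
  proof -
    have "integrable ?L (\<lambda>x. Re (complex_of_real (f x) * G x))" using fG by (rule integrable_Re)
    then show ?thesis by (simp add: GGr)
  qed
  have "(\<lambda>x. f x * Gr x) \<in> borel_measurable (completion ?M)" using fGr unfolding L by (rule borel_measurable_integrable)
  then obtain h where h[measurable]: "h \<in> borel_measurable ?M" and hae: "AE x in ?M. f x * Gr x = h x"
    using completion_ex_borel_measurable_real by blast
  have haeL: "AE x in ?L. f x * Gr x = h x" unfolding L by (rule AE_completion[OF hae])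
  have hL: "h \<in> borel_measurable ?L" unfolding L by (rule measurable_completion[OF h])
  have "integrable ?L h" using fGr integrable_cong_AE[OF borel_measurable_integrable[OF fGr] hL haeL] by simp
  then have hi: "integrable ?M h" using integrable_completion[OF h] unfolding L by simp
  define F where "F = fourier_inverse d g'"
  have Fm[measurable]: "F \<in> borel_measurable ?M" unfolding F_def by (rule fourier_inverse_measurable[OF g'm])
  have FG: "integrable ?M (\<lambda>x. F x * G x)"
  proof (rule Bochner_Integration.integrable_bound)
    show "integrable ?M (\<lambda>x. (LINT \<omega>|?M. cmod (g' \<omega>)) * cmod (G x))" using Gi by simp
    show "(\<lambda>x. F x * G x) \<in> borel_measurable ?M" using Fm Gm by measurable
    show "AE x in ?M. norm (F x * G x) \<le> norm ((LINT \<omega>|?M. cmod (g' \<omega>)) * cmod (G x))"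
      using fourier_inverse_bound[OF g'i]
      by (intro AE_I2) (auto simp: norm_mult F_def abs_mult intro!: mult_right_mono order_trans[OF _ abs_ge_self])
  qed
  \<comment> \<open>The aim is that the integrable function \<open>c\<close> has vanishing Fourier
    transform.\<close>
  define c where "c x = complex_of_real (h x) - F x * G x" for x
  have ci: "integrable ?M c" unfolding c_def using hi FG by auto
  define K where "K = (2 * pi) powr (- real d) * sqrt (2 * pi) ^ d"
  have K: "K * sqrt (2 * pi) ^ d = 1"
    unfolding K_def by (rule powr_minus_sqrt_power) simp
  have K0: "K \<noteq> 0" using K by auto
  have key: "(LINT x|?M. c x * iexp (Rd_inner d \<eta> x)) = 0" for \<eta>
  proof -
    \<comment> \<open>The test Gaussian is centred at the negative, so that its transform carries
      the phase of \<eta> itself.\<close>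
    let ?\<eta> = "\<lambda>i. - \<eta> i"
    have e: "iexp (- Rd_inner d x ?\<eta>) = iexp (Rd_inner d \<eta> x)" for x
      by (simp add: Rd_inner_uminus Rd_inner_commute[of d x])
    have m1: "(\<lambda>x. g' x * gauss_fun d ?\<eta> x) \<in> borel_measurable ?M"
      using gauss_fun_measurable[of d ?\<eta>] by measurable
    have hm: "(\<lambda>x. complex_of_real (h x) * iexp (Rd_inner d \<eta> x)) \<in> borel_measurable ?M" by measurable
    have "(LINT \<omega>|?M. g' \<omega> * gauss_fun d ?\<eta> \<omega>) = (LINT \<omega>|?L. g' \<omega> * gauss_fun d ?\<eta> \<omega>)"
      unfolding L by (rule integral_completion[OF m1, symmetric])
    also have "\<dots> = (LINT \<omega>|?L. g \<omega> * gauss_fun d ?\<eta> \<omega>)"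
    proof (rule integral_cong_AE)
      show "(\<lambda>\<omega>. g' \<omega> * gauss_fun d ?\<eta> \<omega>) \<in> borel_measurable ?L"
        unfolding L by (rule measurable_completion[OF m1])
      show "(\<lambda>\<omega>. g \<omega> * gauss_fun d ?\<eta> \<omega>) \<in> borel_measurable ?L"
        using borel_measurable_integrable[OF g] measurable_completion[OF gauss_fun_measurable[of d ?\<eta>]]
        unfolding L by (rule borel_measurable_times)
      show "AE \<omega> in ?L. g' \<omega> * gauss_fun d ?\<eta> \<omega> = g \<omega> * gauss_fun d ?\<eta> \<omega>"
        using g'aeL by eventually_elim simp
    qed
    also have "\<dots> = (LINT x|?L. complex_of_real (f x) * fourier_integral d (gauss_fun d ?\<eta>) x)"
      using ft gauss_fun_schwartz[of d ?\<eta>] unfolding is_fourier_transform_def by blast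
    also have "\<dots> = (LINT x|?L. complex_of_real K * (complex_of_real (f x * Gr x) * iexp (Rd_inner d \<eta> x)))"
      unfolding gauss_fun_fourier_integral e K_def[symmetric] G_def[symmetric] GGr
      by (intro Bochner_Integration.integral_cong refl) simp
    also have "\<dots> = complex_of_real K * (LINT x|?L. complex_of_real (f x * Gr x) * iexp (Rd_inner d \<eta> x))"
      by (rule integral_mult_right_zero)
    also have "(LINT x|?L. complex_of_real (f x * Gr x) * iexp (Rd_inner d \<eta> x)) =
        (LINT x|?L. complex_of_real (h x) * iexp (Rd_inner d \<eta> x))"
    proof (rule integral_cong_AE)
      have "(\<lambda>x. iexp (Rd_inner d \<eta> x)) \<in> borel_measurable ?M" by measurable
      from measurable_completion[OF this] 
      show "(\<lambda>x. complex_of_real (f x * Gr x) * iexp (Rd_inner d \<eta> x)) \<in> borel_measurable ?L"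
        using measurable_compose[OF borel_measurable_integrable[OF fGr] borel_measurable_of_real] unfolding L by (intro borel_measurable_times)
      show "(\<lambda>x. complex_of_real (h x) * iexp (Rd_inner d \<eta> x)) \<in> borel_measurable ?L"
        unfolding L by (rule measurable_completion[OF hm])
      show "AE x in ?L. complex_of_real (f x * Gr x) * iexp (Rd_inner d \<eta> x) = complex_of_real (h x) * iexp (Rd_inner d \<eta> x)"
        using haeL by eventually_elim simp
    qed
    also have "\<dots> = (LINT x|?M. complex_of_real (h x) * iexp (Rd_inner d \<eta> x))"
      unfolding L by (rule integral_completion[OF hm])
    finally have 1: "(LINT \<omega>|?M. g' \<omega> * gauss_fun d ?\<eta> \<omega>) =
        complex_of_real K * (LINT x|?M. complex_of_real (h x) * iexp (Rd_inner d \<eta> x))" .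
    have fub: "integrable (?M \<Otimes>\<^sub>M ?M) (\<lambda>(x, \<omega>). g' \<omega> * iexp (Rd_inner d \<omega> x) * (G x * iexp (Rd_inner d \<eta> x)))"
    proof (rule Bochner_Integration.integrable_bound[OF integrable_mult_pair[OF Gi g'i]])
      have [measurable]: "(\<lambda>p. Rd_inner d (snd p) (fst p)) \<in> borel_measurable (?M \<Otimes>\<^sub>M ?M)"
        unfolding Rd_inner_def by measurable
      have [measurable]: "(\<lambda>p. Rd_inner d \<eta> (fst p)) \<in> borel_measurable (?M \<Otimes>\<^sub>M ?M)"
        unfolding Rd_inner_def by measurable
      note [measurable] = Gm
      show "(\<lambda>(x, \<omega>). g' \<omega> * iexp (Rd_inner d \<omega> x) * (G x * iexp (Rd_inner d \<eta> x))) \<in> borel_measurable (?M \<Otimes>\<^sub>M ?M)"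
        unfolding split_beta' by measurable
    qed (auto simp: norm_mult mult.commute)
    have "(LINT x|?M. F x * G x * iexp (Rd_inner d \<eta> x)) =
        (LINT x|?M. (LINT \<omega>|?M. g' \<omega> * iexp (Rd_inner d \<omega> x) * (G x * iexp (Rd_inner d \<eta> x))))"
      unfolding F_def fourier_inverse_def integral_mult_left_zero by (simp only: mult.assoc)
    also have "\<dots> = (LINT \<omega>|?M. (LINT x|?M. g' \<omega> * iexp (Rd_inner d \<omega> x) * (G x * iexp (Rd_inner d \<eta> x))))"
      using Fubini_integral[OF fub] by simp
    also have "\<dots> = (LINT \<omega>|?M. complex_of_real (sqrt (2 * pi) ^ d) * (g' \<omega> * gauss_fun d ?\<eta> \<omega>))"
    proof (intro Bochner_Integration.integral_cong refl)
      fix \<omega>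
      \<comment> \<open>The two phases combine to one at \<omega> + \<eta>, and the Gaussian
        integral over x reproduces the test Gaussian centred at -\<eta>.\<close>
      have "g' \<omega> * iexp (Rd_inner d \<omega> x) * (G x * iexp (Rd_inner d \<eta> x)) =
          g' \<omega> * (G x * iexp (Rd_inner d (\<lambda>i. \<omega> i + \<eta> i) x))" for x
        by (simp add: Rd_inner_def distrib_right sum.distrib exp_add ring_distribs)
      then have "(LINT x|?M. g' \<omega> * iexp (Rd_inner d \<omega> x) * (G x * iexp (Rd_inner d \<eta> x))) =
          g' \<omega> * (LINT x|?M. G x * iexp (Rd_inner d (\<lambda>i. \<omega> i + \<eta> i) x))"
        by (simp only: integral_mult_right_zero)
      also have "(LINT x|?M. G x * iexp (Rd_inner d (\<lambda>i. \<omega> i + \<eta> i) x)) =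
          complex_of_real (sqrt (2 * pi) ^ d) * gauss_fun d ?\<eta> \<omega>"
        unfolding G_def gauss_fun_fourier by (simp add: gauss_fun_eq Rd_inner_def)
      finally show "(LINT x|?M. g' \<omega> * iexp (Rd_inner d \<omega> x) * (G x * iexp (Rd_inner d \<eta> x))) =
          complex_of_real (sqrt (2 * pi) ^ d) * (g' \<omega> * gauss_fun d ?\<eta> \<omega>)"
        by (simp only: mult.left_commute)
    qed
    also have "\<dots> = complex_of_real (sqrt (2 * pi) ^ d) * (LINT \<omega>|?M. g' \<omega> * gauss_fun d ?\<eta> \<omega>)"
      by (rule integral_mult_right_zero)
    finally have "(LINT x|?M. F x * G x * iexp (Rd_inner d \<eta> x)) =
        complex_of_real (K * sqrt (2 * pi) ^ d) * (LINT x|?M. complex_of_real (h x) * iexp (Rd_inner d \<eta> x))"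
      unfolding 1 by (simp add: mult_ac)
    then have 2: "(LINT x|?M. F x * G x * iexp (Rd_inner d \<eta> x)) = (LINT x|?M. complex_of_real (h x) * iexp (Rd_inner d \<eta> x))"
      unfolding K by simp
    have i1: "integrable ?M (\<lambda>x. complex_of_real (h x) * iexp (Rd_inner d \<eta> x))"
      by (rule Bochner_Integration.integrable_bound[OF hi]) (use hm in \<open>auto simp: norm_mult\<close>)
    have i2: "integrable ?M (\<lambda>x. F x * G x * iexp (Rd_inner d \<eta> x))"
    proof (rule Bochner_Integration.integrable_bound[OF FG])
      show "(\<lambda>x. F x * G x * iexp (Rd_inner d \<eta> x)) \<in> borel_measurable ?M" using Gm by measurable
    qed (auto simp: norm_mult)
    show ?thesis
      unfolding c_def left_diff_distrib Bochner_Integration.integral_diff[OF i1 i2] using 2 by simp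
  qed
  have cB: "(LINT x|?M. c x * (\<Prod>i\<in>{..<d}. indicator (B i) (x i))) = 0"
    if B: "\<And>i. i \<in> {..<d} \<Longrightarrow> B i \<in> sets borel" for B
  proof (rule integral_prod_indicator_zero[where U = "range (\<lambda>\<zeta> t. iexp (\<zeta> * t))" and ?u0.0 = "\<lambda>t. iexp (0 * t)"])
    show "integrable ?M c" by (rule ci)
    show "(\<lambda>t. iexp (0 * t)) \<in> range (\<lambda>\<zeta> t. iexp (\<zeta> * t))" by blast
    show "u \<in> borel_measurable borel" if "u \<in> range (\<lambda>\<zeta> t. iexp (\<zeta> * t))" for u using that by auto
    show "cmod (u t) \<le> 1" if "u \<in> range (\<lambda>\<zeta> t. iexp (\<zeta> * t))" for u t using that by auto
    show "(LINT x|?M. indicator B (X x) *\<^sub>R f x) = 0"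
      if "integrable ?M f" "X \<in> borel_measurable ?M"
        "\<And>u. u \<in> range (\<lambda>\<zeta> t. iexp (\<zeta> * t)) \<Longrightarrow> (LINT x|?M. f x * u (X x)) = 0" "B \<in> sets borel"
      for f :: "(nat \<Rightarrow> real) \<Rightarrow> complex" and X B
      by (rule integral_indicator_zero_of_fourier[OF that(1,2) _ that(4)]) (use that(3) in blast)
    fix u :: "nat \<Rightarrow> real \<Rightarrow> complex" assume u: "\<And>i. i \<in> {..<d} \<Longrightarrow> u i \<in> range (\<lambda>\<zeta> t. iexp (\<zeta> * t))"
    then have "\<forall>i\<in>{..<d}. \<exists>\<zeta>. u i = (\<lambda>t. iexp (\<zeta> * t))" by blast
    then obtain \<zeta> where \<zeta>: "\<forall>i\<in>{..<d}. u i = (\<lambda>t. iexp (\<zeta> i * t))"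
      by (rule bchoice[THEN exE])
    have "(\<Prod>i\<in>{..<d}. u i (x i)) = iexp (Rd_inner d \<zeta> x)" for x
      unfolding iexp_Rd_inner using \<zeta> by (intro prod.cong) auto
    then show "(LINT x|?M. c x * (\<Prod>i\<in>{..<d}. u i (x i))) = 0" using key by simp
  qed (use B in auto)
  have "AE x in ?M. Re (c x) = 0"
  proof (rule AE_zero_PiM)
    show "integrable ?M (\<lambda>x. Re (c x))" using ci by (rule integrable_Re)
    fix B :: "nat \<Rightarrow> real set" assume B: "\<And>i. i \<in> {..<d} \<Longrightarrow> B i \<in> sets borel"
    have mB: "(\<lambda>x. indicator (B i) (x i) :: complex) \<in> borel_measurable ?M" if "i \<in> {..<d}" for i
      using that B[OF that] by measurable
    have int: "integrable ?M (\<lambda>x. c x * (\<Prod>i\<in>{..<d}. indicator (B i) (x i)))"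
    proof (rule Bochner_Integration.integrable_bound[OF ci])
      show "(\<lambda>x. c x * (\<Prod>i\<in>{..<d}. indicator (B i) (x i))) \<in> borel_measurable ?M"
        using ci mB by (intro borel_measurable_times borel_measurable_prod) auto
      have "norm (\<Prod>i\<in>{..<d}. indicator (B i) (x i) :: complex) \<le> 1" for x
        unfolding prod_norm[symmetric] by (intro prod_le_1) (auto simp: indicator_def)
      then show "AE x in ?M. norm (c x * (\<Prod>i\<in>{..<d}. indicator (B i) (x i))) \<le> norm (c x)"
        by (auto simp: norm_mult intro!: mult_left_le)
    qed
    have ind: "(\<Prod>i\<in>{..<d}. indicator (B i) (x i)) = complex_of_real (\<Prod>i\<in>{..<d}. indicator (B i) (x i))" for x
      by (simp add: indicator_def of_bool_def if_distrib cong: if_cong)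
    have "0 = Re (LINT x|?M. c x * (\<Prod>i\<in>{..<d}. indicator (B i) (x i)))" using cB[OF B] by simp
    also have "\<dots> = (LINT x|?M. Re (c x * (\<Prod>i\<in>{..<d}. indicator (B i) (x i))))"
      by (rule integral_Re[OF int, symmetric])
    also have "\<dots> = (LINT x|?M. Re (c x) * (\<Prod>i\<in>{..<d}. indicator (B i) (x i)))"
      unfolding ind by (intro Bochner_Integration.integral_cong refl) (simp only: times_complex.sel Re_complex_of_real Im_complex_of_real mult_zero_right diff_zero)
    finally show "(LINT x|?M. Re (c x) * (\<Prod>i\<in>{..<d}. indicator (B i) (x i))) = 0" by simp
  qed simp
  with hae have "AE x in ?M. f x = Re (F x)"
  proof eventually_elim
    case (elim x)
    then have "f x * Gr x = Re (F x) * Gr x" by (simp add: c_def GGr)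
    then show ?case using Gr_pos[of x] by simp
  qed
  then have "AE x in ?L. f x = Re (F x)" unfolding L by (rule AE_completion)
  with g'm g'ae show ?thesis unfolding F_def by (rule that)
qed

section \<open>Stratified sampling\<close>

text \<open>The noise around the mean is orthogonal to the constant \<open>s\<close>, so the squares
  add up, and the variance is at most the second moment about any \<open>y\<close>. Later
  \<open>y\<close> is the value at a point of a cell, which avoids working with cell
  averages.\<close>

lemma (in prob_space) second_moment_decomposition:
  fixes f :: "'a \<Rightarrow> real"
  assumes f: "f \<in> borel_measurable M" and b: "\<And>z. z \<in> space M \<Longrightarrow> \<bar>f z\<bar> \<le> K"
  shows "(LINT z|M. (s + c * (f z - (LINT z|M. f z)))\<^sup>2) \<le> s\<^sup>2 + c\<^sup>2 * (LINT z|M. (f z - y)\<^sup>2)"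
proof -
  have i1: "integrable M f" by (rule integrable_const_bound[where B = K]) (use f b in auto)
  have i2: "integrable M (\<lambda>z. (f z)\<^sup>2)"
  proof (rule integrable_const_bound[where B = "K\<^sup>2"])
    show "AE z in M. norm ((f z)\<^sup>2) \<le> K\<^sup>2"
      using b power_mono[of "\<bar>f z\<bar>" K 2 for z] by (intro AE_I2) auto
  qed (use f in auto)
  define T where "T = (LINT z|M. f z)"
  define E where "E = (LINT z|M. (f z)\<^sup>2)"
  have "(\<lambda>z. (s + c * (f z - T))\<^sup>2) = (\<lambda>z. (s - c * T)\<^sup>2 + 2 * c * (s - c * T) * f z + c\<^sup>2 * (f z)\<^sup>2)"
    by (auto simp: power2_eq_square algebra_simps)
  then have 1: "(LINT z|M. (s + c * (f z - T))\<^sup>2) = (s - c * T)\<^sup>2 + 2 * c * (s - c * T) * T + c\<^sup>2 * E"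
    using i1 i2 by (simp add: T_def E_def prob_space)
  have "(\<lambda>z. (f z - y)\<^sup>2) = (\<lambda>z. (f z)\<^sup>2 - 2 * y * f z + y\<^sup>2)"
    by (auto simp: power2_eq_square algebra_simps)
  then have 2: "(LINT z|M. (f z - y)\<^sup>2) = E - 2 * y * T + y\<^sup>2"
    using i1 i2 by (simp add: T_def E_def prob_space)
  have "s\<^sup>2 + c\<^sup>2 * (E - 2 * y * T + y\<^sup>2) - ((s - c * T)\<^sup>2 + 2 * c * (s - c * T) * T + c\<^sup>2 * E) = (c * (T - y))\<^sup>2"
    by (simp add: power2_eq_square algebra_simps)
  then show ?thesis unfolding T_def[symmetric] 1 2 using zero_le_power2[of "c * (T - y)"] by linarith
qed

lemma (in pair_sigma_finite) integrable_bounded_pair: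
  fixes f :: "'a \<times> 'b \<Rightarrow> real"
  assumes "finite_measure M1" "finite_measure M2" "f \<in> borel_measurable (M1 \<Otimes>\<^sub>M M2)"
    and "\<And>z x. z \<in> space M1 \<Longrightarrow> x \<in> space M2 \<Longrightarrow> \<bar>f (z, x)\<bar> \<le> B"
  shows "integrable (M1 \<Otimes>\<^sub>M M2) f"
proof -
  interpret finite_measure "M1 \<Otimes>\<^sub>M M2" by (rule finite_measure_pair_measure[OF assms(2,1)])
  show ?thesis
    by (rule integrable_const_bound[where B = B]) (use assms(3,4) in \<open>auto simp: space_pair_measure\<close>)
qed

lemma abs_sum4_power2_le:
  fixes a b c d :: real
  assumes "\<bar>a\<bar> \<le> A" "\<bar>b\<bar> \<le> B"
  shows "\<bar>(a + c * b)\<^sup>2\<bar> \<le> (A + \<bar>c\<bar> * B)\<^sup>2"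
proof -
  have "\<bar>a + c * b\<bar> \<le> \<bar>a\<bar> + \<bar>c\<bar> * \<bar>b\<bar>" by (metis abs_mult abs_triangle_ineq)
  also have "\<dots> \<le> A + \<bar>c\<bar> * B" using assms by (intro add_mono mult_left_mono) auto
  finally have "\<bar>a + c * b\<bar>\<^sup>2 \<le> (A + \<bar>c\<bar> * B)\<^sup>2" by (intro power_mono) auto
  then show ?thesis by simp
qed

text \<open>The sampling is derandomised greedily, one neuron at a time: some sample is at least as good
  as the average one.\<close>

lemma sampling_step:
  fixes \<Phi> :: "'i \<Rightarrow> 'z \<Rightarrow> 'x \<Rightarrow> real"
  assumes P: "prob_space P" and X: "finite_measure X" and A: "finite A"
    and meas: "\<And>\<alpha>. \<alpha> \<in> A \<Longrightarrow> (\<lambda>(z, x). \<Phi> \<alpha> z x) \<in> borel_measurable (P \<Otimes>\<^sub>M X)"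
    and bound: "\<And>\<alpha> z x. \<alpha> \<in> A \<Longrightarrow> z \<in> space P \<Longrightarrow> x \<in> space X \<Longrightarrow> \<bar>\<Phi> \<alpha> z x\<bar> \<le> K"
    and S: "\<And>\<alpha>. \<alpha> \<in> A \<Longrightarrow> S \<alpha> \<in> borel_measurable X" "\<And>\<alpha> x. \<alpha> \<in> A \<Longrightarrow> x \<in> space X \<Longrightarrow> \<bar>S \<alpha> x\<bar> \<le> KS"
    and cen: "\<And>\<alpha>. \<alpha> \<in> A \<Longrightarrow> cen \<alpha> \<in> borel_measurable X" "\<And>\<alpha> x. \<alpha> \<in> A \<Longrightarrow> x \<in> space X \<Longrightarrow> \<bar>cen \<alpha> x\<bar> \<le> KC"
    and V: "AE z in P. (\<Sum>\<alpha>\<in>A. LINT x|X. (\<Phi> \<alpha> z x - cen \<alpha> x)\<^sup>2) \<le> V"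
    and good: "AE z in P. good z"
  shows "\<exists>z\<in>space P. good z \<and>
    (\<Sum>\<alpha>\<in>A. LINT x|X. (S \<alpha> x + c * (\<Phi> \<alpha> z x - (LINT z|P. \<Phi> \<alpha> z x)))\<^sup>2) \<le>
    (\<Sum>\<alpha>\<in>A. LINT x|X. (S \<alpha> x)\<^sup>2) + c\<^sup>2 * V"
proof -
  interpret P: prob_space P by (rule P)
  interpret X: finite_measure X by (rule X)
  interpret PX: pair_sigma_finite P X ..
  define T where "T \<alpha> x = (LINT z|P. \<Phi> \<alpha> z x)" for \<alpha> x
  have mz: "(\<lambda>z. \<Phi> \<alpha> z x) \<in> borel_measurable P" if "\<alpha> \<in> A" "x \<in> space X" for \<alpha> x
    using measurable_Pair1[OF meas[OF that(1)] that(2)] by simp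
  have Tm: "T \<alpha> \<in> borel_measurable X" if "\<alpha> \<in> A" for \<alpha>
  proof -
    have "(\<lambda>(x, z). \<Phi> \<alpha> z x) \<in> borel_measurable (X \<Otimes>\<^sub>M P)"
      using measurable_compose[OF measurable_pair_swap' meas[OF that]] by (simp add: split_beta')
    then show ?thesis unfolding T_def by (rule P.borel_measurable_lebesgue_integral)
  qed
  have Tb: "\<bar>T \<alpha> x\<bar> \<le> K" if "\<alpha> \<in> A" "x \<in> space X" for \<alpha> x
  proof -
    have i: "integrable P (\<lambda>z. \<Phi> \<alpha> z x)"
      by (rule P.integrable_const_bound[where B = K]) (use mz[OF that] bound[OF that(1) _ that(2)] in auto)
    have "\<Phi> \<alpha> z x \<le> K" "- K \<le> \<Phi> \<alpha> z x" if "z \<in> space P" for z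
      using bound[of \<alpha> z x] \<open>\<alpha> \<in> A\<close> \<open>x \<in> space X\<close> that by auto
    then show ?thesis
      using P.integral_le_const[OF i, of K] P.integral_ge_const[OF i, of "- K"] by (auto simp: T_def abs_le_iff)
  qed
  define R where "R = (\<Sum>\<alpha>\<in>A. LINT x|X. (S \<alpha> x)\<^sup>2) + c\<^sup>2 * V"
  define Q where "Q \<alpha> z x = (S \<alpha> x + c * (\<Phi> \<alpha> z x - T \<alpha> x))\<^sup>2" for \<alpha> z x
  define W where "W \<alpha> z x = (\<Phi> \<alpha> z x - cen \<alpha> x)\<^sup>2" for \<alpha> z x
  have Qi: "integrable (P \<Otimes>\<^sub>M X) (\<lambda>(z, x). Q \<alpha> z x)" if \<alpha>: "\<alpha> \<in> A" for \<alpha>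
  proof (rule PX.integrable_bounded_pair[OF P.finite_measure_axioms X])
    note [measurable] = meas[OF \<alpha>] S(1)[OF \<alpha>] Tm[OF \<alpha>]
    show "(\<lambda>(z, x). Q \<alpha> z x) \<in> borel_measurable (P \<Otimes>\<^sub>M X)" unfolding Q_def by measurable
    fix z x assume "z \<in> space P" "x \<in> space X"
    then have "\<bar>\<Phi> \<alpha> z x - T \<alpha> x\<bar> \<le> K + K" "\<bar>S \<alpha> x\<bar> \<le> KS"
      using bound[OF \<alpha>] Tb[OF \<alpha>] S(2)[OF \<alpha>] abs_triangle_ineq4[of "\<Phi> \<alpha> z x" "T \<alpha> x"] by (force, auto)
    from abs_sum4_power2_le[OF this(2,1), of c]
    show "\<bar>case (z, x) of (z, x) \<Rightarrow> Q \<alpha> z x\<bar> \<le> (KS + \<bar>c\<bar> * (K + K))\<^sup>2"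
      by (simp add: Q_def)
  qed
  have Wi: "integrable (P \<Otimes>\<^sub>M X) (\<lambda>(z, x). W \<alpha> z x)" if \<alpha>: "\<alpha> \<in> A" for \<alpha>
  proof (rule PX.integrable_bounded_pair[OF P.finite_measure_axioms X])
    note [measurable] = meas[OF \<alpha>] cen(1)[OF \<alpha>]
    show "(\<lambda>(z, x). W \<alpha> z x) \<in> borel_measurable (P \<Otimes>\<^sub>M X)" unfolding W_def by measurable
    fix z x assume "z \<in> space P" "x \<in> space X"
    then have "\<bar>\<Phi> \<alpha> z x\<bar> \<le> K" "\<bar>cen \<alpha> x\<bar> \<le> KC"
      using bound[OF \<alpha>] cen(2)[OF \<alpha>] by auto
    from abs_sum4_power2_le[OF this, of "-1"]
    show "\<bar>case (z, x) of (z, x) \<Rightarrow> W \<alpha> z x\<bar> \<le> (K + 1 * KC)\<^sup>2"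
      by (simp add: W_def)
  qed
  have QP: "integrable P (\<lambda>z. LINT x|X. Q \<alpha> z x)" and WP: "integrable P (\<lambda>z. LINT x|X. W \<alpha> z x)"
    and SX: "integrable X (\<lambda>x. (S \<alpha> x)\<^sup>2)" if "\<alpha> \<in> A" for \<alpha>
  proof -
    show "integrable P (\<lambda>z. LINT x|X. Q \<alpha> z x)" using PX.integrable_fst'[OF Qi[OF that]] by simp
    show "integrable P (\<lambda>z. LINT x|X. W \<alpha> z x)" using PX.integrable_fst'[OF Wi[OF that]] by simp
    show "integrable X (\<lambda>x. (S \<alpha> x)\<^sup>2)"
    proof (rule X.integrable_const_bound[where B = "KS\<^sup>2"])
      show "AE x in X. norm ((S \<alpha> x)\<^sup>2) \<le> KS\<^sup>2"
        using S(2)[OF that] power_mono[of "\<bar>S \<alpha> x\<bar>" KS 2 for x] by (intro AE_I2) auto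
    qed (use S(1)[OF that] in auto)
  qed
  \<comment> \<open>The moment inequality is applied at each fixed x; then the integrals over x and
    over the parameter are exchanged.\<close>
  have le: "(LINT z|P. (LINT x|X. Q \<alpha> z x)) \<le> (LINT x|X. (S \<alpha> x)\<^sup>2) + c\<^sup>2 * (LINT z|P. (LINT x|X. W \<alpha> z x))"
    if \<alpha>: "\<alpha> \<in> A" for \<alpha>
  proof -
    have Wx: "integrable X (\<lambda>x. LINT z|P. W \<alpha> z x)"
      using PX.integrable_snd[of "\<lambda>z x. W \<alpha> z x"] Wi[OF \<alpha>] by simp
    have "(LINT z|P. (LINT x|X. Q \<alpha> z x)) = (LINT x|X. (LINT z|P. Q \<alpha> z x))"
      using PX.Fubini_integral[OF Qi[OF \<alpha>]] by simp
    also have "\<dots> \<le> (LINT x|X. (S \<alpha> x)\<^sup>2 + c\<^sup>2 * (LINT z|P. W \<alpha> z x))"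
    proof (rule integral_mono)
      show "integrable X (\<lambda>x. LINT z|P. Q \<alpha> z x)"
        using PX.integrable_snd[of "\<lambda>z x. Q \<alpha> z x"] Qi[OF \<alpha>] by simp
      show "integrable X (\<lambda>x. (S \<alpha> x)\<^sup>2 + c\<^sup>2 * (LINT z|P. W \<alpha> z x))"
        using SX[OF \<alpha>] Wx by simp
      fix x assume "x \<in> space X"
      then show "(LINT z|P. Q \<alpha> z x) \<le> (S \<alpha> x)\<^sup>2 + c\<^sup>2 * (LINT z|P. W \<alpha> z x)"
        unfolding Q_def W_def T_def using bound[OF \<alpha>] mz[OF \<alpha>]
        by (intro P.second_moment_decomposition) auto
    qed
    also have "\<dots> = (LINT x|X. (S \<alpha> x)\<^sup>2) + c\<^sup>2 * (LINT x|X. (LINT z|P. W \<alpha> z x))"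
      using SX[OF \<alpha>] Wx by simp
    also have "(LINT x|X. (LINT z|P. W \<alpha> z x)) = (LINT z|P. (LINT x|X. W \<alpha> z x))"
      using PX.Fubini_integral[OF Wi[OF \<alpha>]] by simp
    finally show ?thesis .
  qed
  define q where "q z = (\<Sum>\<alpha>\<in>A. LINT x|X. Q \<alpha> z x)" for z
  have qi: "integrable P q" unfolding q_def using QP by (intro Bochner_Integration.integrable_sum)
  have "(LINT z|P. q z) = (\<Sum>\<alpha>\<in>A. LINT z|P. (LINT x|X. Q \<alpha> z x))"
    unfolding q_def using QP by (intro Bochner_Integration.integral_sum)
  also have "\<dots> \<le> (\<Sum>\<alpha>\<in>A. (LINT x|X. (S \<alpha> x)\<^sup>2) + c\<^sup>2 * (LINT z|P. (LINT x|X. W \<alpha> z x)))"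
    by (intro sum_mono le)
  also have "\<dots> = (\<Sum>\<alpha>\<in>A. LINT x|X. (S \<alpha> x)\<^sup>2) + c\<^sup>2 * (LINT z|P. (\<Sum>\<alpha>\<in>A. LINT x|X. W \<alpha> z x))"
    using WP by (subst Bochner_Integration.integral_sum) (auto simp: sum.distrib sum_distrib_left)
  also have "\<dots> \<le> R"
  proof -
    have "(LINT z|P. (\<Sum>\<alpha>\<in>A. LINT x|X. W \<alpha> z x)) \<le> (LINT z|P. V)"
      using V WP by (intro integral_mono_AE) (auto simp: W_def)
    then show ?thesis unfolding R_def by (auto simp: P.prob_space intro!: mult_left_mono)
  qed
  finally have EQ: "(LINT z|P. q z) \<le> R" .
  show ?thesis
  proof (rule ccontr)
    \<comment> \<open>Otherwise \<open>q\<close> exceeds \<open>R\<close> almost everywhere although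
      its mean is at most \<open>R\<close>. Goodness can be demanded in addition because it fails
      only on a null set.\<close>
    assume neg: "\<not> ?thesis"
    have gt: "AE z in P. R < q z"
      using good AE_space
    proof eventually_elim
      case (elim z)
      with neg show ?case by (auto simp: R_def q_def Q_def T_def not_le)
    qed
    have i: "integrable P (\<lambda>z. q z - R)" using qi by simp
    have nn: "AE z in P. 0 \<le> q z - R" using gt by eventually_elim simp
    have "(LINT z|P. q z - R) = 0"
      using EQ qi integral_nonneg_AE[OF nn] by (simp add: P.prob_space)
    then have "AE z in P. q z - R = 0" using integral_nonneg_eq_0_iff_AE[OF i nn] by simp
    with gt have "AE z in P. False" by eventually_elim simp
    then show False using P.ae_filter_bot by (simp add: eventually_False)
  qed
qed

text \<open>\<open>S\<close> is the error accumulated by the neurons already chosen. Each new term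
  is centred, so on average it adds no more than its own second moment, and the squared errors add
  up as for independent samples.\<close>

lemma sampling_greedy:
  fixes \<Phi> :: "'i \<Rightarrow> 'z \<Rightarrow> 'x \<Rightarrow> real" and P :: "'j \<Rightarrow> 'z measure"
  assumes I: "finite I" and P: "\<And>i. i \<in> I \<Longrightarrow> prob_space (P i)" and X: "finite_measure X" and A: "finite A"
    and meas: "\<And>i \<alpha>. i \<in> I \<Longrightarrow> \<alpha> \<in> A \<Longrightarrow> (\<lambda>(z, x). \<Phi> \<alpha> z x) \<in> borel_measurable (P i \<Otimes>\<^sub>M X)"
    and bound: "\<And>i \<alpha> z x. i \<in> I \<Longrightarrow> \<alpha> \<in> A \<Longrightarrow> z \<in> space (P i) \<Longrightarrow> x \<in> space X \<Longrightarrow> \<bar>\<Phi> \<alpha> z x\<bar> \<le> K"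
    and cen: "\<And>i \<alpha>. i \<in> I \<Longrightarrow> \<alpha> \<in> A \<Longrightarrow> cen i \<alpha> \<in> borel_measurable X"
      "\<And>i \<alpha> x. i \<in> I \<Longrightarrow> \<alpha> \<in> A \<Longrightarrow> x \<in> space X \<Longrightarrow> \<bar>cen i \<alpha> x\<bar> \<le> KC"
    and V: "\<And>i. i \<in> I \<Longrightarrow> AE z in P i. (\<Sum>\<alpha>\<in>A. LINT x|X. (\<Phi> \<alpha> z x - cen i \<alpha> x)\<^sup>2) \<le> V i"
    and good: "\<And>i. i \<in> I \<Longrightarrow> AE z in P i. good z"
  shows "\<exists>z. (\<forall>i\<in>I. z i \<in> space (P i) \<and> good (z i)) \<and>
    (\<Sum>\<alpha>\<in>A. LINT x|X. (\<Sum>i\<in>I. c i * (\<Phi> \<alpha> (z i) x - (LINT z|P i. \<Phi> \<alpha> z x)))\<^sup>2) \<le> (\<Sum>i\<in>I. (c i)\<^sup>2 * V i)"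
  using I P meas bound cen V good
proof (induction I rule: finite_induct)
  case empty
  then show ?case by simp
next
  case (insert j I)
  interpret X: finite_measure X by (rule X)
  have "\<exists>z. (\<forall>i\<in>I. z i \<in> space (P i) \<and> good (z i)) \<and>
    (\<Sum>\<alpha>\<in>A. LINT x|X. (\<Sum>i\<in>I. c i * (\<Phi> \<alpha> (z i) x - (LINT z|P i. \<Phi> \<alpha> z x)))\<^sup>2) \<le> (\<Sum>i\<in>I. (c i)\<^sup>2 * V i)"
  proof (rule insert.IH)
    show "\<bar>\<Phi> \<alpha> z x\<bar> \<le> K" if "i \<in> I" "\<alpha> \<in> A" "z \<in> space (P i)" "x \<in> space X" for i \<alpha> z x
      by (rule insert.prems(3)) (use that in auto)
  qed (use insert.prems in auto)
  then obtain z where z: "\<And>i. i \<in> I \<Longrightarrow> z i \<in> space (P i) \<and> good (z i)"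
    "(\<Sum>\<alpha>\<in>A. LINT x|X. (\<Sum>i\<in>I. c i * (\<Phi> \<alpha> (z i) x - (LINT z|P i. \<Phi> \<alpha> z x)))\<^sup>2) \<le> (\<Sum>i\<in>I. (c i)\<^sup>2 * V i)"
    by blast
  define S where "S \<alpha> x = (\<Sum>i\<in>I. c i * (\<Phi> \<alpha> (z i) x - (LINT z|P i. \<Phi> \<alpha> z x)))" for \<alpha> x
  have Tm: "(\<lambda>x. LINT z|P i. \<Phi> \<alpha> z x) \<in> borel_measurable X" if "i \<in> I" "\<alpha> \<in> A" for i \<alpha>
  proof -
    interpret Pi: prob_space "P i" using insert.prems(1)[of i] that by simp
    have "(\<lambda>(x, z). \<Phi> \<alpha> z x) \<in> borel_measurable (X \<Otimes>\<^sub>M P i)"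
      using measurable_compose[OF measurable_pair_swap' insert.prems(2)[of i \<alpha>]] that by (simp add: split_beta')
    then show ?thesis by (rule Pi.borel_measurable_lebesgue_integral)
  qed
  have Tb: "\<bar>LINT z|P i. \<Phi> \<alpha> z x\<bar> \<le> K" if i: "i \<in> I" and \<alpha>: "\<alpha> \<in> A" and x: "x \<in> space X" for i \<alpha> x
  proof -
    interpret Pi: prob_space "P i" using insert.prems(1)[of i] i by simp
    have m: "(\<lambda>z. \<Phi> \<alpha> z x) \<in> borel_measurable (P i)"
      using measurable_Pair1[OF insert.prems(2)[of i \<alpha>] x] i \<alpha> by simp
    have b: "\<bar>\<Phi> \<alpha> z x\<bar> \<le> K" if "z \<in> space (P i)" for z using insert.prems(3)[of i \<alpha> z x] i \<alpha> x that by simp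
    have int: "integrable (P i) (\<lambda>z. \<Phi> \<alpha> z x)"
      by (rule Pi.integrable_const_bound[where B = K]) (use m b in auto)
    have "\<Phi> \<alpha> z x \<le> K" "- K \<le> \<Phi> \<alpha> z x" if "z \<in> space (P i)" for z
      using b[OF that] by auto
    then show ?thesis
      using Pi.integral_le_const[OF int, of K] Pi.integral_ge_const[OF int, of "- K"] by (auto simp: abs_le_iff)
  qed
  have "\<exists>y\<in>space (P j). good y \<and>
    (\<Sum>\<alpha>\<in>A. LINT x|X. (S \<alpha> x + c j * (\<Phi> \<alpha> y x - (LINT z|P j. \<Phi> \<alpha> z x)))\<^sup>2) \<le>
    (\<Sum>\<alpha>\<in>A. LINT x|X. (S \<alpha> x)\<^sup>2) + (c j)\<^sup>2 * V j"
  proof (rule sampling_step[OF _ X A, where K = K and KS = "\<Sum>i\<in>I. \<bar>c i\<bar> * (K + K)" and cen = "cen j" and KC = KC])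
    show "S \<alpha> \<in> borel_measurable X" if \<alpha>: "\<alpha> \<in> A" for \<alpha>
    proof -
      have "(\<lambda>x. \<Phi> \<alpha> (z i) x) \<in> borel_measurable X" if "i \<in> I" for i
        using measurable_Pair2[OF insert.prems(2)[of i \<alpha>], of "z i"] z(1)[OF that] that \<alpha> by simp
      then show ?thesis unfolding S_def using Tm \<alpha> by (intro borel_measurable_sum) auto
    qed
    show "\<bar>S \<alpha> x\<bar> \<le> (\<Sum>i\<in>I. \<bar>c i\<bar> * (K + K))" if "\<alpha> \<in> A" "x \<in> space X" for \<alpha> x
      unfolding S_def
    proof (rule order_trans[OF sum_abs sum_mono])
      fix i assume i: "i \<in> I"
      have "\<bar>\<Phi> \<alpha> (z i) x\<bar> \<le> K" using insert.prems(3)[of i \<alpha> "z i" x] z(1)[OF i] i that by simp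
      then have "\<bar>\<Phi> \<alpha> (z i) x - (LINT z|P i. \<Phi> \<alpha> z x)\<bar> \<le> K + K"
        using Tb[OF i that] by linarith
      then show "\<bar>c i * (\<Phi> \<alpha> (z i) x - (LINT z|P i. \<Phi> \<alpha> z x))\<bar> \<le> \<bar>c i\<bar> * (K + K)"
        by (simp add: abs_mult mult_left_mono)
    qed
    show "\<bar>\<Phi> \<alpha> z x\<bar> \<le> K" if "\<alpha> \<in> A" "z \<in> space (P j)" "x \<in> space X" for \<alpha> z x
      by (rule insert.prems(3)) (use that in auto)
  qed (use insert.prems in auto)
  then obtain y where y: "y \<in> space (P j)" "good y"
    "(\<Sum>\<alpha>\<in>A. LINT x|X. (S \<alpha> x + c j * (\<Phi> \<alpha> y x - (LINT z|P j. \<Phi> \<alpha> z x)))\<^sup>2) \<le>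
      (\<Sum>\<alpha>\<in>A. LINT x|X. (S \<alpha> x)\<^sup>2) + (c j)\<^sup>2 * V j"
    by blast
  have eq: "(\<Sum>i\<in>insert j I. c i * (\<Phi> \<alpha> ((z(j := y)) i) x - (LINT z|P i. \<Phi> \<alpha> z x))) =
      S \<alpha> x + c j * (\<Phi> \<alpha> y x - (LINT z|P j. \<Phi> \<alpha> z x))" for \<alpha> x
  proof -
    have "(\<Sum>i\<in>I. c i * (\<Phi> \<alpha> ((z(j := y)) i) x - (LINT z|P i. \<Phi> \<alpha> z x))) = S \<alpha> x"
      unfolding S_def using insert.hyps by (intro sum.cong) auto
    then show ?thesis using insert.hyps by simp
  qed
  show ?case
  proof (intro exI[of _ "z(j := y)"] conjI ballI)
    show "(z(j := y)) i \<in> space (P i)" "good ((z(j := y)) i)" if "i \<in> insert j I" for i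
      using that y z(1) by auto
    show "(\<Sum>\<alpha>\<in>A. LINT x|X. (\<Sum>i\<in>insert j I. c i * (\<Phi> \<alpha> ((z(j := y)) i) x - (LINT z|P i. \<Phi> \<alpha> z x)))\<^sup>2)
        \<le> (\<Sum>i\<in>insert j I. (c i)\<^sup>2 * V i)"
      unfolding eq using y(3) z(2) insert.hyps by (simp add: S_def)
  qed
qed

text \<open>Each cell of positive mass receives a number of samples proportional to its mass,
  rounded up, from the normalised restriction of \<open>M\<close>. The coefficient of a sample is
  then at most the total mass over n, so the cells enter with their second moments weighted by their
  masses. Rounding costs less than one sample per cell, whence the excess by
  \<open>card J\<close>.\<close>

lemma stratified_sampling:
  fixes \<Phi> :: "'i \<Rightarrow> 'z \<Rightarrow> 'x \<Rightarrow> real" and A :: "'j \<Rightarrow> 'z set"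
  assumes M: "finite_measure M" and X: "finite_measure X" and L: "finite L" and J: "finite J" "J \<noteq> {}"
    and A: "\<And>j. j \<in> J \<Longrightarrow> A j \<in> sets M" "disjoint_family_on A J" "(\<Union>j\<in>J. A j) = space M"
    and meas: "\<And>\<alpha>. \<alpha> \<in> L \<Longrightarrow> (\<lambda>(z, x). \<Phi> \<alpha> z x) \<in> borel_measurable (M \<Otimes>\<^sub>M X)"
    and bound: "\<And>\<alpha> z x. \<alpha> \<in> L \<Longrightarrow> z \<in> space M \<Longrightarrow> x \<in> space X \<Longrightarrow> \<bar>\<Phi> \<alpha> z x\<bar> \<le> K"
    and cen: "\<And>j \<alpha>. j \<in> J \<Longrightarrow> \<alpha> \<in> L \<Longrightarrow> cen j \<alpha> \<in> borel_measurable X"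
      "\<And>j \<alpha> x. j \<in> J \<Longrightarrow> \<alpha> \<in> L \<Longrightarrow> x \<in> space X \<Longrightarrow> \<bar>cen j \<alpha> x\<bar> \<le> KC"
    and V: "\<And>j z. j \<in> J \<Longrightarrow> z \<in> A j \<Longrightarrow> (\<Sum>\<alpha>\<in>L. LINT x|X. (\<Phi> \<alpha> z x - cen j \<alpha> x)\<^sup>2) \<le> V j"
    and V0: "\<And>j. j \<in> J \<Longrightarrow> 0 \<le> V j"
    and good: "AE z in M. good z" and n: "n \<ge> 1"
  obtains I :: "('j \<times> nat) set" and z c where "finite I" "card I + 1 \<le> n + card J"
    "\<And>i. i \<in> I \<Longrightarrow> z i \<in> space M \<and> good (z i)"
    "(\<Sum>\<alpha>\<in>L. LINT x|X. ((LINT z|M. \<Phi> \<alpha> z x) - (\<Sum>i\<in>I. c i * \<Phi> \<alpha> (z i) x))\<^sup>2) \<le>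
      measure M (space M) / real n * (\<Sum>j\<in>J. measure M (A j) * V j)"
proof -
  interpret M: finite_measure M by (rule M)
  define \<Lambda> where "\<Lambda> = measure M (space M)"
  define l where "l j = measure M (A j)" for j
  have l0: "0 \<le> l j" for j by (simp add: l_def)
  have sum_l: "(\<Sum>j\<in>J. l j) = \<Lambda>"
    unfolding l_def \<Lambda>_def A(3)[symmetric]
    by (rule M.finite_measure_finite_Union[symmetric]) (use J A in auto)
  have \<Lambda>0: "0 \<le> \<Lambda>" by (simp add: \<Lambda>_def)
  have mz: "(\<lambda>z. \<Phi> \<alpha> z x) \<in> borel_measurable M" if "\<alpha> \<in> L" "x \<in> space X" for \<alpha> x
    using measurable_Pair1[OF meas[OF that(1)] that(2)] by simp
  have \<Phi>i: "integrable M (\<lambda>z. \<Phi> \<alpha> z x)" if "\<alpha> \<in> L" "x \<in> space X" for \<alpha> x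
    by (rule M.integrable_const_bound[where B = K]) (use mz[OF that] bound[OF that(1) _ that(2)] in auto)
  have \<Phi>ij: "integrable M (\<lambda>z. indicator (A j) z * \<Phi> \<alpha> z x)" if "\<alpha> \<in> L" "x \<in> space X" "j \<in> J" for \<alpha> x j
    using integrable_mult_indicator[OF A(1)[OF that(3)] \<Phi>i[OF that(1,2)]] by simp
  have null: "(LINT z|M. indicator (A j) z * \<Phi> \<alpha> z x) = 0" if "j \<in> J" "l j = 0" for j \<alpha> x
  proof (rule integral_eq_zero_AE)
    have "emeasure M (A j) = 0" using that by (simp add: l_def M.emeasure_eq_measure)
    then have "AE z in M. z \<notin> A j" using A(1)[OF that(1)] by (intro AE_not_in) auto
    then show "AE z in M. indicator (A j) z * \<Phi> \<alpha> z x = 0" by eventually_elim simp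
  qed
  have split: "(LINT z|M. \<Phi> \<alpha> z x) = (\<Sum>j\<in>J. LINT z|M. indicator (A j) z * \<Phi> \<alpha> z x)"
    if "\<alpha> \<in> L" "x \<in> space X" for \<alpha> x
  proof -
    have "(LINT z|M. \<Phi> \<alpha> z x) = (LINT z|M. (\<Sum>j\<in>J. indicator (A j) z * \<Phi> \<alpha> z x))"
    proof (rule Bochner_Integration.integral_cong[OF refl])
      fix z assume "z \<in> space M"
      then have "(\<Sum>j\<in>J. indicator (A j) z) = (1 :: real)"
        using indicator_UN_disjoint[OF J(1) A(2), of z] A(3) by (simp add: indicator_def)
      then show "\<Phi> \<alpha> z x = (\<Sum>j\<in>J. indicator (A j) z * \<Phi> \<alpha> z x)" by (simp flip: sum_distrib_right)
    qed
    also have "\<dots> = (\<Sum>j\<in>J. LINT z|M. indicator (A j) z * \<Phi> \<alpha> z x)"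
      by (rule Bochner_Integration.integral_sum) (rule \<Phi>ij[OF that])
    finally show ?thesis .
  qed
  \<comment> \<open>Null cells cannot be normalised, and they contribute nothing to the
    integral.\<close>
  define J' where "J' = {j \<in> J. l j > 0}"
  have J': "finite J'" "J' \<subseteq> J" using J by (auto simp: J'_def)
  define N where "N j = nat \<lceil>real n * l j / \<Lambda>\<rceil>" for j
  define P where "P j = density M (\<lambda>z. ennreal (indicator (A j) z / l j))" for j
  define I where "I = (SIGMA j:J'. {..<N j})"
  have I: "finite I" unfolding I_def using J' by auto
  have \<Lambda>pos: "\<Lambda> > 0" if "j \<in> J'" for j
  proof -
    have "l j \<le> \<Lambda>" unfolding sum_l[symmetric] using that J' J l0 by (intro member_le_sum) auto
    with that show ?thesis by (simp add: J'_def)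
  qed
  have Nge: "real n * l j / \<Lambda> \<le> real (N j)" for j
    unfolding N_def by (rule real_nat_ceiling_ge)
  have Npos: "real (N j) > 0" if "j \<in> J'" for j
  proof -
    have "0 < real n * l j / \<Lambda>" using that \<Lambda>pos[OF that] n by (auto simp: J'_def)
    with Nge[of j] show ?thesis by linarith
  qed
  have dm: "(\<lambda>z. indicator (A j) z / l j) \<in> borel_measurable M" if "j \<in> J" for j
    using A(1)[OF that] by auto
  have prob: "prob_space (P j)" if "j \<in> J'" for j
  proof (rule prob_spaceI)
    have j: "j \<in> J" "l j > 0" using that by (auto simp: J'_def)
    have "emeasure (P j) (space (P j)) = (\<integral>\<^sup>+z. ennreal (indicator (A j) z / l j) \<partial>M)"
      unfolding P_def using dm[OF j(1)] by (simp add: emeasure_density)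
    also have "\<dots> = ennreal (LINT z|M. indicator (A j) z / l j)"
      using j l0 A(1)[OF j(1)]
      by (intro nn_integral_eq_integral integrable_divide_zero integrable_real_indicator)
         (auto simp: M.emeasure_eq_measure)
    also have "(LINT z|M. indicator (A j) z / l j) = 1"
      using j A(1)[OF j(1)] sets.sets_into_space[OF A(1)[OF j(1)]] by (simp add: l_def Int_absorb2)
    finally show "emeasure (P j) (space (P j)) = 1" by simp
  qed
  have spP: "space (P j) = space M" "sets (P j) = sets M" for j by (simp_all add: P_def)
  have Pint: "(LINT z|P j. \<Phi> \<alpha> z x) = (LINT z|M. indicator (A j) z * \<Phi> \<alpha> z x) / l j"
    if "j \<in> J" "\<alpha> \<in> L" "x \<in> space X" for j \<alpha> x
    unfolding P_def using dm[OF that(1)] mz[OF that(2,3)] l0[of j]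
    by (subst integral_density) (auto simp: field_simps simp flip: integral_divide_zero)
  have AEP: "AE z in P j. z \<in> A j \<and> good z" if "j \<in> J" for j
    unfolding P_def using dm[OF that] good
    by (subst AE_density) (auto elim!: eventually_mono simp: indicator_def split: if_splits)
  have "\<exists>z. (\<forall>i\<in>I. z i \<in> space (P (fst i)) \<and> good (z i)) \<and>
    (\<Sum>\<alpha>\<in>L. LINT x|X. (\<Sum>i\<in>I. l (fst i) / real (N (fst i)) * (\<Phi> \<alpha> (z i) x - (LINT z|P (fst i). \<Phi> \<alpha> z x)))\<^sup>2)
      \<le> (\<Sum>i\<in>I. (l (fst i) / real (N (fst i)))\<^sup>2 * V (fst i))"
  proof (rule sampling_greedy[OF I _ X L, where K = K and KC = KC and cen = "\<lambda>i. cen (fst i)"])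
    fix i assume "i \<in> I"
    then have i: "fst i \<in> J'" "fst i \<in> J" using J' by (auto simp: I_def)
    show "prob_space (P (fst i))" by (rule prob[OF i(1)])
    show "(\<lambda>(z, x). \<Phi> \<alpha> z x) \<in> borel_measurable (P (fst i) \<Otimes>\<^sub>M X)" if "\<alpha> \<in> L" for \<alpha>
      using meas[OF that] measurable_cong_sets[OF sets_pair_measure_cong[OF spP(2) refl] refl] by blast
    show "\<bar>\<Phi> \<alpha> z x\<bar> \<le> K" if "\<alpha> \<in> L" "z \<in> space (P (fst i))" "x \<in> space X" for \<alpha> z x
      using bound that by (simp add: spP)
    show "cen (fst i) \<alpha> \<in> borel_measurable X" if "\<alpha> \<in> L" for \<alpha> by (rule cen(1)[OF i(2) that])
    show "\<bar>cen (fst i) \<alpha> x\<bar> \<le> KC" if "\<alpha> \<in> L" "x \<in> space X" for \<alpha> x by (rule cen(2)[OF i(2) that])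
    show "AE z in P (fst i). (\<Sum>\<alpha>\<in>L. LINT x|X. (\<Phi> \<alpha> z x - cen (fst i) \<alpha> x)\<^sup>2) \<le> V (fst i)"
      using AEP[OF i(2)] by eventually_elim (use V[OF i(2)] in auto)
    show "AE z in P (fst i). good z" using AEP[OF i(2)] by eventually_elim simp
  qed
  then obtain z where z: "\<And>i. i \<in> I \<Longrightarrow> z i \<in> space M \<and> good (z i)" and
    zle: "(\<Sum>\<alpha>\<in>L. LINT x|X. (\<Sum>i\<in>I. l (fst i) / real (N (fst i)) * (\<Phi> \<alpha> (z i) x - (LINT z|P (fst i). \<Phi> \<alpha> z x)))\<^sup>2)
      \<le> (\<Sum>i\<in>I. (l (fst i) / real (N (fst i)))\<^sup>2 * V (fst i))"
    unfolding spP by blast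
  define c where "c i = l (fst i) / real (N (fst i))" for i :: "'j \<times> nat"
  \<comment> \<open>The estimator is unbiased: the weighted conditional means add up to the integral
    over the whole space.\<close>
  have err: "(\<Sum>i\<in>I. l (fst i) / real (N (fst i)) * (\<Phi> \<alpha> (z i) x - (LINT z|P (fst i). \<Phi> \<alpha> z x))) =
      - ((LINT z|M. \<Phi> \<alpha> z x) - (\<Sum>i\<in>I. c i * \<Phi> \<alpha> (z i) x))"
    if "\<alpha> \<in> L" "x \<in> space X" for \<alpha> x
  proof -
    have "(\<Sum>i\<in>I. c i * (LINT z|P (fst i). \<Phi> \<alpha> z x)) = (\<Sum>j\<in>J'. \<Sum>k<N j. l j / real (N j) * (LINT z|P j. \<Phi> \<alpha> z x))"
      unfolding I_def c_def by (subst sum.Sigma) (use J' in \<open>auto simp: split_beta'\<close>)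
    also have "\<dots> = (\<Sum>j\<in>J'. LINT z|M. indicator (A j) z * \<Phi> \<alpha> z x)"
    proof (rule sum.cong[OF refl])
      fix j assume j: "j \<in> J'"
      then have "j \<in> J" "l j > 0" by (auto simp: J'_def)
      then show "(\<Sum>k<N j. l j / real (N j) * (LINT z|P j. \<Phi> \<alpha> z x)) = (LINT z|M. indicator (A j) z * \<Phi> \<alpha> z x)"
        using Npos[OF j] that by (simp add: Pint)
    qed
    also have "\<dots> = (\<Sum>j\<in>J. LINT z|M. indicator (A j) z * \<Phi> \<alpha> z x)"
    proof (rule sum.mono_neutral_left[OF J(1) J'(2)], rule ballI)
      fix j assume "j \<in> J - J'"
      then show "(LINT z|M. indicator (A j) z * \<Phi> \<alpha> z x) = 0" using l0[of j] by (intro null) (auto simp: J'_def)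
    qed
    also have "\<dots> = (LINT z|M. \<Phi> \<alpha> z x)" by (rule split[OF that, symmetric])
    finally have "(\<Sum>i\<in>I. c i * (LINT z|P (fst i). \<Phi> \<alpha> z x)) = (LINT z|M. \<Phi> \<alpha> z x)" .
    then show ?thesis by (simp add: c_def right_diff_distrib sum_subtractf)
  qed
  have "(\<Sum>\<alpha>\<in>L. LINT x|X. ((LINT z|M. \<Phi> \<alpha> z x) - (\<Sum>i\<in>I. c i * \<Phi> \<alpha> (z i) x))\<^sup>2) =
      (\<Sum>\<alpha>\<in>L. LINT x|X. (\<Sum>i\<in>I. l (fst i) / real (N (fst i)) * (\<Phi> \<alpha> (z i) x - (LINT z|P (fst i). \<Phi> \<alpha> z x)))\<^sup>2)"
    by (intro sum.cong refl Bochner_Integration.integral_cong) (simp only: err power2_minus)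
  also note zle
  also have "(\<Sum>i\<in>I. (l (fst i) / real (N (fst i)))\<^sup>2 * V (fst i)) = (\<Sum>j\<in>J'. \<Sum>k<N j. (l j / real (N j))\<^sup>2 * V j)"
    unfolding I_def by (subst sum.Sigma) (use J' in \<open>auto simp: split_beta'\<close>)
  \<comment> \<open>Of the two factors l / N only one is estimated, by the total mass over n; the
    denominator of the other cancels against the number of samples in the cell.\<close>
  also have "\<dots> \<le> (\<Sum>j\<in>J'. \<Lambda> / real n * (l j * V j))"
  proof (rule sum_mono)
    fix j assume j: "j \<in> J'"
    have lj: "l j > 0" "j \<in> J" using j by (auto simp: J'_def)
    have "real n * l j \<le> real (N j) * \<Lambda>"
      using Nge[of j] \<Lambda>pos[OF j] by (simp add: field_simps)
    then have "l j / real (N j) \<le> \<Lambda> / real n"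
      using Npos[OF j] n by (simp add: field_simps)
    then have "(l j / real (N j)) * (l j * V j) \<le> \<Lambda> / real n * (l j * V j)"
      using lj V0[OF lj(2)] by (intro mult_right_mono) auto
    moreover have "(\<Sum>k<N j. (l j / real (N j))\<^sup>2 * V j) = (l j / real (N j)) * (l j * V j)"
      using Npos[OF j] by (simp add: power2_eq_square)
    ultimately show "(\<Sum>k<N j. (l j / real (N j))\<^sup>2 * V j) \<le> \<Lambda> / real n * (l j * V j)" by simp
  qed
  also have "\<dots> \<le> (\<Sum>j\<in>J. \<Lambda> / real n * (l j * V j))"
    using J J' \<Lambda>0 l0 V0 by (intro sum_mono2) auto
  also have "\<dots> = \<Lambda> / real n * (\<Sum>j\<in>J. l j * V j)" by (simp add: sum_distrib_left)
  finally have final: "(\<Sum>\<alpha>\<in>L. LINT x|X. ((LINT z|M. \<Phi> \<alpha> z x) - (\<Sum>i\<in>I. c i * \<Phi> \<alpha> (z i) x))\<^sup>2) \<le>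
      \<Lambda> / real n * (\<Sum>j\<in>J. l j * V j)" .
  have "card I + 1 \<le> n + card J"
  \<comment> \<open>Strict inequality of the sums requires a nonempty index set; without one no
    samples are taken at all.\<close>
  proof (cases "J' = {}")
    case True
    then show ?thesis using n by (simp add: I_def)
  next
    case False
    have "card I = (\<Sum>j\<in>J'. N j)" unfolding I_def using J' by simp
    then have "real (card I) = (\<Sum>j\<in>J'. real (N j))" by simp
    also have "\<dots> < (\<Sum>j\<in>J'. real n * l j / \<Lambda> + 1)"
    proof (rule sum_strict_mono[OF J'(1) False])
      fix j assume "j \<in> J'"
      have "0 \<le> real n * l j / \<Lambda>" using l0 \<Lambda>0 by simp
      then show "real (N j) < real n * l j / \<Lambda> + 1"
        unfolding N_def by linarith
    qed
    also have "\<dots> = real n * (\<Sum>j\<in>J'. l j) / \<Lambda> + real (card J')"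
      by (simp add: sum.distrib sum_distrib_left sum_divide_distrib)
    also have "(\<Sum>j\<in>J'. l j) = \<Lambda>"
      unfolding sum_l[symmetric] using J J' l0 by (intro sum.mono_neutral_left) (auto simp: J'_def not_less order.antisym)
    also have "real n * \<Lambda> / \<Lambda> + real (card J') \<le> real n + real (card J)"
      using card_mono[OF J(1) J'(2)] False \<Lambda>pos by auto
    finally have "card I < n + card J" by linarith
    then show ?thesis by simp
  qed
  then show ?thesis using final z by (intro that[OF I, of z c]) (simp_all add: l_def \<Lambda>_def)
qed

section \<open>Counting lattice points\<close>

lemma sum_geometric_two_sided:
  fixes y :: real
  assumes y: "0 < y" "y < 1"
  shows "(\<Sum>k\<in>{- int B..int B}. y ^ nat \<bar>k\<bar>) \<le> 1 + 2 * (y / (1 - y))"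
proof -
  have geo: "(\<Sum>k<B. y ^ Suc k) \<le> y / (1 - y)"
  proof -
    have "(\<Sum>k<B. y ^ Suc k) = y * ((1 - y ^ B) / (1 - y))"
      using y sum_gp_strict[of y B] by (simp add: sum_distrib_left[symmetric])
    also have "\<dots> \<le> y * (1 / (1 - y))" using y by (intro mult_left_mono divide_right_mono) auto
    finally show ?thesis by simp
  qed
  have "{- int B..int B} = {0} \<union> ((\<lambda>k. int (Suc k)) ` {..<B} \<union> (\<lambda>k. - int (Suc k)) ` {..<B})"
  proof (intro equalityI subsetI)
    fix k assume k: "k \<in> {- int B..int B}"
    consider "k = 0" | "k > 0" | "k < 0" by linarith
    then show "k \<in> {0} \<union> ((\<lambda>k. int (Suc k)) ` {..<B} \<union> (\<lambda>k. - int (Suc k)) ` {..<B})"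
    proof cases
      case 2
      then have "k = int (Suc (nat (k - 1)))" "nat (k - 1) < B" using k by auto
      then show ?thesis by blast
    next
      case 3
      then have "k = - int (Suc (nat (- k - 1)))" "nat (- k - 1) < B" using k by auto
      then show ?thesis by blast
    qed simp
  qed auto
  then have "(\<Sum>k\<in>{- int B..int B}. y ^ nat \<bar>k\<bar>) =
      (\<Sum>k\<in>{0} \<union> ((\<lambda>k. int (Suc k)) ` {..<B} \<union> (\<lambda>k. - int (Suc k)) ` {..<B}). y ^ nat \<bar>k\<bar>)"
    by (rule arg_cong)
  also have "\<dots> = (\<Sum>k\<in>{0::int}. y ^ nat \<bar>k\<bar>) +
      (\<Sum>k\<in>(\<lambda>k. int (Suc k)) ` {..<B} \<union> (\<lambda>k. - int (Suc k)) ` {..<B}. y ^ nat \<bar>k\<bar>)"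
    by (rule sum.union_disjoint) auto
  also have "(\<Sum>k\<in>(\<lambda>k. int (Suc k)) ` {..<B} \<union> (\<lambda>k. - int (Suc k)) ` {..<B}. y ^ nat \<bar>k\<bar>) =
      (\<Sum>k\<in>(\<lambda>k. int (Suc k)) ` {..<B}. y ^ nat \<bar>k\<bar>) + (\<Sum>k\<in>(\<lambda>k. - int (Suc k)) ` {..<B}. y ^ nat \<bar>k\<bar>)"
    by (rule sum.union_disjoint) auto
  also have "(\<Sum>k\<in>(\<lambda>k. int (Suc k)) ` {..<B}. y ^ nat \<bar>k\<bar>) = (\<Sum>k<B. y ^ Suc k)"
    by (subst sum.reindex) (auto simp: inj_on_def nat_add_distrib intro!: sum.cong)
  also have "(\<Sum>k\<in>(\<lambda>k. - int (Suc k)) ` {..<B}. y ^ nat \<bar>k\<bar>) = (\<Sum>k<B. y ^ Suc k)"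
    by (subst sum.reindex) (auto simp: inj_on_def nat_add_distrib intro!: sum.cong)
  finally show ?thesis using geo by simp
qed

text \<open>Weighting a lattice point by \<open>exp (- |k| / \<rho>)\<close> factorises the count over the coordinates,
  which gives a bound of the form \<open>(C \<rho>)^D\<close> with \<open>C\<close> independent of the dimension.\<close>

lemma card_lattice_l1_ball:
  fixes \<rho> :: real and D :: nat
  assumes \<rho>: "\<rho> \<ge> 1"
  defines "E \<equiv> {k \<in> {..<D} \<rightarrow>\<^sub>E (UNIV :: int set). (\<Sum>i<D. \<bar>real_of_int (k i)\<bar>) \<le> real D * (\<rho> + 1)}"
  shows "finite E" "real (card E) \<le> (24 * \<rho>) ^ D"
proof -
  define S where "S = real D * (\<rho> + 1)"
  define B where "B = nat \<lceil>S\<rceil>"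
  \<comment> \<open>The rate 1 / \<rho> is a compromise: the loss exp(S / \<rho>) is then
    exponential in D with a base independent of \<rho>, and each one-dimensional sum is of order
    \<rho>.\<close>
  define y where "y = exp (- (1 / \<rho>))"
  have y: "0 < y" "y < 1" using \<rho> by (auto simp: y_def)
  have sub: "E \<subseteq> {..<D} \<rightarrow>\<^sub>E {- int B..int B}"
  proof
    fix k assume k: "k \<in> E"
    have "k i \<in> {- int B..int B}" if i: "i < D" for i
    proof -
      have "\<bar>real_of_int (k i)\<bar> \<le> (\<Sum>i<D. \<bar>real_of_int (k i)\<bar>)" using i by (intro member_le_sum) auto
      also have "\<dots> \<le> S" using k by (simp add: E_def S_def)
      finally have "\<bar>k i\<bar> \<le> int B" unfolding B_def by linarith
      then show ?thesis by auto
    qed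
    then show "k \<in> {..<D} \<rightarrow>\<^sub>E {- int B..int B}" using k by (auto simp: E_def PiE_def)
  qed
  have fin: "finite ({..<D} \<rightarrow>\<^sub>E {- int B..int B})" by (intro finite_PiE) auto
  then show fE: "finite E" using sub finite_subset by blast
  have yk: "y ^ nat \<bar>k\<bar> = exp (- (\<bar>real_of_int k\<bar> / \<rho>))" for k
    unfolding y_def by (simp add: exp_of_nat_mult[symmetric])
  have "real (card E) = (\<Sum>k\<in>E. 1)" by simp
  also have "\<dots> \<le> (\<Sum>k\<in>E. exp (S / \<rho>) * (\<Prod>i<D. y ^ nat \<bar>k i\<bar>))"
  proof (rule sum_mono)
    fix k assume k: "k \<in> E"
    have "(\<Prod>i<D. y ^ nat \<bar>k i\<bar>) = exp (- ((\<Sum>i<D. \<bar>real_of_int (k i)\<bar>) / \<rho>))"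
      unfolding yk by (simp add: exp_sum[symmetric] sum_negf sum_divide_distrib)
    then have "exp (S / \<rho>) * (\<Prod>i<D. y ^ nat \<bar>k i\<bar>) = exp ((S - (\<Sum>i<D. \<bar>real_of_int (k i)\<bar>)) / \<rho>)"
      by (simp add: exp_add[symmetric] diff_divide_distrib)
    moreover have "0 \<le> (S - (\<Sum>i<D. \<bar>real_of_int (k i)\<bar>)) / \<rho>"
      using k \<rho> by (simp add: E_def S_def)
    ultimately show "1 \<le> exp (S / \<rho>) * (\<Prod>i<D. y ^ nat \<bar>k i\<bar>)" by simp
  qed
  also have "\<dots> \<le> (\<Sum>k\<in>{..<D} \<rightarrow>\<^sub>E {- int B..int B}. exp (S / \<rho>) * (\<Prod>i<D. y ^ nat \<bar>k i\<bar>))"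
    by (intro sum_mono2[OF fin sub] mult_nonneg_nonneg prod_nonneg ballI zero_le_power)
       (simp_all add: less_imp_le[OF y(1)])
  also have "\<dots> = exp (S / \<rho>) * (\<Prod>i<D. \<Sum>k\<in>{- int B..int B}. y ^ nat \<bar>k\<bar>)"
    by (subst prod_sum_PiE) (auto simp: sum_distrib_left)
  also have "\<dots> \<le> 8 ^ D * (3 * \<rho>) ^ D"
  proof (rule mult_mono)
    \<comment> \<open>8 bounds exp 2, since (\<rho> + 1) / \<rho> is at most 2; with the factor 3
      \<rho> per coordinate found below this makes 24 \<rho>.\<close>
    have "exp (S / \<rho>) = exp (real D * ((\<rho> + 1) / \<rho>))" by (simp add: S_def)
    also have "\<dots> = exp ((\<rho> + 1) / \<rho>) ^ D" by (rule exp_of_nat_mult)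
    also have "\<dots> \<le> 8 ^ D"
    proof (rule power_mono)
      have "(\<rho> + 1) / \<rho> \<le> 2" using \<rho> by (simp add: field_simps)
      then have "exp ((\<rho> + 1) / \<rho>) \<le> exp 2" by simp
      also have "exp 2 = exp 1 * exp (1::real)" by (simp flip: exp_add)
      also have "\<dots> \<le> 2.75 * 2.75" 
        using e_less_272 by (intro mult_mono) auto
      finally show "exp ((\<rho> + 1) / \<rho>) \<le> 8" by simp
    qed simp
    finally show "exp (S / \<rho>) \<le> 8 ^ D" .
    have "(\<Sum>k\<in>{- int B..int B}. y ^ nat \<bar>k\<bar>) \<le> 3 * \<rho>"
    proof -
      \<comment> \<open>From 1 + 1 / \<rho> <= exp(1 / \<rho>) the ratio y / (1 - y) is at most
        \<rho>, so the two-sided sum is at most 1 + 2 \<rho> <= 3 \<rho>.\<close>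
      have "1 + 1 / \<rho> \<le> exp (1 / \<rho>)" by (rule exp_ge_add_one_self)
      then have "y * (1 + 1 / \<rho>) \<le> y * exp (1 / \<rho>)" using y by (intro mult_left_mono) auto
      also have "\<dots> = 1" by (simp add: y_def exp_minus)
      finally have "y / \<rho> \<le> 1 - y" by (simp add: algebra_simps)
      then have "y / (1 - y) \<le> \<rho>" using y \<rho> by (simp add: field_simps)
      then show ?thesis using sum_geometric_two_sided[OF y, of B] \<rho> by linarith
    qed
    then show "(\<Prod>i<D. \<Sum>k\<in>{- int B..int B}. y ^ nat \<bar>k\<bar>) \<le> (3 * \<rho>) ^ D"
      unfolding prod_constant card_lessThan using y by (intro power_mono sum_nonneg) auto
  qed (use y \<rho> in \<open>auto intro!: prod_nonneg sum_nonneg zero_le_power\<close>)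
  also have "\<dots> = (24 * \<rho>) ^ D" unfolding power_mult_distrib[symmetric] by simp
  finally show "real (card E) \<le> (24 * \<rho>) ^ D" .
qed

section \<open>Ridge functions\<close>

lemma L2_set_product:
  assumes "finite A" "finite B"
  shows "L2_set (\<lambda>(i, j). f i * g j) (A \<times> B) = L2_set f A * L2_set g B"
proof -
  have "(\<Sum>p\<in>A \<times> B. ((case p of (i, j) \<Rightarrow> f i * g j))\<^sup>2) = (\<Sum>i\<in>A. \<Sum>j\<in>B. (f i)\<^sup>2 * (g j)\<^sup>2)"
    by (simp add: sum.cartesian_product power_mult_distrib split_beta')
  also have "\<dots> = (\<Sum>i\<in>A. (f i)\<^sup>2) * (\<Sum>j\<in>B. (g j)\<^sup>2)" by (simp add: sum_product)
  finally show ?thesis by (simp add: L2_set_def real_sqrt_mult)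
qed

lemma L2_set_bounds:
  assumes "L2_set f A \<le> C" shows "(\<Sum>i\<in>A. (f i)\<^sup>2) \<le> C\<^sup>2"
proof -
  have "(\<Sum>i\<in>A. (f i)\<^sup>2) = (L2_set f A)\<^sup>2" by (simp add: L2_set_def sum_nonneg)
  also have "\<dots> \<le> C\<^sup>2" using assms L2_set_nonneg by (intro power_mono) auto
  finally show ?thesis .
qed

lemma L2_set_scale: "L2_set (\<lambda>i. f i * c) A = L2_set f A * \<bar>c\<bar>"
  by (simp add: L2_set_def power_mult_distrib real_sqrt_mult flip: sum_distrib_right)

text \<open>Derivatives are indexed by lists of coordinates rather than by multi-indices. This repeats
  mixed derivatives and so can only increase the error, but the derivatives of a ridge function of
  order \<open>k\<close> then form a tensor power, whose norm \<open>|\<omega>|^k\<close> carries no dimensional constant.\<close>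

definition index_lists :: "nat \<Rightarrow> nat \<Rightarrow> nat list set" where
  "index_lists d k = {js. set js \<subseteq> {..<d} \<and> length js = k}"

lemma finite_index_lists: "finite (index_lists d k)"
  unfolding index_lists_def by (rule finite_lists_length_eq) simp

lemma index_lists_0: "index_lists d 0 = {[]}"
  by (auto simp: index_lists_def)

lemma index_lists_Suc: "index_lists d (Suc k) = (\<lambda>(i, js). i # js) ` ({..<d} \<times> index_lists d k)"
  by (auto simp: index_lists_def length_Suc_conv image_iff)

lemma L2_set_index_lists_Suc:
  "L2_set F (index_lists d (Suc k)) = L2_set (\<lambda>(i, js). F (i # js)) ({..<d} \<times> index_lists d k)"
proof -
  have "inj_on (\<lambda>(i, js). i # js) ({..<d} \<times> index_lists d k)" by (auto simp: inj_on_def)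
  then show ?thesis
    unfolding index_lists_Suc L2_set_def by (simp add: sum.reindex split_beta' o_def)
qed

definition tensor :: "(nat \<Rightarrow> real) \<Rightarrow> nat list \<Rightarrow> real" where
  "tensor v js = (\<Prod>j\<leftarrow>js. v j)"

text \<open>The sum of squares over lists of length k factorises into k equal sums; summing over
  lists instead of multi-indices is what makes this exact.\<close>

lemma L2_set_tensor: "L2_set (tensor v) (index_lists d k) = Rd_norm d v ^ k"
proof (induction k)
  case (Suc k)
  have "L2_set (tensor v) (index_lists d (Suc k)) = L2_set (\<lambda>(i, js). v i * tensor v js) ({..<d} \<times> index_lists d k)"
    unfolding L2_set_index_lists_Suc by (simp add: tensor_def)
  then show ?case using Suc by (simp add: L2_set_product finite_index_lists Rd_norm_def)
qed (simp add: index_lists_0 tensor_def)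

text \<open>One factor is exchanged at a time: the difference of v tensor T and v' tensor T' is v
  tensor (T - T') plus (v - v') tensor T'. Norms of tensors are multiplicative, so the order
  \<open>k\<close> appears but no power of the dimension.\<close>

lemma L2_set_tensor_diff:
  assumes r: "Rd_norm d v \<le> r" "Rd_norm d v' \<le> r"
  shows "L2_set (\<lambda>js. tensor v js - tensor v' js) (index_lists d k) \<le> real k * r ^ (k - 1) * Rd_norm d (\<lambda>i. v i - v' i)"
proof (induction k)
  case (Suc k)
  have r0: "0 \<le> r" using r(1) Rd_norm_nonneg[of d v] by linarith
  let ?D = "Rd_norm d (\<lambda>i. v i - v' i)"
  have "L2_set (\<lambda>js. tensor v js - tensor v' js) (index_lists d (Suc k)) =
      L2_set (\<lambda>p. (case p of (i, js) \<Rightarrow> v i * (tensor v js - tensor v' js)) +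
        (case p of (i, js) \<Rightarrow> (v i - v' i) * tensor v' js)) ({..<d} \<times> index_lists d k)"
    unfolding L2_set_index_lists_Suc by (simp add: tensor_def split_beta' algebra_simps)
  also have "\<dots> \<le> L2_set (\<lambda>(i, js). v i * (tensor v js - tensor v' js)) ({..<d} \<times> index_lists d k) +
      L2_set (\<lambda>(i, js). (v i - v' i) * tensor v' js) ({..<d} \<times> index_lists d k)"
    by (rule L2_set_triangle_ineq)
  also have "\<dots> = Rd_norm d v * L2_set (\<lambda>js. tensor v js - tensor v' js) (index_lists d k) + ?D * Rd_norm d v' ^ k"
    unfolding L2_set_product[OF finite_lessThan finite_index_lists] L2_set_tensor Rd_norm_def ..
  also have "\<dots> \<le> r * (real k * r ^ (k - 1) * ?D) + ?D * r ^ k"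
    using Suc r r0 by (intro add_mono mult_mono power_mono) (auto simp: L2_set_nonneg)
  also have "\<dots> = real (Suc k) * r ^ k * ?D"
    by (cases k) (simp_all add: algebra_simps)
  finally show ?case by simp
qed (simp add: index_lists_0 tensor_def L2_set_def)

lemma Rd_inner_le: "\<bar>Rd_inner d x y\<bar> \<le> Rd_norm d x * Rd_norm d y"
proof -
  have "\<bar>Rd_inner d x y\<bar> \<le> (\<Sum>i<d. \<bar>x i\<bar> * \<bar>y i\<bar>)"
    unfolding Rd_inner_def by (rule order_trans[OF sum_abs]) (simp add: abs_mult)
  also have "\<dots> \<le> Rd_norm d x * Rd_norm d y" unfolding Rd_norm_def by (rule L2_set_mult_ineq)
  finally show ?thesis .
qed

lemma Rd_norm_divide: "Rd_norm d (\<lambda>i. x i / a) = Rd_norm d x / \<bar>a\<bar>"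
  using L2_set_scale[of x "1 / a" "{..<d}"] by (simp add: Rd_norm_def)

lemma Rd_norm_diff: "\<bar>Rd_norm d x - Rd_norm d y\<bar> \<le> Rd_norm d (\<lambda>i. x i - y i)"
proof -
  have "Rd_norm d (\<lambda>i. (x i - y i) + y i) \<le> Rd_norm d (\<lambda>i. x i - y i) + Rd_norm d y"
    unfolding Rd_norm_def by (rule L2_set_triangle_ineq)
  moreover have "Rd_norm d (\<lambda>i. (y i - x i) + x i) \<le> Rd_norm d (\<lambda>i. y i - x i) + Rd_norm d x"
    unfolding Rd_norm_def by (rule L2_set_triangle_ineq)
  moreover have "Rd_norm d (\<lambda>i. y i - x i) = Rd_norm d (\<lambda>i. x i - y i)"
    by (simp add: Rd_norm_def L2_set_def power2_commute)
  ultimately show ?thesis by simp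
qed

lemma abs_ln_diff_le:
  fixes x y :: real assumes "x \<ge> 1" "y \<ge> 1" shows "\<bar>ln x - ln y\<bar> \<le> \<bar>x - y\<bar>"
proof -
  have *: "ln a - ln b \<le> \<bar>a - b\<bar>" if "a \<ge> 1" "b \<ge> 1" for a b :: real
  proof -
    have "ln a - ln b \<le> (a - b) / b" using that by (intro ln_diff_le) auto
    also have "\<dots> \<le> \<bar>a - b\<bar> / b" using that by (intro divide_right_mono) auto
    also have "\<dots> \<le> \<bar>a - b\<bar>" using that mult_right_mono[of 1 b "\<bar>a - b\<bar>"] by (simp add: divide_le_eq mult.commute)
    finally show ?thesis .
  qed
  from *[OF assms] *[OF assms(2,1)] show ?thesis by (simp add: abs_minus_commute)
qed

lemma abs_exp_minus_one_le: "\<bar>exp y - 1\<bar> \<le> \<bar>y\<bar> * exp \<bar>y\<bar>" for y :: real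
proof (cases "y \<ge> 0")
  case True
  have "1 - y \<le> exp (- y)" using exp_ge_add_one_self[of "- y"] by simp
  then have "(1 - y) * exp y \<le> exp (- y) * exp y" by (intro mult_right_mono) auto
  also have "exp (- y) * exp y = 1" by (simp flip: exp_add)
  finally show ?thesis using True by (simp add: algebra_simps)
next
  case False
  have "exp y \<le> 1" using False by simp
  then have "\<bar>exp y - 1\<bar> \<le> \<bar>y\<bar>" using False exp_ge_add_one_self[of y] by linarith
  also have "\<dots> \<le> \<bar>y\<bar> * exp \<bar>y\<bar>" by (simp add: mult_left_le_one_le mult_le_cancel_left1)
  finally show ?thesis .
qed

text \<open>The distance of the bias from the interval of values that the linear part of the
  argument can cancel.\<close>

definition excess :: "nat \<Rightarrow> real \<Rightarrow> (nat \<Rightarrow> real) \<times> real \<Rightarrow> real" where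
  "excess d c z = max 0 (\<bar>snd z\<bar> - c * Rd_norm d (fst z))"

text \<open>A point \<open>z = (\<omega>, b)\<close> is the parameter of the neuron \<open>x \<mapsto> \<sigma> (\<omega> \<cdot> (x - x0) / a + b)\<close>. If
  \<open>|x - x0| \<le> R\<close> and \<open>c = R / |a|\<close>, its argument is at least \<open>|b| - c |\<omega>|\<close> in modulus, so the weight
  bounds all its derivatives up to order \<open>m\<close>.\<close>

definition weight :: "nat \<Rightarrow> nat \<Rightarrow> real \<Rightarrow> real \<Rightarrow> (nat \<Rightarrow> real) \<times> real \<Rightarrow> real" where
  "weight d m p c z = (1 + Rd_norm d (fst z)) ^ m * (1 + excess d c z) powr (- p)"

definition ridge_arg :: "nat \<Rightarrow> real \<Rightarrow> (nat \<Rightarrow> real) \<Rightarrow> (nat \<Rightarrow> real) \<times> real \<Rightarrow> (nat \<Rightarrow> real) \<Rightarrow> real" where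
  "ridge_arg d a x0 z x = Rd_inner d (\<lambda>i. fst z i / a) (\<lambda>i. x i - x0 i) + snd z"

definition ridge :: "nat \<Rightarrow> real \<Rightarrow> (nat \<Rightarrow> real \<Rightarrow> real) \<Rightarrow> (nat \<Rightarrow> real) \<Rightarrow> nat list \<Rightarrow>
    (nat \<Rightarrow> real) \<times> real \<Rightarrow> (nat \<Rightarrow> real) \<Rightarrow> real" where
  "ridge d a s x0 js z x = tensor (\<lambda>i. fst z i / a) js * s (length js) (ridge_arg d a x0 z x)"

definition param_dist :: "nat \<Rightarrow> (nat \<Rightarrow> real) \<times> real \<Rightarrow> (nat \<Rightarrow> real) \<times> real \<Rightarrow> real" where
  "param_dist d z z' = Rd_norm d (\<lambda>i. fst z i - fst z' i) + \<bar>snd z - snd z'\<bar>"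

lemma excess_nonneg: "0 \<le> excess d c z"
  by (simp add: excess_def)

lemma weight_pos: "0 < weight d m p c z"
  using excess_nonneg[of d c z] Rd_norm_nonneg[of d "fst z"]
  unfolding weight_def by (intro mult_pos_pos zero_less_power) (auto simp: add_pos_nonneg)

lemma param_dist_nonneg: "0 \<le> param_dist d z z'"
  by (simp add: param_dist_def)

lemma excess_lipschitz:
  assumes "0 \<le> c" shows "\<bar>excess d c z - excess d c z'\<bar> \<le> (c + 1) * param_dist d z z'"
proof -
  have "\<bar>excess d c z - excess d c z'\<bar> \<le> \<bar>(\<bar>snd z\<bar> - c * Rd_norm d (fst z)) - (\<bar>snd z'\<bar> - c * Rd_norm d (fst z'))\<bar>"
    unfolding excess_def by linarith
  also have "\<dots> \<le> \<bar>snd z - snd z'\<bar> + \<bar>c * (Rd_norm d (fst z) - Rd_norm d (fst z'))\<bar>"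
    by (simp add: right_diff_distrib)
  also have "\<bar>c * (Rd_norm d (fst z) - Rd_norm d (fst z'))\<bar> \<le> c * Rd_norm d (\<lambda>i. fst z i - fst z' i)"
    using assms Rd_norm_diff[of d "fst z" "fst z'"] by (simp add: abs_mult mult_left_mono)
  also have "\<bar>snd z - snd z'\<bar> + c * Rd_norm d (\<lambda>i. fst z i - fst z' i) \<le> (c + 1) * param_dist d z z'"
    using assms mult_nonneg_nonneg[OF assms, of "\<bar>snd z - snd z'\<bar>"] by (simp add: param_dist_def algebra_simps)
  finally show ?thesis by simp
qed

text \<open>The logarithm separates the two factors, whose bases are 1 plus a nonnegative Lipschitz
  function. It controls relative changes of the weight, as dividing by the weight requires.\<close>

lemma ln_weight_lipschitz:
  assumes "0 \<le> c" "0 \<le> p"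
  shows "\<bar>ln (weight d m p c z) - ln (weight d m p c z')\<bar> \<le> (real m + p * (c + 1)) * param_dist d z z'"
proof -
  have lnw: "ln (weight d m p c z) = real m * ln (1 + Rd_norm d (fst z)) - p * ln (1 + excess d c z)" for z
  proof -
    have "0 < 1 + Rd_norm d (fst z)" "0 < 1 + excess d c z"
      using excess_nonneg[of d c z] Rd_norm_nonneg[of d "fst z"] by linarith+
    then show ?thesis unfolding weight_def by (simp add: ln_mult ln_realpow ln_powr)
  qed
  have 1: "\<bar>ln (1 + Rd_norm d (fst z)) - ln (1 + Rd_norm d (fst z'))\<bar> \<le> param_dist d z z'"
  proof -
    have "\<bar>ln (1 + Rd_norm d (fst z)) - ln (1 + Rd_norm d (fst z'))\<bar> \<le> \<bar>(1 + Rd_norm d (fst z)) - (1 + Rd_norm d (fst z'))\<bar>"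
      by (rule abs_ln_diff_le) auto
    also have "\<dots> \<le> param_dist d z z'"
      using Rd_norm_diff[of d "fst z" "fst z'"] by (simp add: param_dist_def)
    finally show ?thesis .
  qed
  have 2: "\<bar>ln (1 + excess d c z) - ln (1 + excess d c z')\<bar> \<le> (c + 1) * param_dist d z z'"
  proof -
    have "\<bar>ln (1 + excess d c z) - ln (1 + excess d c z')\<bar> \<le> \<bar>(1 + excess d c z) - (1 + excess d c z')\<bar>"
      by (rule abs_ln_diff_le) (auto simp: excess_nonneg)
    also have "\<dots> \<le> (c + 1) * param_dist d z z'" using excess_lipschitz[OF assms(1), of d z z'] by simp
    finally show ?thesis .
  qed
  have "\<bar>ln (weight d m p c z) - ln (weight d m p c z')\<bar> \<le>
      \<bar>real m * (ln (1 + Rd_norm d (fst z)) - ln (1 + Rd_norm d (fst z')))\<bar> + \<bar>p * (ln (1 + excess d c z) - ln (1 + excess d c z'))\<bar>"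
    unfolding lnw by (simp add: right_diff_distrib)
  also have "\<dots> \<le> real m * param_dist d z z' + p * ((c + 1) * param_dist d z z')"
    unfolding abs_mult using assms 1 2 by (intro add_mono mult_mono) auto
  finally show ?thesis by (simp add: algebra_simps)
qed

section \<open>Normalised ridge functions\<close>

locale ridge_setup =
  fixes m :: nat and p a R Cs :: real and s :: "nat \<Rightarrow> real \<Rightarrow> real"
  assumes p: "p > 1" and a: "a \<noteq> 0" and R: "R \<ge> 0" and Cs: "Cs > 0"
    and s_bound: "\<And>k x. k \<le> m \<Longrightarrow> \<bar>s k x\<bar> \<le> Cs * (1 + \<bar>x\<bar>) powr (- p)"
    and s_lip: "\<And>k x y. k \<le> m \<Longrightarrow> \<bar>x - y\<bar> \<le> 1 \<Longrightarrow> \<bar>s k x - s k y\<bar> \<le> Cs * (1 + \<bar>x\<bar>) powr (- p) * \<bar>x - y\<bar>"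
begin

text \<open>None of the constants that follow involves the dimension, which is an argument of the
  lemmas and not a parameter of this locale.\<close>

definition c0 :: real where "c0 = R / \<bar>a\<bar>"
text \<open>Bounds the powers of 1 / |a| of all orders up to \<open>m\<close> at once.\<close>

definition scale :: real where "scale = max 1 (1 / \<bar>a\<bar>)"
definition log_lip :: real where "log_lip = real m + p * (c0 + 1)"
definition K0 :: real where "K0 = scale ^ m * Cs"
text \<open>The three summands belong to the increments of three factors: the activation, the tensor
  of inner weights and the reciprocal weight.\<close>

definition L0 :: real where
  "L0 = scale ^ m * Cs * ((c0 + 1) + real m * 2 ^ m * 2 powr p + log_lip * exp log_lip)"
definition K1 :: real where "K1 = real (Suc m) * K0\<^sup>2"
text \<open>The first summand collects the Lipschitz estimates of all orders for nearby parameters;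
  the second serves distant ones, where boundedness is enough.\<close>

definition L1 :: real where "L1 = real (Suc m) * L0\<^sup>2 + 4 * K1 * (c0 + 1)\<^sup>2"

abbreviation wt :: "nat \<Rightarrow> (nat \<Rightarrow> real) \<times> real \<Rightarrow> real" where "wt d z \<equiv> weight d m p c0 z"

lemma c0: "c0 \<ge> 0" using R by (simp add: c0_def)
lemma scale1: "scale \<ge> 1" by (simp add: scale_def)
lemma log_lip: "log_lip \<ge> 0" using p c0 by (simp add: log_lip_def)
lemma K0: "K0 > 0" using Cs scale1 by (simp add: K0_def)
lemma L0: "L0 \<ge> 0" using Cs scale1 c0 log_lip by (simp add: L0_def)
lemma K1: "K1 \<ge> 0" by (simp add: K1_def)
lemma L1: "L1 \<ge> 0" using K1 by (simp add: L1_def)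

lemma scale_power:
  assumes "k \<le> m" shows "(1 / \<bar>a\<bar>) ^ k \<le> scale ^ m"
proof -
  have "(1 / \<bar>a\<bar>) ^ k \<le> scale ^ k" by (intro power_mono) (auto simp: scale_def)
  also have "\<dots> \<le> scale ^ m" using assms scale1 by (intro power_increasing)
  finally show ?thesis .
qed

lemma tensor_norm_bound:
  assumes "k \<le> m"
  shows "L2_set (tensor (\<lambda>i. fst z i / a)) (index_lists d k) \<le> scale ^ m * (1 + Rd_norm d (fst z)) ^ m"
proof -
  have "L2_set (tensor (\<lambda>i. fst z i / a)) (index_lists d k) = (1 / \<bar>a\<bar>) ^ k * Rd_norm d (fst z) ^ k"
    by (simp add: L2_set_tensor Rd_norm_divide power_divide)
  also have "\<dots> \<le> scale ^ m * (1 + Rd_norm d (fst z)) ^ k"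
    using scale1 by (intro mult_mono scale_power[OF assms] power_mono) auto
  also have "\<dots> \<le> scale ^ m * (1 + Rd_norm d (fst z)) ^ m"
    using scale1 assms by (intro mult_left_mono power_increasing) auto
  finally show ?thesis .
qed

lemma ridge_arg_excess:
  assumes "Rd_norm d (\<lambda>i. x i - x0 i) \<le> R"
  shows "excess d c0 z \<le> \<bar>ridge_arg d a x0 z x\<bar>"
proof -
  have "\<bar>Rd_inner d (\<lambda>i. fst z i / a) (\<lambda>i. x i - x0 i)\<bar> \<le> Rd_norm d (fst z) / \<bar>a\<bar> * Rd_norm d (\<lambda>i. x i - x0 i)"
    using Rd_inner_le[of d "\<lambda>i. fst z i / a"] by (simp add: Rd_norm_divide)
  also have "\<dots> \<le> Rd_norm d (fst z) / \<bar>a\<bar> * R" using assms by (intro mult_left_mono) auto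
  also have "\<dots> = c0 * Rd_norm d (fst z)" by (simp add: c0_def)
  finally show ?thesis unfolding excess_def ridge_arg_def by linarith
qed

lemma s_ridge_bound:
  assumes "k \<le> m" "Rd_norm d (\<lambda>i. x i - x0 i) \<le> R"
  shows "Cs * (1 + \<bar>ridge_arg d a x0 z x\<bar>) powr (- p) \<le> Cs * (1 + excess d c0 z) powr (- p)"
    "\<bar>s k (ridge_arg d a x0 z x)\<bar> \<le> Cs * (1 + excess d c0 z) powr (- p)"
proof -
  have "(1 + \<bar>ridge_arg d a x0 z x\<bar>) powr (- p) \<le> (1 + excess d c0 z) powr (- p)"
    using ridge_arg_excess[OF assms(2), of z] excess_nonneg[of d c0 z] p by (intro powr_mono2') auto
  then show 1: "Cs * (1 + \<bar>ridge_arg d a x0 z x\<bar>) powr (- p) \<le> Cs * (1 + excess d c0 z) powr (- p)"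
    using Cs by simp
  show "\<bar>s k (ridge_arg d a x0 z x)\<bar> \<le> Cs * (1 + excess d c0 z) powr (- p)"
    using s_bound[OF assms(1), of "ridge_arg d a x0 z x"] 1 by linarith
qed

text \<open>Division by the weight makes the family uniformly bounded and uniformly Lipschitz in the
  parameter; the weight itself moves into the sampling measure.\<close>

definition nridge :: "nat \<Rightarrow> (nat \<Rightarrow> real) \<Rightarrow> nat list \<Rightarrow> (nat \<Rightarrow> real) \<times> real \<Rightarrow> (nat \<Rightarrow> real) \<Rightarrow> real" where
  "nridge d x0 js z x = ridge d a s x0 js z x / wt d z"

text \<open>The tensor grows at most like the first factor of the weight and the activation decays
  at least like the second, so the quotient leaves a constant.\<close>

lemma nridge_L2_bound:
  assumes k: "k \<le> m" and x: "Rd_norm d (\<lambda>i. x i - x0 i) \<le> R"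
  shows "L2_set (\<lambda>js. nridge d x0 js z x) (index_lists d k) \<le> K0"
proof -
  have "L2_set (\<lambda>js. nridge d x0 js z x) (index_lists d k) =
      L2_set (\<lambda>js. tensor (\<lambda>i. fst z i / a) js * (s k (ridge_arg d a x0 z x) / wt d z)) (index_lists d k)"
    by (intro L2_set_cong) (auto simp: nridge_def ridge_def index_lists_def)
  also have "\<dots> = L2_set (tensor (\<lambda>i. fst z i / a)) (index_lists d k) * (\<bar>s k (ridge_arg d a x0 z x)\<bar> / wt d z)"
    unfolding L2_set_scale using weight_pos[of d m p c0 z] by simp
  also have "\<dots> \<le> (scale ^ m * (1 + Rd_norm d (fst z)) ^ m) * ((Cs * (1 + excess d c0 z) powr (- p)) / wt d z)"
    using tensor_norm_bound[OF k] s_ridge_bound(2)[OF k x] weight_pos[of d m p c0 z] scale1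
    by (intro mult_mono divide_right_mono) auto
  also have "\<dots> = K0 * (wt d z / wt d z)" by (simp add: K0_def weight_def)
  also have "\<dots> = K0" using weight_pos[of d m p c0 z] by simp
  finally show ?thesis .
qed

text \<open>One factor is changed at a time. Smallness of the distance keeps the arguments of the
  activation within 1 of each other, where its increments decay, and makes norms and decay at the
  two parameters comparable; the latter is needed for the mixed term, which has the activation at
  one parameter and the weight at the other.\<close>

lemma nridge_L2_lipschitz:
  assumes k: "k \<le> m" and x: "Rd_norm d (\<lambda>i. x i - x0 i) \<le> R" and small: "(c0 + 1) * param_dist d z z' \<le> 1"
  shows "L2_set (\<lambda>js. nridge d x0 js z x - nridge d x0 js z' x) (index_lists d k) \<le> L0 * param_dist d z z'"
proof -
  define \<Delta> where "\<Delta> = param_dist d z z'"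
  define v where "v = (\<lambda>i. fst z i / a)"
  define v' where "v' = (\<lambda>i. fst z' i / a)"
  define u where "u = ridge_arg d a x0 z x"
  define u' where "u' = ridge_arg d a x0 z' x"
  define r where "r = 1 + Rd_norm d (fst z)"
  define r' where "r' = 1 + Rd_norm d (fst z')"
  define h where "h = (1 + excess d c0 z) powr (- p)"
  define h' where "h' = (1 + excess d c0 z') powr (- p)"
  define W where "W = wt d z"
  define W' where "W' = wt d z'"
  have W: "W = r ^ m * h" "W' = r' ^ m * h'" by (simp_all add: W_def W'_def weight_def r_def r'_def h_def h'_def)
  have Wpos: "W > 0" "W' > 0" by (simp_all add: W_def W'_def weight_pos)
  have r1: "r \<ge> 1" "r' \<ge> 1" by (simp_all add: r_def r'_def)
  have h0: "h > 0" "h' > 0" using excess_nonneg[of d c0 z] excess_nonneg[of d c0 z'] by (simp_all add: h_def h'_def)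
  have \<Delta>0: "0 \<le> \<Delta>" by (simp add: \<Delta>_def param_dist_nonneg)
  have \<Delta>1: "\<Delta> \<le> 1"
  proof -
    have "\<Delta> \<le> (c0 + 1) * \<Delta>" using c0 \<Delta>0 mult_nonneg_nonneg[of c0 \<Delta>] by (simp add: algebra_simps)
    then show ?thesis using small by (simp add: \<Delta>_def)
  qed
  have rr: "r' \<le> 2 * r"
  proof -
    have "r' - r \<le> Rd_norm d (\<lambda>i. fst z i - fst z' i)"
      using Rd_norm_diff[of d "fst z" "fst z'"] by (simp add: r_def r'_def abs_le_iff)
    also have "\<dots> \<le> \<Delta>" by (simp add: \<Delta>_def param_dist_def)
    finally show ?thesis using \<Delta>1 r1 by simp
  qed
  have hh: "h' \<le> 2 powr p * h"
  proof -
    \<comment> \<open>The excess changes by at most 1, so 1 plus the excess shrinks at most by a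
      factor 2.\<close>
    have "(1 + excess d c0 z) / 2 \<le> 1 + excess d c0 z'"
      using abs_le_D1[OF order_trans[OF excess_lipschitz[OF c0, of d z z'] small]] excess_nonneg[of d c0 z']
      by (simp add: field_simps)
    then have "h' \<le> ((1 + excess d c0 z) / 2) powr (- p)"
      unfolding h'_def using p excess_nonneg[of d c0 z] by (intro powr_mono2') auto
    also have "\<dots> = 2 powr p * h"
      unfolding h_def using excess_nonneg[of d c0 z] by (subst powr_divide) (auto simp: powr_minus_divide)
    finally show ?thesis .
  qed
  have uu: "\<bar>u - u'\<bar> \<le> (c0 + 1) * \<Delta>"
  proof -
    have "u - u' = Rd_inner d (\<lambda>i. (fst z i - fst z' i) / a) (\<lambda>i. x i - x0 i) + (snd z - snd z')"
      unfolding u_def u'_def ridge_arg_def Rd_inner_def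
      by (simp add: diff_divide_distrib left_diff_distrib sum_subtractf)
    then have "\<bar>u - u'\<bar> \<le> \<bar>Rd_inner d (\<lambda>i. (fst z i - fst z' i) / a) (\<lambda>i. x i - x0 i)\<bar> + \<bar>snd z - snd z'\<bar>"
      by linarith
    also have "\<bar>Rd_inner d (\<lambda>i. (fst z i - fst z' i) / a) (\<lambda>i. x i - x0 i)\<bar> \<le>
        Rd_norm d (\<lambda>i. fst z i - fst z' i) / \<bar>a\<bar> * Rd_norm d (\<lambda>i. x i - x0 i)"
      using Rd_inner_le[of d "\<lambda>i. (fst z i - fst z' i) / a"] by (simp add: Rd_norm_divide)
    also have "\<dots> \<le> Rd_norm d (\<lambda>i. fst z i - fst z' i) / \<bar>a\<bar> * R" using x by (intro mult_left_mono) auto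
    also have "\<dots> = c0 * Rd_norm d (\<lambda>i. fst z i - fst z' i)" by (simp add: c0_def)
    also have "c0 * Rd_norm d (\<lambda>i. fst z i - fst z' i) + \<bar>snd z - snd z'\<bar> \<le> (c0 + 1) * \<Delta>"
      using c0 mult_nonneg_nonneg[OF c0, of "\<bar>snd z - snd z'\<bar>"] by (simp add: \<Delta>_def param_dist_def algebra_simps)
    finally show ?thesis by simp
  qed
  have ss: "\<bar>s k u - s k u'\<bar> \<le> Cs * h * ((c0 + 1) * \<Delta>)"
  proof -
    have "\<bar>s k u - s k u'\<bar> \<le> Cs * (1 + \<bar>u\<bar>) powr (- p) * \<bar>u - u'\<bar>"
      using uu small by (intro s_lip[OF k]) (simp add: \<Delta>_def)
    also have "\<dots> \<le> Cs * h * ((c0 + 1) * \<Delta>)"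
      using s_ridge_bound(1)[OF k x, of z] uu Cs h0 by (intro mult_mono) (auto simp: u_def h_def)
    finally show ?thesis .
  qed
  have s': "\<bar>s k u'\<bar> \<le> Cs * h'" using s_ridge_bound(2)[OF k x, of z'] by (simp add: u'_def h'_def)
  have tv: "L2_set (tensor v) (index_lists d k) \<le> scale ^ m * r ^ m"
    using tensor_norm_bound[OF k, of z d] by (simp add: v_def r_def)
  have tv': "L2_set (tensor v') (index_lists d k) \<le> scale ^ m * r' ^ m"
    using tensor_norm_bound[OF k, of z' d] by (simp add: v'_def r'_def)
  have tdiff: "L2_set (\<lambda>js. tensor v js - tensor v' js) (index_lists d k) \<le> scale ^ m * (real m * 2 ^ m * r ^ m * \<Delta>)"
  proof -
    have b1: "Rd_norm d v \<le> 2 * r / \<bar>a\<bar>" unfolding v_def Rd_norm_divide r_def by (intro divide_right_mono) auto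
    have b2: "Rd_norm d v' \<le> 2 * r / \<bar>a\<bar>"
      using rr unfolding v'_def Rd_norm_divide r'_def by (intro divide_right_mono) auto
    have b3: "Rd_norm d (\<lambda>i. v i - v' i) \<le> \<Delta> / \<bar>a\<bar>"
      using Rd_norm_divide[of d "\<lambda>i. fst z i - fst z' i" a]
      by (simp add: v_def v'_def \<Delta>_def param_dist_def diff_divide_distrib divide_right_mono)
    have "L2_set (\<lambda>js. tensor v js - tensor v' js) (index_lists d k) \<le>
        real k * (2 * r / \<bar>a\<bar>) ^ (k - 1) * Rd_norm d (\<lambda>i. v i - v' i)"
      by (rule L2_set_tensor_diff[OF b1 b2])
    also have "\<dots> \<le> real k * (2 * r / \<bar>a\<bar>) ^ (k - 1) * (\<Delta> / \<bar>a\<bar>)"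
      using b3 r1 by (intro mult_left_mono) auto
    also have "\<dots> = (1 / \<bar>a\<bar>) ^ k * (real k * (2 * r) ^ (k - 1) * \<Delta>)"
      by (cases k) (simp_all add: power_divide field_simps)
    also have "\<dots> \<le> scale ^ m * (real m * (2 * r) ^ m * \<Delta>)"
      using k r1 \<Delta>0 scale1
      by (intro mult_mono scale_power[OF k] power_increasing) auto
    finally show ?thesis by (simp add: power_mult_distrib mult_ac)
  qed
  \<comment> \<open>The ratio of the weights is the exponential of a quantity bounded by a multiple
    of \<Delta>, so the reciprocal weight changes little relative to \<open>W'\<close>, which bounds
    the factor that multiplies it.\<close>
  have quot: "\<bar>1 / W - 1 / W'\<bar> * W' \<le> log_lip * exp log_lip * \<Delta>"
  proof -
    define y where "y = ln W' - ln W"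
    have y: "\<bar>y\<bar> \<le> log_lip * \<Delta>"
      using ln_weight_lipschitz[OF c0, of p d m z z'] p
      unfolding y_def W_def W'_def log_lip_def \<Delta>_def by (simp add: abs_minus_commute)
    have "\<bar>1 / W - 1 / W'\<bar> * W' = \<bar>(1 / W - 1 / W') * W'\<bar>" using Wpos by (simp add: abs_mult)
    also have "(1 / W - 1 / W') * W' = exp y - 1"
      using Wpos by (simp add: y_def exp_diff field_simps)
    also have "\<bar>exp y - 1\<bar> \<le> \<bar>y\<bar> * exp \<bar>y\<bar>" by (rule abs_exp_minus_one_le)
    also have "\<dots> \<le> (log_lip * \<Delta>) * exp log_lip"
    proof (intro mult_mono y)
      have "log_lip * \<Delta> \<le> log_lip * 1" using log_lip \<Delta>1 by (intro mult_left_mono) auto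
      then show "exp \<bar>y\<bar> \<le> exp log_lip" using y by simp
    qed (use log_lip \<Delta>0 in auto)
    finally show ?thesis by (simp add: mult_ac)
  qed
  let ?T = "index_lists d k"
  have "L2_set (\<lambda>js. nridge d x0 js z x - nridge d x0 js z' x) ?T =
      L2_set (\<lambda>js. (tensor v js * ((s k u - s k u') / W) + (tensor v js - tensor v' js) * (s k u' / W)) +
         tensor v' js * (s k u' * (1 / W - 1 / W'))) ?T"
    by (intro L2_set_cong refl)
       (auto simp: nridge_def ridge_def index_lists_def u_def[symmetric] u'_def[symmetric] v_def[symmetric]
          v'_def[symmetric] W_def[symmetric] W'_def[symmetric] diff_divide_distrib algebra_simps)
  also have "\<dots> \<le> (L2_set (\<lambda>js. tensor v js * ((s k u - s k u') / W)) ?T +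
      L2_set (\<lambda>js. (tensor v js - tensor v' js) * (s k u' / W)) ?T) +
      L2_set (\<lambda>js. tensor v' js * (s k u' * (1 / W - 1 / W'))) ?T"
    by (rule order_trans[OF L2_set_triangle_ineq]) (intro add_right_mono L2_set_triangle_ineq)
  also have "\<dots> = (L2_set (tensor v) ?T * (\<bar>s k u - s k u'\<bar> / W) +
      L2_set (\<lambda>js. tensor v js - tensor v' js) ?T * (\<bar>s k u'\<bar> / W)) +
      L2_set (tensor v') ?T * (\<bar>s k u'\<bar> * \<bar>1 / W - 1 / W'\<bar>)"
    unfolding L2_set_scale using Wpos by (simp add: abs_mult)
  also have "\<dots> \<le> (scale ^ m * r ^ m * ((Cs * h * ((c0 + 1) * \<Delta>)) / W) +
      scale ^ m * (real m * 2 ^ m * r ^ m * \<Delta>) * ((Cs * (2 powr p * h)) / W)) +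
      scale ^ m * r' ^ m * ((Cs * h') * \<bar>1 / W - 1 / W'\<bar>)"
  proof (intro add_mono mult_mono divide_right_mono tv tv' tdiff ss s')
    show "\<bar>s k u'\<bar> \<le> Cs * (2 powr p * h)" using s' hh Cs by (meson mult_left_mono order_trans less_imp_le)
  qed (use Wpos r1 scale1 h0 Cs \<Delta>0 c0 in \<open>auto simp: L2_set_nonneg\<close>)
  also have "\<dots> = scale ^ m * Cs * ((c0 + 1) * \<Delta> * (W / W) + real m * 2 ^ m * 2 powr p * \<Delta> * (W / W) + \<bar>1 / W - 1 / W'\<bar> * W')"
    unfolding W by (simp add: algebra_simps add_divide_distrib)
  also have "\<dots> \<le> scale ^ m * Cs * ((c0 + 1) * \<Delta> + real m * 2 ^ m * 2 powr p * \<Delta> + log_lip * exp log_lip * \<Delta>)"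
    using Wpos quot scale1 Cs by (intro mult_left_mono add_mono) auto
  also have "\<dots> = L0 * \<Delta>" by (simp add: L0_def algebra_simps)
  finally show ?thesis by (simp add: \<Delta>_def)
qed

definition lists_upto :: "nat \<Rightarrow> nat list set" where
  "lists_upto d = (\<Union>k\<le>m. index_lists d k)"

lemma finite_lists_upto: "finite (lists_upto d)"
  unfolding lists_upto_def using finite_index_lists by auto

lemma sum_lists_upto: "(\<Sum>js\<in>lists_upto d. F js) = (\<Sum>k\<le>m. \<Sum>js\<in>index_lists d k. F js)"
  unfolding lists_upto_def by (subst sum.UNION_disjoint) (auto simp: finite_index_lists, auto simp: index_lists_def)

lemma nridge_sum_bound:
  assumes x: "Rd_norm d (\<lambda>i. x i - x0 i) \<le> R"
  shows "(\<Sum>js\<in>lists_upto d. (nridge d x0 js z x)\<^sup>2) \<le> K1"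
proof -
  have "(\<Sum>js\<in>lists_upto d. (nridge d x0 js z x)\<^sup>2) \<le> (\<Sum>k\<le>m. K0\<^sup>2)"
    unfolding sum_lists_upto by (intro sum_mono L2_set_bounds nridge_L2_bound x) auto
  then show ?thesis by (simp add: K1_def)
qed

text \<open>Where the parameters are too far apart for the Lipschitz estimate, (c0 + 1) times their
  distance exceeds 1, so the trivial bound 4 K1 may be multiplied by its square.\<close>

lemma nridge_sum_lipschitz:
  assumes x: "Rd_norm d (\<lambda>i. x i - x0 i) \<le> R"
  shows "(\<Sum>js\<in>lists_upto d. (nridge d x0 js z x - nridge d x0 js z' x)\<^sup>2) \<le> L1 * (param_dist d z z')\<^sup>2"
proof (cases "(c0 + 1) * param_dist d z z' \<le> 1")
  case True
  have "(\<Sum>js\<in>lists_upto d. (nridge d x0 js z x - nridge d x0 js z' x)\<^sup>2) \<le> (\<Sum>k\<le>m. (L0 * param_dist d z z')\<^sup>2)"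
    unfolding sum_lists_upto by (intro sum_mono L2_set_bounds nridge_L2_lipschitz x True) auto
  also have "\<dots> = real (Suc m) * L0\<^sup>2 * (param_dist d z z')\<^sup>2" by (simp add: power_mult_distrib)
  also have "\<dots> \<le> L1 * (param_dist d z z')\<^sup>2"
    unfolding L1_def using K1 by (intro mult_right_mono) auto
  finally show ?thesis .
next
  case False
  have "(\<Sum>js\<in>lists_upto d. (nridge d x0 js z x - nridge d x0 js z' x)\<^sup>2) \<le>
      (\<Sum>js\<in>lists_upto d. 2 * (nridge d x0 js z x)\<^sup>2 + 2 * (nridge d x0 js z' x)\<^sup>2)"
  proof (rule sum_mono)
    fix js
    have "0 \<le> (nridge d x0 js z x + nridge d x0 js z' x)\<^sup>2" by simp
    then show "(nridge d x0 js z x - nridge d x0 js z' x)\<^sup>2 \<le> 2 * (nridge d x0 js z x)\<^sup>2 + 2 * (nridge d x0 js z' x)\<^sup>2"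
      by (simp add: power2_sum power2_diff)
  qed
  also have "\<dots> \<le> 2 * K1 + 2 * K1"
    unfolding sum.distrib sum_distrib_left[symmetric] by (intro add_mono mult_left_mono nridge_sum_bound x) auto
  also have "\<dots> = 4 * K1 * 1\<^sup>2" by simp
  also have "\<dots> \<le> 4 * K1 * ((c0 + 1) * param_dist d z z')\<^sup>2"
    using False K1 by (intro mult_left_mono power_mono) auto
  also have "\<dots> = (4 * K1 * (c0 + 1)\<^sup>2) * (param_dist d z z')\<^sup>2" by (simp add: power_mult_distrib)
  also have "\<dots> \<le> L1 * (param_dist d z z')\<^sup>2"
    unfolding L1_def by (intro mult_right_mono) auto
  finally show ?thesis .
qed

end

section \<open>The Sobolev norm\<close>

text \<open>The sorted list among those that represent a multi-index; this choice embeds the sum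
  over multi-indices into the sum over lists.\<close>

definition index_list :: "nat \<Rightarrow> (nat \<Rightarrow> nat) \<Rightarrow> nat list" where
  "index_list d \<alpha> = concat (map (\<lambda>i. replicate (\<alpha> i) i) [0..<d])"

lemma multi_deriv_index_list: "multi_deriv d \<alpha> f = partial_derivs (index_list d \<alpha>) f"
  by (simp add: multi_deriv_def index_list_def)

lemma length_index_list: "length (index_list d \<alpha>) = (\<Sum>i<d. \<alpha> i)"
  by (induction d) (simp_all add: index_list_def)

lemma set_index_list: "set (index_list d \<alpha>) \<subseteq> {..<d}"
  unfolding index_list_def by (rule multi_deriv_list)

lemma count_index_list: "i < d \<Longrightarrow> count_list (index_list d \<alpha>) i = \<alpha> i"
proof (induction d)
  case (Suc d)
  have rep: "count_list (replicate n j) k = (if k = j then n else 0)" for n j k :: nat by (induction n) auto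
  have "index_list (Suc d) \<alpha> = index_list d \<alpha> @ replicate (\<alpha> d) d" by (simp add: index_list_def)
  moreover have "count_list (index_list d \<alpha>) d = 0" using set_index_list[of d \<alpha>] by (auto simp: count_list_0_iff)
  ultimately show ?case using Suc by (cases "i = d") (auto simp: rep)
qed simp

lemma index_list_mem:
  "\<alpha> \<in> multi_indices d m \<Longrightarrow> index_list d \<alpha> \<in> (\<Union>k\<le>m. index_lists d k)"
  using set_index_list[of d \<alpha>] by (auto simp: multi_indices_def index_lists_def length_index_list)

lemma inj_on_index_list: "inj_on (index_list d) (multi_indices d m)"
proof (rule inj_onI, rule ext)
  fix \<alpha> \<beta> i assume *: "\<alpha> \<in> multi_indices d m" "\<beta> \<in> multi_indices d m" "index_list d \<alpha> = index_list d \<beta>"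
  show "\<alpha> i = \<beta> i"
    using * count_index_list[of i d \<alpha>] count_index_list[of i d \<beta>]
    by (cases "i < d") (auto simp: multi_indices_def)
qed

lemma set_lebesgue_integral_Rd_leb:
  fixes H :: "(nat \<Rightarrow> real) \<Rightarrow> real"
  assumes \<Omega>: "\<Omega> \<in> sets (Rd_borel d)" and H: "H \<in> borel_measurable (Rd_borel d)"
  shows "(LINT x:\<Omega>|Rd_leb d. H x) = (LINT x|Rd_borel d. indicator \<Omega> x * H x)"
  unfolding set_lebesgue_integral_def Rd_leb_def
  using \<Omega> H by (subst integral_completion) auto

text \<open>\<open>f\<close> and the networks are known only up to null sets. All subsets of a null
  set are measurable in the completion, so changing a function there preserves
  measurability.\<close>

lemma measurable_completion_cong_AE:
  fixes f g :: "'a \<Rightarrow> 'b::topological_space"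
  assumes f: "f \<in> borel_measurable (completion M)" and ae: "AE x in completion M. f x = g x"
  shows "g \<in> borel_measurable (completion M)"
proof (rule measurableI)
  fix A :: "'b set" assume A: "A \<in> sets borel"
  obtain N where N: "N \<in> null_sets (completion M)" "{x \<in> space (completion M). f x \<noteq> g x} \<subseteq> N"
    using ae by (auto simp: eventually_ae_filter)
  have "g -` A \<inter> N \<inter> space (completion M) \<in> null_sets (completion M)"
    by (rule null_sets_completion_subset[OF _ N(1)]) auto
  then have "(f -` A \<inter> space (completion M) - N) \<union> (g -` A \<inter> N \<inter> space (completion M)) \<in> sets (completion M)"
    using measurable_sets[OF f A] N(1) by (intro sets.Un sets.Diff) auto
  also have "(f -` A \<inter> space (completion M) - N) \<union> (g -` A \<inter> N \<inter> space (completion M)) =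
      g -` A \<inter> space (completion M)"
    using N(2) by (auto simp del: space_completion)
  finally show "g -` A \<inter> space (completion M) \<in> sets (completion M)" .
qed auto

lemma completion_integral_cong_AE:
  fixes f g :: "'a \<Rightarrow> 'b::{banach, second_countable_topology}"
  assumes f: "f \<in> borel_measurable M" and ae: "AE x in completion M. f x = g x"
  shows "integral\<^sup>L (completion M) g = integral\<^sup>L M f"
    "integrable M f \<Longrightarrow> integrable (completion M) g"
proof -
  have fc: "f \<in> borel_measurable (completion M)" using f by (rule measurable_completion)
  have gc: "g \<in> borel_measurable (completion M)" by (rule measurable_completion_cong_AE[OF fc ae])
  show "integral\<^sup>L (completion M) g = integral\<^sup>L M f"
    using integral_cong_AE[OF fc gc ae] integral_completion[OF f] by simp
  show "integrable (completion M) g" if "integrable M f"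
    using integrable_cong_AE[OF fc gc ae] integrable_completion[OF f] that by simp
qed

text \<open>The norm is defined with weak derivatives picked by \<open>SOME\<close>. Bounded Borel
  candidates \<open>W\<close> with the right integration by parts determine them almost everywhere
  by uniqueness, and enlarging the sum from multi-indices to lists only adds nonnegative
  terms.\<close>

lemma sobolev_norm_le:
  fixes W :: "nat list \<Rightarrow> (nat \<Rightarrow> real) \<Rightarrow> real"
  defines "L \<equiv> (\<lambda>d m. \<Union>k\<le>m. index_lists d k)"
  assumes \<Omega>: "openin (Rd_top d) \<Omega>" "emeasure (Rd_borel d) \<Omega> < \<infinity>"
    and W: "\<And>js. js \<in> L d m \<Longrightarrow> W js \<in> borel_measurable (Rd_borel d)"
      "\<And>js x. js \<in> L d m \<Longrightarrow> x \<in> \<Omega> \<Longrightarrow> \<bar>W js x\<bar> \<le> B"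
    and h: "AE x in Rd_leb d. x \<in> \<Omega> \<longrightarrow> h x = W [] x"
    and wd: "\<And>js \<phi>. js \<in> L d m \<Longrightarrow> \<phi> \<in> test_functions d \<Omega> \<Longrightarrow>
      (LINT x|Rd_borel d. indicator \<Omega> x * (W [] x * partial_derivs js \<phi> x)) =
      (- 1) ^ length js * (LINT x|Rd_borel d. indicator \<Omega> x * (W js x * \<phi> x))"
    and E: "(\<Sum>js\<in>L d m. LINT x|Rd_borel d. indicator \<Omega> x * (W js x)\<^sup>2) \<le> E"
  shows "sobolev_norm d m \<Omega> h \<le> ennreal (sqrt E)"
proof -
  let ?M = "Rd_borel d" and ?L = "Rd_leb d"
  have Lc: "?L = completion ?M" by (simp add: Rd_leb_def)
  have \<Omega>s: "\<Omega> \<in> sets ?M" by (rule openin_Rd_sets[OF \<Omega>(1)])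
  have \<Omega>L: "\<Omega> \<in> sets ?L" unfolding Lc using \<Omega>s by (rule sets_completionI_sets)
  have \<Omega>sub: "\<Omega> \<subseteq> Rd d" using openin_subset[OF \<Omega>(1)] by (simp add: topspace_Rd_top)
  have nil: "[] \<in> L d m" by (auto simp: L_def index_lists_def)
  have WL: "W js \<in> borel_measurable ?L" if "js \<in> L d m" for js
    unfolding Lc by (rule measurable_completion[OF W(1)[OF that]])
  have loc: "locally_integrable d \<Omega> f"
    if js: "js \<in> L d m" and f: "AE x in ?L. x \<in> \<Omega> \<longrightarrow> f x = W js x" for f js
    unfolding locally_integrable_def
  proof (intro allI impI, elim conjE)
    fix K assume K: "compactin (Rd_top d) K" "K \<subseteq> \<Omega>"
    have Ks: "K \<in> sets ?M" by (rule compactin_Rd_sets[OF K(1)])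
    have i: "integrable ?M (\<lambda>x. indicator K x * W js x)"
    proof (rule Bochner_Integration.integrable_bound)
      show "integrable ?M (\<lambda>x. indicator K x * B)"
        using compactin_Rd_emeasure[OF K(1)] Ks by (intro integrable_mult_left integrable_real_indicator) auto
      show "(\<lambda>x. indicator K x * W js x) \<in> borel_measurable ?M" using W(1)[OF js] Ks by measurable
      show "AE x in ?M. norm (indicator K x * W js x) \<le> norm (indicator K x * B)"
        using W(2)[OF js] K(2) by (intro AE_I2) (force simp: indicator_def)
    qed
    have e: "AE x in completion ?M. indicator K x * W js x = indicator K x *\<^sub>R f x"
      using f unfolding Lc by eventually_elim (use K(2) in \<open>auto simp: indicator_def\<close>)
    show "set_integrable ?L K f"
      unfolding set_integrable_def Lc
      by (rule completion_integral_cong_AE(2)[OF borel_measurable_integrable[OF i] e i])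
  qed
  have fin: "finite (L d m)" unfolding L_def using finite_index_lists by auto
  have wdh: "is_weak_deriv d \<Omega> \<alpha> h (W (index_list d \<alpha>))" if \<alpha>: "\<alpha> \<in> multi_indices d m" for \<alpha>
    unfolding is_weak_deriv_def
  proof (intro conjI ballI)
    have js: "index_list d \<alpha> \<in> L d m" unfolding L_def by (rule index_list_mem[OF \<alpha>])
    show "locally_integrable d \<Omega> h" by (rule loc[OF nil h])
    show "locally_integrable d \<Omega> (W (index_list d \<alpha>))" by (rule loc[OF js]) simp
    fix \<phi> assume \<phi>: "\<phi> \<in> test_functions d \<Omega>"
    have d\<phi>: "partial_derivs (index_list d \<alpha>) \<phi> \<in> test_functions d \<Omega>"
      by (rule test_functions_partial_derivs[OF \<phi> set_index_list])
    have m1: "(\<lambda>x. W [] x * partial_derivs (index_list d \<alpha>) \<phi> x) \<in> borel_measurable ?M"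
      using W(1)[OF nil] test_functions_measurable[OF d\<phi>] by measurable
    have m2: "(\<lambda>x. W (index_list d \<alpha>) x * \<phi> x) \<in> borel_measurable ?M"
      using W(1)[OF js] test_functions_measurable[OF \<phi>] by measurable
    have "(LINT x:\<Omega>|?L. h x * multi_deriv d \<alpha> \<phi> x) =
        (LINT x|?M. indicator \<Omega> x * (W [] x * partial_derivs (index_list d \<alpha>) \<phi> x))"
      unfolding set_lebesgue_integral_def multi_deriv_index_list Lc
    proof (rule completion_integral_cong_AE(1))
      show "(\<lambda>x. indicator \<Omega> x * (W [] x * partial_derivs (index_list d \<alpha>) \<phi> x)) \<in> borel_measurable ?M"
        using m1 \<Omega>s by measurable
      show "AE x in completion ?M. indicator \<Omega> x * (W [] x * partial_derivs (index_list d \<alpha>) \<phi> x) =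
          indicator \<Omega> x *\<^sub>R (h x * partial_derivs (index_list d \<alpha>) \<phi> x)"
        using h unfolding Lc by eventually_elim (auto simp: indicator_def)
    qed
    also have "\<dots> = (- 1) ^ length (index_list d \<alpha>) * (LINT x|?M. indicator \<Omega> x * (W (index_list d \<alpha>) x * \<phi> x))"
      by (rule wd[OF js \<phi>])
    also have "(LINT x|?M. indicator \<Omega> x * (W (index_list d \<alpha>) x * \<phi> x)) = (LINT x:\<Omega>|?L. W (index_list d \<alpha>) x * \<phi> x)"
      by (rule set_lebesgue_integral_Rd_leb[OF \<Omega>s m2, symmetric])
    finally show "(LINT x:\<Omega>|?L. h x * multi_deriv d \<alpha> \<phi> x) =
        (- 1) ^ (\<Sum>i<d. \<alpha> i) * (LINT x:\<Omega>|?L. W (index_list d \<alpha>) x * \<phi> x)"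
      by (simp only: length_index_list)
  qed
  have ae: "AE x in ?L. x \<in> \<Omega> \<longrightarrow> weak_deriv d \<Omega> \<alpha> h x = W (index_list d \<alpha>) x"
    if \<alpha>: "\<alpha> \<in> multi_indices d m" for \<alpha>
  proof -
    have w: "is_weak_deriv d \<Omega> \<alpha> h (weak_deriv d \<Omega> \<alpha> h)"
      unfolding weak_deriv_def using wdh[OF \<alpha>] by (rule someI[of "is_weak_deriv d \<Omega> \<alpha> h"])
    note w' = wdh[OF \<alpha>]
    let ?v = "weak_deriv d \<Omega> \<alpha> h" and ?w = "W (index_list d \<alpha>)"
    have i: "set_integrable ?L \<Omega> (\<lambda>x. f x * \<phi> x)"
      if f: "locally_integrable d \<Omega> f" and \<phi>: "\<phi> \<in> test_functions d \<Omega>" for f \<phi>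
    proof -
      obtain K where K: "compactin (Rd_top d) K" "K \<subseteq> \<Omega>" "\<And>x. x \<in> Rd d - K \<Longrightarrow> \<phi> x = 0"
        using test_functionsD(2)[OF \<phi>] by blast
      obtain b where b: "b > 0" "\<And>x. x \<in> Rd d \<Longrightarrow> \<bar>\<phi> x\<bar> \<le> b" using test_functions_bounded[OF \<phi>] by metis
      have fK: "integrable ?L (\<lambda>x. indicator K x *\<^sub>R f x)"
        using f K unfolding locally_integrable_def set_integrable_def by blast
      have \<phi>m: "\<phi> \<in> borel_measurable ?L" unfolding Lc by (rule measurable_completion[OF test_functions_measurable[OF \<phi>]])
      have "integrable ?L (\<lambda>x. (indicator K x *\<^sub>R f x) * \<phi> x)"
      proof (rule Bochner_Integration.integrable_bound)
        show "integrable ?L (\<lambda>x. norm (indicator K x *\<^sub>R f x) * b)" using fK by (intro integrable_mult_left integrable_norm)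
        show "(\<lambda>x. (indicator K x *\<^sub>R f x) * \<phi> x) \<in> borel_measurable ?L"
          using borel_measurable_integrable[OF fK] \<phi>m by (rule borel_measurable_times)
        show "AE x in ?L. norm ((indicator K x *\<^sub>R f x) * \<phi> x) \<le> norm (norm (indicator K x *\<^sub>R f x) * b)"
        proof (rule AE_I2)
          fix x assume "x \<in> space ?L"
          then have "\<bar>\<phi> x\<bar> \<le> b" using b(2) by (simp add: space_Rd_leb)
          then show "norm ((indicator K x *\<^sub>R f x) * \<phi> x) \<le> norm (norm (indicator K x *\<^sub>R f x) * b)"
            using b(1) by (simp add: abs_mult mult_left_mono)
        qed
      qed
      then show ?thesis
        unfolding set_integrable_def
      proof (rule Bochner_Integration.integrable_cong[THEN iffD1, OF refl, rotated])
        fix x assume "x \<in> space ?L"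
        then show "(indicator K x *\<^sub>R f x) * \<phi> x = indicator \<Omega> x *\<^sub>R (f x * \<phi> x)"
          using K(2,3) by (cases "x \<in> K") (auto simp: space_Rd_leb indicator_def)
      qed
    qed
    have "AE x in ?L. x \<in> \<Omega> \<longrightarrow> ?v x - ?w x = 0"
    proof (rule weak_uniqueness[OF \<Omega>(1)])
      show "locally_integrable d \<Omega> (\<lambda>x. ?v x - ?w x)"
        using w w' unfolding is_weak_deriv_def locally_integrable_def by (auto intro: set_integral_diff)
      fix \<phi> assume \<phi>: "\<phi> \<in> test_functions d \<Omega>"
      have "(- 1) ^ (\<Sum>i<d. \<alpha> i) * (LINT x:\<Omega>|?L. ?v x * \<phi> x) = (- 1) ^ (\<Sum>i<d. \<alpha> i) * (LINT x:\<Omega>|?L. ?w x * \<phi> x)"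
        using w w' \<phi> unfolding is_weak_deriv_def by metis
      then have "(LINT x:\<Omega>|?L. ?v x * \<phi> x) = (LINT x:\<Omega>|?L. ?w x * \<phi> x)" by simp
      moreover have "(LINT x:\<Omega>|?L. (?v x - ?w x) * \<phi> x) = (LINT x:\<Omega>|?L. ?v x * \<phi> x) - (LINT x:\<Omega>|?L. ?w x * \<phi> x)"
        unfolding left_diff_distrib using w w' \<phi> unfolding is_weak_deriv_def by (intro set_integral_diff i) auto
      ultimately show "(LINT x:\<Omega>|?L. (?v x - ?w x) * \<phi> x) = 0" by simp
    qed
    then show ?thesis by eventually_elim simp
  qed
  have Wsq: "integrable ?M (\<lambda>x. indicator \<Omega> x * (W js x)\<^sup>2)" if js: "js \<in> L d m" for js
  proof (rule Bochner_Integration.integrable_bound)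
    show "integrable ?M (\<lambda>x. indicator \<Omega> x * B\<^sup>2)"
      using \<Omega>(2) \<Omega>s by (intro integrable_mult_left integrable_real_indicator) auto
    show "(\<lambda>x. indicator \<Omega> x * (W js x)\<^sup>2) \<in> borel_measurable ?M" using W(1)[OF js] \<Omega>s by measurable
    show "AE x in ?M. norm (indicator \<Omega> x * (W js x)\<^sup>2) \<le> norm (indicator \<Omega> x * B\<^sup>2)"
    proof (rule AE_I2)
      fix x show "norm (indicator \<Omega> x * (W js x)\<^sup>2) \<le> norm (indicator \<Omega> x * B\<^sup>2)"
        using power_mono[OF W(2)[OF js], of x 2] by (auto simp: indicator_def)
    qed
  qed
  have sq: "set_integrable ?L \<Omega> (\<lambda>x. (weak_deriv d \<Omega> \<alpha> h x)\<^sup>2)"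
      "(LINT x:\<Omega>|?L. (weak_deriv d \<Omega> \<alpha> h x)\<^sup>2) = (LINT x|?M. indicator \<Omega> x * (W (index_list d \<alpha>) x)\<^sup>2)"
    if \<alpha>: "\<alpha> \<in> multi_indices d m" for \<alpha>
  proof -
    have js: "index_list d \<alpha> \<in> L d m" unfolding L_def by (rule index_list_mem[OF \<alpha>])
    let ?f = "\<lambda>x. indicator \<Omega> x * (W (index_list d \<alpha>) x)\<^sup>2"
    have e: "AE x in completion ?M. ?f x = indicator \<Omega> x *\<^sub>R (weak_deriv d \<Omega> \<alpha> h x)\<^sup>2"
      using ae[OF \<alpha>] unfolding Lc by eventually_elim (auto simp: indicator_def)
    have fm: "?f \<in> borel_measurable ?M" using Wsq[OF js] by (rule borel_measurable_integrable)
    show "set_integrable ?L \<Omega> (\<lambda>x. (weak_deriv d \<Omega> \<alpha> h x)\<^sup>2)"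
      unfolding set_integrable_def Lc by (rule completion_integral_cong_AE(2)[OF fm e Wsq[OF js]])
    show "(LINT x:\<Omega>|?L. (weak_deriv d \<Omega> \<alpha> h x)\<^sup>2) = (LINT x|?M. ?f x)"
      unfolding set_lebesgue_integral_def Lc by (rule completion_integral_cong_AE(1)[OF fm e])
  qed
  have "h \<in> sobolev_space d m \<Omega>"
    unfolding sobolev_space_def using wdh sq(1) by blast
  then have "sobolev_norm d m \<Omega> h = ennreal (sqrt (\<Sum>\<alpha>\<in>multi_indices d m. LINT x|?M. indicator \<Omega> x * (W (index_list d \<alpha>) x)\<^sup>2))"
    unfolding sobolev_norm_def using sq(2) by simp
  also have "(\<Sum>\<alpha>\<in>multi_indices d m. LINT x|?M. indicator \<Omega> x * (W (index_list d \<alpha>) x)\<^sup>2) =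
      (\<Sum>js\<in>index_list d ` multi_indices d m. LINT x|?M. indicator \<Omega> x * (W js x)\<^sup>2)"
    by (simp add: sum.reindex[OF inj_on_index_list])
  also have "ennreal (sqrt \<dots>) \<le> ennreal (sqrt E)"
  proof (intro ennreal_leI real_sqrt_le_mono order_trans[OF _ E] sum_mono2[OF fin])
    show "index_list d ` multi_indices d m \<subseteq> L d m" unfolding L_def using index_list_mem by blast
    show "0 \<le> (LINT x|?M. indicator \<Omega> x * (W js x)\<^sup>2)" for js
      by (intro Bochner_Integration.integral_nonneg) (auto simp: indicator_def)
  qed
  finally show ?thesis .
qed

section \<open>Superpositions of neurons\<close>

lemma Rd_norm_measurable [measurable]: "Rd_norm d \<in> borel_measurable (Rd_borel d)"
  unfolding Rd_norm_def[abs_def] L2_set_def by measurable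

text \<open>\<open>g\<close> is a Borel version of the Fourier transform, \<open>nz\<close> provides
  the constant of the kernel identity, and \<open>g_fin\<close> is finiteness of the Barron norm of
  order m + 1, at which the superposition already converges together with its derivatives up to
  order m.\<close>

locale barron_rep = ridge_setup +
  fixes d :: nat and x0 :: "nat \<Rightarrow> real" and g :: "(nat \<Rightarrow> real) \<Rightarrow> complex"
  assumes s_cont: "\<And>k. k \<le> m \<Longrightarrow> continuous_on UNIV (s k)"
    and s_der: "\<And>k x. k < m \<Longrightarrow> (s k has_real_derivative s (Suc k) x) (at x)"
    and nz: "(LINT y|lborel. complex_of_real (s 0 y) * iexp (- a * y)) \<noteq> 0"
    and g[measurable]: "g \<in> borel_measurable (Rd_borel d)"
    and g_fin: "(\<integral>\<^sup>+\<omega>. ennreal ((1 + Rd_norm d \<omega>) ^ (m + 1) * cmod (g \<omega>)) \<partial>Rd_borel d) < \<infinity>"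
begin

definition Z :: "((nat \<Rightarrow> real) \<times> real) measure" where "Z = Rd_borel d \<Otimes>\<^sub>M lborel"

definition kappa :: complex where
  "kappa = 1 / (LINT y|lborel. complex_of_real (s 0 y) * iexp (- a * y))"

text \<open>Since \<open>\<integral> s (\<omega> \<cdot> y / a + b) exp (- i a b) db = exp (i \<omega> \<cdot> y) / \<kappa>\<close>, the Fourier inversion
  formula becomes a superposition of neurons with density \<open>q\<close>.\<close>

definition q :: "(nat \<Rightarrow> real) \<times> real \<Rightarrow> real" where
  "q z = Re (kappa * iexp (- a * snd z) * (iexp (Rd_inner d (fst z) x0) * g (fst z)))"

text \<open>At frequency omega the bias integral of the decay is at most 2 c0 |omega| + 2 / (p - 1);
  this constant turns the bound into a multiple of 1 + |omega|.\<close>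

definition mass_const :: real where "mass_const = 2 * c0 + 2 / (p - 1)"

lemma mass_const: "mass_const > 0" using p c0 by (simp add: mass_const_def add_nonneg_pos)

lemma mass_const_linear:
  assumes "0 \<le> y" shows "2 * (c0 * y) + 2 / (p - 1) \<le> mass_const * (1 + y)"
proof -
  define e where "e = 2 / (p - 1)"
  have "e \<ge> 0" using p by (simp add: e_def)
  then have "0 \<le> 2 * c0 + e * y" using c0 assms by simp
  moreover have "mass_const * (1 + y) = (2 * (c0 * y) + e) + (2 * c0 + e * y)"
    unfolding mass_const_def e_def[symmetric] by (simp add: algebra_simps)
  ultimately show ?thesis unfolding e_def[symmetric] by linarith
qed

lemma space_Z: "space Z = Rd d \<times> UNIV" by (simp add: Z_def space_pair_measure space_Rd_borel)

lemma sigma_finite_Z: "sigma_finite_measure Z"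
  unfolding Z_def by (intro sigma_finite_pair_measure sigma_finite_Rd_borel) standard

lemma s_meas: "k \<le> m \<Longrightarrow> s k \<in> borel_measurable borel"
  by (intro borel_measurable_continuous_onI s_cont)

lemma fst_measurable: "fst \<in> measurable Z (Rd_borel d)" and snd_measurable: "snd \<in> borel_measurable Z"
  unfolding Z_def by measurable

lemma Rd_inner_measurable': "(\<lambda>x. Rd_inner d x w) \<in> borel_measurable (Rd_borel d)"
  unfolding Rd_inner_def by measurable

lemma q_measurable [measurable]: "q \<in> borel_measurable Z"
proof -
  note [measurable] = fst_measurable snd_measurable
  have [measurable]: "(\<lambda>z. g (fst z)) \<in> borel_measurable Z" by (rule measurable_compose[OF fst_measurable g])
  have [measurable]: "(\<lambda>z. Rd_inner d (fst z) x0) \<in> borel_measurable Z"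
    by (rule measurable_compose[OF fst_measurable Rd_inner_measurable'])
  show ?thesis unfolding q_def by measurable
qed

lemma norm_fst_measurable: "(\<lambda>z. Rd_norm d (fst z)) \<in> borel_measurable Z"
  by (rule measurable_compose[OF fst_measurable Rd_norm_measurable])

lemma wt_measurable: "(\<lambda>z. wt d z) \<in> borel_measurable Z"
proof -
  note [measurable] = norm_fst_measurable snd_measurable
  show ?thesis unfolding weight_def excess_def by measurable
qed

lemma q_bound: "\<bar>q z\<bar> \<le> cmod kappa * cmod (g (fst z))"
proof -
  have "\<bar>q z\<bar> \<le> cmod (kappa * iexp (- a * snd z) * (iexp (Rd_inner d (fst z) x0) * g (fst z)))"
    unfolding q_def by (rule abs_Re_le_cmod)
  also have "\<dots> = cmod kappa * cmod (g (fst z))" by (simp add: norm_mult)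
  finally show ?thesis .
qed

text \<open>The bias is integrated first, at fixed frequency, after the oscillating density is
  bounded by its modulus. \<open>T\<close> will be the whole space for the total mass and
  \<open>tail_set\<close> for the remainder.\<close>

lemma nn_integral_q_weight_le:
  assumes T: "T \<in> sets Z"
    and c: "\<And>\<omega>. \<omega> \<in> Rd d \<Longrightarrow>
      (\<integral>\<^sup>+b. ennreal ((1 + max 0 (\<bar>b\<bar> - c0 * Rd_norm d \<omega>)) powr (- p)) * indicator T (\<omega>, b) \<partial>lborel) \<le> ennreal (c \<omega>)"
  shows "(\<integral>\<^sup>+z. ennreal (\<bar>q z\<bar> * wt d z) * indicator T z \<partial>Z) \<le>
    (\<integral>\<^sup>+\<omega>. ennreal (cmod kappa * cmod (g \<omega>) * (1 + Rd_norm d \<omega>) ^ m) * ennreal (c \<omega>) \<partial>Rd_borel d)"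
proof -
  note [measurable] = wt_measurable T
  have "(\<lambda>z. ennreal (\<bar>q z\<bar> * wt d z) * indicator T z) \<in> borel_measurable Z" by measurable
  then have "(\<integral>\<^sup>+z. ennreal (\<bar>q z\<bar> * wt d z) * indicator T z \<partial>Z) =
      (\<integral>\<^sup>+\<omega>. (\<integral>\<^sup>+b. ennreal (\<bar>q (\<omega>, b)\<bar> * wt d (\<omega>, b)) * indicator T (\<omega>, b) \<partial>lborel) \<partial>Rd_borel d)"
    unfolding Z_def by (subst lborel.nn_integral_fst[symmetric]) auto
  also have "\<dots> \<le> (\<integral>\<^sup>+\<omega>. ennreal (cmod kappa * cmod (g \<omega>) * (1 + Rd_norm d \<omega>) ^ m) * ennreal (c \<omega>) \<partial>Rd_borel d)"
  proof (rule nn_integral_mono)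
    fix \<omega> assume "\<omega> \<in> space (Rd_borel d)"
    then have \<omega>: "\<omega> \<in> Rd d" by (simp add: space_Rd_borel)
    let ?A = "cmod kappa * cmod (g \<omega>) * (1 + Rd_norm d \<omega>) ^ m"
    have A0: "0 \<le> ?A" by simp
    have Tm: "(\<lambda>b. indicator T (\<omega>, b) :: ennreal) \<in> borel_measurable lborel"
    proof -
      have "(\<lambda>z. indicator T z :: ennreal) \<in> borel_measurable (Rd_borel d \<Otimes>\<^sub>M lborel)"
        using T unfolding Z_def by simp
      from measurable_Pair2[OF this] \<open>\<omega> \<in> space (Rd_borel d)\<close> show ?thesis by simp
    qed
    have "(\<integral>\<^sup>+b. ennreal (\<bar>q (\<omega>, b)\<bar> * wt d (\<omega>, b)) * indicator T (\<omega>, b) \<partial>lborel) \<le>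
        (\<integral>\<^sup>+b. ennreal ?A * (ennreal ((1 + max 0 (\<bar>b\<bar> - c0 * Rd_norm d \<omega>)) powr (- p)) * indicator T (\<omega>, b)) \<partial>lborel)"
    proof (rule nn_integral_mono)
      fix b
      have "\<bar>q (\<omega>, b)\<bar> * wt d (\<omega>, b) \<le> (cmod kappa * cmod (g \<omega>)) * wt d (\<omega>, b)"
        using q_bound[of "(\<omega>, b)"] weight_pos[of d m p c0 "(\<omega>, b)"] by (intro mult_right_mono) auto
      also have "\<dots> = ?A * (1 + max 0 (\<bar>b\<bar> - c0 * Rd_norm d \<omega>)) powr (- p)"
        by (simp add: weight_def excess_def)
      finally show "ennreal (\<bar>q (\<omega>, b)\<bar> * wt d (\<omega>, b)) * indicator T (\<omega>, b) \<le>
          ennreal ?A * (ennreal ((1 + max 0 (\<bar>b\<bar> - c0 * Rd_norm d \<omega>)) powr (- p)) * indicator T (\<omega>, b))"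
        using A0 by (auto simp: indicator_def ennreal_leI simp flip: ennreal_mult)
    qed
    also have "\<dots> = ennreal ?A * (\<integral>\<^sup>+b. ennreal ((1 + max 0 (\<bar>b\<bar> - c0 * Rd_norm d \<omega>)) powr (- p)) * indicator T (\<omega>, b) \<partial>lborel)"
      by (rule nn_integral_cmult) (use Tm in measurable)
    also have "\<dots> \<le> ennreal ?A * ennreal (c \<omega>)" by (intro mult_left_mono c \<omega>) auto
    finally show "(\<integral>\<^sup>+b. ennreal (\<bar>q (\<omega>, b)\<bar> * wt d (\<omega>, b)) * indicator T (\<omega>, b) \<partial>lborel) \<le> ennreal ?A * ennreal (c \<omega>)" .
  qed
  finally show ?thesis .
qed

lemma nn_integral_q_weight:
  "(\<integral>\<^sup>+z. ennreal (\<bar>q z\<bar> * wt d z) \<partial>Z) \<le>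
    ennreal (cmod kappa * mass_const) * (\<integral>\<^sup>+\<omega>. ennreal ((1 + Rd_norm d \<omega>) ^ (m + 1) * cmod (g \<omega>)) \<partial>Rd_borel d)"
proof -
  have "(\<integral>\<^sup>+z. ennreal (\<bar>q z\<bar> * wt d z) \<partial>Z) = (\<integral>\<^sup>+z. ennreal (\<bar>q z\<bar> * wt d z) * indicator (space Z) z \<partial>Z)"
    by (intro nn_integral_cong) simp
  also have "\<dots> \<le> (\<integral>\<^sup>+\<omega>. ennreal (cmod kappa * cmod (g \<omega>) * (1 + Rd_norm d \<omega>) ^ m) *
      ennreal (2 * (c0 * Rd_norm d \<omega>) + 2 / (p - 1)) \<partial>Rd_borel d)"
  proof (rule nn_integral_q_weight_le)
    fix \<omega> assume "\<omega> \<in> Rd d"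
    then show "(\<integral>\<^sup>+b. ennreal ((1 + max 0 (\<bar>b\<bar> - c0 * Rd_norm d \<omega>)) powr (- p)) * indicator (space Z) (\<omega>, b) \<partial>lborel)
        \<le> ennreal (2 * (c0 * Rd_norm d \<omega>) + 2 / (p - 1))"
      using nn_integral_weight[of "c0 * Rd_norm d \<omega>" p] c0 p by (simp add: space_Z)
  qed simp
  also have "\<dots> \<le> (\<integral>\<^sup>+\<omega>. ennreal (cmod kappa * mass_const) * ennreal ((1 + Rd_norm d \<omega>) ^ (m + 1) * cmod (g \<omega>)) \<partial>Rd_borel d)"
  proof (rule nn_integral_mono)
    fix \<omega>
    have "2 * (c0 * Rd_norm d \<omega>) + 2 / (p - 1) \<le> mass_const * (1 + Rd_norm d \<omega>)"
      by (rule mass_const_linear) simp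
    then have "(cmod kappa * cmod (g \<omega>) * (1 + Rd_norm d \<omega>) ^ m) * (2 * (c0 * Rd_norm d \<omega>) + 2 / (p - 1)) \<le>
        (cmod kappa * cmod (g \<omega>) * (1 + Rd_norm d \<omega>) ^ m) * (mass_const * (1 + Rd_norm d \<omega>))"
      by (intro mult_left_mono) auto
    also have "\<dots> = (cmod kappa * mass_const) * ((1 + Rd_norm d \<omega>) ^ (m + 1) * cmod (g \<omega>))"
      by simp
    finally have "ennreal ((cmod kappa * cmod (g \<omega>) * (1 + Rd_norm d \<omega>) ^ m) * (2 * (c0 * Rd_norm d \<omega>) + 2 / (p - 1))) \<le>
        ennreal ((cmod kappa * mass_const) * ((1 + Rd_norm d \<omega>) ^ (m + 1) * cmod (g \<omega>)))"
      by (rule ennreal_leI)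
    then show "ennreal (cmod kappa * cmod (g \<omega>) * (1 + Rd_norm d \<omega>) ^ m) * ennreal (2 * (c0 * Rd_norm d \<omega>) + 2 / (p - 1))
      \<le> ennreal (cmod kappa * mass_const) * ennreal ((1 + Rd_norm d \<omega>) ^ (m + 1) * cmod (g \<omega>))"
      using mass_const
      by (subst (1 2) ennreal_mult'[symmetric]) auto
  qed
  also have "\<dots> = ennreal (cmod kappa * mass_const) * (\<integral>\<^sup>+\<omega>. ennreal ((1 + Rd_norm d \<omega>) ^ (m + 1) * cmod (g \<omega>)) \<partial>Rd_borel d)"
    by (rule nn_integral_cmult) measurable
  finally show ?thesis .
qed

text \<open>The bound on the bias is larger by the factor c0 + 1: at a frequency of norm at most r,
  a bias in the tail lies beyond the plateau of the weight by more than r.\<close>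

definition tail_set :: "real \<Rightarrow> ((nat \<Rightarrow> real) \<times> real) set" where
  "tail_set r = {z \<in> space Z. Rd_norm d (fst z) > r \<or> \<bar>snd z\<bar> > (c0 + 1) * r}"

lemma tail_set_sets: "tail_set r \<in> sets Z"
proof -
  note [measurable] = norm_fst_measurable snd_measurable
  show ?thesis unfolding tail_set_def by measurable
qed

text \<open>Large frequencies pay with t further powers of 1 + |omega|, as r < |omega|. At small
  frequencies the bias is far out and the decay gives (1 + r)^(1 - p), which is at most r^(-t)
  because t <= p - 1; this is why t is a minimum of p - 1 and eps in the rate.\<close>

lemma nn_integral_q_weight_tail:
  assumes r: "r \<ge> 1" and t: "0 < t" "t \<le> p - 1"
  shows "(\<integral>\<^sup>+z. ennreal (\<bar>q z\<bar> * wt d z) * indicator (tail_set r) z \<partial>Z) \<le>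
    ennreal (cmod kappa * mass_const * r powr (- t)) *
    (\<integral>\<^sup>+\<omega>. ennreal ((1 + Rd_norm d \<omega>) powr (real m + 1 + t) * cmod (g \<omega>)) \<partial>Rd_borel d)"
proof -
  have "(\<integral>\<^sup>+z. ennreal (\<bar>q z\<bar> * wt d z) * indicator (tail_set r) z \<partial>Z) \<le>
     (\<integral>\<^sup>+\<omega>. ennreal (cmod kappa * cmod (g \<omega>) * (1 + Rd_norm d \<omega>) ^ m) *
      ennreal (mass_const * r powr (- t) * ((1 + Rd_norm d \<omega>) * (1 + Rd_norm d \<omega>) powr t)) \<partial>Rd_borel d)"
  proof (rule nn_integral_q_weight_le[OF tail_set_sets])
    fix \<omega> assume \<omega>: "\<omega> \<in> Rd d"
    let ?n = "Rd_norm d \<omega>"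
    let ?h = "\<lambda>b. ennreal ((1 + max 0 (\<bar>b\<bar> - c0 * ?n)) powr (- p))"
    show "(\<integral>\<^sup>+b. ?h b * indicator (tail_set r) (\<omega>, b) \<partial>lborel) \<le>
        ennreal (mass_const * r powr (- t) * ((1 + ?n) * (1 + ?n) powr t))"
    proof (cases "?n > r")
      case True
      have "(\<integral>\<^sup>+b. ?h b * indicator (tail_set r) (\<omega>, b) \<partial>lborel) \<le> (\<integral>\<^sup>+b. ?h b \<partial>lborel)"
        by (intro nn_integral_mono) (auto simp: indicator_def)
      also have "\<dots> \<le> ennreal (2 * (c0 * ?n) + 2 / (p - 1))"
        using c0 p by (intro nn_integral_weight) auto
      also have "\<dots> \<le> ennreal (mass_const * r powr (- t) * ((1 + ?n) * (1 + ?n) powr t))"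
      proof (rule ennreal_leI)
        have "2 * (c0 * ?n) + 2 / (p - 1) \<le> mass_const * (1 + ?n)"
          by (rule mass_const_linear) simp
        also have "\<dots> = mass_const * (1 + ?n) * 1" by simp
        also have "\<dots> \<le> mass_const * (1 + ?n) * (r powr (- t) * (1 + ?n) powr t)"
        proof (rule mult_left_mono)
          have "r powr t \<le> (1 + ?n) powr t" using True r t by (intro powr_mono2) auto
          then have "r powr (- t) * r powr t \<le> r powr (- t) * (1 + ?n) powr t" by (intro mult_left_mono) auto
          then show "1 \<le> r powr (- t) * (1 + ?n) powr t" using r by (simp add: powr_minus)
        qed (use mass_const in auto)
        finally show "2 * (c0 * ?n) + 2 / (p - 1) \<le> mass_const * r powr (- t) * ((1 + ?n) * (1 + ?n) powr t)"
          by (simp add: mult_ac)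
      qed
      finally show ?thesis .
    next
      case False
      have cn: "c0 * ?n \<le> c0 * r" using False c0 by (intro mult_left_mono) auto
      have "(\<integral>\<^sup>+b. ?h b * indicator (tail_set r) (\<omega>, b) \<partial>lborel) \<le>
          (\<integral>\<^sup>+b. ?h b * indicator {b. \<bar>b\<bar> \<ge> c0 * ?n + r} b \<partial>lborel)"
      proof (intro nn_integral_mono mult_left_mono)
        fix b
        have "c0 * ?n + r \<le> (c0 + 1) * r" using cn by (simp add: algebra_simps)
        then show "indicator (tail_set r) (\<omega>, b) \<le> (indicator {b. \<bar>b\<bar> \<ge> c0 * ?n + r} b :: ennreal)"
          using False by (auto simp: tail_set_def indicator_def)
      qed auto
      also have "\<dots> \<le> ennreal (2 * (1 + r) powr (1 - p) / (p - 1))"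
        using c0 p r by (intro nn_integral_weight_tail) auto
      also have "\<dots> \<le> ennreal (mass_const * r powr (- t) * ((1 + ?n) * (1 + ?n) powr t))"
      proof (rule ennreal_leI)
        have "(1 + r) powr (1 - p) \<le> (1 + r) powr (- t)" using r t by (intro powr_mono) auto
        also have "\<dots> \<le> r powr (- t)" using r t by (intro powr_mono2') auto
        finally have "2 * (1 + r) powr (1 - p) / (p - 1) \<le> 2 / (p - 1) * r powr (- t)"
          using p by (simp add: divide_right_mono)
        also have "\<dots> \<le> mass_const * r powr (- t)" using c0 by (intro mult_right_mono) (auto simp: mass_const_def)
        also have "\<dots> = mass_const * r powr (- t) * (1 * 1)" by simp
        also have "\<dots> \<le> mass_const * r powr (- t) * ((1 + ?n) * (1 + ?n) powr t)"
          using mass_const t ge_one_powr_ge_zero[of "1 + ?n" t]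
          by (intro mult_left_mono mult_mono) auto
        finally show "2 * (1 + r) powr (1 - p) / (p - 1) \<le> mass_const * r powr (- t) * ((1 + ?n) * (1 + ?n) powr t)" .
      qed
      finally show ?thesis .
    qed
  qed
  also have "\<dots> = (\<integral>\<^sup>+\<omega>. ennreal (cmod kappa * mass_const * r powr (- t)) *
      ennreal ((1 + Rd_norm d \<omega>) powr (real m + 1 + t) * cmod (g \<omega>)) \<partial>Rd_borel d)"
  proof (rule nn_integral_cong)
    fix \<omega>
    have n: "0 < 1 + Rd_norm d \<omega>" using Rd_norm_nonneg[of d \<omega>] by linarith
    have "(1 + Rd_norm d \<omega>) powr (real m + 1 + t) = (1 + Rd_norm d \<omega>) ^ m * ((1 + Rd_norm d \<omega>) * (1 + Rd_norm d \<omega>) powr t)"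
      using n by (simp add: powr_add powr_realpow)
    then show "ennreal (cmod kappa * cmod (g \<omega>) * (1 + Rd_norm d \<omega>) ^ m) *
        ennreal (mass_const * r powr (- t) * ((1 + Rd_norm d \<omega>) * (1 + Rd_norm d \<omega>) powr t)) =
      ennreal (cmod kappa * mass_const * r powr (- t)) * ennreal ((1 + Rd_norm d \<omega>) powr (real m + 1 + t) * cmod (g \<omega>))"
      using n mass_const by (simp add: mult_ac flip: ennreal_mult)
  qed
  also have "\<dots> = ennreal (cmod kappa * mass_const * r powr (- t)) *
      (\<integral>\<^sup>+\<omega>. ennreal ((1 + Rd_norm d \<omega>) powr (real m + 1 + t) * cmod (g \<omega>)) \<partial>Rd_borel d)"
    by (rule nn_integral_cmult) measurable
  finally show ?thesis .
qed

lemma g_integrable: "integrable (Rd_borel d) g"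
proof (rule integrableI_bounded)
  have "(\<integral>\<^sup>+\<omega>. ennreal (norm (g \<omega>)) \<partial>Rd_borel d) \<le> (\<integral>\<^sup>+\<omega>. ennreal ((1 + Rd_norm d \<omega>) ^ (m + 1) * cmod (g \<omega>)) \<partial>Rd_borel d)"
  proof (intro nn_integral_mono ennreal_leI)
    fix \<omega>
    have "1 \<le> (1 + Rd_norm d \<omega>) ^ (m + 1)" by (rule one_le_power) simp
    then show "norm (g \<omega>) \<le> (1 + Rd_norm d \<omega>) ^ (m + 1) * cmod (g \<omega>)"
      using mult_right_mono[of 1 _ "cmod (g \<omega>)"] by fastforce
  qed
  then show "(\<integral>\<^sup>+\<omega>. ennreal (norm (g \<omega>)) \<partial>Rd_borel d) < \<infinity>" using g_fin by (rule le_less_trans)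
qed measurable

lemma qw_integrable: "integrable Z (\<lambda>z. \<bar>q z\<bar> * wt d z)"
proof (rule integrableI_bounded)
  show "(\<lambda>z. \<bar>q z\<bar> * wt d z) \<in> borel_measurable Z" using wt_measurable by measurable
  have "(\<integral>\<^sup>+z. ennreal (norm (\<bar>q z\<bar> * wt d z)) \<partial>Z) = (\<integral>\<^sup>+z. ennreal (\<bar>q z\<bar> * wt d z) \<partial>Z)"
    using weight_pos[of d m p c0] by (intro nn_integral_cong) (simp add: abs_mult less_imp_le)
  also have "\<dots> < \<infinity>"
    by (rule le_less_trans[OF nn_integral_q_weight]) (use g_fin in \<open>auto simp: ennreal_mult_less_top\<close>)
  finally show "(\<integral>\<^sup>+z. ennreal (norm (\<bar>q z\<bar> * wt d z)) \<partial>Z) < \<infinity>" .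
qed

section \<open>The superposition and its weak derivatives\<close>

lemma lists_upto_props: "js \<in> lists_upto d \<Longrightarrow> set js \<subseteq> {..<d} \<and> length js \<le> m"
  by (auto simp: lists_upto_def index_lists_def)

lemma Nil_lists_upto: "[] \<in> lists_upto d"
  by (auto simp: lists_upto_def index_lists_def)

lemma component_measurable: "i < d \<Longrightarrow> (\<lambda>z. fst z i) \<in> borel_measurable Z"
proof -
  assume "i < d"
  then have "(\<lambda>x. x i) \<in> borel_measurable (Rd_borel d)"
    using measurable_component_singleton[of i "{..<d}" "\<lambda>_. lborel :: real measure"] by simp
  from measurable_compose[OF fst_measurable this] show ?thesis .
qed

lemma ridge_measurable:
  assumes "js \<in> lists_upto d"
  shows "(\<lambda>(z, x). ridge d a s x0 js z x) \<in> borel_measurable (Z \<Otimes>\<^sub>M Rd_borel d)"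
proof -
  have js: "set js \<subseteq> {..<d}" "length js \<le> m" using lists_upto_props[OF assms] by auto
  have zc: "(\<lambda>zx. fst (fst zx) i) \<in> borel_measurable (Z \<Otimes>\<^sub>M Rd_borel d)" if "i < d" for i
    by (rule measurable_compose[OF measurable_fst component_measurable[OF that]])
  have xc: "(\<lambda>zx. snd zx i) \<in> borel_measurable (Z \<Otimes>\<^sub>M Rd_borel d)" if "i < d" for i
  proof -
    have "(\<lambda>x. x i) \<in> borel_measurable (Rd_borel d)"
      using measurable_component_singleton[of i "{..<d}" "\<lambda>_. lborel :: real measure"] that by simp
    from measurable_compose[OF measurable_snd this] show ?thesis .
  qed
  have bc: "(\<lambda>zx. snd (fst zx)) \<in> borel_measurable (Z \<Otimes>\<^sub>M Rd_borel d)"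
    by (rule measurable_compose[OF measurable_fst snd_measurable])
  have tm: "(\<lambda>zx. tensor (\<lambda>i. fst (fst zx) i / a) js) \<in> borel_measurable (Z \<Otimes>\<^sub>M Rd_borel d)"
    using js(1)
  proof (induction js)
    case (Cons i js)
    then have "(\<lambda>zx. fst (fst zx) i / a) \<in> borel_measurable (Z \<Otimes>\<^sub>M Rd_borel d)" using zc[of i] by simp
    moreover have "(\<lambda>zx. tensor (\<lambda>i. fst (fst zx) i / a) js) \<in> borel_measurable (Z \<Otimes>\<^sub>M Rd_borel d)"
      using Cons by simp
    ultimately show ?case
      unfolding tensor_def list.map prod_list.Cons by (rule borel_measurable_times)
  qed (simp add: tensor_def)
  have "(\<lambda>zx. ridge_arg d a x0 (fst zx) (snd zx)) \<in> borel_measurable (Z \<Otimes>\<^sub>M Rd_borel d)"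
    unfolding ridge_arg_def Rd_inner_def using zc xc bc by auto
  from measurable_compose[OF this s_meas[OF js(2)]] tm
  show ?thesis unfolding ridge_def split_beta' by simp
qed

lemma nridge_abs_bound:
  assumes js: "js \<in> lists_upto d" and x: "Rd_norm d (\<lambda>i. x i - x0 i) \<le> R"
  shows "\<bar>nridge d x0 js z x\<bar> \<le> sqrt K1"
proof -
  have "(nridge d x0 js z x)\<^sup>2 \<le> (\<Sum>js\<in>lists_upto d. (nridge d x0 js z x)\<^sup>2)"
    using js finite_lists_upto by (intro member_le_sum) auto
  also have "\<dots> \<le> K1" by (rule nridge_sum_bound[OF x])
  finally show ?thesis using real_sqrt_le_mono by fastforce
qed

lemma ridge_eq_nridge: "ridge d a s x0 js z x = wt d z * nridge d x0 js z x"
  using weight_pos[of d m p c0 z] by (simp add: nridge_def)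

lemma q_ridge_bound:
  assumes js: "js \<in> lists_upto d" and x: "Rd_norm d (\<lambda>i. x i - x0 i) \<le> R"
  shows "\<bar>q z * ridge d a s x0 js z x\<bar> \<le> (\<bar>q z\<bar> * wt d z) * sqrt K1"
  unfolding ridge_eq_nridge abs_mult
  using nridge_abs_bound[OF js x, of z] weight_pos[of d m p c0 z]
  by (simp add: mult.assoc mult_left_mono)

lemma q_ridge_measurable:
  assumes js: "js \<in> lists_upto d" and x: "x \<in> Rd d"
  shows "(\<lambda>z. q z * ridge d a s x0 js z x) \<in> borel_measurable Z"
  using measurable_Pair1[OF ridge_measurable[OF js], of x] x by (simp add: space_Rd_borel)

lemma q_ridge_integrable:
  assumes js: "js \<in> lists_upto d" and x: "x \<in> Rd d" "Rd_norm d (\<lambda>i. x i - x0 i) \<le> R"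
  shows "integrable Z (\<lambda>z. q z * ridge d a s x0 js z x)"
proof (rule Bochner_Integration.integrable_bound)
  show "integrable Z (\<lambda>z. (\<bar>q z\<bar> * wt d z) * sqrt K1)" using qw_integrable by (rule integrable_mult_left)
  show "AE z in Z. norm (q z * ridge d a s x0 js z x) \<le> norm ((\<bar>q z\<bar> * wt d z) * sqrt K1)"
    using q_ridge_bound[OF js x(2)] by (intro AE_I2) (metis abs_ge_self order_trans real_norm_def)
qed (rule q_ridge_measurable[OF js x(1)])

text \<open>\<open>superpos []\<close> will be the function itself and \<open>superpos js\<close>
  its weak derivative along \<open>js\<close>, obtained by differentiating the neurons.\<close>

definition superpos :: "nat list \<Rightarrow> (nat \<Rightarrow> real) \<Rightarrow> real" where
  "superpos js x = (LINT z|Z. q z * ridge d a s x0 js z x)"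

lemma superpos_measurable:
  assumes "js \<in> lists_upto d" shows "superpos js \<in> borel_measurable (Rd_borel d)"
proof -
  interpret sigma_finite_measure Z by (rule sigma_finite_Z)
  have "(\<lambda>(x, z). ridge d a s x0 js z x) \<in> borel_measurable (Rd_borel d \<Otimes>\<^sub>M Z)"
    using measurable_compose[OF measurable_pair_swap' ridge_measurable[OF assms]] by (simp add: split_beta')
  then have "(\<lambda>(x, z). q z * ridge d a s x0 js z x) \<in> borel_measurable (Rd_borel d \<Otimes>\<^sub>M Z)"
    unfolding split_beta' by measurable
  then show ?thesis unfolding superpos_def by (rule borel_measurable_lebesgue_integral)
qed

lemma s0_integrable: "integrable lborel (s 0)"
  by (rule Bochner_Integration.integrable_bound[OF integrable_mult_right[OF integrable_powr_decay[OF p], of Cs]])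
     (use s_meas[of 0] s_bound[of 0] Cs in \<open>auto simp: abs_mult\<close>)

text \<open>Translating the bias by \<open>u\<close> costs a phase; the remaining integral is the
  constant that \<open>kappa\<close> inverts.\<close>

lemma kappa_shift:
  "kappa * (LINT b|lborel. complex_of_real (s 0 (u + b)) * iexp (- a * b)) = iexp (a * u)"
proof -
  let ?F = "\<lambda>y. complex_of_real (s 0 y) * iexp (- a * y)"
  have "(LINT y|lborel. ?F y) = (LINT b|lborel. ?F (u + 1 * b))"
    using lborel_integral_real_affine[of 1 ?F u] by simp
  also have "\<dots> = (LINT b|lborel. iexp (- a * u) * (complex_of_real (s 0 (u + b)) * iexp (- a * b)))"
    by (intro Bochner_Integration.integral_cong refl) (simp add: algebra_simps exp_diff exp_add exp_minus divide_inverse)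
  also have "\<dots> = iexp (- a * u) * (LINT b|lborel. complex_of_real (s 0 (u + b)) * iexp (- a * b))"
    by (rule integral_mult_right_zero)
  finally have "iexp (a * u) * (LINT y|lborel. ?F y) = (LINT b|lborel. complex_of_real (s 0 (u + b)) * iexp (- a * b))"
    by (simp add: mult.assoc[symmetric] exp_add[symmetric])
  then show ?thesis using nz unfolding kappa_def by (simp add: field_simps)
qed

lemma superpos_eq_fourier_inverse:
  assumes x: "x \<in> Rd d" "Rd_norm d (\<lambda>i. x i - x0 i) \<le> R"
  shows "superpos [] x = Re (fourier_inverse d g x)"
proof -
  interpret M: sigma_finite_measure "Rd_borel d" by (rule sigma_finite_Rd_borel)
  interpret P: pair_sigma_finite "Rd_borel d" "lborel :: real measure" ..
  have "superpos [] x = (LINT \<omega>|Rd_borel d. (LINT b|lborel. q (\<omega>, b) * ridge d a s x0 [] (\<omega>, b) x))"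
    using P.integral_fst'[of "\<lambda>z. q z * ridge d a s x0 [] z x"] q_ridge_integrable[OF Nil_lists_upto x]
    unfolding superpos_def Z_def by simp
  also have "\<dots> = (LINT \<omega>|Rd_borel d. Re (g \<omega> * iexp (Rd_inner d \<omega> x)))"
  proof (rule Bochner_Integration.integral_cong[OF refl])
    fix \<omega>
    define u where "u = Rd_inner d (\<lambda>i. \<omega> i / a) (\<lambda>i. x i - x0 i)"
    define w where "w = iexp (Rd_inner d \<omega> x0) * g \<omega>"
    \<comment> \<open>The inner weight was divided by \<open>a\<close>, so the kernel identity
      returns the phase of \<omega> at x - x0; the factor of \<open>q\<close> that depends on
      \<open>x0\<close> restores the phase at x.\<close>
    have au: "a * u = Rd_inner d \<omega> x - Rd_inner d \<omega> x0"
      using a by (simp add: u_def Rd_inner_def sum_distrib_left right_diff_distrib sum_subtractf)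
    have int0: "integrable lborel (\<lambda>b. complex_of_real (s 0 (u + b)) * iexp (- a * b))"
    proof (rule Bochner_Integration.integrable_bound)
      show "integrable lborel (\<lambda>b. s 0 (u + 1 * b))"
        using lborel_integrable_real_affine[OF s0_integrable, of 1 u] by simp
      have "(\<lambda>b. s 0 (u + b)) \<in> borel_measurable borel"
        by (rule measurable_compose[OF _ s_meas[of 0]]) auto
      then show "(\<lambda>b. complex_of_real (s 0 (u + b)) * iexp (- a * b)) \<in> borel_measurable lborel" by measurable
    qed (auto simp: norm_mult)
    have "(LINT b|lborel. q (\<omega>, b) * ridge d a s x0 [] (\<omega>, b) x) =
        (LINT b|lborel. Re ((kappa * w) * (complex_of_real (s 0 (u + b)) * iexp (- a * b))))"
    proof (intro Bochner_Integration.integral_cong refl)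
      fix b
      have "q (\<omega>, b) * s 0 (u + b) = Re ((kappa * iexp (- a * b) * w) * complex_of_real (s 0 (u + b)))"
        unfolding q_def w_def by (simp only: fst_conv snd_conv times_complex.sel Re_complex_of_real Im_complex_of_real mult_zero_right diff_zero)
      also have "(kappa * iexp (- a * b) * w) * complex_of_real (s 0 (u + b)) = (kappa * w) * (complex_of_real (s 0 (u + b)) * iexp (- a * b))"
        by (simp only: mult_ac)
      finally show "q (\<omega>, b) * ridge d a s x0 [] (\<omega>, b) x = Re ((kappa * w) * (complex_of_real (s 0 (u + b)) * iexp (- a * b)))"
        by (simp add: ridge_def tensor_def ridge_arg_def u_def)
    qed
    also have "\<dots> = Re (LINT b|lborel. (kappa * w) * (complex_of_real (s 0 (u + b)) * iexp (- a * b)))"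
      by (rule integral_Re[OF integrable_mult_right[OF int0]])
    also have "(LINT b|lborel. (kappa * w) * (complex_of_real (s 0 (u + b)) * iexp (- a * b))) = w * iexp (a * u)"
      unfolding integral_mult_right_zero kappa_shift[symmetric] by (simp only: mult_ac)
    also have "w * iexp (a * u) = g \<omega> * iexp (Rd_inner d \<omega> x)"
      unfolding w_def au by (simp add: exp_diff right_diff_distrib)
    finally show "(LINT b|lborel. q (\<omega>, b) * ridge d a s x0 [] (\<omega>, b) x) = Re (g \<omega> * iexp (Rd_inner d \<omega> x))" .
  qed
  also have "\<dots> = Re (fourier_inverse d g x)"
    unfolding fourier_inverse_def
  proof (rule integral_Re)
    show "complex_integrable (Rd_borel d) (\<lambda>\<omega>. g \<omega> * iexp (Rd_inner d \<omega> x))"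
    proof (rule Bochner_Integration.integrable_bound[OF g_integrable])
      have [measurable]: "(\<lambda>\<omega>. Rd_inner d \<omega> x) \<in> borel_measurable (Rd_borel d)" by (rule Rd_inner_measurable')
      show "(\<lambda>\<omega>. g \<omega> * iexp (Rd_inner d \<omega> x)) \<in> borel_measurable (Rd_borel d)" by measurable
    qed (auto simp: norm_mult)
  qed
  finally show ?thesis .
qed

lemma ridge_weak_derivative:
  assumes js: "js \<in> lists_upto d" and \<phi>: "\<phi> \<in> test_functions d \<Omega>"
  shows "(LINT x|Rd_borel d. ridge d a s x0 [] z x * partial_derivs js \<phi> x) =
    (- 1) ^ length js * (LINT x|Rd_borel d. ridge d a s x0 js z x * \<phi> x)"
proof -
  have js': "set js \<subseteq> {..<d}" "length js \<le> m" using lists_upto_props[OF js] by auto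
  define w where "w = (\<lambda>i. fst z i / a)"
  define c where "c = snd z - Rd_inner d w x0"
  have arg: "ridge_arg d a x0 z x = Rd_inner d w x + c" for x
    by (simp add: ridge_arg_def w_def c_def Rd_inner_def right_diff_distrib sum_subtractf)
  have b: "\<bar>s k x\<bar> \<le> Cs" if "k \<le> m" for k x
  proof -
    have "(1 + \<bar>x\<bar>) powr (- p) \<le> 1 powr (- p)" using p by (intro powr_mono2') auto
    then have "Cs * (1 + \<bar>x\<bar>) powr (- p) \<le> Cs * 1" using Cs by (intro mult_left_mono) auto
    with s_bound[OF that, of x] show ?thesis by simp
  qed
  have "(LINT x|Rd_borel d. s 0 (Rd_inner d w x + c) * partial_derivs js \<phi> x) =
      (- 1) ^ length js * (\<Prod>j\<leftarrow>js. w j) * (LINT x|Rd_borel d. s (0 + length js) (Rd_inner d w x + c) * \<phi> x)"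
    by (rule ridge_integration_by_parts[where m = m and B = Cs]) (use s_cont s_der b \<phi> js' in auto)
  then show ?thesis by (simp add: ridge_def tensor_def arg w_def[symmetric] mult.assoc)
qed

text \<open>Exchanging the integrals brings the test function to each neuron separately, where
  integration by parts is available. The exchange needs a bound on the neurons uniform in x, which
  holds on \<Omega>; elsewhere the test function vanishes.\<close>

lemma superpos_weak_derivative:
  assumes js: "js \<in> lists_upto d" and \<phi>: "\<phi> \<in> test_functions d \<Omega>"
    and \<Omega>: "\<Omega> \<in> sets (Rd_borel d)" "\<And>x. x \<in> \<Omega> \<Longrightarrow> Rd_norm d (\<lambda>i. x i - x0 i) \<le> R"
  shows "(LINT x|Rd_borel d. indicator \<Omega> x * (superpos [] x * partial_derivs js \<phi> x)) =
    (- 1) ^ length js * (LINT x|Rd_borel d. indicator \<Omega> x * (superpos js x * \<phi> x))"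
proof -
  interpret M: sigma_finite_measure "Rd_borel d" by (rule sigma_finite_Rd_borel)
  interpret Z: sigma_finite_measure Z by (rule sigma_finite_Z)
  interpret P: pair_sigma_finite Z "Rd_borel d" ..
  have outside: "\<psi> x = 0" if "\<psi> \<in> test_functions d \<Omega>" "x \<in> Rd d - \<Omega>" for \<psi> x
    using test_functionsD(2)[OF that(1)] that(2) by blast
  have swap: "(LINT x|Rd_borel d. indicator \<Omega> x * (superpos ks x * \<psi> x)) =
      (LINT z|Z. q z * (LINT x|Rd_borel d. ridge d a s x0 ks z x * \<psi> x))"
    if ks: "ks \<in> lists_upto d" and \<psi>: "\<psi> \<in> test_functions d \<Omega>" for ks \<psi>
  proof -
    have \<psi>i: "integrable (Rd_borel d) \<psi>"
      using integrable_bounded_times_test_function[OF \<psi>, of "\<lambda>_. 1" 1] by simp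
    note [measurable] = test_functions_measurable[OF \<psi>] \<Omega>(1)
    have "integrable (Z \<Otimes>\<^sub>M Rd_borel d) (\<lambda>(z, x). q z * ridge d a s x0 ks z x * \<psi> x)"
    proof (rule Bochner_Integration.integrable_bound[OF P.integrable_mult_pair[OF integrable_mult_left[OF qw_integrable] \<psi>i]])
      show "(\<lambda>(z, x). q z * ridge d a s x0 ks z x * \<psi> x) \<in> borel_measurable (Z \<Otimes>\<^sub>M Rd_borel d)"
        using ridge_measurable[OF ks] unfolding split_beta' by measurable
      show "AE zx in Z \<Otimes>\<^sub>M Rd_borel d. norm (case zx of (z, x) \<Rightarrow> q z * ridge d a s x0 ks z x * \<psi> x) \<le>
          norm (case zx of (z, x) \<Rightarrow> (\<bar>q z\<bar> * wt d z * sqrt K1) * \<psi> x)"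
      proof (rule AE_I2)
        fix zx assume "zx \<in> space (Z \<Otimes>\<^sub>M Rd_borel d)"
        then obtain z x where zx: "zx = (z, x)" "x \<in> Rd d" by (auto simp: space_pair_measure space_Rd_borel)
        show "norm (case zx of (z, x) \<Rightarrow> q z * ridge d a s x0 ks z x * \<psi> x) \<le>
          norm (case zx of (z, x) \<Rightarrow> (\<bar>q z\<bar> * wt d z * sqrt K1) * \<psi> x)"
        proof (cases "x \<in> \<Omega>")
          case True
          have "\<bar>q z * ridge d a s x0 ks z x\<bar> \<le> \<bar>\<bar>q z\<bar> * wt d z * sqrt K1\<bar>"
            using q_ridge_bound[OF ks \<Omega>(2)[OF True], of z] by linarith
          then have "\<bar>q z * ridge d a s x0 ks z x\<bar> * \<bar>\<psi> x\<bar> \<le> \<bar>\<bar>q z\<bar> * wt d z * sqrt K1\<bar> * \<bar>\<psi> x\<bar>"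
            by (intro mult_right_mono) auto
          then show ?thesis unfolding zx(1) by (simp only: prod.case real_norm_def abs_mult[of _ "\<psi> x"])
        next
          case False
          then show ?thesis using outside[OF \<psi>] zx by simp
        qed
      qed
    qed
    then have "(LINT x|Rd_borel d. (LINT z|Z. q z * ridge d a s x0 ks z x * \<psi> x)) =
        (LINT z|Z. (LINT x|Rd_borel d. q z * ridge d a s x0 ks z x * \<psi> x))"
      by (rule P.Fubini_integral)
    moreover have "(LINT x|Rd_borel d. q z * ridge d a s x0 ks z x * \<psi> x) = q z * (LINT x|Rd_borel d. ridge d a s x0 ks z x * \<psi> x)" for z
      by (simp only: mult.assoc integral_mult_right_zero)
    moreover have "(LINT x|Rd_borel d. (LINT z|Z. q z * ridge d a s x0 ks z x * \<psi> x)) =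
        (LINT x|Rd_borel d. indicator \<Omega> x * (superpos ks x * \<psi> x))"
    proof (rule Bochner_Integration.integral_cong[OF refl])
      fix x assume "x \<in> space (Rd_borel d)"
      then show "(LINT z|Z. q z * ridge d a s x0 ks z x * \<psi> x) = indicator \<Omega> x * (superpos ks x * \<psi> x)"
        using outside[OF \<psi>, of x] unfolding integral_mult_left_zero superpos_def
        by (auto simp: space_Rd_borel indicator_def)
    qed
    ultimately show ?thesis by simp
  qed
  have d\<phi>: "partial_derivs js \<phi> \<in> test_functions d \<Omega>"
    using lists_upto_props[OF js] by (intro test_functions_partial_derivs[OF \<phi>]) auto
  have "(LINT x|Rd_borel d. indicator \<Omega> x * (superpos [] x * partial_derivs js \<phi> x)) =
      (LINT z|Z. (- 1) ^ length js * (q z * (LINT x|Rd_borel d. ridge d a s x0 js z x * \<phi> x)))"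
    unfolding swap[OF Nil_lists_upto d\<phi>] ridge_weak_derivative[OF js \<phi>] by (simp only: mult.left_commute)
  also have "\<dots> = (- 1) ^ length js * (LINT x|Rd_borel d. indicator \<Omega> x * (superpos js x * \<phi> x))"
    unfolding integral_mult_right_zero swap[OF js \<phi>] ..
  finally show ?thesis .
qed

end

section \<open>Approximation by shallow networks\<close>

text \<open>Along coordinate 0 the map is an affine bijection of the line, as \<open>w 0\<close> is
  not zero, so the exceptional set meets each such line in a null set; Fubini's theorem then makes
  it null.\<close>

lemma AE_affine_Rd_inner:
  assumes P: "AE y in lebesgue. P y" and d: "d \<ge> 1" and w: "w 0 \<noteq> 0"
  shows "AE x in Rd_borel d. P (Rd_inner d w x + c)"
proof -
  interpret product_sigma_finite "\<lambda>_. lborel :: real measure" by (rule product_sigma_finite_lborel)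
  have "AE y in lborel. P y" using P by (simp add: AE_completion_iff)
  then obtain N where N: "N \<in> null_sets lborel" "{y. \<not> P y} \<subseteq> N"
    by (auto simp: eventually_ae_filter)
  have [measurable]: "N \<in> sets borel" using N(1) by auto
  have ins: "insert 0 ({..<d} - {0}) = {..<d}" using d by auto
  have im: "(\<lambda>x. Rd_inner d w x + c) \<in> borel_measurable (Rd_borel d)" by measurable
  have ind: "(\<lambda>x. indicator N (Rd_inner d w x + c) :: ennreal) \<in> borel_measurable (Rd_borel d)"
    by (rule measurable_compose[OF im]) measurable
  have "(\<integral>\<^sup>+x. indicator N (Rd_inner d w x + c) \<partial>Rd_borel d) =
      (\<integral>\<^sup>+x. (\<integral>\<^sup>+y. indicator N (Rd_inner d w (x(0 := y)) + c) \<partial>lborel) \<partial>(\<Pi>\<^sub>M j\<in>{..<d} - {0}. lborel))"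
    using product_nn_integral_insert[of "{..<d} - {0}" 0 "\<lambda>x. indicator N (Rd_inner d w x + c)"] ind
    unfolding ins by simp
  also have "\<dots> = (\<integral>\<^sup>+x. 0 \<partial>(\<Pi>\<^sub>M j\<in>{..<d} - {0}. lborel :: real measure))"
  proof (rule nn_integral_cong)
    fix x :: "nat \<Rightarrow> real"
    define r where "r = (\<Sum>j\<in>{..<d} - {0}. w j * x j) + c"
    have "(\<integral>\<^sup>+y. indicator N y \<partial>lborel) = ennreal \<bar>w 0\<bar> * (\<integral>\<^sup>+y. indicator N (r + w 0 * y) \<partial>lborel)"
      using nn_integral_real_affine[of "indicator N" "w 0" r] w by simp
    moreover have "(\<integral>\<^sup>+y. indicator N y \<partial>lborel) = 0" using N(1) by (simp add: null_setsD1)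
    ultimately have "(\<integral>\<^sup>+y. indicator N (r + w 0 * y) \<partial>lborel) = 0" using w by simp
    then show "(\<integral>\<^sup>+y. indicator N (Rd_inner d w (x(0 := y)) + c) \<partial>lborel) = 0"
      using d by (simp add: Rd_inner_upd r_def add_ac)
  qed
  finally have "(\<integral>\<^sup>+x. indicator N (Rd_inner d w x + c) \<partial>Rd_borel d) = 0" by simp
  then have "AE x in Rd_borel d. (indicator N (Rd_inner d w x + c) :: ennreal) = 0"
    using nn_integral_0_iff_AE[OF ind] by simp
  then show ?thesis
    by eventually_elim (use N(2) in \<open>auto simp: indicator_def split: if_splits\<close>)
qed

text \<open>The domain enters the estimates through its volume and through the ball of radius
  \<open>R\<close> around \<open>x0\<close> that contains it.\<close>

locale approx_setup = barron_rep +
  fixes \<Omega> :: "(nat \<Rightarrow> real) set" and \<sigma> :: "real \<Rightarrow> real" and f :: "(nat \<Rightarrow> real) \<Rightarrow> real"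
  assumes d: "d \<ge> 1" and \<Omega>: "openin (Rd_top d) \<Omega>" "emeasure (Rd_borel d) \<Omega> < \<infinity>"
    and \<Omega>R: "\<And>x. x \<in> \<Omega> \<Longrightarrow> Rd_norm d (\<lambda>i. x i - x0 i) \<le> R"
    and \<sigma>: "AE y in lebesgue. \<sigma> y = s 0 y"
    and f: "AE x in Rd_leb d. f x = Re (fourier_inverse d g x)"
begin

definition vol :: real where "vol = measure (Rd_borel d) \<Omega>"

definition X :: "(nat \<Rightarrow> real) measure" where "X = restrict_space (Rd_borel d) \<Omega>"

text \<open>The signed density is split: its modulus times the weight becomes a finite positive
  measure, its sign goes into \<open>feature\<close>, and the normalisation of the ridge functions
  cancels the weight. Integrating \<open>feature\<close> against \<open>Q\<close> thus gives back
  \<open>superpos\<close>.\<close>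

definition Q :: "((nat \<Rightarrow> real) \<times> real) measure" where
  "Q = density Z (\<lambda>z. ennreal (\<bar>q z\<bar> * wt d z))"

definition sg :: "(nat \<Rightarrow> real) \<times> real \<Rightarrow> real" where "sg z = (if 0 \<le> q z then 1 else - 1)"

definition feature :: "nat list \<Rightarrow> (nat \<Rightarrow> real) \<times> real \<Rightarrow> (nat \<Rightarrow> real) \<Rightarrow> real" where
  "feature js z x = sg z * nridge d x0 js z x"

text \<open>The activation agrees with its continuous representative only almost everywhere, and a neuron
  sees this only if its inner weight does not vanish.\<close>

definition nonzero :: "(nat \<Rightarrow> real) \<times> real \<Rightarrow> bool" where "nonzero z \<longleftrightarrow> fst z 0 \<noteq> 0"

lemma \<Omega>_sets: "\<Omega> \<in> sets (Rd_borel d)" by (rule openin_Rd_sets[OF \<Omega>(1)])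

lemma \<Omega>_sub: "\<Omega> \<subseteq> Rd d" using openin_subset[OF \<Omega>(1)] by (simp add: topspace_Rd_top)

lemma space_X: "space X = \<Omega>"
  using \<Omega>_sub by (auto simp: X_def space_restrict_space space_Rd_borel)

lemma finite_X: "finite_measure X"
proof (rule finite_measureI)
  have "emeasure X (space X) = emeasure (Rd_borel d) \<Omega>"
    using \<Omega>_sets \<Omega>_sub unfolding space_X unfolding X_def
    by (subst emeasure_restrict_space) (auto simp: space_Rd_borel Int_absorb2)
  then show "emeasure X (space X) \<noteq> \<infinity>" using \<Omega>(2) by simp
qed

lemma vol0: "0 \<le> vol" by (simp add: vol_def)

lemma measure_X: "measure X (space X) = vol"
  using \<Omega>_sets \<Omega>_sub unfolding space_X unfolding X_def vol_def
  by (subst measure_restrict_space) (auto simp: space_Rd_borel Int_absorb2)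

lemma integral_X:
  fixes h :: "(nat \<Rightarrow> real) \<Rightarrow> real"
  shows "(LINT x|X. h x) = (LINT x|Rd_borel d. indicator \<Omega> x * h x)"
  unfolding X_def using \<Omega>_sets \<Omega>_sub
  by (subst integral_restrict_space) (auto simp: space_Rd_borel Int_absorb2)

lemma qw_nonneg: "0 \<le> \<bar>q z\<bar> * wt d z"
  using weight_pos[of d m p c0 z] by simp

lemma qw_measurable: "(\<lambda>z. \<bar>q z\<bar> * wt d z) \<in> borel_measurable Z"
  using qw_integrable by (rule borel_measurable_integrable)

lemma space_Q: "space Q = space Z" and sets_Q: "sets Q = sets Z"
  by (simp_all add: Q_def)

lemma emeasure_Q: "T \<in> sets Z \<Longrightarrow> emeasure Q T = (\<integral>\<^sup>+z. ennreal (\<bar>q z\<bar> * wt d z) * indicator T z \<partial>Z)"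
  unfolding Q_def using qw_measurable by (intro emeasure_density) auto

lemma emeasure_Q_space: "emeasure Q (space Q) = (\<integral>\<^sup>+z. ennreal (\<bar>q z\<bar> * wt d z) \<partial>Z)"
  unfolding space_Q by (subst emeasure_Q) (auto intro!: nn_integral_cong)

lemma finite_Q: "finite_measure Q"
proof (rule finite_measureI)
  have "(\<integral>\<^sup>+z. ennreal (\<bar>q z\<bar> * wt d z) \<partial>Z) < \<infinity>"
    by (rule le_less_trans[OF nn_integral_q_weight]) (use g_fin in \<open>auto simp: ennreal_mult_less_top\<close>)
  then show "emeasure Q (space Q) \<noteq> \<infinity>" unfolding emeasure_Q_space by simp
qed

lemma sg_measurable: "sg \<in> borel_measurable Z"
  unfolding sg_def by measurable

lemma nridge_measurable:
  assumes "js \<in> lists_upto d"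
  shows "(\<lambda>(z, x). nridge d x0 js z x) \<in> borel_measurable (Z \<Otimes>\<^sub>M Rd_borel d)"
proof -
  have "(\<lambda>zx. wt d (fst zx)) \<in> borel_measurable (Z \<Otimes>\<^sub>M Rd_borel d)"
    by (rule measurable_compose[OF measurable_fst wt_measurable])
  then show ?thesis
    using ridge_measurable[OF assms] unfolding nridge_def split_beta' by (intro borel_measurable_divide)
qed

lemma feature_measurable_Rd:
  assumes "js \<in> lists_upto d"
  shows "(\<lambda>(z, x). feature js z x) \<in> borel_measurable (Z \<Otimes>\<^sub>M Rd_borel d)"
proof -
  have "(\<lambda>zx. sg (fst zx)) \<in> borel_measurable (Z \<Otimes>\<^sub>M Rd_borel d)"
    by (rule measurable_compose[OF measurable_fst sg_measurable])
  then show ?thesis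
    using nridge_measurable[OF assms] unfolding feature_def split_beta' by (intro borel_measurable_times)
qed

lemma feature_measurable:
  assumes "js \<in> lists_upto d"
  shows "(\<lambda>(z, x). feature js z x) \<in> borel_measurable (Q \<Otimes>\<^sub>M X)"
proof -
  have "(\<lambda>x. x) \<in> measurable X (Rd_borel d)" unfolding X_def by (rule measurable_restrict_space1) simp
  then have "(\<lambda>zx. (fst zx, snd zx)) \<in> measurable (Z \<Otimes>\<^sub>M X) (Z \<Otimes>\<^sub>M Rd_borel d)"
    by (intro measurable_Pair measurable_fst measurable_compose[OF measurable_snd])
  from measurable_compose[OF this feature_measurable_Rd[OF assms]]
  have "(\<lambda>(z, x). feature js z x) \<in> borel_measurable (Z \<Otimes>\<^sub>M X)" by (simp add: split_beta')
  then show ?thesis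
    using measurable_cong_sets[OF sets_pair_measure_cong[OF sets_Q refl] refl] by blast
qed

lemma feature_slice_measurable:
  assumes "js \<in> lists_upto d" "z \<in> space Z"
  shows "feature js z \<in> borel_measurable (Rd_borel d)"
  using measurable_Pair2[OF feature_measurable_Rd[OF assms(1)] assms(2)] by simp

lemma abs_sg: "\<bar>sg z\<bar> = 1" by (simp add: sg_def)

lemma feature_bound: "js \<in> lists_upto d \<Longrightarrow> x \<in> \<Omega> \<Longrightarrow> \<bar>feature js z x\<bar> \<le> sqrt K1"
  using nridge_abs_bound[OF _ \<Omega>R] by (simp add: feature_def abs_mult abs_sg)

lemma integral_feature:
  assumes js: "js \<in> lists_upto d" and x: "x \<in> \<Omega>"
  shows "(LINT z|Q. feature js z x) = superpos js x"
proof -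
  have xR: "x \<in> space (Rd_borel d)" using x \<Omega>_sub by (auto simp: space_Rd_borel)
  have m: "(\<lambda>z. feature js z x) \<in> borel_measurable Z"
    using measurable_Pair1[OF feature_measurable_Rd[OF js] xR] by simp
  have "(LINT z|Q. feature js z x) = (LINT z|Z. (\<bar>q z\<bar> * wt d z) *\<^sub>R feature js z x)"
    unfolding Q_def using m qw_measurable qw_nonneg by (intro integral_density) auto
  also have "\<dots> = superpos js x"
    unfolding superpos_def
  proof (intro Bochner_Integration.integral_cong refl)
    fix z
    have "\<bar>q z\<bar> * sg z = q z" by (simp add: sg_def)
    then show "(\<bar>q z\<bar> * wt d z) *\<^sub>R feature js z x = q z * ridge d a s x0 js z x"
      by (simp add: ridge_eq_nridge feature_def mult_ac)
  qed
  finally show ?thesis .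
qed

text \<open>The hyperplane of frequencies with vanishing coordinate 0 is a null set, and
  \<open>Q\<close> has a density with respect to \<open>Z\<close>.\<close>

lemma AE_nonzero: "AE z in Q. nonzero z"
proof -
  have "emeasure (Rd_borel d) (\<Pi>\<^sub>E i\<in>{..<d}. if i = 0 then {0::real} else UNIV) =
      (\<Prod>i<d. emeasure lborel (if i = 0 then {0::real} else UNIV))"
    by (rule product_sigma_finite.emeasure_PiM[OF product_sigma_finite_lborel]) auto
  also have "\<dots> = 0" using d by (intro prod_zero) (auto intro!: bexI[of _ 0])
  finally have "emeasure (Rd_borel d) (\<Pi>\<^sub>E i\<in>{..<d}. if i = 0 then {0::real} else UNIV) = 0" .
  moreover have "(\<Pi>\<^sub>E i\<in>{..<d}. if i = 0 then {0::real} else UNIV) \<in> sets (Rd_borel d)"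
    by (rule sets_PiM_I_finite) auto
  ultimately have "emeasure Z ((\<Pi>\<^sub>E i\<in>{..<d}. if i = 0 then {0::real} else UNIV) \<times> UNIV) = 0"
    and "(\<Pi>\<^sub>E i\<in>{..<d}. if i = 0 then {0::real} else UNIV) \<times> (UNIV :: real set) \<in> sets Z"
    unfolding Z_def by (subst lborel.emeasure_pair_measure_Times, auto)
  then have "AE z in Z. z \<notin> (\<Pi>\<^sub>E i\<in>{..<d}. if i = 0 then {0::real} else UNIV) \<times> UNIV"
    by (intro AE_not_in) auto
  then have "AE z in Z. nonzero z"
    using AE_space
  proof eventually_elim
    case (elim z)
    then show ?case by (cases z) (auto simp: nonzero_def space_Z Rd_def PiE_def Pi_def split: if_splits)
  qed
  then show ?thesis
    unfolding Q_def using qw_measurable by (subst AE_density) auto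
qed

lemma sum_list_integral:
  assumes "\<And>js x. js \<in> lists_upto d \<Longrightarrow> x \<in> \<Omega> \<Longrightarrow> \<bar>h js x\<bar> \<le> B"
    and "\<And>js. js \<in> lists_upto d \<Longrightarrow> h js \<in> borel_measurable X"
    and "\<And>x. x \<in> \<Omega> \<Longrightarrow> (\<Sum>js\<in>lists_upto d. (h js x)\<^sup>2) \<le> V"
  shows "(\<Sum>js\<in>lists_upto d. LINT x|X. (h js x)\<^sup>2) \<le> V * vol"
proof -
  interpret X: finite_measure X by (rule finite_X)
  have i: "integrable X (\<lambda>x. (h js x)\<^sup>2)" if "js \<in> lists_upto d" for js
  proof (rule X.integrable_const_bound[where B = "B\<^sup>2"])
    show "AE x in X. norm ((h js x)\<^sup>2) \<le> B\<^sup>2"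
    proof (rule AE_I2)
      fix x assume "x \<in> space X"
      then show "norm ((h js x)\<^sup>2) \<le> B\<^sup>2"
        using power_mono[OF assms(1)[OF that], of x 2] by (simp add: space_X)
    qed
  qed (use assms(2)[OF that] in measurable)
  have "(\<Sum>js\<in>lists_upto d. LINT x|X. (h js x)\<^sup>2) = (LINT x|X. (\<Sum>js\<in>lists_upto d. (h js x)\<^sup>2))"
    using i by (intro Bochner_Integration.integral_sum[symmetric])
  also have "\<dots> \<le> (LINT x|X. V)"
    using i assms(3) by (intro integral_mono Bochner_Integration.integrable_sum) (auto simp: space_X)
  also have "\<dots> = V * vol" by (simp add: measure_X)
  finally show ?thesis .
qed

lemma superpos_bound:
  assumes js: "js \<in> lists_upto d" and x: "x \<in> \<Omega>"
  shows "\<bar>superpos js x\<bar> \<le> (LINT z|Z. \<bar>q z\<bar> * wt d z) * sqrt K1"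
proof -
  have xR: "x \<in> Rd d" using x \<Omega>_sub by auto
  have "\<bar>superpos js x\<bar> \<le> (LINT z|Z. \<bar>q z * ridge d a s x0 js z x\<bar>)"
    unfolding superpos_def by (rule integral_abs_bound)
  also have "\<dots> \<le> (LINT z|Z. (\<bar>q z\<bar> * wt d z) * sqrt K1)"
    using q_ridge_integrable[OF js xR \<Omega>R[OF x]] q_ridge_bound[OF js \<Omega>R[OF x]] qw_integrable
    by (intro integral_mono integrable_abs integrable_mult_left) auto
  finally show ?thesis by simp
qed

text \<open>The inner weights are restricted to the index set in order to lie in
  \<open>Rd d\<close>, and the base point \<open>x0\<close> is absorbed into the bias.\<close>

definition neuron :: "(nat \<Rightarrow> real) \<times> real \<Rightarrow> (nat \<Rightarrow> real) \<Rightarrow> real" where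
  "neuron z x = \<sigma> (Rd_inner d (\<lambda>i\<in>{..<d}. fst z i / a) x + (snd z - Rd_inner d (\<lambda>i. fst z i / a) x0))"

lemma shallow_nets_sum:
  assumes I: "finite I" "card I \<le> n" and z: "\<And>i. i \<in> I \<Longrightarrow> z i \<in> space Z"
  shows "(\<lambda>x. \<Sum>i\<in>I. \<beta> i * neuron (z i) x) \<in> shallow_nets \<sigma> d n"
proof -
  obtain e where e: "bij_betw e {..<card I} I" using ex_bij_betw_nat_finite[OF I(1)] atLeast0LessThan by auto
  \<comment> \<open>Missing neurons are filled up with outer weight 0, as a network has exactly n
    summands.\<close>
  define \<beta>' where "\<beta>' k = (if k < card I then \<beta> (e k) else 0)" for k
  define \<omega>' where "\<omega>' k = (\<lambda>i\<in>{..<d}. fst (z (e k)) i / a)" for k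
  define b' where "b' k = snd (z (e k)) - Rd_inner d (\<lambda>i. fst (z (e k)) i / a) x0" for k
  have "(\<Sum>i\<in>I. \<beta> i * neuron (z i) x) = (\<Sum>k<n. \<beta>' k * \<sigma> (Rd_inner d (\<omega>' k) x + b' k))" for x
  proof -
    have "(\<Sum>i\<in>I. \<beta> i * neuron (z i) x) = (\<Sum>k<card I. \<beta> (e k) * neuron (z (e k)) x)"
      by (rule sum.reindex_bij_betw[OF e, symmetric])
    also have "\<dots> = (\<Sum>k<card I. \<beta>' k * \<sigma> (Rd_inner d (\<omega>' k) x + b' k))"
      by (intro sum.cong) (auto simp: \<beta>'_def neuron_def \<omega>'_def b'_def)
    also have "\<dots> = (\<Sum>k<n. \<beta>' k * \<sigma> (Rd_inner d (\<omega>' k) x + b' k))"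
      using I(2) by (intro sum.mono_neutral_left) (auto simp: \<beta>'_def)
    finally show ?thesis .
  qed
  moreover have "\<omega>' k \<in> Rd d" for k by (simp add: \<omega>'_def Rd_def)
  ultimately show ?thesis unfolding shallow_nets_def by blast
qed

lemma neuron_AE:
  assumes "nonzero z"
  shows "AE x in Rd_leb d. neuron z x = ridge d a s x0 [] z x"
proof -
  define w where "w = (\<lambda>i\<in>{..<d}. fst z i / a)"
  define c where "c = snd z - Rd_inner d (\<lambda>i. fst z i / a) x0"
  have "w 0 \<noteq> 0" using assms d a by (simp add: w_def nonzero_def)
  from AE_completion[OF AE_affine_Rd_inner[where P = "\<lambda>y. \<sigma> y = s 0 y" and w = w and c = c, OF \<sigma> d this]]
  have "AE x in Rd_leb d. \<sigma> (Rd_inner d w x + c) = s 0 (Rd_inner d w x + c)" unfolding Rd_leb_def .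
  moreover have "Rd_inner d w x + c = ridge_arg d a x0 z x" for x
    by (simp add: w_def c_def ridge_arg_def Rd_inner_def right_diff_distrib sum_subtractf)
  ultimately show ?thesis
    unfolding neuron_def w_def[symmetric] c_def[symmetric] by (simp add: ridge_def tensor_def)
qed

text \<open>All derivatives of the error are formed with the same neurons and coefficients:
  \<open>W js\<close> is the weak derivative of \<open>W []\<close> because integration by parts
  holds for the superposition and for every ridge function. So the sampling error summed over lists
  bounds the Sobolev norm.\<close>

lemma net_error:
  assumes I: "finite I" and z: "\<And>i. i \<in> I \<Longrightarrow> z i \<in> space Z \<and> nonzero (z i)"
    and E: "(\<Sum>js\<in>lists_upto d. LINT x|X. ((LINT z|Q. feature js z x) - (\<Sum>i\<in>I. c i * feature js (z i) x))\<^sup>2) \<le> E"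
  shows "sobolev_norm d m \<Omega> (\<lambda>x. f x - (\<Sum>i\<in>I. (c i * sg (z i) / wt d (z i)) * neuron (z i) x)) \<le> ennreal (sqrt E)"
proof -
  define W where "W js x = superpos js x - (\<Sum>i\<in>I. c i * feature js (z i) x)" for js x
  have fm: "feature js (z i) \<in> borel_measurable (Rd_borel d)" if "js \<in> lists_upto d" "i \<in> I" for js i
    using feature_slice_measurable that z by blast
  have feat: "feature js z x = sg z / wt d z * ridge d a s x0 js z x" for js z x
    by (simp add: feature_def nridge_def)
  show ?thesis
  proof (rule sobolev_norm_le[OF \<Omega>, where W = W and m = m, folded lists_upto_def,
        where B = "(LINT z|Z. \<bar>q z\<bar> * wt d z) * sqrt K1 + (\<Sum>i\<in>I. \<bar>c i\<bar> * sqrt K1)"])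
    fix js assume js: "js \<in> lists_upto d"
    show "W js \<in> borel_measurable (Rd_borel d)"
      unfolding W_def using superpos_measurable[OF js] fm[OF js] by (intro borel_measurable_diff borel_measurable_sum borel_measurable_times) auto
    show "\<bar>W js x\<bar> \<le> (LINT z|Z. \<bar>q z\<bar> * wt d z) * sqrt K1 + (\<Sum>i\<in>I. \<bar>c i\<bar> * sqrt K1)" if x: "x \<in> \<Omega>" for x
    proof -
      have "\<bar>\<Sum>i\<in>I. c i * feature js (z i) x\<bar> \<le> (\<Sum>i\<in>I. \<bar>c i\<bar> * sqrt K1)"
        by (rule order_trans[OF sum_abs sum_mono]) (use feature_bound[OF js x] in \<open>auto simp: abs_mult mult_left_mono\<close>)
      then show ?thesis unfolding W_def using superpos_bound[OF js x] by linarith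
    qed
    fix \<phi> assume \<phi>: "\<phi> \<in> test_functions d \<Omega>"
    have d\<phi>: "partial_derivs js \<phi> \<in> test_functions d \<Omega>"
      using lists_upto_props[OF js] by (intro test_functions_partial_derivs[OF \<phi>]) auto
    have split: "(LINT x|Rd_borel d. indicator \<Omega> x * (W ks x * \<psi> x)) =
        (LINT x|Rd_borel d. indicator \<Omega> x * (superpos ks x * \<psi> x)) -
        (\<Sum>i\<in>I. (c i * sg (z i) / wt d (z i)) * (LINT x|Rd_borel d. ridge d a s x0 ks (z i) x * \<psi> x))"
      if ks: "ks \<in> lists_upto d" and \<psi>: "\<psi> \<in> test_functions d \<Omega>" for ks \<psi>
    proof -
      have zero: "\<psi> x = 0" if "x \<in> Rd d - \<Omega>" for x
        using test_functionsD(2)[OF \<psi>] that by blast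
      have i1: "integrable (Rd_borel d) (\<lambda>x. (indicator \<Omega> x * superpos ks x) * \<psi> x)"
      proof (rule integrable_bounded_times_test_function[OF \<psi>])
        show "(\<lambda>x. indicator \<Omega> x * superpos ks x) \<in> borel_measurable (Rd_borel d)"
          using superpos_measurable[OF ks] \<Omega>_sets by measurable
        show "\<bar>indicator \<Omega> x * superpos ks x\<bar> \<le> \<bar>(LINT z|Z. \<bar>q z\<bar> * wt d z) * sqrt K1\<bar>" for x
          using superpos_bound[OF ks, of x] by (auto simp: indicator_def)
      qed
      have i2: "integrable (Rd_borel d) (\<lambda>x. (indicator \<Omega> x * feature ks (z i) x) * \<psi> x)" if "i \<in> I" for i
      proof (rule integrable_bounded_times_test_function[OF \<psi>])
        show "(\<lambda>x. indicator \<Omega> x * feature ks (z i) x) \<in> borel_measurable (Rd_borel d)"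
          using fm[OF ks that] \<Omega>_sets by measurable
        show "\<bar>indicator \<Omega> x * feature ks (z i) x\<bar> \<le> sqrt K1" for x
          using feature_bound[OF ks, of x] K1 by (auto simp: indicator_def)
      qed
      have "(\<lambda>x. indicator \<Omega> x * (W ks x * \<psi> x)) =
          (\<lambda>x. (indicator \<Omega> x * superpos ks x) * \<psi> x - (\<Sum>i\<in>I. c i * ((indicator \<Omega> x * feature ks (z i) x) * \<psi> x)))"
        by (auto simp: W_def algebra_simps sum_distrib_left sum_distrib_right fun_eq_iff)
      then have "(LINT x|Rd_borel d. indicator \<Omega> x * (W ks x * \<psi> x)) =
          (LINT x|Rd_borel d. (indicator \<Omega> x * superpos ks x) * \<psi> x) -
          (\<Sum>i\<in>I. c i * (LINT x|Rd_borel d. (indicator \<Omega> x * feature ks (z i) x) * \<psi> x))"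
        using i1 i2 by (simp add: Bochner_Integration.integral_sum)
      moreover have "c i * (LINT x|Rd_borel d. (indicator \<Omega> x * feature ks (z i) x) * \<psi> x) =
          (c i * sg (z i) / wt d (z i)) * (LINT x|Rd_borel d. ridge d a s x0 ks (z i) x * \<psi> x)" for i
      proof -
        have "(LINT x|Rd_borel d. (indicator \<Omega> x * feature ks (z i) x) * \<psi> x) =
            (LINT x|Rd_borel d. (sg (z i) / wt d (z i)) * (ridge d a s x0 ks (z i) x * \<psi> x))"
        proof (rule Bochner_Integration.integral_cong[OF refl])
          fix x assume "x \<in> space (Rd_borel d)"
          then show "(indicator \<Omega> x * feature ks (z i) x) * \<psi> x = (sg (z i) / wt d (z i)) * (ridge d a s x0 ks (z i) x * \<psi> x)"
            using zero[of x] by (cases "x \<in> \<Omega>") (auto simp: feat space_Rd_borel)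
        qed
        then show ?thesis by simp
      qed
      ultimately show ?thesis by (simp add: mult.assoc)
    qed
    show "(LINT x|Rd_borel d. indicator \<Omega> x * (W [] x * partial_derivs js \<phi> x)) =
        (- 1) ^ length js * (LINT x|Rd_borel d. indicator \<Omega> x * (W js x * \<phi> x))"
    proof -
      let ?S = "\<lambda>ks \<psi>. LINT x|Rd_borel d. indicator \<Omega> x * (superpos ks x * \<psi> x)"
      let ?r = "\<lambda>ks \<psi> i. LINT x|Rd_borel d. ridge d a s x0 ks (z i) x * \<psi> x"
      let ?c = "\<lambda>i. c i * sg (z i) / wt d (z i)"
      have 1: "?S [] (partial_derivs js \<phi>) = (- 1) ^ length js * ?S js \<phi>"
        by (rule superpos_weak_derivative[OF js \<phi> \<Omega>_sets \<Omega>R])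
      have 2: "?r [] (partial_derivs js \<phi>) i = (- 1) ^ length js * ?r js \<phi> i" for i
        by (rule ridge_weak_derivative[OF js \<phi>])
      have "(\<Sum>i\<in>I. ?c i * ?r [] (partial_derivs js \<phi>) i) = (- 1) ^ length js * (\<Sum>i\<in>I. ?c i * ?r js \<phi> i)"
        unfolding 2 sum_distrib_left by (intro sum.cong refl) (simp add: mult_ac)
      then show ?thesis
        unfolding split[OF Nil_lists_upto d\<phi>] split[OF js \<phi>] 1 by (simp only: right_diff_distrib)
    qed
  next
    have "AE x in Rd_leb d. \<forall>i\<in>I. neuron (z i) x = ridge d a s x0 [] (z i) x"
      using I z neuron_AE by (intro AE_finite_allI) auto
    then show "AE x in Rd_leb d. x \<in> \<Omega> \<longrightarrow>
        f x - (\<Sum>i\<in>I. (c i * sg (z i) / wt d (z i)) * neuron (z i) x) = W [] x"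
      using f
    proof eventually_elim
      case (elim x)
      show ?case
      proof
        assume x: "x \<in> \<Omega>"
        have "(\<Sum>i\<in>I. (c i * sg (z i) / wt d (z i)) * neuron (z i) x) = (\<Sum>i\<in>I. c i * feature [] (z i) x)"
          using elim(1) by (intro sum.cong) (auto simp: feat)
        moreover have "f x = superpos [] x"
          using elim(2) superpos_eq_fourier_inverse[OF _ \<Omega>R[OF x]] x \<Omega>_sub by auto
        ultimately show "f x - (\<Sum>i\<in>I. (c i * sg (z i) / wt d (z i)) * neuron (z i) x) = W [] x"
          by (simp add: W_def)
      qed
    qed
  next
    have "(\<Sum>js\<in>lists_upto d. LINT x|Rd_borel d. indicator \<Omega> x * (W js x)\<^sup>2) =
        (\<Sum>js\<in>lists_upto d. LINT x|X. ((LINT z|Q. feature js z x) - (\<Sum>i\<in>I. c i * feature js (z i) x))\<^sup>2)"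
      unfolding integral_X[symmetric]
      by (intro sum.cong refl Bochner_Integration.integral_cong) (simp add: space_X W_def integral_feature)
    then show "(\<Sum>js\<in>lists_upto d. LINT x|Rd_borel d. indicator \<Omega> x * (W js x)\<^sup>2) \<le> E" using E by simp
  qed
qed

text \<open>Plain sampling is the case of one cell with centre 0, whose second moment is at most K1
  times the volume; with a single cell the count of stratified sampling gives at most n
  neurons.\<close>

lemma single_cell_sample:
  assumes n: "n \<ge> 1"
  shows "\<exists>N\<in>shallow_nets \<sigma> d n. sobolev_norm d m \<Omega> (\<lambda>x. f x - N x) \<le>
    ennreal (sqrt (measure Q (space Q) / real n * (measure Q (space Q) * (K1 * vol))))"
proof -
  have J: "(\<Union>j\<in>{()}. space Q) = space Q" by simp
  obtain I :: "(unit \<times> nat) set" and z c where I: "finite I" "card I + 1 \<le> n + card {()}"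
    "\<And>i. i \<in> I \<Longrightarrow> z i \<in> space Q \<and> nonzero (z i)"
    "(\<Sum>js\<in>lists_upto d. LINT x|X. ((LINT z|Q. feature js z x) - (\<Sum>i\<in>I. c i * feature js (z i) x))\<^sup>2) \<le>
      measure Q (space Q) / real n * (\<Sum>j\<in>{()}. measure Q (space Q) * (K1 * vol))"
  proof (rule stratified_sampling[OF finite_Q finite_X finite_lists_upto, where J = "{()}" and A = "\<lambda>_. space Q"
        and \<Phi> = feature and K = "sqrt K1" and cen = "\<lambda>_ _ _. 0" and KC = 0 and V = "\<lambda>_. K1 * vol"
        and good = nonzero and n = n])
    show "(\<lambda>(z, x). feature js z x) \<in> borel_measurable (Q \<Otimes>\<^sub>M X)" if "js \<in> lists_upto d" for js
      by (rule feature_measurable[OF that])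
    show "\<bar>feature js z x\<bar> \<le> sqrt K1" if "js \<in> lists_upto d" "x \<in> space X" for js z x
      using feature_bound that by (simp add: space_X)
    show "(\<Sum>js\<in>lists_upto d. LINT x|X. (feature js z x - 0)\<^sup>2) \<le> K1 * vol" if "z \<in> space Q" for z
    proof -
      have "(\<Sum>js\<in>lists_upto d. LINT x|X. (feature js z x)\<^sup>2) \<le> K1 * vol"
      proof (rule sum_list_integral[OF feature_bound])
        show "feature js z \<in> borel_measurable X" if "js \<in> lists_upto d" for js
          unfolding X_def using feature_slice_measurable[OF that] \<open>z \<in> space Q\<close>
          by (intro measurable_restrict_space1) (simp add: space_Q)
        show "(\<Sum>js\<in>lists_upto d. (feature js z x)\<^sup>2) \<le> K1" if "x \<in> \<Omega>" for x
          using nridge_sum_bound[OF \<Omega>R[OF that], of z] by (simp add: feature_def power_mult_distrib sg_def)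
      qed auto
      then show ?thesis by simp
    qed
  qed (use n K1 vol0 AE_nonzero in \<open>auto simp: disjoint_family_on_def\<close>)
  have "sobolev_norm d m \<Omega> (\<lambda>x. f x - (\<Sum>i\<in>I. (c i * sg (z i) / wt d (z i)) * neuron (z i) x)) \<le>
      ennreal (sqrt (measure Q (space Q) / real n * (measure Q (space Q) * (K1 * vol))))"
    by (rule net_error[OF I(1)]) (use I(3,4) in \<open>auto simp: space_Q\<close>)
  moreover have "(\<lambda>x. \<Sum>i\<in>I. (c i * sg (z i) / wt d (z i)) * neuron (z i) x) \<in> shallow_nets \<sigma> d n"
    by (rule shallow_nets_sum[OF I(1)]) (use I(2,3) in \<open>auto simp: space_Q\<close>)
  ultimately show ?thesis by (rule bexI)
qed

end

section \<open>Cells of the parameter space\<close>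

context barron_rep
begin

definition coord :: "(nat \<Rightarrow> real) \<times> real \<Rightarrow> nat \<Rightarrow> real" where
  "coord z i = (if i < d then fst z i else snd z)"

text \<open>Half-open cubes of side \<open>h\<close> in d + 1 dimensions; as level sets of floors
  they are disjoint and cover everything.\<close>

definition in_cell :: "real \<Rightarrow> (nat \<Rightarrow> int) \<Rightarrow> (nat \<Rightarrow> real) \<times> real \<Rightarrow> bool" where
  "in_cell h k z \<longleftrightarrow> (\<forall>i\<in>{..<Suc d}. \<lfloor>coord z i / h\<rfloor> = k i)"

lemma coord_measurable: "(\<lambda>z. coord z i) \<in> borel_measurable Z"
  using component_measurable[of i] snd_measurable by (cases "i < d") (auto simp: coord_def)

lemma in_cell_measurable: "{z \<in> space Z. in_cell h k z} \<in> sets Z"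
proof -
  note [measurable] = coord_measurable
  show ?thesis unfolding in_cell_def by measurable
qed

lemma in_cell_param_dist:
  assumes "in_cell h k z" "in_cell h k z'" and h: "h > 0"
  shows "param_dist d z z' \<le> 2 * (h * sqrt (real (Suc d)))"
proof -
  have c: "\<bar>coord z i - coord z' i\<bar> \<le> h" if "i < Suc d" for i
  proof -
    have "\<lfloor>coord z i / h\<rfloor> = \<lfloor>coord z' i / h\<rfloor>" using assms that by (auto simp: in_cell_def)
    then have "\<bar>coord z i / h - coord z' i / h\<bar> \<le> 1" by linarith
    then show ?thesis using h by (simp add: diff_divide_distrib[symmetric] abs_divide)
  qed
  have "Rd_norm d (\<lambda>i. fst z i - fst z' i) \<le> sqrt (\<Sum>i<d. h\<^sup>2)"
    unfolding Rd_norm_def L2_set_def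
  proof (intro real_sqrt_le_mono sum_mono)
    fix i assume "i \<in> {..<d}"
    then show "(fst z i - fst z' i)\<^sup>2 \<le> h\<^sup>2"
      using power_mono[OF c[of i], of 2] by (simp add: coord_def)
  qed
  also have "\<dots> = h * sqrt (real d)" using h by (simp add: real_sqrt_mult)
  also have "\<dots> \<le> h * sqrt (real (Suc d))" using h by simp
  finally have 1: "Rd_norm d (\<lambda>i. fst z i - fst z' i) \<le> h * sqrt (real (Suc d))" .
  have "\<bar>snd z - snd z'\<bar> \<le> h * 1" using c[of d] by (simp add: coord_def)
  also have "\<dots> \<le> h * sqrt (real (Suc d))" using h by (intro mult_left_mono) auto
  finally show ?thesis using 1 by (simp add: param_dist_def)
qed

text \<open>By Cauchy-Schwarz the l1 norm costs a factor sqrt(d + 1). Measuring in cubes of side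
  \<delta> / sqrt(d + 1) costs the same factor again, so the lattice indices fill an l1 ball of
  radius proportional to d + 1, the case in which the count has a base free of the
  dimension.\<close>

lemma sum_coord_le:
  assumes z: "z \<in> space Z - tail_set r" and r: "r > 0"
  shows "(\<Sum>i<Suc d. \<bar>coord z i\<bar>) \<le> sqrt (real (Suc d)) * ((c0 + 2) * r)"
proof -
  have zr: "Rd_norm d (fst z) \<le> r" "\<bar>snd z\<bar> \<le> (c0 + 1) * r" using z by (auto simp: tail_set_def)
  have "(\<Sum>i<d. \<bar>fst z i\<bar> * \<bar>1\<bar>) \<le> L2_set (fst z) {..<d} * L2_set (\<lambda>_. 1) {..<d}"
    by (rule L2_set_mult_ineq)
  then have "(\<Sum>i<d. \<bar>fst z i\<bar>) \<le> Rd_norm d (fst z) * sqrt (real d)"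
    by (simp add: Rd_norm_def L2_set_def)
  also have "\<dots> \<le> r * sqrt (real (Suc d))" using zr r by (intro mult_mono) auto
  finally have 1: "(\<Sum>i<d. \<bar>fst z i\<bar>) \<le> r * sqrt (real (Suc d))" .
  have "\<bar>snd z\<bar> \<le> (c0 + 1) * r * 1" using zr by simp
  also have "\<dots> \<le> (c0 + 1) * r * sqrt (real (Suc d))" using r c0 by (intro mult_left_mono) auto
  finally have 2: "\<bar>snd z\<bar> \<le> (c0 + 1) * r * sqrt (real (Suc d))" .
  have "(\<Sum>i<Suc d. \<bar>coord z i\<bar>) = (\<Sum>i<d. \<bar>fst z i\<bar>) + \<bar>snd z\<bar>" by (simp add: coord_def)
  also have "\<dots> \<le> r * sqrt (real (Suc d)) + (c0 + 1) * r * sqrt (real (Suc d))" using 1 2 by (rule add_mono)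
  also have "\<dots> = sqrt (real (Suc d)) * ((c0 + 2) * r)" by (simp only: algebra_simps)
  finally show ?thesis .
qed

end

context approx_setup
begin

text \<open>The cells are small cubes inside the region, and the tail, each split by the sign of the
  density; with the sign fixed, the features are Lipschitz on a cube. At most half of the n neurons
  is spent on rounding, which costs the factor 2 in the bound.\<close>

lemma stratified_sample:
  assumes r: "r > 0" and \<rho>: "\<rho> \<ge> 1" and n: "4 * ((24 * \<rho>) ^ Suc d + 1) \<le> real n"
  defines "\<delta> \<equiv> (c0 + 2) * r / \<rho>"
  shows "\<exists>N\<in>shallow_nets \<sigma> d n. sobolev_norm d m \<Omega> (\<lambda>x. f x - N x) \<le>
    ennreal (sqrt (2 * measure Q (space Q) / real n *
      (vol * (4 * L1 * \<delta>\<^sup>2 * measure Q (space Q) + K1 * measure Q (tail_set r)))))"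
proof -
  interpret Q: finite_measure Q by (rule finite_Q)
  \<comment> \<open>Two points of a cube of this side have parameter distance at most 2
    \<delta>.\<close>
  define h where "h = \<delta> / sqrt (real (Suc d))"
  have \<delta>: "\<delta> > 0" using r \<rho> c0 by (simp add: \<delta>_def)
  then have h: "h > 0" by (simp add: h_def)
  have h\<delta>: "h * sqrt (real (Suc d)) = \<delta>" by (simp add: h_def)
  \<comment> \<open>The summand 1 per coordinate allows for rounding to the lattice index.\<close>
  define E where "E = {k \<in> {..<Suc d} \<rightarrow>\<^sub>E (UNIV :: int set). (\<Sum>i<Suc d. \<bar>real_of_int (k i)\<bar>) \<le> real (Suc d) * (\<rho> + 1)}"
  have E: "finite E" "real (card E) \<le> (24 * \<rho>) ^ Suc d"
    using card_lattice_l1_ball[OF \<rho>, of "Suc d"] by (simp_all add: E_def)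
  \<comment> \<open>The first component records whether \<open>q\<close> is nonnegative;
    \<open>None\<close> stands for the tail, \<open>Some k\<close> for the cube with index
    \<open>k\<close>.\<close>
  define J where "J = (UNIV :: bool set) \<times> insert None (Some ` E)"
  have finJ: "finite J" and neJ: "J \<noteq> {}" using E(1) by (auto simp: J_def)
  have cardJ: "card J = 2 * (card E + 1)"
    unfolding J_def card_cartesian_product using E(1) by (simp add: card_image UNIV_bool)
  \<comment> \<open>The factor 4 in the hypothesis on n is used here: 2 for the signs, 2 to keep
    half of the neurons.\<close>
  then have cJ: "real (card J) \<le> real n / 2" using E(2) n by simp
  define A where "A j = {z \<in> space Z. (0 \<le> q z) = fst j \<and>
      (case snd j of None \<Rightarrow> z \<in> tail_set r | Some k \<Rightarrow> z \<notin> tail_set r \<and> in_cell h k z)}" for j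
  have Asub: "A j \<subseteq> space Z" for j by (auto simp: A_def)
  have Asets: "A j \<in> sets Z" for j
  proof -
    note [measurable] = in_cell_measurable tail_set_sets
    have [measurable]: "Measurable.pred Z (in_cell h k)" for k
      using in_cell_measurable by (simp add: pred_def)
    show ?thesis
    proof (cases "snd j")
      case None
      then have "A j = {z \<in> space Z. (0 \<le> q z) = fst j \<and> z \<in> tail_set r}" by (simp add: A_def)
      also have "\<dots> \<in> sets Z" by measurable
      finally show ?thesis .
    next
      case (Some k)
      then have "A j = {z \<in> space Z. (0 \<le> q z) = fst j \<and> z \<notin> tail_set r \<and> in_cell h k z}" by (simp add: A_def)
      also have "\<dots> \<in> sets Z" by measurable
      finally show ?thesis .
    qed
  qed
  have disj: "disjoint_family_on A J"
    unfolding disjoint_family_on_def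
  proof (intro ballI impI equals0I)
    fix j j' z assume j: "j \<in> J" "j' \<in> J" "j \<noteq> j'" and "z \<in> A j \<inter> A j'"
    then have z: "z \<in> A j" "z \<in> A j'" by auto
    then have f: "fst j = fst j'" by (auto simp: A_def)
    show False
    proof (cases "snd j")
      case None
      then have "snd j' = None" using z by (cases "snd j'") (auto simp: A_def)
      then show False using None f j(3) by (simp add: prod_eq_iff)
    next
      case (Some k)
      then obtain k' where k': "snd j' = Some k'" using z by (cases "snd j'") (auto simp: A_def)
      have "in_cell h k z" "in_cell h k' z" using z Some k' by (auto simp: A_def)
      then have "k i = k' i" if "i \<in> {..<Suc d}" for i using that by (simp add: in_cell_def)
      moreover have "k \<in> E" "k' \<in> E" using j(1,2) Some k' by (auto simp: J_def)
      ultimately have "k = k'" by (intro PiE_ext[of k "{..<Suc d}" "\<lambda>_. UNIV"]) (auto simp: E_def)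
      then show False using Some k' f j(3) by (simp add: prod_eq_iff)
    qed
  qed
  have cover: "(\<Union>j\<in>J. A j) = space Z"
  proof
    show "space Z \<subseteq> (\<Union>j\<in>J. A j)"
    proof
      fix z assume z: "z \<in> space Z"
      show "z \<in> (\<Union>j\<in>J. A j)"
      proof (cases "z \<in> tail_set r")
        case True
        then have "z \<in> A (0 \<le> q z, None)" using z by (simp add: A_def)
        then show ?thesis unfolding J_def by blast
      next
        case False
        define k where "k = (\<lambda>i\<in>{..<Suc d}. \<lfloor>coord z i / h\<rfloor>)"
        have "(\<Sum>i<Suc d. \<bar>real_of_int (k i)\<bar>) \<le> (\<Sum>i<Suc d. \<bar>coord z i\<bar> / h + 1)"
        proof (rule sum_mono)
          fix i assume "i \<in> {..<Suc d}"
          moreover have "\<bar>real_of_int \<lfloor>coord z i / h\<rfloor>\<bar> \<le> \<bar>coord z i / h\<bar> + 1" by linarith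
          ultimately show "\<bar>real_of_int (k i)\<bar> \<le> \<bar>coord z i\<bar> / h + 1" using h by (simp add: k_def abs_divide)
        qed
        also have "\<dots> = (\<Sum>i<Suc d. \<bar>coord z i\<bar>) / h + real (Suc d)"
          by (simp add: sum.distrib sum_divide_distrib add_divide_distrib)
        also have "\<dots> \<le> sqrt (real (Suc d)) * ((c0 + 2) * r) / h + real (Suc d)"
          using h sum_coord_le[of z r] z False r by (intro add_right_mono divide_right_mono) auto
        \<comment> \<open>The root in \<open>h\<close> and the root from Cauchy-Schwarz multiply to
          d + 1.\<close>
        also have "sqrt (real (Suc d)) * ((c0 + 2) * r) / h = real (Suc d) * \<rho>"
        proof -
          have *: "y * S / (S / \<rho> / y) = (y * y) * \<rho>" if "S > 0" "y > 0" for y S :: real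
            using that \<rho> by (simp add: field_simps)
          have "(c0 + 2) * r > 0" using r c0 by simp
          from *[OF this, of "sqrt (real (Suc d))"] show ?thesis unfolding h_def \<delta>_def by simp
        qed
        finally have "k \<in> E" by (simp add: E_def k_def algebra_simps)
        moreover have "z \<in> A (0 \<le> q z, Some k)" using z False by (simp add: A_def in_cell_def k_def)
        ultimately show ?thesis unfolding J_def by blast
      qed
    qed
  qed (use Asub in auto)
  \<comment> \<open>One more than n - card J, because the bound on the number of sampled neurons is
    strict.\<close>
  define n0 where "n0 = n + 1 - card J"
  have cJn: "card J \<le> n" using cJ by linarith
  have n0: "n0 \<ge> 1" "n0 + card J = n + 1" "real n0 \<ge> real n / 2"
    using cJn cJ by (auto simp: n0_def of_nat_diff)
  \<comment> \<open>In a cube any point of the cell serves as reference. The tail has no nearby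
    reference point, so 0 is used there, as well as for empty cells, from which nothing can be
    chosen.\<close>
  define cen where "cen j js x = (if snd j = None \<or> A j = {} then 0 else feature js (SOME z. z \<in> A j) x)" for j js x
  \<comment> \<open>The factor 4 is the square of the 2 in the diameter of a cube. The Lipschitz
    term is granted to the tail cells too, so that it sums to the total mass.\<close>
  define V where "V j = 4 * L1 * \<delta>\<^sup>2 * vol + (if snd j = None then K1 * vol else 0)" for j :: "bool \<times> (nat \<Rightarrow> int) option"
  have V0: "0 \<le> V j" for j using L1 K1 vol0 by (simp add: V_def)
  have slice: "feature js z \<in> borel_measurable X" if "js \<in> lists_upto d" "z \<in> space Z" for js z
    unfolding X_def using feature_slice_measurable[OF that] by (rule measurable_restrict_space1)
  have pick: "(SOME z. z \<in> A j) \<in> A j" if "A j \<noteq> {}" for j using that by (simp add: some_in_eq)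
  have cen_m: "cen j js \<in> borel_measurable X" if "js \<in> lists_upto d" for j js
  proof (cases "snd j = None \<or> A j = {}")
    case True
    then have "cen j js = (\<lambda>_. 0)" by (simp add: cen_def fun_eq_iff)
    then show ?thesis by simp
  next
    case False
    have "cen j js = feature js (SOME z. z \<in> A j)"
      by (rule ext) (unfold cen_def, rule if_not_P[OF False])
    moreover have "(SOME z. z \<in> A j) \<in> space Z" using pick[of j] False Asub[of j] by blast
    ultimately show ?thesis using slice[OF that] by (simp only:)
  qed
  have cen_b: "\<bar>cen j js x\<bar> \<le> sqrt K1" if "js \<in> lists_upto d" "x \<in> \<Omega>" for j js x
    using feature_bound[OF that] K1 by (simp add: cen_def)
  have VA: "(\<Sum>js\<in>lists_upto d. LINT x|X. (feature js z x - cen j js x)\<^sup>2) \<le> V j" if z: "z \<in> A j" for j z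
  proof -
    have zZ: "z \<in> space Z" using z Asub by blast
    have "(\<Sum>js\<in>lists_upto d. LINT x|X. (feature js z x - cen j js x)\<^sup>2) \<le>
        (4 * L1 * \<delta>\<^sup>2 + (if snd j = None then K1 else 0)) * vol"
    proof (rule sum_list_integral)
      show "\<bar>feature js z x - cen j js x\<bar> \<le> 2 * sqrt K1" if "js \<in> lists_upto d" "x \<in> \<Omega>" for js x
        using feature_bound[OF that, of z] cen_b[OF that, of j] by linarith
      show "(\<lambda>x. feature js z x - cen j js x) \<in> borel_measurable X" if "js \<in> lists_upto d" for js
        using slice[OF that zZ] cen_m[OF that] by (rule borel_measurable_diff)
      show "(\<Sum>js\<in>lists_upto d. (feature js z x - cen j js x)\<^sup>2) \<le> 4 * L1 * \<delta>\<^sup>2 + (if snd j = None then K1 else 0)"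
        if x: "x \<in> \<Omega>" for x
      proof (cases "snd j")
        case None
        have "(\<Sum>js\<in>lists_upto d. (feature js z x - cen j js x)\<^sup>2) \<le> K1"
          using nridge_sum_bound[OF \<Omega>R[OF x], of z] None by (simp add: cen_def feature_def power_mult_distrib sg_def)
        then show ?thesis using None L1 by (simp add: add_increasing)
      next
        case (Some k)
        define z' where "z' = (SOME z. z \<in> A j)"
        have z': "z' \<in> A j" using pick[of j] z by (auto simp: z'_def)
        \<comment> \<open>This is what the splitting by sign achieves: features of one cell differ
          only through the Lipschitz factor.\<close>
        have sgz: "sg z' = sg z" using z z' by (auto simp: A_def sg_def)
        have "in_cell h k z" "in_cell h k z'" using z z' Some by (auto simp: A_def)
        from in_cell_param_dist[OF this h] have pd: "param_dist d z z' \<le> 2 * \<delta>" by (simp only: h\<delta>)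
        have "(\<Sum>js\<in>lists_upto d. (feature js z x - cen j js x)\<^sup>2) =
            (\<Sum>js\<in>lists_upto d. (nridge d x0 js z x - nridge d x0 js z' x)\<^sup>2)"
        proof (intro sum.cong refl)
          fix js
          have "feature js z x - cen j js x = sg z * (nridge d x0 js z x - nridge d x0 js z' x)"
            using Some z sgz by (auto simp: cen_def z'_def[symmetric] feature_def right_diff_distrib)
          then show "(feature js z x - cen j js x)\<^sup>2 = (nridge d x0 js z x - nridge d x0 js z' x)\<^sup>2"
            by (simp add: power_mult_distrib sg_def)
        qed
        also have "\<dots> \<le> L1 * (param_dist d z z')\<^sup>2" by (rule nridge_sum_lipschitz[OF \<Omega>R[OF x]])
        also have "\<dots> \<le> L1 * (2 * \<delta>)\<^sup>2" using pd L1 param_dist_nonneg by (intro mult_left_mono power_mono) auto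
        finally show ?thesis using Some by (simp add: power_mult_distrib)
      qed
    qed
    also have "\<dots> = V j" by (simp add: V_def distrib_right)
    finally show ?thesis .
  qed
  obtain I :: "((bool \<times> (nat \<Rightarrow> int) option) \<times> nat) set" and z c where I: "finite I" "card I + 1 \<le> n0 + card J"
    "\<And>i. i \<in> I \<Longrightarrow> z i \<in> space Q \<and> nonzero (z i)"
    "(\<Sum>js\<in>lists_upto d. LINT x|X. ((LINT z|Q. feature js z x) - (\<Sum>i\<in>I. c i * feature js (z i) x))\<^sup>2) \<le>
      measure Q (space Q) / real n0 * (\<Sum>j\<in>J. measure Q (A j) * V j)"
  proof (rule stratified_sampling[OF finite_Q finite_X finite_lists_upto finJ neJ, where A = A
        and \<Phi> = feature and K = "sqrt K1" and cen = cen and KC = "sqrt K1" and V = V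
        and good = nonzero and n = n0])
    show "A j \<in> sets Q" for j using Asets by (simp add: sets_Q)
    show "(\<Union>j\<in>J. A j) = space Q" using cover by (simp add: space_Q)
    show "(\<lambda>(z, x). feature js z x) \<in> borel_measurable (Q \<Otimes>\<^sub>M X)" if "js \<in> lists_upto d" for js
      by (rule feature_measurable[OF that])
    show "\<bar>feature js z x\<bar> \<le> sqrt K1" if "js \<in> lists_upto d" "x \<in> space X" for js z x
      using feature_bound that by (simp add: space_X)
    show "\<bar>cen j js x\<bar> \<le> sqrt K1" if "js \<in> lists_upto d" "x \<in> space X" for j js x
      using cen_b that by (simp add: space_X)
  qed (use disj cen_m VA V0 AE_nonzero n0(1) in auto)
  define \<Lambda> where "\<Lambda> = measure Q (space Q)"
  have \<Lambda>0: "0 \<le> \<Lambda>" by (simp add: \<Lambda>_def)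
  have "(\<Sum>j\<in>J. measure Q (A j)) = \<Lambda>"
  proof -
    have "(\<Sum>j\<in>J. measure Q (A j)) = measure Q (\<Union>j\<in>J. A j)"
      using finJ disj Asets by (intro Q.finite_measure_finite_Union[symmetric]) (auto simp: sets_Q)
    then show ?thesis by (simp add: cover \<Lambda>_def space_Q)
  qed
  moreover have "(\<Sum>j\<in>J. measure Q (A j) * (if snd j = None then K1 * vol else 0)) = measure Q (tail_set r) * (K1 * vol)"
  proof -
    let ?T = "(UNIV :: bool set) \<times> {None :: (nat \<Rightarrow> int) option}"
    have sub: "?T \<subseteq> J" by (auto simp: J_def)
    have "(\<Sum>j\<in>J. measure Q (A j) * (if snd j = None then K1 * vol else 0)) = (\<Sum>j\<in>?T. measure Q (A j) * (K1 * vol))"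
      using finJ sub by (intro sum.mono_neutral_cong_right) auto
    also have "\<dots> = (\<Sum>j\<in>?T. measure Q (A j)) * (K1 * vol)" by (rule sum_distrib_right[symmetric])
    also have "(\<Sum>j\<in>?T. measure Q (A j)) = measure Q (\<Union>j\<in>?T. A j)"
      using disjoint_family_on_mono[OF sub disj] Asets
      by (intro Q.finite_measure_finite_Union[symmetric]) (auto simp: sets_Q)
    also have "(\<Union>j\<in>?T. A j) = tail_set r" by (auto simp: A_def tail_set_def)
    finally show ?thesis .
  qed
  ultimately have sumV: "(\<Sum>j\<in>J. measure Q (A j) * V j) = vol * (4 * L1 * \<delta>\<^sup>2 * \<Lambda> + K1 * measure Q (tail_set r))"
    unfolding V_def distrib_left sum.distrib by (simp flip: sum_distrib_right)
  define F where "F = vol * (4 * L1 * \<delta>\<^sup>2 * \<Lambda> + K1 * measure Q (tail_set r))"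
  have F0: "0 \<le> F" using vol0 L1 K1 \<Lambda>0 by (simp add: F_def)
  have npos: "real n > 0" using n \<rho> by (smt (verit) zero_le_power)
  have "\<Lambda> / real n0 \<le> \<Lambda> / (real n / 2)" using \<Lambda>0 n0 npos by (intro divide_left_mono) auto
  then have "\<Lambda> / real n0 * F \<le> 2 * \<Lambda> / real n * F" using F0 by (intro mult_right_mono) (auto simp: mult.commute)
  then have bound: "(\<Sum>js\<in>lists_upto d. LINT x|X. ((LINT z|Q. feature js z x) - (\<Sum>i\<in>I. c i * feature js (z i) x))\<^sup>2) \<le>
      2 * \<Lambda> / real n * F"
    using I(4) unfolding sumV \<Lambda>_def[symmetric] F_def[symmetric] by linarith
  have "sobolev_norm d m \<Omega> (\<lambda>x. f x - (\<Sum>i\<in>I. (c i * sg (z i) / wt d (z i)) * neuron (z i) x)) \<le>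
      ennreal (sqrt (2 * \<Lambda> / real n * F))"
    by (rule net_error[OF I(1) _ bound]) (use I(3) in \<open>auto simp: space_Q\<close>)
  moreover have "(\<lambda>x. \<Sum>i\<in>I. (c i * sg (z i) / wt d (z i)) * neuron (z i) x) \<in> shallow_nets \<sigma> d n"
    by (rule shallow_nets_sum[OF I(1)]) (use I(2,3) n0 in \<open>auto simp: space_Q\<close>)
  ultimately show ?thesis unfolding F_def \<Lambda>_def by (rule bexI)
qed

end

section \<open>Balancing the radius against the number of cells\<close>

context barron_rep
begin

text \<open>The sum covers both regimes: 100 sqrt K1 belongs to few neurons, the other root to many.
  Every ingredient is built from \<open>m\<close>, \<open>p\<close>, \<open>a\<close>,
  \<open>R\<close>, \<open>Cs\<close> and \<open>s\<close>, so the constant is independent of the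
  dimension and of the function.\<close>

definition err_const :: real where
  "err_const = cmod kappa * mass_const * (100 * sqrt K1 + sqrt (2 * (4 * L1 * (100 * (c0 + 2))\<^sup>2 + K1)))"

lemma err_const: "0 \<le> err_const"
  using mass_const K1 L1 c0 by (simp add: err_const_def)

end

context approx_setup
begin

lemma net_approximation:
  assumes t: "0 < t" "t \<le> p - 1" and n: "n \<ge> 1" and B: "0 \<le> B"
    and gB: "(\<integral>\<^sup>+\<omega>. ennreal ((1 + Rd_norm d \<omega>) powr (real m + 1 + t) * cmod (g \<omega>)) \<partial>Rd_borel d) = ennreal B"
  shows "\<exists>N\<in>shallow_nets \<sigma> d n. sobolev_norm d m \<Omega> (\<lambda>x. f x - N x) \<le>
    ennreal (sqrt vol * err_const * real n powr (- 1 / 2 - t / ((2 + t) * (real d + 1))) * B)"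
proof -
  interpret Q: finite_measure Q by (rule finite_Q)
  define D where "D = Suc d"
  have D: "real D = real d + 1" "D \<ge> 2" using d by (auto simp: D_def)
  \<comment> \<open>The additional factor of the rate is \<open>real n powr (- e)\<close>, called
    \<open>Et\<close>; it governs both cases below.\<close>
  define e where "e = t / ((2 + t) * real D)"
  define Et where "Et = real n powr (- e)"
  define Kb where "Kb = cmod kappa * mass_const"
  define c where "c = 100 * (c0 + 2)"
  define \<Lambda> where "\<Lambda> = measure Q (space Q)"
  define T where "T = Kb * B"
  have Kb: "0 \<le> Kb" using mass_const by (simp add: Kb_def)
  then have T: "0 \<le> T" using B by (simp add: T_def)
  have \<Lambda>0: "0 \<le> \<Lambda>" by (simp add: \<Lambda>_def)
  have npos: "real n > 0" using n by simp
  have Et: "Et > 0" using n by (simp add: Et_def)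
  have eD: "e * real D = t / (2 + t)" using D(2) by (simp add: e_def)
  \<comment> \<open>The total mass needs the moment of order m + 1; it is enlarged to order m + 1 +
    t so that one bound \<open>T\<close> serves the mass and the tail.\<close>
  have "ennreal \<Lambda> = (\<integral>\<^sup>+z. ennreal (\<bar>q z\<bar> * wt d z) \<partial>Z)"
    unfolding \<Lambda>_def Q.emeasure_eq_measure[symmetric] by (rule emeasure_Q_space)
  also have "\<dots> \<le> ennreal Kb * (\<integral>\<^sup>+\<omega>. ennreal ((1 + Rd_norm d \<omega>) ^ (m + 1) * cmod (g \<omega>)) \<partial>Rd_borel d)"
    unfolding Kb_def by (rule nn_integral_q_weight)
  also have "\<dots> \<le> ennreal Kb * ennreal B"
    unfolding gB[symmetric]
  proof (intro mult_left_mono nn_integral_mono ennreal_leI mult_right_mono)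
    fix \<omega>
    have "(1 + Rd_norm d \<omega>) ^ (m + 1) = (1 + Rd_norm d \<omega>) powr (real m + 1)"
      by (subst powr_realpow[symmetric]) (auto simp: add_pos_nonneg add.commute)
    also have "\<dots> \<le> (1 + Rd_norm d \<omega>) powr (real m + 1 + t)" using t by (intro powr_mono) auto
    finally show "(1 + Rd_norm d \<omega>) ^ (m + 1) \<le> (1 + Rd_norm d \<omega>) powr (real m + 1 + t)" .
  qed auto
  also have "\<dots> = ennreal T" using Kb B by (simp add: T_def ennreal_mult)
  finally have \<Lambda>: "\<Lambda> \<le> T" using T by (simp add: ennreal_le_iff)
  have tail: "measure Q (tail_set r) \<le> T * r powr (- t)" if r: "r \<ge> 1" for r
  proof -
    have "ennreal (measure Q (tail_set r)) = (\<integral>\<^sup>+z. ennreal (\<bar>q z\<bar> * wt d z) * indicator (tail_set r) z \<partial>Z)"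
      unfolding Q.emeasure_eq_measure[symmetric] by (rule emeasure_Q[OF tail_set_sets])
    also have "\<dots> \<le> ennreal (Kb * r powr (- t)) * ennreal B"
      unfolding Kb_def gB[symmetric] by (rule nn_integral_q_weight_tail[OF r t])
    also have "\<dots> = ennreal (T * r powr (- t))"
      using Kb B by (simp add: T_def ennreal_mult[symmetric] mult_ac)
    finally show ?thesis using T by (simp add: ennreal_le_iff)
  qed
  \<comment> \<open>Both cases end alike: the root of the squared error is the plain rate times
    \<open>Et\<close> times a constant below the sum in \<open>err_const\<close>.\<close>
  have goal: ?thesis
    if N: "\<exists>N\<in>shallow_nets \<sigma> d n. sobolev_norm d m \<Omega> (\<lambda>x. f x - N x) \<le> ennreal (sqrt G)"
      and G: "sqrt G \<le> sqrt vol * T * k * Et / sqrt (real n)"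
      and k: "k \<le> 100 * sqrt K1 + sqrt (2 * (4 * L1 * c\<^sup>2 + K1))" for G k
  proof -
    have "sqrt G \<le> sqrt vol * T * k * Et / sqrt (real n)" by (rule G)
    also have "\<dots> \<le> sqrt vol * T * (100 * sqrt K1 + sqrt (2 * (4 * L1 * c\<^sup>2 + K1))) * Et / sqrt (real n)"
      using k T Et vol0 by (intro divide_right_mono mult_right_mono mult_left_mono) auto
    also have "\<dots> = sqrt vol * err_const * (Et / sqrt (real n)) * B"
      by (simp add: err_const_def T_def Kb_def c_def)
    also have "Et / sqrt (real n) = real n powr (- 1 / 2 - t / ((2 + t) * (real d + 1)))"
    proof -
      have "- (1 / 2) + - e = - 1 / 2 - t / ((2 + t) * (real d + 1))" by (simp add: e_def D(1))
      moreover have "Et / sqrt (real n) = real n powr (- (1 / 2) + - e)"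
      proof -
        have "real n powr (- (1 / 2)) = 1 / sqrt (real n)" by (simp add: powr_minus_divide powr_half_sqrt)
        then show ?thesis unfolding powr_add Et_def by simp
      qed
      ultimately show ?thesis by (simp only:)
    qed
    finally show ?thesis using N by (meson ennreal_leI order_trans)
  qed
  show ?thesis
  proof (cases "real n < 100 ^ D")
    case True
    \<comment> \<open>For n below 100^D the factor \<open>Et\<close> is at least 1/100, because e D
      = t / (2 + t) is less than 1; so plain sampling loses only a factor 100.\<close>
    have "1 / 100 = (100::real) powr (- 1)" by (simp add: powr_minus)
    also have "\<dots> \<le> 100 powr (- (e * real D))" using t unfolding eD by (intro powr_mono) (auto simp: divide_le_eq)
    also have "\<dots> = (100 ^ D) powr (- e)" by (simp add: powr_realpow[symmetric] powr_powr mult.commute)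
    also have "\<dots> \<le> Et" unfolding Et_def using True n t by (intro powr_mono2') (auto simp: e_def)
    finally have Et100: "1 \<le> 100 * Et" by simp
    show ?thesis
    proof (rule goal[OF single_cell_sample[OF n], folded \<Lambda>_def])
      have "sqrt (\<Lambda> / real n * (\<Lambda> * (K1 * vol))) = sqrt (\<Lambda>\<^sup>2) * sqrt K1 * sqrt vol / sqrt (real n)"
        unfolding real_sqrt_mult[symmetric] real_sqrt_divide[symmetric] by (simp add: power2_eq_square mult_ac)
      also have "\<dots> = sqrt vol * \<Lambda> * sqrt K1 * 1 / sqrt (real n)" using \<Lambda>0 by simp
      also have "\<dots> \<le> sqrt vol * T * sqrt K1 * (100 * Et) / sqrt (real n)"
        using \<Lambda> \<Lambda>0 T vol0 K1 Et100 by (intro divide_right_mono mult_mono) auto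
      finally show "sqrt (\<Lambda> / real n * (\<Lambda> * (K1 * vol))) \<le> sqrt vol * T * (100 * sqrt K1) * Et / sqrt (real n)"
        by (simp add: mult_ac)
    qed (use L1 K1 in simp)
  next
    case False
    then have n100: "100 ^ D \<le> real n" by simp
    \<comment> \<open>Chosen so that r^(-t) equals (r n^(-1/D))^2: tail mass and squared diameter of
      the cells are then both of order \<open>Et\<^sup>2\<close>.\<close>
    define r where "r = real n powr (2 / ((2 + t) * real D))"
    \<comment> \<open>The number of cubes is then at most (24/100)^D n, hence at most 0.0576 n as D
      >= 2; since n >= 100 this leaves room for the factor 4 and the summand 1. The threshold 100^D
      is what makes \<rho> at least 1.\<close>
    define \<rho> where "\<rho> = real n powr (1 / real D) / 100"
    have r: "r \<ge> 1" unfolding r_def using n t D by (intro ge_one_powr_ge_zero) auto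
    have "(100::real) = (100 ^ D) powr (1 / real D)" using D by (simp add: powr_realpow[symmetric] powr_powr)
    also have "\<dots> \<le> real n powr (1 / real D)" using n100 by (intro powr_mono2) auto
    finally have \<rho>: "\<rho> \<ge> 1" by (simp add: \<rho>_def)
    have "(24 * \<rho>) ^ Suc d = (24 / 100) ^ D * (real n powr (1 / real D)) ^ D"
      unfolding D_def[symmetric] power_mult_distrib[symmetric] by (simp add: \<rho>_def)
    also have "(real n powr (1 / real D)) ^ D = real n"
      using npos D by (simp add: powr_realpow[symmetric] powr_powr)
    also have "(24 / 100) ^ D * real n \<le> (24 / 100) ^ 2 * real n"
      using D by (intro mult_right_mono power_decreasing) auto
    finally have c1: "(24 * \<rho>) ^ Suc d \<le> (24 / 100) ^ 2 * real n" .
    have "(100::real) \<le> 100 ^ D" using power_increasing[of 1 D "100::real"] D by simp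
    then have "100 \<le> real n" using n100 by (rule order_trans)
    moreover have "4 * (y + 1) \<le> x" if "y \<le> (24 / 100) ^ 2 * x" "100 \<le> x" for x y :: real
      using that by (simp add: power2_eq_square)
    ultimately have card: "4 * ((24 * \<rho>) ^ Suc d + 1) \<le> real n" using c1 by blast
    \<comment> \<open>The balance in terms of exponents: r / \<rho> is of order \<open>Et\<close>,
      and the tail mass of order \<open>Et\<^sup>2\<close>.\<close>
    have exps: "2 / ((2 + t) * real D) - 1 / real D = - e" "2 / ((2 + t) * real D) * (- t) = - e + - e"
    proof -
      have "2 / (y * x) - 1 / x = - ((y - 2) / (y * x))" if "x > 0" "y > 0" for x y :: real
        using that by (simp add: field_simps)
      from this[of "real D" "2 + t"] show "2 / ((2 + t) * real D) - 1 / real D = - e"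
        using D(2) t unfolding e_def by simp
    qed (simp add: e_def)
    have "r / \<rho> = 100 * (real n powr (2 / ((2 + t) * real D)) / real n powr (1 / real D))"
      by (simp add: r_def \<rho>_def)
    also have "\<dots> = 100 * Et" unfolding powr_diff[symmetric] exps Et_def ..
    finally have r\<rho>: "r / \<rho> = 100 * Et" .
    have \<delta>: "(c0 + 2) * r / \<rho> = c * Et"
      using r\<rho> by (simp add: c_def flip: times_divide_eq_right)
    have rt: "r powr (- t) = Et\<^sup>2"
      unfolding r_def powr_powr exps powr_add Et_def power2_eq_square ..
    show ?thesis
    proof (rule goal)
      show "\<exists>N\<in>shallow_nets \<sigma> d n. sobolev_norm d m \<Omega> (\<lambda>x. f x - N x) \<le>
        ennreal (sqrt (2 * \<Lambda> / real n * (vol * (4 * L1 * (c * Et)\<^sup>2 * \<Lambda> + K1 * measure Q (tail_set r)))))"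
        using stratified_sample[OF _ \<rho> card, of r] r unfolding \<Lambda>_def \<delta> by simp
      have "2 * \<Lambda> / real n * (vol * (4 * L1 * (c * Et)\<^sup>2 * \<Lambda> + K1 * measure Q (tail_set r))) \<le>
          2 * T / real n * (vol * (4 * L1 * (c * Et)\<^sup>2 * T + K1 * (T * Et\<^sup>2)))"
        using \<Lambda> \<Lambda>0 T vol0 L1 K1 tail[OF r] unfolding rt
        by (intro mult_mono divide_right_mono add_mono mult_left_mono order_refl) auto
      also have "\<dots> = vol * T\<^sup>2 * (2 * (4 * L1 * c\<^sup>2 + K1)) * Et\<^sup>2 / real n"
        by (simp add: power_mult_distrib power2_eq_square algebra_simps add_divide_distrib)
      finally have "sqrt (2 * \<Lambda> / real n * (vol * (4 * L1 * (c * Et)\<^sup>2 * \<Lambda> + K1 * measure Q (tail_set r)))) \<le>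
          sqrt (vol * T\<^sup>2 * (2 * (4 * L1 * c\<^sup>2 + K1)) * Et\<^sup>2 / real n)"
        by (rule real_sqrt_le_mono)
      also have "\<dots> = sqrt vol * T * sqrt (2 * (4 * L1 * c\<^sup>2 + K1)) * Et / sqrt (real n)"
        unfolding real_sqrt_divide real_sqrt_mult real_sqrt_abs using T Et by simp
      finally show "sqrt (2 * \<Lambda> / real n * (vol * (4 * L1 * (c * Et)\<^sup>2 * \<Lambda> + K1 * measure Q (tail_set r)))) \<le>
          sqrt vol * T * sqrt (2 * (4 * L1 * c\<^sup>2 + K1)) * Et / sqrt (real n)" .
    qed (use K1 in simp)
  qed
qed

end

section \<open>Barron functions\<close>

lemma Rd_norm_minus_le: "Rd_norm d (\<lambda>i. x i - y i) \<le> Rd_norm d x + Rd_norm d y"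
proof -
  have "Rd_norm d (\<lambda>i. x i + - y i) \<le> Rd_norm d x + Rd_norm d (\<lambda>i. - y i)"
    unfolding Rd_norm_def by (rule L2_set_triangle_ineq)
  then show ?thesis by (simp add: Rd_norm_def L2_set_def)
qed

text \<open>Boundedness makes the supremum in \<open>Rd_diameter\<close> a genuine upper
  bound.\<close>

lemma Rd_norm_le_diameter:
  assumes B: "\<forall>x\<in>S. Rd_norm d x \<le> B" and xy: "x \<in> S" "y \<in> S"
  shows "Rd_norm d (\<lambda>i. x i - y i) \<le> Rd_diameter d S"
proof -
  have "bdd_above ((\<lambda>(x, y). Rd_norm d (\<lambda>i. x i - y i)) ` (S \<times> S))"
  proof (rule bdd_aboveI2)
    fix p assume "p \<in> S \<times> S"
    then have "Rd_norm d (fst p) \<le> B" "Rd_norm d (snd p) \<le> B" using B by auto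
    then have "Rd_norm d (\<lambda>i. fst p i - snd p i) \<le> B + B"
      using Rd_norm_minus_le[of d "fst p" "snd p"] by linarith
    then show "(case p of (x, y) \<Rightarrow> Rd_norm d (\<lambda>i. x i - y i)) \<le> B + B" by (simp add: split_beta')
  qed
  from cSUP_upper[OF _ this, of "(x, y)"] show ?thesis using xy by (auto simp: Rd_diameter_def)
qed

lemma abs_le_Rd_norm: "i < d \<Longrightarrow> \<bar>x i\<bar> \<le> Rd_norm d x"
  using member_le_L2_set[of "{..<d}" i "\<lambda>i. \<bar>x i\<bar>"] by (simp add: Rd_norm_def L2_set_def)

lemma emeasure_bounded_Rd:
  assumes "S \<subseteq> Rd d" "\<forall>x\<in>S. Rd_norm d x \<le> B"
  shows "emeasure (Rd_borel d) S < \<infinity>"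
proof -
  have "S \<subseteq> closed_box d (\<lambda>_. (- B, B))"
  proof
    fix x assume x: "x \<in> S"
    have "\<bar>x i\<bar> \<le> B" if "i < d" for i
      using abs_le_Rd_norm[OF that, of x] assms(2) x by (meson order_trans)
    then show "x \<in> closed_box d (\<lambda>_. (- B, B))"
      using assms(1) x by (auto simp: closed_box_def Rd_def PiE_iff abs_le_iff minus_le_iff)
  qed
  then have "emeasure (Rd_borel d) S \<le> emeasure (Rd_borel d) (closed_box d (\<lambda>_. (- B, B)))"
    by (rule emeasure_mono[OF _ sets_closed_box])
  then show ?thesis using emeasure_closed_box by (rule le_less_trans)
qed

text \<open>The weight is at least 1, so a finite norm makes the chosen transform integrable and
  inversion applies. The Borel version it provides agrees almost everywhere with the transform and
  leaves the norm unchanged.\<close>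

lemma barron_representation:
  assumes f: "f \<in> barron_space d \<beta>" and \<beta>: "\<beta> \<ge> 0"
  obtains g where "g \<in> borel_measurable (Rd_borel d)"
    "AE x in Rd_leb d. f x = Re (fourier_inverse d g x)"
    "barron_norm d \<beta> f = (\<integral>\<^sup>+\<omega>. ennreal ((1 + Rd_norm d \<omega>) powr \<beta> * cmod (g \<omega>)) \<partial>Rd_borel d)"
proof -
  define h where "h = fourier_transform d f"
  have L: "Rd_leb d = completion (Rd_borel d)" by (simp add: Rd_leb_def)
  have fin: "barron_norm d \<beta> f < \<infinity>" using f by (simp add: barron_space_def)
  then have ex: "\<exists>g. is_fourier_transform d f g" by (auto simp: barron_norm_def split: if_splits)
  have bn: "barron_norm d \<beta> f = (\<integral>\<^sup>+\<omega>. ennreal ((1 + Rd_norm d \<omega>) powr \<beta> * cmod (h \<omega>)) \<partial>Rd_leb d)"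
    using ex by (simp add: barron_norm_def h_def)
  have ft: "is_fourier_transform d f h" unfolding h_def fourier_transform_def by (rule someI_ex[OF ex])
  \<comment> \<open>Measurability of the transform is extracted from temperedness: its product with
    a Gaussian is integrable, and the Gaussian has no zero.\<close>
  let ?G = "gauss_fun d (\<lambda>_. 0)"
  have G0: "?G x \<noteq> 0" for x by (simp add: gauss_fun_eq)
  have "integrable (Rd_leb d) (\<lambda>x. h x * ?G x)"
    using ft gauss_fun_schwartz unfolding is_fourier_transform_def tempered_def by blast
  then have "(\<lambda>x. h x * ?G x) \<in> borel_measurable (Rd_leb d)" by (rule borel_measurable_integrable)
  moreover have "?G \<in> borel_measurable (Rd_leb d)"
    unfolding L by (rule measurable_completion[OF gauss_fun_measurable])
  ultimately have "(\<lambda>x. h x * ?G x / ?G x) \<in> borel_measurable (Rd_leb d)" by (rule borel_measurable_divide)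
  then have hm: "h \<in> borel_measurable (Rd_leb d)" using G0 by simp
  have "integrable (Rd_leb d) h"
  proof (rule integrableI_bounded[OF hm])
    have "(\<integral>\<^sup>+\<omega>. ennreal (norm (h \<omega>)) \<partial>Rd_leb d) \<le> barron_norm d \<beta> f"
      unfolding bn
    proof (intro nn_integral_mono ennreal_leI)
      fix \<omega>
      have "1 \<le> (1 + Rd_norm d \<omega>) powr \<beta>" using \<beta> by (intro ge_one_powr_ge_zero) auto
      then show "norm (h \<omega>) \<le> (1 + Rd_norm d \<omega>) powr \<beta> * cmod (h \<omega>)"
        using mult_right_mono[of 1 "(1 + Rd_norm d \<omega>) powr \<beta>" "cmod (h \<omega>)"] by simp
    qed
    then show "(\<integral>\<^sup>+\<omega>. ennreal (norm (h \<omega>)) \<partial>Rd_leb d) < \<infinity>" using fin by (rule le_less_trans)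
  qed
  from fourier_inversion[OF ft this] obtain g where g: "g \<in> borel_measurable (Rd_borel d)"
    "AE \<omega> in Rd_borel d. h \<omega> = g \<omega>" "AE x in Rd_leb d. f x = Re (fourier_inverse d g x)" by blast
  have "barron_norm d \<beta> f = (\<integral>\<^sup>+\<omega>. ennreal ((1 + Rd_norm d \<omega>) powr \<beta> * cmod (g \<omega>)) \<partial>Rd_leb d)"
    unfolding bn
  proof (rule nn_integral_cong_AE)
    show "AE \<omega> in Rd_leb d. ennreal ((1 + Rd_norm d \<omega>) powr \<beta> * cmod (h \<omega>)) =
        ennreal ((1 + Rd_norm d \<omega>) powr \<beta> * cmod (g \<omega>))"
      unfolding L by (rule AE_completion) (use g(2) in eventually_elim, simp)
  qed
  also have "\<dots> = (\<integral>\<^sup>+\<omega>. ennreal ((1 + Rd_norm d \<omega>) powr \<beta> * cmod (g \<omega>)) \<partial>Rd_borel d)"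
    unfolding L by (rule nn_integral_completion)
  finally show thesis using that g by blast
qed

theorem theorem5:
  fixes m :: nat and p :: real and \<sigma> :: "real \<Rightarrow> real"
  assumes "p > 1"
    and "\<sigma> \<in> W_inf m"
    and "\<not> (AE s in lebesgue. \<sigma> s = 0)"
    and "\<exists>Cp. \<forall>k\<le>m + 1. \<exists>v. is_weak_deriv_real k \<sigma> v \<and>
           (AE s in lebesgue. \<bar>v s\<bar> \<le> Cp * (1 + \<bar>s\<bar>) powr (- p))"
  shows "\<exists>C :: real \<Rightarrow> real. \<forall>d \<Omega> (\<epsilon>::real) t f (n::nat).
           d \<ge> 1 \<longrightarrow> bounded_domain d \<Omega> \<longrightarrow> \<epsilon> > 0 \<longrightarrow> t = min (p - 1) \<epsilon> \<longrightarrow>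
           f \<in> barron_space d (real m + 1 + \<epsilon>) \<longrightarrow> n \<ge> 1 \<longrightarrow>
           (INF g\<in>shallow_nets \<sigma> d n. sobolev_norm d m \<Omega> (\<lambda>x. f x - g x)) \<le>
           ennreal (sqrt (measure (Rd_leb d) \<Omega>) * C (Rd_diameter d \<Omega>) *
                    real n powr (- 1 / 2 - t / ((2 + t) * (real d + 1)))) *
           barron_norm d (real m + 1 + \<epsilon>) f"
proof -
  obtain s :: "nat \<Rightarrow> real \<Rightarrow> real" and Cs where Cs: "Cs > 0"
    and \<sigma>s: "AE x in lebesgue. \<sigma> x = s 0 x"
    and s_cont: "\<And>k. k \<le> m \<Longrightarrow> continuous_on UNIV (s k)"
    and s_der: "\<And>k x. k < m \<Longrightarrow> (s k has_real_derivative s (Suc k) x) (at x)"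
    and s_bound: "\<And>k x. k \<le> m \<Longrightarrow> \<bar>s k x\<bar> \<le> Cs * (1 + \<bar>x\<bar>) powr (- p)"
    and s_lip: "\<And>k x y. k \<le> m \<Longrightarrow> \<bar>x - y\<bar> \<le> 1 \<Longrightarrow> \<bar>s k x - s k y\<bar> \<le> Cs * (1 + \<bar>x\<bar>) powr (- p) * \<bar>x - y\<bar>"
    by (rule regular_representatives[OF assms(1,4)]) blast
  have "s 0 \<in> borel_measurable borel" by (intro borel_measurable_continuous_onI s_cont) simp
  then have s0: "integrable lborel (s 0)"
    by (intro Bochner_Integration.integrable_bound[OF integrable_mult_right[OF integrable_powr_decay[OF assms(1)], of Cs]])
       (use s_bound[of 0] Cs in \<open>auto simp: abs_mult\<close>)
  \<comment> \<open>The continuous representative inherits that \<sigma> is non-zero, which yields a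
    frequency \<open>a\<close> for the kernel identity.\<close>
  have "\<not> (AE x in lborel. s 0 x = 0)"
  proof
    assume "AE x in lborel. s 0 x = 0"
    then have "AE x in lebesgue. s 0 x = 0" by (rule AE_completion)
    with \<sigma>s have "AE x in lebesgue. \<sigma> x = 0" by eventually_elim simp
    then show False using assms(3) by simp
  qed
  from fourier_nonzero[OF s0 this] obtain a where a: "a \<noteq> 0"
    and nz: "(LINT y|lborel. complex_of_real (s 0 y) * iexp (- a * y)) \<noteq> 0" by blast
  \<comment> \<open>The representatives and \<open>a\<close> are chosen from \<sigma>,
    \<open>m\<close> and \<open>p\<close> alone, before the dimension and the domain; the domain
    enters through \<open>R\<close>, which becomes its diameter.\<close>
  define C where "C R = barron_rep.err_const m p a R Cs s" for R
  show ?thesis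
  proof (intro exI[of _ C] allI impI)
    fix d :: nat and \<Omega> :: "(nat \<Rightarrow> real) set" and \<epsilon> t :: real and f :: "(nat \<Rightarrow> real) \<Rightarrow> real" and n :: nat
    assume d: "d \<ge> 1" and bd: "bounded_domain d \<Omega>" and \<epsilon>: "\<epsilon> > 0" and t: "t = min (p - 1) \<epsilon>"
      and f: "f \<in> barron_space d (real m + 1 + \<epsilon>)" and n: "n \<ge> 1"
    define R where "R = Rd_diameter d \<Omega>"
    have t': "0 < t" "t \<le> p - 1" "t \<le> \<epsilon>" using t \<epsilon> assms(1) by auto
    have op: "openin (Rd_top d) \<Omega>" using bd by (simp add: bounded_domain_def)
    obtain B where B: "\<forall>x\<in>\<Omega>. Rd_norm d x \<le> B" using bd unfolding bounded_domain_def by blast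
    \<comment> \<open>Any point of \<Omega> serves as the centre, since \<Omega> lies in the closed
      ball around it whose radius is the diameter.\<close>
    obtain x0 where x0: "x0 \<in> \<Omega>" using bd by (auto simp: bounded_domain_def)
    have \<Omega>R: "Rd_norm d (\<lambda>i. x i - x0 i) \<le> R" if "x \<in> \<Omega>" for x
      unfolding R_def by (rule Rd_norm_le_diameter[OF B that x0])
    have R: "R \<ge> 0" using \<Omega>R[OF x0] Rd_norm_nonneg order_trans by blast
    have \<Omega>f: "emeasure (Rd_borel d) \<Omega> < \<infinity>"
      using openin_subset[OF op] B by (intro emeasure_bounded_Rd) (auto simp: topspace_Rd_top)
    obtain g where g: "g \<in> borel_measurable (Rd_borel d)"
      "AE x in Rd_leb d. f x = Re (fourier_inverse d g x)"
      "barron_norm d (real m + 1 + \<epsilon>) f =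
        (\<integral>\<^sup>+\<omega>. ennreal ((1 + Rd_norm d \<omega>) powr (real m + 1 + \<epsilon>) * cmod (g \<omega>)) \<partial>Rd_borel d)"
      by (rule barron_representation[OF f]) (use \<epsilon> in auto)
    have fin: "barron_norm d (real m + 1 + \<epsilon>) f < \<infinity>" using f by (simp add: barron_space_def)
    \<comment> \<open>Moments of the transform: u = 0 gives the finiteness needed to form the
      superposition, u = t the bound in the rate; both are dominated by the given norm as 0 and t
      are at most \<epsilon>.\<close>
    define I where "I u = (\<integral>\<^sup>+\<omega>. ennreal ((1 + Rd_norm d \<omega>) powr (real m + 1 + u) * cmod (g \<omega>)) \<partial>Rd_borel d)" for u
    have I: "I u \<le> barron_norm d (real m + 1 + \<epsilon>) f" if "u \<le> \<epsilon>" for u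
      unfolding I_def g(3) using that
      by (intro nn_integral_mono ennreal_leI mult_right_mono powr_mono) auto
    have "(\<integral>\<^sup>+\<omega>. ennreal ((1 + Rd_norm d \<omega>) ^ (m + 1) * cmod (g \<omega>)) \<partial>Rd_borel d) = I 0"
      unfolding I_def
    proof (rule nn_integral_cong)
      fix \<omega>
      have "(1 + Rd_norm d \<omega>) ^ (m + 1) = (1 + Rd_norm d \<omega>) powr real (m + 1)"
        by (intro powr_realpow[symmetric]) (simp add: add_pos_nonneg)
      then show "ennreal ((1 + Rd_norm d \<omega>) ^ (m + 1) * cmod (g \<omega>)) =
          ennreal ((1 + Rd_norm d \<omega>) powr (real m + 1 + 0) * cmod (g \<omega>))" by (simp add: add.commute)
    qed
    then have g_fin: "(\<integral>\<^sup>+\<omega>. ennreal ((1 + Rd_norm d \<omega>) ^ (m + 1) * cmod (g \<omega>)) \<partial>Rd_borel d) < \<infinity>"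
      using I[of 0] \<epsilon> fin by (metis le_less_trans less_imp_le)
    interpret approx_setup m p a R Cs s d x0 g \<Omega> \<sigma> f
      by unfold_locales (fact assms(1) a R Cs s_bound s_lip s_cont s_der nz g(1,2) g_fin d op \<Omega>f \<Omega>R \<sigma>s)+
    have It: "I t < \<infinity>" using I[OF t'(3)] fin by (rule le_less_trans)
    define Bt where "Bt = enn2real (I t)"
    have Bt: "0 \<le> Bt" "ennreal Bt = I t" using It by (simp_all add: Bt_def less_top)
    obtain N where N: "N \<in> shallow_nets \<sigma> d n" "sobolev_norm d m \<Omega> (\<lambda>x. f x - N x) \<le>
        ennreal (sqrt vol * err_const * real n powr (- 1 / 2 - t / ((2 + t) * (real d + 1))) * Bt)"
      using net_approximation[OF t'(1,2) n Bt(1) Bt(2)[unfolded I_def, symmetric]] by blast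
    have vol: "vol = measure (Rd_leb d) \<Omega>"
      unfolding vol_def Rd_leb_def using \<Omega>_sets by simp
    have "(INF g\<in>shallow_nets \<sigma> d n. sobolev_norm d m \<Omega> (\<lambda>x. f x - g x)) \<le>
        ennreal (sqrt vol * err_const * real n powr (- 1 / 2 - t / ((2 + t) * (real d + 1))) * Bt)"
      by (rule INF_lower2[OF N(1)]) (rule N(2))
    also have "\<dots> = ennreal (sqrt vol * err_const * real n powr (- 1 / 2 - t / ((2 + t) * (real d + 1)))) * I t"
      using vol0 err_const Bt by (subst ennreal_mult) auto
    also have "\<dots> \<le> ennreal (sqrt vol * err_const * real n powr (- 1 / 2 - t / ((2 + t) * (real d + 1)))) *
        barron_norm d (real m + 1 + \<epsilon>) f"
      by (intro mult_left_mono I t') simp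
    finally show "(INF g\<in>shallow_nets \<sigma> d n. sobolev_norm d m \<Omega> (\<lambda>x. f x - g x)) \<le>
        ennreal (sqrt (measure (Rd_leb d) \<Omega>) * C (Rd_diameter d \<Omega>) *
          real n powr (- 1 / 2 - t / ((2 + t) * (real d + 1)))) *
        barron_norm d (real m + 1 + \<epsilon>) f"
      unfolding C_def R_def[symmetric] vol[symmetric] .
  qed
qed

end
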